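(* Let $\varphi = P_m$ be a Chebyshev polynomial for some integer $m \geq 2$. Let $K$ be a number field with algebraic closure $\overline{K}$, and let $S$ be a finite set of places of $K$ containing all the archimedean places. Suppose that $\alpha \in K$ is not of the form $\zeta + \zeta^{-1}$ for any root of unity $\zeta$. Then the set $$\{ x \in \overline{\mathbb{Q}} : x \text{ is } S\text{-integral with respect to } \alpha \text{ and } x \text{ is } \varphi\text{-preperiodic} \}$$ is finite.
   Context: The polynomials $P_m \in \mathbb{Z}[z]$ are defined by $P_1(z) = z$, $P_2(z) = z^2 - 2$, and $P_{m+1}(z) = z P_m(z) - P_{m-1}(z)$ for all $m \geq 2$; a Chebyshev polynomial is any $P_m$ with $m \geq 2$. A point $x$ is $\varphi$-preperiodic if there are integers $j \neq k \geq 0$ with $\varphi^j(x) = \varphi^k(x)$, where $\varphi^k$ denotes the $k$-th iterate. For a place $v$ of $K$, $|\cdot|_v$ denotes an absolute value in the class of $v$, extended to an algebraic closure $\overline{K}_v$ of the completion $K_v$. For $\alpha \in K$ and $\beta \in \overline{K}$, $\beta$ is called $S$-integral with respect to $\alpha$ if for every place $v \notin S$ and every $K$-embedding $\sigma : K(\beta) \to \overline{K}_v$ one has $|\sigma(\beta) - \alpha|_v \geq 1$ if $|\alpha|_v \leq 1$, and $|\sigma(\beta)|_v \leq 1$ if $|\alpha|_v > 1$. *)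

theory Defs
  imports Complex_Main "HOL-Algebra.Algebraic_Closure_Type" "HOL-Algebra.Generated_Fields"
begin

section \<open>Chebyshev polynomials and preperiodic points\<close>

(* The value at 0 is a convention only; 2 is the value that extends the recurrence downwards. *)
fun chebyshev :: "nat \<Rightarrow> int poly" where
  "chebyshev 0 = [:2:]"
| "chebyshev (Suc 0) = [:0, 1:]"
| "chebyshev (Suc (Suc 0)) = [:-2, 0, 1:]"
| "chebyshev (Suc (Suc (Suc m))) = [:0, 1:] * chebyshev (Suc (Suc m)) - chebyshev (Suc m)"

definition poly_map :: "int poly \<Rightarrow> complex \<Rightarrow> complex" where
  "poly_map p x = poly (map_poly of_int p) x"

definition preperiodic :: "('a \<Rightarrow> 'a) \<Rightarrow> 'a \<Rightarrow> bool" where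
  "preperiodic f x \<longleftrightarrow> (\<exists>j k. j \<noteq> k \<and> (f ^^ j) x = (f ^^ k) x)"


section \<open>Number fields\<close>

(* Number fields are taken inside the complex numbers; the algebraic closure of each of them is
   then the field of algebraic complex numbers. *)

abbreviation complex_field :: "complex ring" where
  "complex_field \<equiv> ring_of_type_algebra"

abbreviation subfield_ring :: "complex set \<Rightarrow> complex ring" where
  "subfield_ring K \<equiv> complex_field \<lparr>carrier := K\<rparr>"

definition number_field :: "complex set \<Rightarrow> bool" where
  "number_field K \<longleftrightarrow> subfield K complex_field \<and> ring.finite_dimension complex_field \<rat> K"


section \<open>Absolute values and places\<close>

definition abs_value :: "('a, 'b) ring_scheme \<Rightarrow> ('a \<Rightarrow> real) \<Rightarrow> bool" where
  "abs_value R v \<longleftrightarrow>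
     (\<forall>x \<in> carrier R. v x \<ge> 0 \<and> (v x = 0 \<longleftrightarrow> x = \<zero>\<^bsub>R\<^esub>)) \<and>
     (\<forall>x \<in> carrier R. \<forall>y \<in> carrier R. v (x \<otimes>\<^bsub>R\<^esub> y) = v x * v y) \<and>
     (\<forall>x \<in> carrier R. \<forall>y \<in> carrier R. v (x \<oplus>\<^bsub>R\<^esub> y) \<le> v x + v y)"

definition nontrivial_abs_value :: "('a, 'b) ring_scheme \<Rightarrow> ('a \<Rightarrow> real) \<Rightarrow> bool" where
  "nontrivial_abs_value R v \<longleftrightarrow>
     abs_value R v \<and> (\<exists>x \<in> carrier R. x \<noteq> \<zero>\<^bsub>R\<^esub> \<and> v x \<noteq> 1)"

definition abs_value_equiv :: "('a, 'b) ring_scheme \<Rightarrow> (('a \<Rightarrow> real) \<times> ('a \<Rightarrow> real)) set" where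
  "abs_value_equiv R =
     {(v, w). nontrivial_abs_value R v \<and> nontrivial_abs_value R w \<and>
              (\<exists>s > 0. \<forall>x \<in> carrier R. w x = v x powr s)}"

definition places :: "('a, 'b) ring_scheme \<Rightarrow> ('a \<Rightarrow> real) set set" where
  "places R = {v. nontrivial_abs_value R v} // abs_value_equiv R"

definition archimedean_place :: "('a, 'b) ring_scheme \<Rightarrow> ('a \<Rightarrow> real) set \<Rightarrow> bool" where
  "archimedean_place R p \<longleftrightarrow>
     (\<exists>v \<in> p. \<exists>x \<in> carrier R. \<exists>y \<in> carrier R. v (x \<oplus>\<^bsub>R\<^esub> y) > max (v x) (v y))"


section \<open>Completions and their algebraic closures\<close>

definition cauchy_ring :: "('a, 'b) ring_scheme \<Rightarrow> ('a \<Rightarrow> real) \<Rightarrow> (nat \<Rightarrow> 'a) ring" where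
  "cauchy_ring R v =
     \<lparr>carrier = {s. (\<forall>n. s n \<in> carrier R) \<and>
                    (\<forall>e > 0. \<exists>N. \<forall>m \<ge> N. \<forall>n \<ge> N. v (s m \<ominus>\<^bsub>R\<^esub> s n) < e)},
      monoid.mult = (\<lambda>s t n. s n \<otimes>\<^bsub>R\<^esub> t n), one = (\<lambda>n. \<one>\<^bsub>R\<^esub>),
      ring.zero = (\<lambda>n. \<zero>\<^bsub>R\<^esub>), add = (\<lambda>s t n. s n \<oplus>\<^bsub>R\<^esub> t n)\<rparr>"

definition null_sequences :: "('a, 'b) ring_scheme \<Rightarrow> ('a \<Rightarrow> real) \<Rightarrow> (nat \<Rightarrow> 'a) set" where
  "null_sequences R v = {s \<in> carrier (cauchy_ring R v). (\<lambda>n. v (s n)) \<longlonglongrightarrow> 0}"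

definition completion :: "('a, 'b) ring_scheme \<Rightarrow> ('a \<Rightarrow> real) \<Rightarrow> (nat \<Rightarrow> 'a) set ring" where
  "completion R v = cauchy_ring R v Quot null_sequences R v"

definition completion_embed :: "('a, 'b) ring_scheme \<Rightarrow> ('a \<Rightarrow> real) \<Rightarrow> 'a \<Rightarrow> (nat \<Rightarrow> 'a) set" where
  "completion_embed R v x = null_sequences R v +>\<^bsub>cauchy_ring R v\<^esub> (\<lambda>n. x)"

definition completion_abs :: "('a \<Rightarrow> real) \<Rightarrow> (nat \<Rightarrow> 'a) set \<Rightarrow> real" where
  "completion_abs v c = (THE r. \<forall>s \<in> c. (\<lambda>n. v (s n)) \<longlonglongrightarrow> r)"

type_synonym 'a completion_closure =
  "((nat \<Rightarrow> 'a) set list \<times> nat) multiset \<Rightarrow> (nat \<Rightarrow> 'a) set"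

definition completion_closure ::
    "('a, 'b) ring_scheme \<Rightarrow> ('a \<Rightarrow> real) \<Rightarrow> 'a completion_closure ring" where
  "completion_closure R v = field.alg_closure (completion R v)"

(* The library's algebraic closure contains the base field via indexed_const. *)
definition closure_embed ::
    "('a, 'b) ring_scheme \<Rightarrow> ('a \<Rightarrow> real) \<Rightarrow> 'a \<Rightarrow> 'a completion_closure" where
  "closure_embed R v x = ring.indexed_const (completion R v) (completion_embed R v x)"

definition extends_to_closure ::
    "('a, 'b) ring_scheme \<Rightarrow> ('a \<Rightarrow> real) \<Rightarrow> ('a completion_closure \<Rightarrow> real) \<Rightarrow> bool" where
  "extends_to_closure R v w \<longleftrightarrow>
     abs_value (completion_closure R v) w \<and>
     (\<forall>c \<in> carrier (completion R v).
        w (ring.indexed_const (completion R v) c) = completion_abs v c)"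


section \<open>Integrality relative to a point\<close>

definition adjoin :: "complex set \<Rightarrow> complex \<Rightarrow> complex set" where
  "adjoin K \<beta> = generate_field complex_field (insert \<beta> K)"

definition K_embeddings ::
    "complex set \<Rightarrow> (complex \<Rightarrow> real) \<Rightarrow> complex \<Rightarrow> (complex \<Rightarrow> complex completion_closure) set" where
  "K_embeddings K v \<beta> =
     {\<sigma> \<in> ring_hom (subfield_ring (adjoin K \<beta>)) (completion_closure (subfield_ring K) v).
        \<forall>x \<in> K. \<sigma> x = closure_embed (subfield_ring K) v x}"

(* All representatives v of a place give the same condition, since they are powers of each other
   and only comparisons with 1 occur. The extension w of v to the algebraic closure of the
   completion exists and is unique. *)
definition S_integral ::
    "complex set \<Rightarrow> (complex \<Rightarrow> real) set set \<Rightarrow> complex \<Rightarrow> complex \<Rightarrow> bool" where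
  "S_integral K S \<alpha> \<beta> \<longleftrightarrow>
     (\<forall>p \<in> places (subfield_ring K) - S. \<forall>v \<in> p. \<forall>w.
        extends_to_closure (subfield_ring K) v w \<longrightarrow>
        (\<forall>\<sigma> \<in> K_embeddings K v \<beta>.
           (v \<alpha> \<le> 1 \<longrightarrow>
              w (\<sigma> \<beta> \<ominus>\<^bsub>completion_closure (subfield_ring K) v\<^esub> closure_embed (subfield_ring K) v \<alpha>) \<ge> 1) \<and>
           (v \<alpha> > 1 \<longrightarrow> w (\<sigma> \<beta>) \<le> 1)))"

end

theory Submission
  imports Defs "HOL-Complex_Analysis.Complex_Analysis" "HOL-Number_Theory.Number_Theory" "HOL-Real_Asymp.Real_Asymp"
begin

text \<open>
  A preperiodic point of a Chebyshev polynomial has the form \<open>x = \<zeta> + \<zeta>\<^sup>-\<^sup>1\<close> with \<open>\<zeta>\<close> a root of unity of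
  some order \<open>n\<close>; write \<open>\<alpha> = \<gamma> + \<gamma>\<^sup>-\<^sup>1\<close> and let \<open>f\<close> be the minimal polynomial of \<open>x\<close> over \<open>K\<close>. By
  \<open>S\<close>-integrality the norm of \<open>f(\<alpha>)\<close> is a nonzero rational number of \<open>p\<close>-adic absolute value at least 1
  for all primes outside a finite set, so by the product formula its absolute values at the remaining places have
  product at most 1. On the other hand a Parseval argument bounds the power sums of the conjugates
  of \<open>\<zeta>\<close> over \<open>K\<close>, so that these are equidistributed, and \<open>\<gamma>\<^sup>n\<close> does not come too close to 1:
  \<open>ln \<bar>\<gamma>\<^sup>n - 1\<bar> \<ge> - C n\<close> to the power \<open>3/4\<close> on the unit circle by Schneider's method, and \<open>\<bar>\<gamma>\<^sup>n - 1\<bar> \<ge> c / n\<close>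
  \<open>p\<close>-adically. Hence at each place \<open>ln \<bar>f(\<alpha>)\<bar>\<close> is at least \<open>deg f\<close> times the local height of \<open>\<gamma>\<close>,
  up to an error of order \<open>n\<close> to the power \<open>3/4\<close>. The local heights have positive sum by Kronecker's theorem, and
  \<open>deg f\<close> is at least a constant times \<open>n / ln n\<close>; so \<open>n\<close> is bounded.
\<close>

subsection \<open>Extending absolute values to algebraic elements\<close>

text \<open>Only one absolute value is fixed over each prime, on all algebraic numbers at once; the
  places of \<open>K\<close> enter by composing it with the embeddings \<open>emb t\<close>, so that
  norms to the rationals reduce the product formula of \<open>K\<close> to the elementary one. The
  obstacle is a conjugate of \<open>\<gamma>\<close> on the unit circle: the Liouville bound for
  \<open>\<gamma> ^ n - 1\<close> is only exponential in \<open>n\<close>, worse than the main term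
  of order \<open>n / ln n\<close>, so a transcendence argument must supply an exponent below 1. The
  value \<open>3/4\<close> arises twice: the inner radius \<open>1 - n powr (-1/4)\<close> balances
  the two errors of equidistribution, and the auxiliary function has parameters proportional to the
  fourth root of \<open>n\<close>, whose cube is the exponent obtained. Equidistribution avoids
  Galois groups: if the trace of \<open>\<zeta> ^ c\<close> is conjugate to that of
  \<open>\<zeta>\<close>, then \<open>r\<close> to \<open>r ^ c\<close> permutes the conjugates in
  every embedding, so one power sum fills as many Parseval terms as there are conjugates.
  Integrality enters through roots: a small \<open>f(\<alpha>)\<close> would place a root of
  \<open>f\<close> too close to \<open>\<alpha>\<close> in the closure of the completion.\<close>

primrec (in ring) poly_span :: "'a set \<Rightarrow> 'a \<Rightarrow> nat \<Rightarrow> 'a set" where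
  "poly_span A x 0 = A"
| "poly_span A x (Suc n) = {x \<otimes> d \<oplus> a | d a. d \<in> poly_span A x n \<and> a \<in> A}"

context field
begin

context
  fixes A assumes A: "subring A R"
begin

lemma subring_closed:
  "x \<in> A \<Longrightarrow> x \<in> carrier R" "\<one> \<in> A" "\<zero> \<in> A"
  "x \<in> A \<Longrightarrow> y \<in> A \<Longrightarrow> x \<otimes> y \<in> A" "x \<in> A \<Longrightarrow> y \<in> A \<Longrightarrow> x \<oplus> y \<in> A"
  "x \<in> A \<Longrightarrow> \<ominus> x \<in> A" "x \<in> A \<Longrightarrow> y \<in> A \<Longrightarrow> x \<ominus> y \<in> A"
  "x \<in> A \<Longrightarrow> x [^] (n::nat) \<in> A"
proof -
  show c: "x \<in> A \<Longrightarrow> x \<in> carrier R" "\<one> \<in> A" "\<zero> \<in> A"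
  "\<And>x y. x \<in> A \<Longrightarrow> y \<in> A \<Longrightarrow> x \<otimes> y \<in> A" "x \<in> A \<Longrightarrow> y \<in> A \<Longrightarrow> x \<oplus> y \<in> A"
  "x \<in> A \<Longrightarrow> \<ominus> x \<in> A" "x \<in> A \<Longrightarrow> y \<in> A \<Longrightarrow> x \<ominus> y \<in> A" for x y
    using subringE[OF A] by (auto simp: a_minus_def)
  show "x \<in> A \<Longrightarrow> x [^] (n::nat) \<in> A" by (induct n) (auto simp: c)
qed

lemma poly_span_carrier: "x \<in> carrier R \<Longrightarrow> d \<in> poly_span A x n \<Longrightarrow> d \<in> carrier R"
  by (induct n arbitrary: d) (auto dest: subring_closed(1))

lemma poly_span_add:
  "x \<in> carrier R \<Longrightarrow> d \<in> poly_span A x n \<Longrightarrow> e \<in> poly_span A x n \<Longrightarrow> d \<oplus> e \<in> poly_span A x n"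
proof (induct n arbitrary: d e)
  case (Suc n)
  then obtain d' a e' b where *: "d = x \<otimes> d' \<oplus> a" "d' \<in> poly_span A x n" "a \<in> A"
     "e = x \<otimes> e' \<oplus> b" "e' \<in> poly_span A x n" "b \<in> A" by auto
  have cc: "d' \<in> carrier R" "e' \<in> carrier R" "a \<in> carrier R" "b \<in> carrier R"
    using * Suc.prems(1) poly_span_carrier subring_closed(1) by auto
  have "d \<oplus> e = x \<otimes> (d' \<oplus> e') \<oplus> (a \<oplus> b)"
    unfolding * using cc Suc.prems(1) by algebra
  then show ?case using Suc.hyps[OF Suc.prems(1) *(2,5)] subring_closed(5)[OF *(3,6)] by auto
qed (auto simp: subring_closed)

lemma poly_span_smult:
  "x \<in> carrier R \<Longrightarrow> d \<in> poly_span A x n \<Longrightarrow> c \<in> A \<Longrightarrow> c \<otimes> d \<in> poly_span A x n"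
proof (induct n arbitrary: d)
  case (Suc n)
  then obtain d' a where *: "d = x \<otimes> d' \<oplus> a" "d' \<in> poly_span A x n" "a \<in> A" by auto
  have cc: "d' \<in> carrier R" "a \<in> carrier R" "c \<in> carrier R"
    using * Suc.prems poly_span_carrier subring_closed(1) by auto
  have "c \<otimes> d = x \<otimes> (c \<otimes> d') \<oplus> (c \<otimes> a)"
    unfolding * using cc Suc.prems(1) by algebra
  then show ?case using Suc.hyps[OF Suc.prems(1) *(2) Suc.prems(3)] subring_closed(4)[OF Suc.prems(3) *(3)] by auto
qed (auto simp: subring_closed)

lemma poly_span_Suc: "x \<in> carrier R \<Longrightarrow> d \<in> poly_span A x n \<Longrightarrow> d \<in> poly_span A x (Suc n)"
proof (induct n arbitrary: d)
  case 0
  then have "d = x \<otimes> \<zero> \<oplus> d" using subring_closed(1) by auto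
  then show ?case using 0 subring_closed(3) by (simp, blast)
next
  case (Suc n)
  then obtain d' a where *: "d = x \<otimes> d' \<oplus> a" "d' \<in> poly_span A x n" "a \<in> A" by auto
  show ?case using Suc.hyps[OF Suc.prems(1) *(2)] * by (simp, blast)
qed

lemma poly_span_pow: "x \<in> carrier R \<Longrightarrow> x [^] n \<in> poly_span A x n"
proof (induct n)
  case (Suc n)
  have "x [^] Suc n = x \<otimes> x [^] n \<oplus> \<zero>" using Suc.prems by (simp add: m_comm)
  then show ?case using Suc.hyps[OF Suc.prems] subring_closed(3)
    by (simp only: poly_span.simps mem_Collect_eq) blast
qed (auto simp: subring_closed)

lemma poly_span_top:
  "x \<in> carrier R \<Longrightarrow> d \<in> poly_span A x (Suc n) \<Longrightarrow>
     \<exists>e \<in> poly_span A x n. \<exists>a \<in> A. d = e \<oplus> a \<otimes> x [^] Suc n"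
proof (induct n arbitrary: d)
  case 0
  then obtain d' a where *: "d = x \<otimes> d' \<oplus> a" "d' \<in> A" "a \<in> A" by auto
  have "d = a \<oplus> d' \<otimes> x [^] Suc 0"
    unfolding * using subring_closed(1)[OF *(2)] subring_closed(1)[OF *(3)] 0 by (simp add: m_comm a_comm)
  then show ?case using * by (auto simp del: nat_pow_Suc)
next
  case (Suc n)
  then obtain d' a where *: "d = x \<otimes> d' \<oplus> a" "d' \<in> poly_span A x (Suc n)" "a \<in> A"
    by (simp only: poly_span.simps(2)[of A x "Suc n"]) blast
  obtain e b where eb: "e \<in> poly_span A x n" "b \<in> A" "d' = e \<oplus> b \<otimes> x [^] Suc n"
    using Suc.hyps[OF Suc.prems(1) *(2)] by blast
  have cc: "e \<in> carrier R" "b \<in> carrier R" "a \<in> carrier R" "x [^] Suc n \<in> carrier R"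
    using * eb Suc.prems poly_span_carrier subring_closed(1) by auto
  have "x [^] Suc (Suc n) = x \<otimes> x [^] Suc n"
    using Suc.prems(1) nat_pow_Suc[of x "Suc n"] cc(4) m_comm by simp
  then have "d = (x \<otimes> e \<oplus> a) \<oplus> b \<otimes> x [^] Suc (Suc n)"
    unfolding * eb using cc Suc.prems(1) by algebra
  moreover have "x \<otimes> e \<oplus> a \<in> poly_span A x (Suc n)" using eb *(3) by auto
  ultimately show ?case using eb(2) by blast
qed

text \<open>Reversal of coefficients. \<open>poly_span A y k\<close> consists of the values at
  \<open>y\<close> of polynomials over \<open>A\<close> of degree at most \<open>k\<close>, in
  Horner form; multiplication by \<open>x [^] l\<close> trades powers of \<open>y\<close>, the
  inverse of \<open>x\<close>, for powers of \<open>x\<close>.\<close>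

lemma poly_span_flip:
  assumes "x \<in> carrier R" "y \<in> carrier R" "x \<otimes> y = \<one>"
  shows "d \<in> poly_span A y k \<Longrightarrow> k \<le> l \<Longrightarrow> x [^] l \<otimes> d \<in> poly_span A x l"
proof (induct k arbitrary: d l)
  case 0
  then have "d \<otimes> x [^] l \<in> poly_span A x l"
    using poly_span_smult[OF assms(1) poly_span_pow[OF assms(1)]] by auto
  then show ?case using 0 assms subring_closed(1) by (simp add: m_comm)
next
  case (Suc k)
  then obtain d' b where *: "d = y \<otimes> d' \<oplus> b" "d' \<in> poly_span A y k" "b \<in> A" by auto
  from Suc.prems obtain l' where l: "l = Suc l'" "k \<le> l'" by (cases l) auto
  have cc: "d' \<in> carrier R" "b \<in> carrier R" "x [^] l' \<in> carrier R"
    using * assms poly_span_carrier subring_closed(1) by auto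
  have "x [^] l \<otimes> d = (x \<otimes> y) \<otimes> (x [^] l' \<otimes> d') \<oplus> b \<otimes> x [^] l"
    unfolding * l using cc assms(1,2) by (simp, algebra)
  then have "x [^] l \<otimes> d = x [^] l' \<otimes> d' \<oplus> b \<otimes> x [^] l" using cc assms by simp
  moreover have "x [^] l' \<otimes> d' \<in> poly_span A x l"
    using Suc.hyps[OF *(2) l(2)] poly_span_Suc assms(1) l(1) by auto
  moreover have "b \<otimes> x [^] l \<in> poly_span A x l"
    using poly_span_smult[OF assms(1) poly_span_pow[OF assms(1)] *(3)] .
  ultimately show ?case using poly_span_add[OF assms(1)] by simp
qed

lemma simple_extension_poly_span:
  assumes "x \<in> carrier R" "d \<in> simple_extension A x" shows "\<exists>n. d \<in> poly_span A x n"
  using assms(2)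
proof (induct rule: simple_extension.induct)
  case zero then show ?case using subring_closed(3) by (intro exI[of _ 0]) auto
next
  case (lin k1 k2)
  then obtain n where n: "k1 \<in> poly_span A x n" by auto
  have "k1 \<otimes> x \<oplus> k2 = x \<otimes> k1 \<oplus> k2" using poly_span_carrier[OF assms(1) n] assms(1) by (simp add: m_comm)
  then show ?case using n lin(3) by (intro exI[of _ "Suc n"]) auto
qed

end

text \<open>A subring that is maximal among those avoiding \<open>inv p\<close> is a valuation ring; because of the
  avoided element it has rank one on everything algebraic over the base field.\<close>

context
  fixes A p
  assumes A: "subring A R" and p: "p \<in> A" "p \<noteq> \<zero>" and notin: "inv p \<notin> A"
    and max: "\<And>B. subring B R \<Longrightarrow> A \<subseteq> B \<Longrightarrow> inv p \<notin> B \<Longrightarrow> B = A"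
begin

lemma p_carrier: "p \<in> carrier R" "inv p \<in> carrier R" "p \<otimes> inv p = \<one>" "inv p \<otimes> p = \<one>"
proof -
  show "p \<in> carrier R" using p(1) subring_closed(1)[OF A] by auto
  then have "p \<in> Units R" using p(2) field_Units by auto
  then show "inv p \<in> carrier R" "p \<otimes> inv p = \<one>" "inv p \<otimes> p = \<one>" by auto
qed

lemma inv_p_mem_extension:
  assumes "x \<in> carrier R" "x \<notin> A" shows "inv p \<in> simple_extension A x"
proof (rule ccontr)
  assume "inv p \<notin> simple_extension A x"
  then have "simple_extension A x = A"
    using max[OF simple_extension_is_subring[OF A assms(1)]]
      simple_extension_incl[OF subringE(1)[OF A] assms(1)] by auto
  moreover have "x \<in> simple_extension A x" using simple_extension_mem[OF A assms(1)] .
  ultimately show False using assms(2) by auto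
qed

text \<open>If the inverse of \<open>u = 1 - p b\<close> were missing, maximality would put
  \<open>inv p\<close> into the ring generated by it, so \<open>u^k inv p\<close> would lie in
  \<open>A\<close> for some \<open>k\<close>. Since \<open>u^k\<close> is 1 modulo \<open>p\<close>,
  this already gives \<open>inv p\<close> in \<open>A\<close>.\<close>

lemma one_minus_p_unit:
  assumes b: "b \<in> A" shows "\<one> \<ominus> p \<otimes> b \<in> A - {\<zero>}" "inv (\<one> \<ominus> p \<otimes> b) \<in> A"
proof -
  let ?u = "\<one> \<ominus> p \<otimes> b"
  note sc = subring_closed[OF A]
  have bc: "b \<in> carrier R" using sc(1) b by auto
  have u: "?u \<in> A" using sc b p by auto
  have uc: "?u \<in> carrier R" using sc(1) u by auto
  have no: "p \<otimes> c \<noteq> \<one>" if c: "c \<in> A" for c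
  proof
    assume "p \<otimes> c = \<one>"
    then have "inv p = inv p \<otimes> (p \<otimes> c)" using p_carrier by simp
    also have "\<dots> = c" using p_carrier sc(1)[OF c] by (simp add: m_assoc[symmetric])
    finally show False using notin c by simp
  qed
  have u0: "?u \<noteq> \<zero>" using no[OF b] bc p_carrier by (metis m_closed one_closed r_right_minus_eq)
  then show "?u \<in> A - {\<zero>}" using u by auto
  have U: "?u \<in> Units R" using u0 uc field_Units by auto
  show "inv ?u \<in> A"
  proof (rule ccontr)
    assume "inv ?u \<notin> A"
    then have "inv p \<in> simple_extension A (inv ?u)" using inv_p_mem_extension U by auto
    moreover have "\<exists>k::nat. ?u [^] k \<otimes> y \<in> A" if "y \<in> simple_extension A (inv ?u)" for y
      using that
    proof (induct rule: simple_extension.induct)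
      case zero then show ?case using uc sc(3) by (intro exI[of _ 0]) auto
    next
      case (lin k1 k2)
      then obtain k :: nat where k: "?u [^] k \<otimes> k1 \<in> A" by auto
      have k1: "k1 \<in> carrier R"
        using lin(1) simple_extension_in_carrier[OF subringE(1)[OF A], of "inv ?u"] U by auto
      have cc: "k2 \<in> carrier R" "?u [^] k \<in> carrier R" "inv ?u \<in> carrier R" using lin sc(1) uc U by auto
      define u' where "u' = ?u"
      have uc': "u' \<in> carrier R" "inv u' \<in> carrier R" "u' [^] k \<in> carrier R" "u' \<otimes> inv u' = \<one>"
        using uc U cc unfolding u'_def by auto
      have "u' [^] Suc k \<otimes> (k1 \<otimes> inv u' \<oplus> k2) = (u' [^] k \<otimes> k1) \<otimes> (u' \<otimes> inv u') \<oplus> u' [^] Suc k \<otimes> k2"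
        unfolding nat_pow_Suc using uc'(1-3) k1 cc(1) by algebra
      then have "u' [^] Suc k \<otimes> (k1 \<otimes> inv u' \<oplus> k2) = (u' [^] k \<otimes> k1) \<oplus> u' [^] Suc k \<otimes> k2"
        using uc' k1 by simp
      moreover have "\<dots> \<in> A" using k lin(3) sc(4,5,8) u unfolding u'_def by metis
      ultimately show ?case unfolding u'_def by metis
    qed
    ultimately obtain k :: nat where k: "?u [^] k \<otimes> inv p \<in> A" by auto
    have "\<exists>c\<in>A. ?u [^] k = \<one> \<ominus> p \<otimes> c" for k :: nat
    proof (induct k)
      case 0 then show ?case using sc(3) p_carrier by (intro bexI[of _ \<zero>]) (auto simp: a_minus_def)
    next
      case (Suc k)
      then obtain c where c: "c \<in> A" "?u [^] k = \<one> \<ominus> p \<otimes> c" by auto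
      have cc: "c \<in> carrier R" using c sc(1) by auto
      have "?u [^] Suc k = \<one> \<ominus> p \<otimes> (b \<oplus> c \<ominus> p \<otimes> (b \<otimes> c))"
        unfolding nat_pow_Suc c(2) using cc bc p_carrier(1) by algebra
      moreover have "b \<oplus> c \<ominus> p \<otimes> (b \<otimes> c) \<in> A" using c b p sc by auto
      ultimately show ?case by blast
    qed
    then obtain c where c: "c \<in> A" "?u [^] k = \<one> \<ominus> p \<otimes> c" by blast
    have cc: "c \<in> carrier R" using c sc(1) by auto
    have "?u [^] k \<otimes> inv p \<oplus> c = inv p \<ominus> (p \<otimes> inv p) \<otimes> c \<oplus> c"
      unfolding c(2) using cc p_carrier(1,2) by algebra
    also have "\<dots> = inv p" unfolding p_carrier(3) using cc p_carrier(1,2) by algebra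
    finally show False using notin k c sc(5) by metis
  qed
qed

text \<open>Chevalley's argument. In the relation expressing \<open>inv p\<close> through
  \<open>y\<close>, the constant term \<open>b\<close> can be absorbed because
  \<open>1 - p b\<close> is a unit of \<open>A\<close>; multiplied by \<open>x [^] n\<close>, the
  relation expresses \<open>x [^] n\<close> through lower powers of \<open>x\<close>, and this
  replaces the leading term of the relation of degree \<open>n\<close>.\<close>

lemma degree_descent:
  assumes x: "x \<in> carrier R" "y \<in> carrier R" "x \<otimes> y = \<one>"
    and n: "inv p \<in> poly_span A x n" and m: "inv p \<in> poly_span A y m" and mn: "m \<le> n"
  shows "n > 0 \<and> inv p \<in> poly_span A x (n - 1)"
proof -
  note sc = subring_closed[OF A]
  from m notin obtain m' where m': "m = Suc m'" by (cases m) auto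
  then obtain d b where db: "inv p = y \<otimes> d \<oplus> b" "d \<in> poly_span A y m'" "b \<in> A" using m by auto
  obtain n' where n': "n = Suc n'" "m' \<le> n'" using mn m' by (cases n) auto
  have cc: "d \<in> carrier R" "b \<in> carrier R"
    using db sc(1) poly_span_carrier[OF A x(2)] by auto
  define u where "u = \<one> \<ominus> p \<otimes> b"
  have u: "u \<in> carrier R" "u \<noteq> \<zero>" "inv u \<in> A" "inv u \<in> carrier R" "u \<otimes> inv u = \<one>"
    using one_minus_p_unit[OF db(3)] sc(1) unfolding u_def[symmetric]
    using field_Units by auto
  have "u = p \<otimes> inv p \<ominus> p \<otimes> b" using p_carrier u_def by simp
  also have "\<dots> = p \<otimes> (y \<otimes> d)" unfolding db(1) using p_carrier(1) cc x by algebra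
  finally have u2: "u = p \<otimes> (y \<otimes> d)" .
  have X: "x [^] n = x [^] n \<otimes> (u \<otimes> inv u)" using u x by simp
  also have "\<dots> = (inv u \<otimes> p) \<otimes> ((x \<otimes> y) \<otimes> (x [^] n' \<otimes> d))"
    unfolding u2 n' using u(4) p_carrier(1) cc x(1,2)
    by (smt (verit, ccfv_threshold) m_assoc m_closed m_comm nat_pow_Suc nat_pow_closed u2)
  finally have "x [^] n = (inv u \<otimes> p) \<otimes> (x [^] n' \<otimes> d)" using x cc by simp
  moreover have "x [^] n' \<otimes> d \<in> poly_span A x n'" by (rule poly_span_flip[OF A x db(2) n'(2)])
  ultimately have xn: "x [^] n \<in> poly_span A x n'"
    using poly_span_smult[OF A x(1)] sc(4)[OF u(3) p(1)] by simp
  obtain e a where ea: "e \<in> poly_span A x n'" "a \<in> A" "inv p = e \<oplus> a \<otimes> x [^] Suc n'"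
    using poly_span_top[OF A x(1)] n n' by blast
  have "inv p \<in> poly_span A x n'"
    unfolding ea(3) using poly_span_add[OF A x(1) ea(1) poly_span_smult[OF A x(1) _ ea(2)]] xn n'(1) by simp
  then show ?thesis using n' by simp
qed

text \<open>If \<open>x\<close> and \<open>inv x\<close> were both missing, maximality would make
  \<open>inv p\<close> a polynomial in each of them. The descent can always lower the larger of the
  two degrees, which is impossible.\<close>

lemma valuation_ring:
  assumes x: "x \<in> carrier R" "x \<noteq> \<zero>" shows "x \<in> A \<or> inv x \<in> A"
proof (rule ccontr)
  assume neg: "\<not> ?thesis"
  have U: "x \<in> Units R" using x field_Units by auto
  have xx: "inv x \<in> carrier R" "x \<otimes> inv x = \<one>" "inv x \<otimes> x = \<one>" using U by auto
  obtain n m where nm: "inv p \<in> poly_span A x n" "inv p \<in> poly_span A (inv x) m"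
    using simple_extension_poly_span[OF A x(1)] simple_extension_poly_span[OF A xx(1)]
      inv_p_mem_extension x xx neg by metis
  have False if "inv p \<in> poly_span A x n" "inv p \<in> poly_span A (inv x) m" for n m
    using that
  proof (induct "n + m" arbitrary: n m rule: less_induct)
    case less
    show False
    proof (cases "m \<le> n")
      case True
      then show False using degree_descent[OF x(1) xx(1,2) less(2,3) True] less(1)[of "n-1" m] less(3) by auto
    next
      case False
      then have "n \<le> m" by simp
      then show False using degree_descent[OF xx(1) x(1) xx(3) less(3,2)] less(1)[of n "m-1"] less(2) by auto
    qed
  qed
  with nm show False by blast
qed

end

end

section \<open>Extension of a non-archimedean absolute value to algebraic elements\<close>

context field
begin

lemma subfield_inv:
  assumes "subfield F R" "x \<in> F" "x \<noteq> \<zero>"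
  shows "inv x \<in> F" "inv x \<in> carrier R" "inv x \<noteq> \<zero>" "x \<otimes> inv x = \<one>" "inv x \<otimes> x = \<one>"
  using subfield_m_inv[OF assms(1), of x] assms subfieldE(3)[OF assms(1)] by blast+

lemma inv_nonzero:
  assumes "x \<in> carrier R" "x \<noteq> \<zero>"
  shows "inv x \<in> carrier R" "inv x \<noteq> \<zero>" "x \<otimes> inv x = \<one>" "inv x \<otimes> x = \<one>"
proof -
  have "x \<in> Units R" using assms field_Units by auto
  then show "inv x \<in> carrier R" "x \<otimes> inv x = \<one>" "inv x \<otimes> x = \<one>" by auto
  then show "inv x \<noteq> \<zero>" using assms by auto
qed

lemma inv_pow: assumes "c \<in> carrier R" "c \<noteq> \<zero>" shows "inv (c [^] (b::nat)) = (inv c) [^] b"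
proof (rule comm_inv_char)
  show "c [^] b \<otimes> (inv c) [^] b = \<one>"
    using nat_pow_distrib[OF assms(1) inv_nonzero(1)[OF assms], of b] inv_nonzero(3)[OF assms] by simp
qed (use inv_nonzero[OF assms] assms in auto)

lemma pow_nonzero: assumes "c \<in> carrier R" "c \<noteq> \<zero>" shows "c [^] (b::nat) \<noteq> \<zero>"
  using assms by (induct b) (auto simp: integral_iff)

lemma inv_mult_nonzero:
  assumes "c \<in> carrier R" "c \<noteq> \<zero>" "d \<in> carrier R" "d \<noteq> \<zero>" shows "inv (c \<otimes> d) = inv c \<otimes> inv d"
proof (rule comm_inv_char)
  note i = inv_nonzero[OF assms(1,2)] inv_nonzero[OF assms(3,4)]
  have "c \<otimes> d \<otimes> (inv c \<otimes> inv d) = (c \<otimes> inv c) \<otimes> (d \<otimes> inv d)" using assms i(1,5) by (simp add: m_ac)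
  then show "c \<otimes> d \<otimes> (inv c \<otimes> inv d) = \<one>" using i by simp
qed (use assms inv_nonzero in auto)

lemma abs_value_simps:
  assumes F: "subfield F R" and v: "abs_value (R\<lparr>carrier := F\<rparr>) v"
  shows "x \<in> F \<Longrightarrow> v x \<ge> 0" "x \<in> F \<Longrightarrow> v x = 0 \<longleftrightarrow> x = \<zero>" "x \<in> F \<Longrightarrow> x \<noteq> \<zero> \<Longrightarrow> v x > 0"
    "x \<in> F \<Longrightarrow> y \<in> F \<Longrightarrow> v (x \<otimes> y) = v x * v y" "v \<one> = 1"
    "x \<in> F \<Longrightarrow> v (x [^] (n::nat)) = v x ^ n"
    "x \<in> F \<Longrightarrow> x \<noteq> \<zero> \<Longrightarrow> v (inv x) = inverse (v x)"
proof -
  have S: "subring F R" using subfieldE(1)[OF F] .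
  note sc = subring_closed[OF S]
  show a: "x \<in> F \<Longrightarrow> v x \<ge> 0" "x \<in> F \<Longrightarrow> v x = 0 \<longleftrightarrow> x = \<zero>" for x
    using v unfolding abs_value_def by auto
  show a3: "x \<in> F \<Longrightarrow> x \<noteq> \<zero> \<Longrightarrow> v x > 0" for x using a[of x] by linarith
  show m: "x \<in> F \<Longrightarrow> y \<in> F \<Longrightarrow> v (x \<otimes> y) = v x * v y" for x y
    using v unfolding abs_value_def by auto
  have "v \<one> * v \<one> = v \<one>" using m[of \<one> \<one>] sc(2) by simp
  moreover have "v \<one> \<noteq> 0" using a(2)[OF sc(2)] by simp
  ultimately show o: "v \<one> = 1" by simp
  show "x \<in> F \<Longrightarrow> v (x [^] (n::nat)) = v x ^ n" by (induct n) (auto simp: o m sc(8))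
  show "x \<in> F \<Longrightarrow> x \<noteq> \<zero> \<Longrightarrow> v (inv x) = inverse (v x)"
    using m[of x "inv x"] o subfield_inv[OF F] a(2) by (simp add: inverse_eq_divide eq_divide_eq mult.commute)
qed

text \<open>\<open>A\<close> is a valuation ring that contains the unit ball of \<open>v\<close> and
  avoids \<open>inv p\<close>, and \<open>w x\<close> is the infimum of
  \<open>v c powr (1 / b)\<close> over those \<open>c\<close> in \<open>F\<close> for which
  \<open>x [^] b\<close> lies in \<open>c A\<close>: the size of \<open>x\<close> is read off from
  comparisons with elements of \<open>F\<close>. The result is confined to the subring
  \<open>U\<close>, obtained by inverting \<open>p\<close>, since transcendental elements may be
  infinitely large.\<close>

lemma extend_abs_value:
  assumes F: "subfield F R" and v: "abs_value (R\<lparr>carrier := F\<rparr>) v"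
    and ultra: "\<And>x y. x \<in> F \<Longrightarrow> y \<in> F \<Longrightarrow> v (x \<oplus> y) \<le> max (v x) (v y)"
    and p: "p \<in> F" "p \<noteq> \<zero>" "v p < 1"
  shows "\<exists>U w. subring U R \<and> F \<subseteq> U \<and> (\<forall>x \<in> carrier R. (algebraic over F) x \<longrightarrow> x \<in> U) \<and>
    (\<forall>x \<in> U. 0 \<le> w x) \<and> (\<forall>x \<in> F. w x = v x) \<and>
    (\<forall>x \<in> U. \<forall>y \<in> U. w (x \<otimes> y) = w x * w y) \<and>
    (\<forall>x \<in> U. \<forall>y \<in> U. w (x \<oplus> y) \<le> max (w x) (w y))"
proof -
  have S: "subring F R" using subfieldE(1)[OF F] .
  note sF = subring_closed[OF S] and vs = abs_value_simps[OF F v] and iF = subfield_inv[OF F]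
  have p': "p \<in> carrier R" "inv p \<in> F" "inv p \<noteq> \<zero>" "p \<otimes> inv p = \<one>" "0 < v p"
    using p sF(1) iF vs(3) by auto
  define F0 where "F0 = {x \<in> F. v x \<le> 1}"
  have vneg: "v (\<ominus> x) = v x" if "x \<in> F" for x
  proof -
    have "v (\<ominus> \<one>) * v (\<ominus> \<one>) = 1" using vs(4)[of "\<ominus> \<one>" "\<ominus> \<one>"] vs(5) sF by (simp add: l_minus)
    then have "v (\<ominus> \<one>) = 1" using vs(1)[of "\<ominus> \<one>"] sF(2,6)
      by (metis abs_of_nonneg mult_1 power2_eq_1_iff power2_eq_square abs_minus_cancel abs_one)
    then show ?thesis using vs(4)[of "\<ominus> \<one>" x] that sF by (simp add: l_minus)
  qed
  have F0: "subring F0 R"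
  proof (rule subringI)
    show "F0 \<subseteq> carrier R" "\<one> \<in> F0" using sF vs unfolding F0_def by auto
    fix x y assume xy: "x \<in> F0" "y \<in> F0"
    show "\<ominus> x \<in> F0" using xy vneg sF unfolding F0_def by auto
    show "x \<otimes> y \<in> F0" using xy vs sF unfolding F0_def by (auto intro: mult_le_one)
    show "x \<oplus> y \<in> F0" using xy ultra[of x y] sF unfolding F0_def by auto
  qed
  define AA where "AA = {A. subring A R \<and> F0 \<subseteq> A \<and> inv p \<notin> A}"
  have "v (inv p) > 1" using vs(7)[OF p(1,2)] p' p(3) by (simp add: one_less_inverse)
  then have "F0 \<in> AA" using F0 unfolding AA_def F0_def by auto
  moreover have "\<Union>C \<in> AA" if C: "C \<noteq> {}" "subset.chain AA C" for C
  proof -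
    have CA: "\<And>A. A \<in> C \<Longrightarrow> A \<in> AA" using C(2) unfolding subset.chain_def by auto
    have two: "\<exists>A\<in>C. x \<in> A \<and> y \<in> A" if "x \<in> \<Union>C" "y \<in> \<Union>C" for x y
      using that C(2) unfolding subset.chain_def by blast
    have "subring (\<Union>C) R"
    proof (rule subringI)
      show "\<Union>C \<subseteq> carrier R" using CA subringE(1) unfolding AA_def by blast
      show "\<one> \<in> \<Union>C" using C(1) CA subringE(3) unfolding AA_def by blast
      fix x y assume xy: "x \<in> \<Union>C" "y \<in> \<Union>C"
      then obtain A where A: "A \<in> C" "x \<in> A" "y \<in> A" using two by blast
      then have "subring A R" using CA AA_def by auto
      then have "\<ominus> x \<in> A" "x \<otimes> y \<in> A" "x \<oplus> y \<in> A" using A(2,3) subringE(5,6,7)[of A R] by auto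
      then show "\<ominus> x \<in> \<Union>C" "x \<otimes> y \<in> \<Union>C" "x \<oplus> y \<in> \<Union>C" using A(1) by auto
    qed
    then show ?thesis using C(1) CA unfolding AA_def by blast
  qed
  ultimately obtain A where "A \<in> AA" and Amax: "\<And>B. B \<in> AA \<Longrightarrow> A \<subseteq> B \<Longrightarrow> B = A"
    using subset_Zorn_nonempty[of AA] by blast
  then have A: "subring A R" "F0 \<subseteq> A" "inv p \<notin> A" unfolding AA_def by auto
  note sA = subring_closed[OF A(1)]
  have pA: "p \<in> A" using A(2) p unfolding F0_def by auto
  have val: "x \<in> A \<or> inv x \<in> A" if "x \<in> carrier R" "x \<noteq> \<zero>" for x
  proof (rule valuation_ring[OF A(1) pA p(2) A(3) _ that])
    fix B assume "subring B R" "A \<subseteq> B" "inv p \<notin> B"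
    then show "B = A" using Amax[of B] A(2) unfolding AA_def by auto
  qed
  \<comment> \<open>If \<open>v z > 1\<close>, a high power of \<open>z\<close> exceeds
    \<open>inv p\<close> in size, so \<open>inv p\<close> is the product of that power with an
    element of the unit ball and would lie in \<open>A\<close>.\<close>
  have AF: "v z \<le> 1" if z: "z \<in> A" "z \<in> F" for z
  proof (rule ccontr)
    assume "\<not> v z \<le> 1"
    then have z1: "v z > 1" by simp
    then obtain k where k: "inverse (v p) < v z ^ k" using real_arch_pow by blast
    have z0: "z \<noteq> \<zero>" using z1 vs(2)[OF z(2)] by auto
    have zk: "z [^] k \<in> F" "z [^] k \<noteq> \<zero>" using sF z z0 vs(2,6) by (auto, metis power_eq_0_iff sF(8) vs(2) vs(6))
    define c where "c = inv p \<otimes> inv (z [^] k)"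
    have c: "c \<in> F" using p' zk iF(1) sF(4) unfolding c_def by auto
    have "v c = inverse (v p) * inverse (v z ^ k)"
      unfolding c_def using vs(4)[OF p'(2) iF(1)[OF zk]] vs(7)[OF zk] vs(7)[OF p(1,2)] vs(6)[OF z(2)] by simp
    also have "\<dots> = inverse (v p * v z ^ k)" by simp
    also have "\<dots> \<le> 1"
    proof -
      have "1 < v p * v z ^ k" using k p'(5) by (simp add: field_simps)
      then show ?thesis by (simp only: inverse_le_1_iff) auto
    qed
    finally have "c \<in> A" using A(2) c unfolding F0_def by auto
    then have "c \<otimes> z [^] k \<in> A" using sA z by auto
    moreover have "c \<otimes> z [^] k = inv p"
      unfolding c_def using iF[OF zk] iF[OF p(1,2)] zk sF(1) by (simp add: m_assoc)
    ultimately show False using A(3) by simp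
  qed
  define U where "U = {x \<in> carrier R. \<exists>k::nat. p [^] k \<otimes> x \<in> A}"
  have pk: "p [^] (k::nat) \<in> A" "p [^] (k::nat) \<in> carrier R" "p [^] (k::nat) \<in> F" for k
    using sA pA p' sF p by auto
  have Umono: "p [^] (k + l) \<otimes> x \<in> A" if "p [^] k \<otimes> x \<in> A" "x \<in> carrier R" for x and k l :: nat
    using sA(4)[OF pk(1)[of l] that(1)] that(2) p'(1) by (simp add: nat_pow_mult[symmetric] m_ac)
  have U: "subring U R"
  proof (rule subringI)
    show "U \<subseteq> carrier R" unfolding U_def by auto
    show "\<one> \<in> U" unfolding U_def using sA by (auto intro!: exI[of _ "0::nat"])
    fix x y assume "x \<in> U" "y \<in> U"
    then obtain k l :: nat where xy: "x \<in> carrier R" "y \<in> carrier R" "p [^] k \<otimes> x \<in> A" "p [^] l \<otimes> y \<in> A"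
      unfolding U_def by auto
    have "p [^] k \<otimes> (\<ominus> x) \<in> A" using sA(6)[OF xy(3)] xy pk by (simp add: r_minus)
    then show "\<ominus> x \<in> U" unfolding U_def using xy by auto
    have "p [^] (k + l) \<otimes> (x \<otimes> y) = (p [^] k \<otimes> x) \<otimes> (p [^] l \<otimes> y)"
      using xy pk p' by (simp add: nat_pow_mult[symmetric] m_ac)
    then have "p [^] (k + l) \<otimes> (x \<otimes> y) \<in> A" using sA(4)[OF xy(3,4)] by simp
    then show "x \<otimes> y \<in> U" unfolding U_def using xy by blast
    have "p [^] (k + l) \<otimes> (x \<oplus> y) = p [^] (k + l) \<otimes> x \<oplus> p [^] (l + k) \<otimes> y"
      using xy pk by (simp add: r_distr add.commute)
    also have "\<dots> \<in> A" by (intro sA Umono xy)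
    finally show "x \<oplus> y \<in> U" unfolding U_def using xy by blast
  qed
  note sU = subring_closed[OF U]
  have AU: "A \<subseteq> U" unfolding U_def using sA by (auto intro!: exI[of _ "0::nat"])
  have FU: "F \<subseteq> U"
  proof
    fix x assume x: "x \<in> F"
    obtain k where "v p ^ k < inverse (v x + 1)" using real_arch_pow_inv[of "inverse (v x + 1)" "v p"] p(3) vs(1)[OF x] by auto
    then have "v p ^ k * v x \<le> inverse (v x + 1) * v x" using vs(1)[OF x] by (intro mult_right_mono) auto
    also have "\<dots> \<le> 1" using vs(1)[OF x] by (simp add: field_simps)
    finally have "v (p [^] k \<otimes> x) \<le> 1" using vs(4)[OF pk(3) x] vs(6)[OF p(1)] by simp
    then have "p [^] k \<otimes> x \<in> A" using A(2) sF(4)[OF pk(3) x] unfolding F0_def by auto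
    then show "x \<in> U" using x sF(1) unfolding U_def by blast
  qed
  \<comment> \<open>Otherwise the inverse \<open>y\<close> of \<open>x\<close> lies in
    \<open>A\<close>. An algebraic equation divided by the next-to-highest power of \<open>x\<close>
    writes \<open>c x\<close> as a polynomial in \<open>y\<close>, and the leading coefficient
    \<open>c\<close> is invertible in \<open>F\<close>.\<close>
  have algU: "x \<in> U" if x: "x \<in> carrier R" and alg: "(algebraic over F) x" for x
  proof (rule ccontr)
    assume xU: "x \<notin> U"
    then have x0: "x \<noteq> \<zero>" using sU by auto
    define y where "y = inv x"
    have y: "y \<in> U" "y \<in> carrier R" "x \<otimes> y = \<one>"
      using val[OF x x0] xU AU inv_nonzero[OF x x0] unfolding y_def by auto
    have ev: "eval q x \<otimes> y [^] m \<in> U" if "set q \<subseteq> F" "length q \<le> Suc m" for q m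
      using that
    proof (induct q)
      case Nil then show ?case using sU y by auto
    next
      case (Cons c q)
      have c: "c \<in> F" "c \<in> carrier R" "c \<in> U" using Cons.prems sF FU by auto
      have q: "eval q x \<in> carrier R" using Cons.prems eval_in_carrier[of q x] x sF(1) by auto
      have len: "length q \<le> m" using Cons.prems by simp
      have "x [^] length q \<otimes> y [^] m = x [^] length q \<otimes> y [^] length q \<otimes> y [^] (m - length q)"
        using x y len by (simp add: m_assoc nat_pow_mult)
      also have "\<dots> = (x \<otimes> y) [^] length q \<otimes> y [^] (m - length q)" using x y(2) by (simp add: nat_pow_distrib)
      also have "\<dots> = y [^] (m - length q)" using y by simp
      finally have "eval (c # q) x \<otimes> y [^] m = c \<otimes> y [^] (m - length q) \<oplus> eval q x \<otimes> y [^] m"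
        using x y c q by (simp add: l_distr m_assoc)
      then show ?case using Cons c y sU by auto
    qed
    obtain P where P: "P \<in> carrier (F[X])" "P \<noteq> []" "eval P x = \<zero>"
      using algebraicE[OF S x alg] by auto
    then obtain c q where cq: "P = c # q" by (cases P) auto
    have pF: "set P \<subseteq> F" "c \<noteq> \<zero>" using P(1) cq unfolding sym[OF univ_poly_carrier] polynomial_def by auto
    have c: "c \<in> F" "c \<in> carrier R" "c \<in> U" "set q \<subseteq> F" using pF cq sF FU by auto
    have q: "eval q x \<in> carrier R" using c eval_in_carrier[of q x] x sF(1) by auto
    show False
    proof (cases q)
      case Nil
      then have "c = \<zero>" using P(3) cq c x by simp
      then show False using pF by simp
    next
      case (Cons c' q')
      define m where "m = length q'"
      have m: "length q = Suc m" using Cons m_def by simp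
      have "x [^] length q \<otimes> y [^] m = x \<otimes> (x \<otimes> y) [^] m"
        using x y(2) by (simp add: nat_pow_distrib m, simp add: m_ac)
      then have 1: "x [^] length q \<otimes> y [^] m = x" using x y by simp
      have "\<zero> = eval P x \<otimes> y [^] m" using P y by simp
      also have "\<dots> = c \<otimes> x \<oplus> eval q x \<otimes> y [^] m" using cq c x y q 1 by (simp add: l_distr m_assoc)
      finally have "c \<otimes> x = \<ominus> (eval q x \<otimes> y [^] m)"
        using c x q y by (metis m_closed minus_equality nat_pow_closed minus_minus a_comm)
      moreover have "eval q x \<otimes> y [^] m \<in> U" using ev[of q m] c m by auto
      ultimately have "c \<otimes> x \<in> U" using sU by auto
      then have "inv c \<otimes> (c \<otimes> x) \<in> U" using sU(4) iF(1)[OF c(1) pF(2)] FU by auto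
      moreover have "inv c \<otimes> (c \<otimes> x) = x" using iF[OF c(1) pF(2)] c x by (simp add: m_assoc[symmetric])
      ultimately show False using xU by simp
    qed
  qed
  define G where "G x = {v c powr (1 / real b) | c b. c \<in> F \<and> c \<noteq> \<zero> \<and> b \<ge> (1::nat) \<and> inv c \<otimes> x [^] b \<in> A}" for x
  define w where "w x = (if x = \<zero> then 0 else Inf (G x))" for x
  have Gpos: "g \<in> G x \<Longrightarrow> g > 0" for g x unfolding G_def using vs(3) by fastforce
  have Gbd: "bdd_below (G x)" for x by (intro bdd_belowI[of _ 0]) (use Gpos in \<open>auto intro: less_imp_le\<close>)
  have Gne: "G x \<noteq> {}" if xU: "x \<in> U" for x
  proof -
    obtain k :: nat where k: "x \<in> carrier R" "p [^] k \<otimes> x \<in> A" using xU unfolding U_def by auto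
    have pk0: "p [^] k \<noteq> \<zero>" using vs(2)[OF pk(3)] vs(6)[OF p(1)] p'(5) by auto
    have i: "inv (p [^] k) \<in> F" "inv (p [^] k) \<noteq> \<zero>" using iF[OF pk(3) pk0] by auto
    have "inv (inv (p [^] k)) = p [^] k" using pk0 pk field_Units by (simp add: Units_inv_inv)
    then have "v (inv (p [^] k)) powr (1 / real (1::nat)) \<in> G x"
      unfolding G_def using i k by (intro CollectI exI[of _ "inv (p [^] k)"] exI[of _ "1::nat"]) auto
    then show ?thesis by auto
  qed
  have wle: "w x \<le> v c powr (1 / real b)"
    if "x \<in> carrier R" "c \<in> F" "c \<noteq> \<zero>" "b \<ge> 1" "inv c \<otimes> x [^] b \<in> A" for x c and b :: nat
  proof (cases "x = \<zero>")
    case False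
    have "Inf (G x) \<le> v c powr (1 / real b)" by (rule cInf_lower[OF _ Gbd]) (use that in \<open>auto simp: G_def\<close>)
    then show ?thesis using False by (simp add: w_def)
  qed (simp add: w_def)
  have w0: "w x \<ge> 0" if "x \<in> U" for x
    using cInf_greatest[OF Gne[OF that], of 0] Gpos unfolding w_def by (auto intro: less_imp_le)
  have wless: "\<exists>c b. c \<in> F \<and> c \<noteq> \<zero> \<and> b \<ge> (1::nat) \<and> inv c \<otimes> x [^] b \<in> A \<and> v c powr (1 / real b) < r"
    if "x \<in> U" "x \<noteq> \<zero>" "w x < r" for x r
    using cInf_lessD[OF Gne[OF that(1)], of r] that(2,3) unfolding w_def G_def by auto
  \<comment> \<open>Roots of the values of powers of \<open>p\<close> alone are already dense in the
    positive reals.\<close>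
  have dens: "\<exists>c b. c \<in> F \<and> c \<noteq> \<zero> \<and> b \<ge> (1::nat) \<and> s < v c powr (1 / real b) \<and> v c powr (1 / real b) < t"
    if st: "0 < s" "s < t" for s t
  proof -
    have lq: "ln (v p) < 0" using p' p(3) by simp
    have "ln t / ln (v p) < ln s / ln (v p)" using st lq by (simp add: divide_strict_right_mono_neg)
    then obtain r where r: "r \<in> \<rat>" "ln t / ln (v p) < r" "r < ln s / ln (v p)" using Rats_dense_in_real by blast
    then obtain a :: int and b :: nat where ab: "b \<noteq> 0" "r = real_of_int a / real b"
      using r(1) unfolding Rats_eq_int_div_nat by auto
    obtain c where c: "c \<in> F" "c \<noteq> \<zero>" "v c = v p powr real_of_int a"
    proof (cases "a \<ge> 0")
      case True
      have "v (p [^] nat a) = v p powr real (nat a)" using vs(6)[OF p(1)] powr_realpow[OF p'(5)] by metis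
      also have "real (nat a) = real_of_int a" using True by simp
      finally have "v (p [^] nat a) = v p powr real_of_int a" .
      moreover from this have "p [^] nat a \<noteq> \<zero>" using vs(2)[OF pk(3)[of "nat a"]] p'(5) by auto
      ultimately show ?thesis using that pk(3) by blast
    next
      case False
      have "v (p [^] nat (-a)) = v p powr real (nat (-a))" using vs(6)[OF p(1)] powr_realpow[OF p'(5)] by metis
      also have "real (nat (-a)) = real_of_int (-a)" using False by simp
      finally have e: "v (p [^] nat (-a)) = v p powr real_of_int (-a)" .
      moreover from this have n: "p [^] nat (-a) \<noteq> \<zero>" using vs(2)[OF pk(3)[of "nat (-a)"]] p'(5) by auto
      ultimately have "v (inv (p [^] nat (-a))) = v p powr real_of_int a"
        using vs(7)[OF pk(3) n] by (simp add: powr_minus)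
      then show ?thesis using that iF[OF pk(3) n] by blast
    qed
    have "v c powr (1 / real b) = v p powr r" using c ab p'(5) by (simp add: powr_powr)
    also have "\<dots> = exp (r * ln (v p))" using p'(5) by (simp add: powr_def)
    finally have e: "v c powr (1 / real b) = exp (r * ln (v p))" .
    have "ln s < r * ln (v p)" "r * ln (v p) < ln t" using r lq by (simp_all add: field_simps)
    then have "s < exp (r * ln (v p))" "exp (r * ln (v p)) < t" using st
      by (metis exp_less_mono exp_ln, metis exp_less_mono exp_ln order_less_trans)
    then show ?thesis using c ab e by (intro exI[of _ c] exI[of _ b]) auto
  qed
  have pw: "(inv c \<otimes> z) [^] b = inv (c [^] b) \<otimes> z [^] b" if "c \<in> F" "c \<noteq> \<zero>" "z \<in> carrier R" for c z and b :: nat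
    using that inv_pow[of c b] sF(1) inv_nonzero(1) by (simp add: nat_pow_distrib)
  have pwF: "c [^] b \<in> F" "c [^] b \<noteq> \<zero>" if "c \<in> F" "c \<noteq> \<zero>" for c and b :: nat
    using that sF(8) vs(2,6)[of c] vs(2)[of "c [^] b"] by auto
  have prF: "c \<otimes> d \<in> F" "c \<otimes> d \<noteq> \<zero>" "inv (c \<otimes> d) = inv c \<otimes> inv d" if "c \<in> F" "c \<noteq> \<zero>" "d \<in> F" "d \<noteq> \<zero>" for c d
    using that sF(1,4) integral_iff[of c d] inv_mult_nonzero[of c d] by auto
  have powr_eq: "(v (c [^] b' \<otimes> d [^] b)) powr (1 / real (b * b')) = v c powr (1 / real b) * v d powr (1 / real b')"
    if "c \<in> F" "c \<noteq> \<zero>" "d \<in> F" "d \<noteq> \<zero>" "b \<ge> 1" "b' \<ge> 1" for c d and b b' :: nat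
  proof -
    have "v (c [^] b' \<otimes> d [^] b) = v c ^ b' * v d ^ b" using vs(4,6) that pwF by auto
    also have "\<dots> = v c powr real b' * v d powr real b" using vs(3) that by (simp add: powr_realpow)
    finally show ?thesis using that vs(1) by (simp add: powr_mult powr_powr)
  qed
  have lim: "z \<le> s * t" if "\<And>a b. s < a \<Longrightarrow> t < b \<Longrightarrow> z \<le> a * b" for s t z :: real
  proof -
    have "((\<lambda>e. (s + e) * (t + e)) \<longlongrightarrow> (s + 0) * (t + 0)) (at_right 0)" by (intro tendsto_intros)
    moreover have "\<forall>\<^sub>F e in at_right 0. z \<le> (s + e) * (t + e)"
      using that by (auto simp: eventually_at_right_field intro!: exI[of _ 1])
    ultimately show ?thesis using tendsto_lowerbound[of _ "(s+0)*(t+0)" "at_right 0" z] trivial_limit_at_right_real by fastforce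
  qed
  have wsub: "w (x \<otimes> y) \<le> w x * w y" if xy: "x \<in> U" "y \<in> U" "x \<noteq> \<zero>" "y \<noteq> \<zero>" for x y
  proof (rule lim)
    fix r t assume rt: "w x < r" "w y < t"
    obtain c b where c: "c \<in> F" "c \<noteq> \<zero>" "b \<ge> (1::nat)" "inv c \<otimes> x [^] b \<in> A" "v c powr (1 / real b) < r"
      using wless[OF xy(1,3) rt(1)] by auto
    obtain d b' where d: "d \<in> F" "d \<noteq> \<zero>" "b' \<ge> (1::nat)" "inv d \<otimes> y [^] b' \<in> A" "v d powr (1 / real b') < t"
      using wless[OF xy(2,4) rt(2)] by auto
    have cc: "x \<in> carrier R" "y \<in> carrier R" using xy sU(1) by auto
    have ci: "inv (c [^] b') \<in> carrier R" "inv (d [^] b) \<in> carrier R" using iF(2) pwF c d by auto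
    have "inv (c [^] b' \<otimes> d [^] b) \<otimes> (x \<otimes> y) [^] (b * b') =
        (inv c \<otimes> x [^] b) [^] b' \<otimes> (inv d \<otimes> y [^] b') [^] b"
      using cc ci c(1,2) d(1,2) pwF[OF c(1,2)] pwF[OF d(1,2)]
      by (simp add: pw prF nat_pow_pow nat_pow_distrib mult.commute[of b' b] m_ac)
    moreover have "\<dots> \<in> A" using sA(4,8) c(4) d(4) by auto
    ultimately have "w (x \<otimes> y) \<le> v (c [^] b' \<otimes> d [^] b) powr (1 / real (b * b'))"
      using wle[of "x \<otimes> y" "c [^] b' \<otimes> d [^] b" "b * b'"] cc c d pwF prF by (simp del: of_nat_mult)
    also have "\<dots> = v c powr (1 / real b) * v d powr (1 / real b')" using powr_eq c d by auto
    also have "\<dots> \<le> r * t" using c(5) d(5) 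
      by (intro mult_mono) (auto intro!: less_imp_le[OF le_less_trans[OF powr_ge_zero c(5)]])
    finally show "w (x \<otimes> y) \<le> r * t" .
  qed
  \<comment> \<open>Here the valuation ring property enters. If \<open>w (x y)\<close> were too
    small, density gives \<open>d\<close> whose root value lies below \<open>w x\<close> but above
    \<open>g / w y\<close>; then \<open>x [^] b'\<close> divided by \<open>d\<close> is outside
    \<open>A\<close>, its inverse is inside, and multiplying this inverse into the relation for
    \<open>x y\<close> bounds \<open>w y\<close> strictly below itself.\<close>
  have wsup: "w x * w y \<le> w (x \<otimes> y)" if xy: "x \<in> U" "y \<in> U" "x \<noteq> \<zero>" "y \<noteq> \<zero>" for x y
  proof (rule ccontr)
    assume neg: "\<not> ?thesis"
    have cc: "x \<in> carrier R" "y \<in> carrier R" "x \<otimes> y \<in> U" "x \<otimes> y \<noteq> \<zero>"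
      using xy sU(1,4) integral_iff[of x y] by auto
    have "w x * w y > 0" using neg w0[OF cc(3)] by linarith
    then have pos: "w x > 0" "w y > 0" using w0[OF xy(1)] w0[OF xy(2)] by (auto simp: zero_less_mult_iff)
    obtain c b where c: "c \<in> F" "c \<noteq> \<zero>" "b \<ge> (1::nat)" "inv c \<otimes> (x \<otimes> y) [^] b \<in> A"
        "v c powr (1 / real b) < w x * w y"
      using wless[OF cc(3,4), of "w x * w y"] neg by auto
    define g where "g = v c powr (1 / real b)"
    have g: "g > 0" "g / w y < w x" using c(5) vs(3)[OF c(1,2)] pos unfolding g_def by (auto simp: field_simps)
    obtain d b' where d: "d \<in> F" "d \<noteq> \<zero>" "b' \<ge> (1::nat)" "g / w y < v d powr (1 / real b')"
        "v d powr (1 / real b') < w x"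
      using dens[OF divide_pos_pos[OF g(1) pos(2)] g(2)] by blast
    define xi where "xi = inv x"
    have xi: "xi \<in> carrier R" "x \<otimes> xi = \<one>" "xi \<noteq> \<zero>" using inv_nonzero[OF cc(1) xy(3)] unfolding xi_def by auto
    have i: "inv d \<in> F" "inv d \<noteq> \<zero>" "inv d \<in> carrier R" "d \<otimes> inv d = \<one>" "d \<in> carrier R" using iF[OF d(1,2)] sF(1) d by auto
    have xb: "x [^] b' \<in> carrier R" "x [^] b' \<noteq> \<zero>" using cc(1) pow_nonzero[OF cc(1) xy(3)] by auto
    have "inv d \<otimes> x [^] b' \<notin> A" using wle[OF cc(1) d(1-3)] d(5) by auto
    then have "inv (inv d \<otimes> x [^] b') \<in> A"
      using val[of "inv d \<otimes> x [^] b'"] i xb integral_iff by (metis m_closed)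
    moreover have "inv (inv d \<otimes> x [^] b') = d \<otimes> xi [^] b'"
    proof (rule comm_inv_char)
      have "inv d \<otimes> x [^] b' \<otimes> (d \<otimes> xi [^] b') = (d \<otimes> inv d) \<otimes> (x \<otimes> xi) [^] b'"
        using i(3,5) xb(1) xi(1) cc(1) by (simp add: nat_pow_distrib m_ac)
      then show "inv d \<otimes> x [^] b' \<otimes> (d \<otimes> xi [^] b') = \<one>" using i xi by simp
    qed (use i xb xi in auto)
    ultimately have dA: "d \<otimes> xi [^] b' \<in> A" by simp
    have id: "inv (inv d) = d" using comm_inv_char[of "inv d" d] i m_comm[of d "inv d"] by auto
    define e where "e = c [^] b' \<otimes> (inv d) [^] b"
    have e: "e \<in> F" "e \<noteq> \<zero>" using prF pwF c i unfolding e_def by auto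
    have ei: "inv e = inv (c [^] b') \<otimes> d [^] b"
      unfolding e_def using prF(3)[OF pwF[OF c(1,2)] pwF[OF i(1,2)]] inv_pow[OF i(3,2), of b] id by simp
    have ci: "inv (c [^] b') \<in> carrier R" using iF(2) pwF[OF c(1,2)] by auto
    have "inv e \<otimes> y [^] (b * b') = (inv c \<otimes> (x \<otimes> y) [^] b) [^] b' \<otimes> (d \<otimes> xi [^] b') [^] b"
    proof -
      have "(inv c \<otimes> (x \<otimes> y) [^] b) [^] b' \<otimes> (d \<otimes> xi [^] b') [^] b
          = inv (c [^] b') \<otimes> (x [^] (b * b') \<otimes> y [^] (b * b')) \<otimes> (d [^] b \<otimes> xi [^] (b * b'))"
        using cc(1,2) c(1,2) xi(1) i(5) ci by (simp add: pw nat_pow_distrib nat_pow_pow mult.commute[of b' b])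
      also have "\<dots> = (inv (c [^] b') \<otimes> d [^] b) \<otimes> y [^] (b * b') \<otimes> (x \<otimes> xi) [^] (b * b')"
        using cc(1,2) xi(1) i(5) ci by (simp add: nat_pow_distrib m_ac)
      finally show ?thesis using xi(2) cc(2) ei ci i(5) by simp
    qed
    moreover have "\<dots> \<in> A" using sA(4,8) c(4) dA by auto
    ultimately have "w y \<le> v e powr (1 / real (b * b'))"
      using wle[of y e "b * b'"] cc e c d by (simp del: of_nat_mult)
    also have "\<dots> = g * v (inv d) powr (1 / real b')" unfolding e_def g_def using powr_eq c d i by auto
    also have "v (inv d) = inverse (v d)" using vs(7) d by auto
    also have "g * (inverse (v d)) powr (1 / real b') = g / (v d powr (1 / real b'))"
      using vs(3)[OF d(1,2)] by (simp add: powr_divide inverse_eq_divide)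
    also have "\<dots> < w y"
    proof -
      have "v d powr (1 / real b') > 0" using vs(3)[OF d(1,2)] by simp
      then show ?thesis using d(4) pos(2) by (simp add: field_simps)
    qed
    finally show False by simp
  qed
  have wmult: "w (x \<otimes> y) = w x * w y" if xy: "x \<in> U" "y \<in> U" for x y
  proof (cases "x = \<zero> \<or> y = \<zero>")
    case True then show ?thesis using xy sU(1) by (auto simp: w_def)
  next
    case False then show ?thesis using wsub[OF xy] wsup[OF xy] by auto
  qed
  have wA: "w x \<le> 1" if "x \<in> A" for x
    using wle[of x \<one> 1] that sA(1) sF(2) vs(5) by auto
  have wul: "w (x \<oplus> y) \<le> w y" if xy: "x \<in> U" "y \<in> U" "y \<noteq> \<zero>" "x \<otimes> inv y \<in> A" for x y
  proof -
    define z where "z = x \<otimes> inv y"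
    have cc: "x \<in> carrier R" "y \<in> carrier R" using xy sU(1) by auto
    have y: "inv y \<in> carrier R" "inv y \<otimes> y = \<one>" using inv_nonzero[OF cc(2) xy(3)] by auto
    have z: "z \<in> A" "z \<in> carrier R" using xy sA(1) z_def by auto
    have "z \<otimes> y = x" unfolding z_def using cc y by (simp add: m_assoc)
    then have "(z \<oplus> \<one>) \<otimes> y = x \<oplus> y" using z cc by (simp add: l_distr)
    moreover have zA: "z \<oplus> \<one> \<in> A" using z sA by auto
    ultimately have "w (x \<oplus> y) = w (z \<oplus> \<one>) * w y" using wmult[of "z \<oplus> \<one>" y] AU xy by auto
    also have "\<dots> \<le> 1 * w y" using wA[OF zA] w0[OF xy(2)] by (intro mult_right_mono) auto
    finally show ?thesis by simp
  qed
  have wultra: "w (x \<oplus> y) \<le> max (w x) (w y)" if xy: "x \<in> U" "y \<in> U" for x y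
  proof (cases "x = \<zero> \<or> y = \<zero>")
    case True then show ?thesis using xy sU(1) by auto
  next
    case False
    have cc: "x \<in> carrier R" "y \<in> carrier R" using xy sU(1) by auto
    have ix: "inv x \<in> carrier R" "x \<otimes> inv x = \<one>" "inv x \<noteq> \<zero>" and iy: "inv y \<in> carrier R" "y \<otimes> inv y = \<one>" "inv y \<noteq> \<zero>"
      using inv_nonzero[OF cc(1)] inv_nonzero[OF cc(2)] False by auto
    have "x \<otimes> inv y \<noteq> \<zero>" using False cc iy integral by blast
    then have "x \<otimes> inv y \<in> A \<or> inv (x \<otimes> inv y) \<in> A" using val cc iy by auto
    moreover have "inv (x \<otimes> inv y) = y \<otimes> inv x"
    proof (rule comm_inv_char)
      have "x \<otimes> inv y \<otimes> (y \<otimes> inv x) = (x \<otimes> inv x) \<otimes> (y \<otimes> inv y)" using cc ix(1) iy(1) by (simp add: m_ac)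
      then show "x \<otimes> inv y \<otimes> (y \<otimes> inv x) = \<one>" using ix iy by simp
    qed (use cc ix iy in auto)
    ultimately consider "x \<otimes> inv y \<in> A" | "y \<otimes> inv x \<in> A" by auto
    then show ?thesis
    proof cases
      case 1 then show ?thesis using wul[OF xy] False by auto
    next
      case 2
      have "w (y \<oplus> x) \<le> w x" using wul[OF xy(2,1)] 2 False by auto
      then show ?thesis using cc by (simp add: a_comm)
    qed
  qed
  have wF: "w c = v c" if c: "c \<in> F" for c
  proof (cases "c = \<zero>")
    case True then show ?thesis using vs(2)[OF sF(3)] by (simp add: w_def)
  next
    case False
    have "w c \<le> v c powr (1 / real (1::nat))"
      by (rule wle) (use c sF(1) False iF[OF c False] sA(2) in auto)
    then have le: "w c \<le> v c" using vs(3)[OF c False] by simp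
    have "v c \<le> g" if gG: "g \<in> G c" for g
    proof -
      obtain d b where d: "d \<in> F" "d \<noteq> \<zero>" "b \<ge> (1::nat)" "inv d \<otimes> c [^] b \<in> A" "g = v d powr (1 / real b)"
        using gG unfolding G_def by auto
      have cb: "c [^] b \<in> F" using sF(8)[OF c] .
      have "v (inv d \<otimes> c [^] b) \<le> 1" using AF d(4) sF(4)[OF iF(1)[OF d(1,2)] cb] by auto
      then have "inverse (v d) * v c ^ b \<le> 1" using vs(4)[OF iF(1)[OF d(1,2)] cb] vs(7)[OF d(1,2)] vs(6)[OF c] by simp
      then have "v c ^ b \<le> v d" using vs(3)[OF d(1,2)] by (simp add: field_simps)
      then have "(v c ^ b) powr (1 / real b) \<le> v d powr (1 / real b)"
        using vs(1)[OF c] by (intro powr_mono2) auto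
      moreover have "(v c ^ b) powr (1 / real b) = v c"
        using vs(3)[OF c False] d(3) by (simp add: powr_realpow[symmetric] powr_powr)
      ultimately show ?thesis using d(5) by simp
    qed
    then have "v c \<le> Inf (G c)" using cInf_greatest[OF Gne] c FU by blast
    then show ?thesis using le False by (simp add: w_def)
  qed
  show ?thesis
    using U FU algU w0 wF wmult wultra by (intro exI[of _ U] exI[of _ w]) blast
qed

end

subsection \<open>Completions of non-archimedean fields\<close>

locale nonarch_field = field R for R (structure) +
  fixes v :: "'a \<Rightarrow> real"
  assumes v_abs: "abs_value R v"
    and v_ultra: "x \<in> carrier R \<Longrightarrow> y \<in> carrier R \<Longrightarrow> v (x \<oplus> y) \<le> max (v x) (v y)"
begin

lemma v_simps:
  "x \<in> carrier R \<Longrightarrow> v x \<ge> 0" "x \<in> carrier R \<Longrightarrow> v x = 0 \<longleftrightarrow> x = \<zero>" "x \<in> carrier R \<Longrightarrow> x \<noteq> \<zero> \<Longrightarrow> v x > 0"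
  "x \<in> carrier R \<Longrightarrow> y \<in> carrier R \<Longrightarrow> v (x \<otimes> y) = v x * v y" "v \<one> = 1"
  "x \<in> carrier R \<Longrightarrow> v (x [^] (n::nat)) = v x ^ n"
  "x \<in> carrier R \<Longrightarrow> x \<noteq> \<zero> \<Longrightarrow> v (inv x) = inverse (v x)" "v \<zero> = 0"
  using abs_value_simps[OF carrier_is_subfield] v_abs by auto

lemma v_neg: assumes "x \<in> carrier R" shows "v (\<ominus> x) = v x"
proof -
  have "v (\<ominus> \<one>) * v (\<ominus> \<one>) = 1" using v_simps(4)[of "\<ominus> \<one>" "\<ominus> \<one>"] v_simps(5) by (simp add: l_minus)
  then have "v (\<ominus> \<one>) = 1" using v_simps(1)[of "\<ominus> \<one>"]
    by (metis abs_of_nonneg power2_eq_1_iff power2_eq_square abs_minus_cancel abs_one a_inv_closed one_closed)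
  then show ?thesis using v_simps(4)[of "\<ominus> \<one>" x] assms by (simp add: l_minus)
qed

lemma v_minus_commute: "x \<in> carrier R \<Longrightarrow> y \<in> carrier R \<Longrightarrow> v (x \<ominus> y) = v (y \<ominus> x)"
  using v_neg[of "x \<ominus> y"] minus_add[of x "\<ominus> y"] by (simp add: a_minus_def a_comm)

lemma v_diff_le:
  assumes "x \<in> carrier R" "y \<in> carrier R" shows "\<bar>v x - v y\<bar> \<le> v (x \<ominus> y)"
proof -
  have "x = (x \<ominus> y) \<oplus> y" "y = (y \<ominus> x) \<oplus> x" using assms by (simp_all add: a_minus_def a_assoc l_neg)
  then have "v x \<le> max (v (x \<ominus> y)) (v y)" "v y \<le> max (v (y \<ominus> x)) (v x)"
    using v_ultra[of "x \<ominus> y" y] v_ultra[of "y \<ominus> x" x] assms by auto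
  then show ?thesis using v_minus_commute[OF assms] v_simps(1)[OF assms(1)] v_simps(1)[OF assms(2)]
      v_simps(1)[of "x \<ominus> y"] assms by auto
qed

abbreviation "CR \<equiv> cauchy_ring R v"
abbreviation "NS \<equiv> null_sequences R v"
abbreviation "KV \<equiv> Defs.completion R v"

lemma cauchy_ring_simps:
  "s \<otimes>\<^bsub>CR\<^esub> t = (\<lambda>n. s n \<otimes> t n)" "s \<oplus>\<^bsub>CR\<^esub> t = (\<lambda>n. s n \<oplus> t n)" "\<one>\<^bsub>CR\<^esub> = (\<lambda>n. \<one>)" "\<zero>\<^bsub>CR\<^esub> = (\<lambda>n. \<zero>)"
  by (auto simp: cauchy_ring_def)

lemma cauchy_carrier:
  "s \<in> carrier CR \<longleftrightarrow> (\<forall>n. s n \<in> carrier R) \<and> (\<forall>e > 0. \<exists>N. \<forall>m \<ge> N. \<forall>n \<ge> N. v (s m \<ominus> s n) < e)"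
  by (auto simp: cauchy_ring_def)

lemma cauchy_closed: "s \<in> carrier CR \<Longrightarrow> s n \<in> carrier R" by (simp add: cauchy_carrier)

lemma cauchy_bounded:
  assumes "s \<in> carrier CR" obtains N B where "B > 0" "\<And>n. n \<ge> N \<Longrightarrow> v (s n) \<le> B"
proof -
  obtain N where N: "\<And>m n. m \<ge> N \<Longrightarrow> n \<ge> N \<Longrightarrow> v (s m \<ominus> s n) < 1"
    using assms unfolding cauchy_carrier by (meson zero_less_one)
  have "v (s n) \<le> v (s N) + 1" if "n \<ge> N" for n
    using N[OF that order_refl] v_diff_le[of "s n" "s N"] cauchy_closed[OF assms] by fastforce
  then show ?thesis using that[of "v (s N) + 1" N] v_simps(1)[OF cauchy_closed[OF assms, of N]] by auto
qed

lemma cauchy_const: "x \<in> carrier R \<Longrightarrow> (\<lambda>n. x) \<in> carrier CR"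
  by (auto simp: cauchy_carrier a_minus_def r_neg v_simps)

lemma cauchy_add: assumes s: "s \<in> carrier CR" and t: "t \<in> carrier CR" shows "(\<lambda>n. s n \<oplus> t n) \<in> carrier CR"
  unfolding cauchy_carrier
proof (intro conjI allI impI)
  fix e :: real assume e: "e > 0"
  obtain N1 where N1: "\<And>m n. m \<ge> N1 \<Longrightarrow> n \<ge> N1 \<Longrightarrow> v (s m \<ominus> s n) < e" using s e unfolding cauchy_carrier by meson
  obtain N2 where N2: "\<And>m n. m \<ge> N2 \<Longrightarrow> n \<ge> N2 \<Longrightarrow> v (t m \<ominus> t n) < e" using t e unfolding cauchy_carrier by meson
  have "v (s m \<oplus> t m \<ominus> (s n \<oplus> t n)) < e" if "m \<ge> max N1 N2" "n \<ge> max N1 N2" for m n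
  proof -
    have "s m \<oplus> t m \<ominus> (s n \<oplus> t n) = (s m \<ominus> s n) \<oplus> (t m \<ominus> t n)"
      using cauchy_closed[OF s] cauchy_closed[OF t] by (simp add: a_minus_def minus_add a_ac)
    then have "v (s m \<oplus> t m \<ominus> (s n \<oplus> t n)) \<le> max (v (s m \<ominus> s n)) (v (t m \<ominus> t n))"
      using v_ultra[of "s m \<ominus> s n" "t m \<ominus> t n"] cauchy_closed[OF s] cauchy_closed[OF t] by simp
    moreover have "v (s m \<ominus> s n) < e" "v (t m \<ominus> t n) < e" using N1[of m n] N2[of m n] that by auto
    ultimately show ?thesis by linarith
  qed
  then show "\<exists>N. \<forall>m\<ge>N. \<forall>n\<ge>N. v (s m \<oplus> t m \<ominus> (s n \<oplus> t n)) < e" by blast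
qed (use cauchy_closed s t in auto)

lemma v_mult_diff:
  assumes "a \<in> carrier R" "b \<in> carrier R" "c \<in> carrier R" "d \<in> carrier R"
  shows "v (a \<otimes> b \<ominus> c \<otimes> d) \<le> max (v a * v (b \<ominus> d)) (v d * v (a \<ominus> c))"
proof -
  have "a \<otimes> b \<ominus> c \<otimes> d = a \<otimes> (b \<ominus> d) \<oplus> d \<otimes> (a \<ominus> c)" using assms by algebra
  then show ?thesis using v_ultra[of "a \<otimes> (b \<ominus> d)" "d \<otimes> (a \<ominus> c)"] assms v_simps(4) by simp
qed

lemma cauchy_mult: assumes s: "s \<in> carrier CR" and t: "t \<in> carrier CR" shows "(\<lambda>n. s n \<otimes> t n) \<in> carrier CR"
  unfolding cauchy_carrier
proof (intro conjI allI impI)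
  fix e :: real assume e: "e > 0"
  obtain N0 B where B: "B > 0" "\<And>n. n \<ge> N0 \<Longrightarrow> v (s n) \<le> B" using cauchy_bounded[OF s] by blast
  obtain N3 B' where B': "B' > 0" "\<And>n. n \<ge> N3 \<Longrightarrow> v (t n) \<le> B'" using cauchy_bounded[OF t] by blast
  have "e / B' > 0" "e / B > 0" using e B B' by auto
  obtain N1 where N1: "\<And>m n. m \<ge> N1 \<Longrightarrow> n \<ge> N1 \<Longrightarrow> v (s m \<ominus> s n) < e / B'"
    using s \<open>e / B' > 0\<close> unfolding cauchy_carrier by meson
  obtain N2 where N2: "\<And>m n. m \<ge> N2 \<Longrightarrow> n \<ge> N2 \<Longrightarrow> v (t m \<ominus> t n) < e / B"
    using t \<open>e / B > 0\<close> unfolding cauchy_carrier by meson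
  have "v (s m \<otimes> t m \<ominus> s n \<otimes> t n) < e" if mn: "m \<ge> N0 + N1 + N2 + N3" "n \<ge> N0 + N1 + N2 + N3" for m n
  proof -
    have c: "s m \<in> carrier R" "t m \<in> carrier R" "s n \<in> carrier R" "t n \<in> carrier R" using cauchy_closed s t by auto
    have "v (s m) * v (t m \<ominus> t n) \<le> B * v (t m \<ominus> t n)" using B(2)[of m] mn v_simps(1) c by (intro mult_right_mono) auto
    also have "\<dots> < B * (e / B)" using N2[of m n] mn B(1) by (intro mult_strict_left_mono) auto
    finally have 1: "v (s m) * v (t m \<ominus> t n) < e" using B by simp
    have "v (t n) * v (s m \<ominus> s n) \<le> B' * v (s m \<ominus> s n)" using B'(2)[of n] mn v_simps(1) c by (intro mult_right_mono) auto
    also have "\<dots> < B' * (e / B')" using N1[of m n] mn B'(1) by (intro mult_strict_left_mono) auto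
    finally have 2: "v (t n) * v (s m \<ominus> s n) < e" using B' by simp
    show ?thesis using v_mult_diff[OF c] 1 2 by linarith
  qed
  then show "\<exists>N. \<forall>m\<ge>N. \<forall>n\<ge>N. v (s m \<otimes> t m \<ominus> s n \<otimes> t n) < e" by blast
qed (use cauchy_closed s t in auto)

lemma cauchy_neg: assumes s: "s \<in> carrier CR" shows "(\<lambda>n. \<ominus> s n) \<in> carrier CR"
  using cauchy_mult[OF cauchy_const[of "\<ominus> \<one>"] s] cauchy_closed[OF s] by (simp add: l_minus)

lemma cauchy_cring: "cring CR"
proof (rule cringI)
  show "abelian_group CR"
  proof (rule abelian_groupI)
    fix x assume x: "x \<in> carrier CR"
    have "(\<lambda>n. \<ominus> x n) \<in> carrier CR" "(\<lambda>n. \<ominus> x n) \<oplus>\<^bsub>CR\<^esub> x = \<zero>\<^bsub>CR\<^esub>"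
      using cauchy_neg[OF x] cauchy_closed[OF x] by (auto simp: cauchy_ring_simps l_neg)
    then show "\<exists>y\<in>carrier CR. y \<oplus>\<^bsub>CR\<^esub> x = \<zero>\<^bsub>CR\<^esub>" by blast
  qed (auto simp: cauchy_ring_simps cauchy_add cauchy_const cauchy_closed a_ac)
  show "Group.comm_monoid CR"
    by (rule comm_monoidI) (auto simp: cauchy_ring_simps cauchy_mult cauchy_const cauchy_closed m_ac)
qed (auto simp: cauchy_ring_simps cauchy_closed l_distr)

interpretation CR: cring CR by (rule cauchy_cring)

lemma cauchy_uminus: assumes "s \<in> carrier CR" shows "\<ominus>\<^bsub>CR\<^esub> s = (\<lambda>n. \<ominus> s n)"
  by (rule CR.minus_equality) (use assms cauchy_neg cauchy_closed[OF assms] in \<open>auto simp: cauchy_ring_simps l_neg\<close>)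

lemma null_ideal: "ideal NS CR"
proof (rule idealI)
  show "subgroup NS (add_monoid CR)"
  proof (rule CR.add.subgroupI)
    show "NS \<subseteq> carrier CR" by (auto simp: null_sequences_def)
    show "NS \<noteq> {}" using cauchy_const[of \<zero>] by (auto simp: null_sequences_def v_simps intro!: exI[of _ "\<lambda>n. \<zero>"])
  next
    fix a assume a: "a \<in> NS"
    then have "a \<in> carrier CR" by (simp add: null_sequences_def)
    then show "\<ominus>\<^bsub>CR\<^esub> a \<in> NS"
      using a cauchy_neg[of a] cauchy_closed[of a] by (simp add: cauchy_uminus null_sequences_def v_neg)
  next
    fix a b assume ab: "a \<in> NS" "b \<in> NS"
    then have c: "a \<in> carrier CR" "b \<in> carrier CR" and l: "(\<lambda>n. v (a n)) \<longlonglongrightarrow> 0" "(\<lambda>n. v (b n)) \<longlonglongrightarrow> 0"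
      by (auto simp: null_sequences_def)
    have "(\<lambda>n. v (a n \<oplus> b n)) \<longlonglongrightarrow> 0"
    proof (rule tendsto_sandwich[OF _ _ tendsto_const tendsto_max[OF l, simplified]])
      show "\<forall>\<^sub>F n in sequentially. 0 \<le> v (a n \<oplus> b n)" using v_simps(1) cauchy_closed c by auto
      show "\<forall>\<^sub>F n in sequentially. v (a n \<oplus> b n) \<le> max (v (a n)) (v (b n))" using v_ultra cauchy_closed c by auto
    qed
    then show "a \<oplus>\<^bsub>CR\<^esub> b \<in> NS" using cauchy_add[OF c] by (simp add: cauchy_ring_simps null_sequences_def)
  qed
next
  fix a x assume a: "a \<in> NS" and x: "x \<in> carrier CR"
  then have c: "a \<in> carrier CR" and l: "(\<lambda>n. v (a n)) \<longlonglongrightarrow> 0" by (auto simp: null_sequences_def)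
  obtain N B where B: "B > 0" "\<And>n. n \<ge> N \<Longrightarrow> v (x n) \<le> B" using cauchy_bounded[OF x] by blast
  have "(\<lambda>n. v (x n \<otimes> a n)) \<longlonglongrightarrow> 0"
  proof (rule tendsto_sandwich[OF _ _ tendsto_const tendsto_mult_right_zero[OF l, of B]])
    show "\<forall>\<^sub>F n in sequentially. 0 \<le> v (x n \<otimes> a n)" using v_simps(1) cauchy_closed c x by auto
    show "\<forall>\<^sub>F n in sequentially. v (x n \<otimes> a n) \<le> B * v (a n)"
      unfolding eventually_sequentially using B(2) v_simps(1,4) cauchy_closed[OF c] cauchy_closed[OF x]
      by (intro exI[of _ N]) (auto intro!: mult_right_mono)
  qed
  then have "x \<otimes>\<^bsub>CR\<^esub> a \<in> NS" using cauchy_mult[OF x c] by (simp add: cauchy_ring_simps null_sequences_def)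
  then show "x \<otimes>\<^bsub>CR\<^esub> a \<in> NS" "a \<otimes>\<^bsub>CR\<^esub> x \<in> NS" using CR.m_comm[OF x c] by auto
qed (rule CR.ring_axioms)

interpretation NS: ideal NS CR by (rule null_ideal)

abbreviation cls where "cls s \<equiv> NS +>\<^bsub>CR\<^esub> s"

lemma KV_carrier: "c \<in> carrier KV \<longleftrightarrow> (\<exists>s \<in> carrier CR. c = cls s)"
  unfolding Defs.completion_def FactRing_def A_RCOSETS_def' by auto

lemma KV_ops:
  assumes "s \<in> carrier CR" "t \<in> carrier CR"
  shows "cls s \<otimes>\<^bsub>KV\<^esub> cls t = cls (\<lambda>n. s n \<otimes> t n)" "cls s \<oplus>\<^bsub>KV\<^esub> cls t = cls (\<lambda>n. s n \<oplus> t n)"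
proof -
  note h = NS.rcos_ring_hom[folded Defs.completion_def]
  show "cls s \<otimes>\<^bsub>KV\<^esub> cls t = cls (\<lambda>n. s n \<otimes> t n)" "cls s \<oplus>\<^bsub>KV\<^esub> cls t = cls (\<lambda>n. s n \<oplus> t n)"
    using ring_hom_mult[OF h assms] ring_hom_add[OF h assms] by (simp_all add: cauchy_ring_simps)
qed

lemma KV_units: "\<one>\<^bsub>KV\<^esub> = cls (\<lambda>n. \<one>)" "\<zero>\<^bsub>KV\<^esub> = cls (\<lambda>n. \<zero>)"
proof -
  note h = NS.rcos_ring_hom[folded Defs.completion_def]
  show "\<one>\<^bsub>KV\<^esub> = cls (\<lambda>n. \<one>)" using ring_hom_one[OF h] by (simp add: cauchy_ring_simps)
  show "\<zero>\<^bsub>KV\<^esub> = cls (\<lambda>n. \<zero>)"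
    using ring_hom_zero[OF h CR.ring_axioms NS.quotient_is_ring[folded Defs.completion_def]] by (simp add: cauchy_ring_simps)
qed

lemma cls_mem: assumes "s \<in> carrier CR" shows "t \<in> cls s \<longleftrightarrow> t \<in> carrier CR \<and> (\<lambda>n. v (t n \<ominus> s n)) \<longlonglongrightarrow> 0"
proof -
  have "t \<in> cls s \<longleftrightarrow> (\<exists>h\<in>NS. t = (\<lambda>n. h n \<oplus> s n))" by (auto simp: a_r_coset_def' cauchy_ring_simps)
  also have "\<dots> \<longleftrightarrow> t \<in> carrier CR \<and> (\<lambda>n. v (t n \<ominus> s n)) \<longlonglongrightarrow> 0"
  proof
    assume "\<exists>h\<in>NS. t = (\<lambda>n. h n \<oplus> s n)"
    then obtain h where h0: "h \<in> NS" "t = (\<lambda>n. h n \<oplus> s n)" by blast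
    have h: "h \<in> carrier CR" "(\<lambda>n. v (h n)) \<longlonglongrightarrow> 0" using h0(1) unfolding null_sequences_def by blast+
    have "h n \<oplus> s n \<ominus> s n = h n" for n using cauchy_closed[OF h(1)] cauchy_closed[OF assms] by (simp add: a_minus_def a_assoc r_neg)
    then show "t \<in> carrier CR \<and> (\<lambda>n. v (t n \<ominus> s n)) \<longlonglongrightarrow> 0" using h(2) cauchy_add[OF h(1) assms] unfolding h0(2) by simp
  next
    assume t: "t \<in> carrier CR \<and> (\<lambda>n. v (t n \<ominus> s n)) \<longlonglongrightarrow> 0"
    define h where "h = (\<lambda>n. t n \<ominus> s n)"
    have "h \<in> carrier CR" unfolding h_def a_minus_def using cauchy_add[OF conjunct1[OF t] cauchy_neg[OF assms]] .
    then have "h \<in> NS" using conjunct2[OF t] unfolding null_sequences_def h_def by blast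
    moreover have "t = (\<lambda>n. h n \<oplus> s n)"
      unfolding h_def a_minus_def
      using cauchy_closed[OF conjunct1[OF t]] cauchy_closed[OF assms] by (simp add: a_assoc l_neg)
    ultimately show "\<exists>h\<in>NS. t = (\<lambda>n. h n \<oplus> s n)" by blast
  qed
  finally show ?thesis .
qed

lemma cls_eqI:
  assumes s: "s \<in> carrier CR" and t: "t \<in> carrier CR" and l: "(\<lambda>n. v (t n \<ominus> s n)) \<longlonglongrightarrow> 0"
  shows "cls t = cls s"
proof -
  have "t \<ominus>\<^bsub>CR\<^esub> s = (\<lambda>n. t n \<ominus> s n)" unfolding a_minus_def cauchy_uminus[OF s] cauchy_ring_simps ..
  moreover have "t \<ominus>\<^bsub>CR\<^esub> s \<in> carrier CR" using CR.minus_closed[OF t s] .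
  ultimately have "t \<ominus>\<^bsub>CR\<^esub> s \<in> NS" using l unfolding null_sequences_def by simp
  then show ?thesis using CR.quotient_eq_iff_same_a_r_cos[OF null_ideal t s] by simp
qed

lemma v_convergent: assumes "s \<in> carrier CR" shows "\<exists>r. (\<lambda>n. v (s n)) \<longlonglongrightarrow> r"
proof -
  have "Cauchy (\<lambda>n. v (s n))"
  proof (rule metric_CauchyI)
    fix e :: real assume "e > 0"
    then obtain N where N: "\<And>m n. m \<ge> N \<Longrightarrow> n \<ge> N \<Longrightarrow> v (s m \<ominus> s n) < e" using assms unfolding cauchy_carrier by meson
    then show "\<exists>M. \<forall>m\<ge>M. \<forall>n\<ge>M. dist (v (s m)) (v (s n)) < e"
      unfolding dist_real_def using le_less_trans[OF v_diff_le[OF cauchy_closed[OF assms] cauchy_closed[OF assms]]] by blast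
  qed
  then show ?thesis using Cauchy_convergent_iff convergent_def by blast
qed

lemma completion_abs_eq:
  assumes s: "s \<in> carrier CR" and r: "(\<lambda>n. v (s n)) \<longlonglongrightarrow> r" shows "completion_abs v (cls s) = r"
  unfolding completion_abs_def
proof (rule the_equality)
  show "\<forall>t\<in>cls s. (\<lambda>n. v (t n)) \<longlonglongrightarrow> r"
  proof
    fix t assume "t \<in> cls s"
    then have t: "t \<in> carrier CR" "(\<lambda>n. v (t n \<ominus> s n)) \<longlonglongrightarrow> 0" using cls_mem[OF s] by auto
    have "(\<lambda>n. v (t n) - v (s n)) \<longlonglongrightarrow> 0"
      by (rule Lim_null_comparison[OF _ t(2)]) (use v_diff_le cauchy_closed s t in auto)
    from tendsto_add[OF this r] show "(\<lambda>n. v (t n)) \<longlonglongrightarrow> r" by simp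
  qed
  fix r' assume "\<forall>t\<in>cls s. (\<lambda>n. v (t n)) \<longlonglongrightarrow> r'"
  moreover have "s \<in> cls s" using cls_mem[OF s] s cauchy_closed[OF s] by (simp add: a_minus_def r_neg v_simps)
  ultimately show "r' = r" using r LIMSEQ_unique by blast
qed

lemma completion_is_field: "field KV"
proof -
  have "cring KV" unfolding Defs.completion_def by (rule NS.quotient_is_cring[OF cauchy_cring])
  then show ?thesis
  proof (rule cring.cring_fieldI2)
    have "completion_abs v \<zero>\<^bsub>KV\<^esub> = 0" "completion_abs v \<one>\<^bsub>KV\<^esub> = 1"
      using completion_abs_eq[OF cauchy_const, of \<zero> 0] completion_abs_eq[OF cauchy_const, of \<one> 1] KV_units
      by (auto simp: v_simps)
    then show "\<zero>\<^bsub>KV\<^esub> \<noteq> \<one>\<^bsub>KV\<^esub>" by auto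
    fix a assume a: "a \<in> carrier KV" "a \<noteq> \<zero>\<^bsub>KV\<^esub>"
    then obtain s where s: "s \<in> carrier CR" "a = cls s" using KV_carrier by auto
    note sc = cauchy_closed[OF s(1)]
    obtain r where r: "(\<lambda>n. v (s n)) \<longlonglongrightarrow> r" using v_convergent[OF s(1)] by auto
    have "r \<ge> 0" using LIMSEQ_le_const[OF r] v_simps(1)[OF sc] by blast
    moreover have "r \<noteq> 0"
    proof
      assume "r = 0"
      then have "cls s = cls (\<lambda>n. \<zero>)" using r s sc by (intro cls_eqI) (auto simp: cauchy_const a_minus_def)
      then show False using a s KV_units(2) by simp
    qed
    ultimately have r0: "r > 0" by simp
    obtain N where N: "\<And>n. n \<ge> N \<Longrightarrow> v (s n) > r / 2"
      using order_tendstoD(1)[OF r, of "r/2"] r0 by (auto simp: eventually_sequentially)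
    \<comment> \<open>The terms before \<open>N\<close> may vanish and have no inverse; the value
      put there is arbitrary because only the tail determines the class.\<close>
    define t where "t n = (if n \<ge> N then inv (s n) else \<zero>)" for n
    have s0: "s n \<noteq> \<zero>" if "n \<ge> N" for n using N[OF that] r0 v_simps(8) by force
    have tc: "t n \<in> carrier R" for n using s0 inv_nonzero(1)[OF sc] by (simp add: t_def)
    have st: "s n \<otimes> t n = \<one>" if "n \<ge> N" for n using that s0 inv_nonzero(3)[OF sc] by (simp add: t_def)
    have tC: "t \<in> carrier CR" unfolding cauchy_carrier
    proof (intro conjI allI impI tc)
      fix e :: real assume e: "e > 0"
      define q where "q = (r/2) * (r/2)"
      have q: "q > 0" using r0 by (simp add: q_def)
      then have "q * e > 0" using e by simp
      then obtain M where M: "\<And>m n. m \<ge> M \<Longrightarrow> n \<ge> M \<Longrightarrow> v (s m \<ominus> s n) < q * e"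
        using s unfolding cauchy_carrier by meson
      have "v (t m \<ominus> t n) < e" if mn: "m \<ge> N + M" "n \<ge> N + M" for m n
      proof -
        have "s m \<otimes> s n \<otimes> (t m \<ominus> t n) = (s m \<otimes> t m) \<otimes> s n \<ominus> (s n \<otimes> t n) \<otimes> s m"
          using sc[of m] sc[of n] tc[of m] tc[of n] by algebra
        also have "\<dots> = s n \<ominus> s m" using st[of m] st[of n] mn sc by simp
        finally have "v (s m) * v (s n) * v (t m \<ominus> t n) = v (s n \<ominus> s m)"
          using v_simps(4)[of "s m \<otimes> s n" "t m \<ominus> t n"] v_simps(4)[of "s m" "s n"] sc tc by simp
        also have "\<dots> < q * e" using M[of n m] mn by auto
        finally have 1: "v (s m) * v (s n) * v (t m \<ominus> t n) < q * e" .
        have 2: "q \<le> v (s m) * v (s n)"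
          unfolding q_def using N[of m] N[of n] mn r0 by (intro mult_mono) auto
        have "q * v (t m \<ominus> t n) \<le> v (s m) * v (s n) * v (t m \<ominus> t n)"
          by (rule mult_right_mono[OF 2]) (use v_simps(1) tc in auto)
        with 1 have "q * v (t m \<ominus> t n) < q * e" by linarith
        then show ?thesis using mult_less_cancel_left_pos[OF q] by blast
      qed
      then show "\<exists>N. \<forall>m\<ge>N. \<forall>n\<ge>N. v (t m \<ominus> t n) < e" by blast
    qed
    have eq: "cls (\<lambda>n. s n \<otimes> t n) = cls (\<lambda>n. \<one>)"
    proof (rule cls_eqI[OF cauchy_const cauchy_mult[OF s(1) tC]])
      show "(\<lambda>n. v (s n \<otimes> t n \<ominus> \<one>)) \<longlonglongrightarrow> 0"
        by (rule tendsto_eventually)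
           (auto simp: eventually_sequentially st a_minus_def r_neg v_simps intro!: exI[of _ N])
    qed auto
    have "cls t \<in> carrier KV" using KV_carrier tC by blast
    moreover have "a \<otimes>\<^bsub>KV\<^esub> cls t = \<one>\<^bsub>KV\<^esub>" unfolding s(2) KV_ops(1)[OF s(1) tC] KV_units(1) by (rule eq)
    ultimately show "\<exists>b\<in>carrier KV. a \<otimes>\<^bsub>KV\<^esub> b = \<one>\<^bsub>KV\<^esub>" by blast
  qed
qed

lemma completion_abs_value:
  shows "abs_value KV (completion_abs v)"
    and "c \<in> carrier KV \<Longrightarrow> d \<in> carrier KV \<Longrightarrow>
      completion_abs v (c \<oplus>\<^bsub>KV\<^esub> d) \<le> max (completion_abs v c) (completion_abs v d)"
proof -
  have rep: "\<exists>s r. s \<in> carrier CR \<and> c = cls s \<and> (\<lambda>n. v (s n)) \<longlonglongrightarrow> r \<and> completion_abs v c = r \<and> r \<ge> 0"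
    if c: "c \<in> carrier KV" for c
  proof -
    obtain s where s: "s \<in> carrier CR" "c = cls s" using KV_carrier c by auto
    obtain r where r: "(\<lambda>n. v (s n)) \<longlonglongrightarrow> r" using v_convergent[OF s(1)] by auto
    have "r \<ge> 0" using LIMSEQ_le_const[OF r] v_simps(1)[OF cauchy_closed[OF s(1)]] by blast
    then show ?thesis using s r completion_abs_eq by blast
  qed
  show ul: "completion_abs v (c \<oplus>\<^bsub>KV\<^esub> d) \<le> max (completion_abs v c) (completion_abs v d)"
    if cd: "c \<in> carrier KV" "d \<in> carrier KV" for c d
  proof -
    obtain s r where s: "s \<in> carrier CR" "c = cls s" "(\<lambda>n. v (s n)) \<longlonglongrightarrow> r" "completion_abs v c = r" using rep[OF cd(1)] by blast
    obtain t q where t: "t \<in> carrier CR" "d = cls t" "(\<lambda>n. v (t n)) \<longlonglongrightarrow> q" "completion_abs v d = q" using rep[OF cd(2)] by blast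
    obtain u where u: "(\<lambda>n. v (s n \<oplus> t n)) \<longlonglongrightarrow> u" using v_convergent[OF cauchy_add[OF s(1) t(1)]] by auto
    have "u \<le> max r q"
      by (rule LIMSEQ_le[OF u tendsto_max[OF s(3) t(3)]]) (use v_ultra cauchy_closed s t in auto)
    then show ?thesis using KV_ops(2)[OF s(1) t(1)] s t completion_abs_eq[OF cauchy_add[OF s(1) t(1)] u] by simp
  qed
  have nn: "completion_abs v c \<ge> 0" if "c \<in> carrier KV" for c using rep[OF that] by auto
  have z: "completion_abs v c = 0 \<longleftrightarrow> c = \<zero>\<^bsub>KV\<^esub>" if c: "c \<in> carrier KV" for c
  proof -
    obtain s r where s: "s \<in> carrier CR" "c = cls s" "(\<lambda>n. v (s n)) \<longlonglongrightarrow> r" "completion_abs v c = r" using rep[OF c] by blast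
    note k = KV_units(2)
    show ?thesis
    proof
      assume "completion_abs v c = 0"
      then have "cls s = cls (\<lambda>n. \<zero>)" using s cauchy_closed[OF s(1)] by (intro cls_eqI) (auto simp: cauchy_const a_minus_def)
      then show "c = \<zero>\<^bsub>KV\<^esub>" using s k by simp
    next
      assume "c = \<zero>\<^bsub>KV\<^esub>" then show "completion_abs v c = 0" using k completion_abs_eq[OF cauchy_const, of \<zero> 0] by (auto simp: v_simps)
    qed
  qed
  have m: "completion_abs v (c \<otimes>\<^bsub>KV\<^esub> d) = completion_abs v c * completion_abs v d"
    if cd: "c \<in> carrier KV" "d \<in> carrier KV" for c d
  proof -
    obtain s r where s: "s \<in> carrier CR" "c = cls s" "(\<lambda>n. v (s n)) \<longlonglongrightarrow> r" "completion_abs v c = r" using rep[OF cd(1)] by blast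
    obtain t q where t: "t \<in> carrier CR" "d = cls t" "(\<lambda>n. v (t n)) \<longlonglongrightarrow> q" "completion_abs v d = q" using rep[OF cd(2)] by blast
    have "(\<lambda>n. v (s n \<otimes> t n)) \<longlonglongrightarrow> r * q"
      using tendsto_mult[OF s(3) t(3)] v_simps(4) cauchy_closed s(1) t(1) by simp
    then show ?thesis using KV_ops(1)[OF s(1) t(1)] s t completion_abs_eq[OF cauchy_mult[OF s(1) t(1)]] by simp
  qed
  show "abs_value KV (completion_abs v)"
    unfolding abs_value_def
  proof (intro conjI ballI)
    fix x y assume "x \<in> carrier KV" "y \<in> carrier KV"
    then show "completion_abs v (x \<oplus>\<^bsub>KV\<^esub> y) \<le> completion_abs v x + completion_abs v y"
      using ul[of x y] nn[of x] nn[of y] by auto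
  qed (use nn z m in auto)
qed

lemma completion_embed:
  shows "completion_embed R v \<in> ring_hom R KV"
    and "x \<in> carrier R \<Longrightarrow> completion_abs v (completion_embed R v x) = v x"
proof -
  show "completion_embed R v \<in> ring_hom R KV"
  proof (rule ring_hom_memI)
    fix x y assume xy: "x \<in> carrier R" "y \<in> carrier R"
    show "completion_embed R v x \<in> carrier KV" using KV_carrier cauchy_const[OF xy(1)] by (auto simp: completion_embed_def)
    show "completion_embed R v (x \<otimes> y) = completion_embed R v x \<otimes>\<^bsub>KV\<^esub> completion_embed R v y"
      "completion_embed R v (x \<oplus> y) = completion_embed R v x \<oplus>\<^bsub>KV\<^esub> completion_embed R v y"
      using KV_ops(1,2)[OF cauchy_const[OF xy(1)] cauchy_const[OF xy(2)]] by (auto simp: completion_embed_def)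
  next
    show "completion_embed R v \<one> = \<one>\<^bsub>KV\<^esub>" using KV_units by (auto simp: completion_embed_def)
  qed
  show "x \<in> carrier R \<Longrightarrow> completion_abs v (completion_embed R v x) = v x"
    using completion_abs_eq[OF cauchy_const] unfolding completion_embed_def by auto
qed

lemma exists_nontrivial_small:
  assumes "\<exists>x \<in> carrier R. x \<noteq> \<zero> \<and> v x \<noteq> 1"
  shows "\<exists>y \<in> carrier R. y \<noteq> \<zero> \<and> v y < 1"
proof -
  obtain x where x: "x \<in> carrier R" "x \<noteq> \<zero>" "v x \<noteq> 1" using assms by auto
  show ?thesis
  proof (cases "v x < 1")
    case False
    then have "v (inv x) < 1" using x v_simps(7) by (auto simp: inverse_less_1_iff)
    then show ?thesis using inv_nonzero[OF x(1,2)] by blast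
  qed (use x in auto)
qed

lemma nonarch_completion: "nonarch_field KV (completion_abs v)"
  using completion_is_field completion_abs_value by (simp add: nonarch_field_def nonarch_field_axioms_def)

end

text \<open>The absolute value is transported to the copy of \<open>R\<close> inside its closure and
  extended from there. Every element of the closure is algebraic over that copy, so the subring
  \<open>U\<close> of the extension is everything, and the existence of inverses makes
  \<open>w\<close> definite.\<close>

lemma (in nonarch_field) extend_to_alg_closure:
  assumes "\<exists>x \<in> carrier R. x \<noteq> \<zero> \<and> v x \<noteq> 1"
  shows "\<exists>w. abs_value alg_closure w \<and> (\<forall>c \<in> carrier R. w (indexed_const c) = v c)"
proof -
  define E where "E = alg_closure"
  define j :: "'a \<Rightarrow> ('a list \<times> nat) multiset \<Rightarrow> 'a" where "j = indexed_const"
  have ac: "algebraic_closure E (j ` carrier R)"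
    unfolding E_def j_def by (rule alg_closureE)
  note Ef = algebraic_closure.axioms(1)[OF ac] and Es = algebraic_closure.axioms(2)[OF ac]
  have jh: "j \<in> ring_hom R E" unfolding E_def j_def by (rule alg_closureE)
  have jc: "x \<in> carrier R \<Longrightarrow> j x \<in> carrier E"
    and jm: "x \<in> carrier R \<Longrightarrow> y \<in> carrier R \<Longrightarrow> j (x \<otimes> y) = j x \<otimes>\<^bsub>E\<^esub> j y"
    and ja: "x \<in> carrier R \<Longrightarrow> y \<in> carrier R \<Longrightarrow> j (x \<oplus> y) = j x \<oplus>\<^bsub>E\<^esub> j y"
    and j1: "j \<one> = \<one>\<^bsub>E\<^esub>" and j0: "j \<zero> = \<zero>\<^bsub>E\<^esub>" for x y
    using ring_hom_memE[OF jh] ring_hom_zero[OF jh ring_axioms field.is_ring[OF Ef]] by auto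
  have inj: "inj_on j (carrier R)"
    by (rule non_trivial_field_hom_is_inj[OF jh field_axioms Ef])
  define u where "u x = v (inv_into (carrier R) j x)" for x
  have u: "u (j c) = v c" if "c \<in> carrier R" for c using inv_into_f_f[OF inj that] by (simp add: u_def)
  have j0': "j c = \<zero>\<^bsub>E\<^esub> \<longleftrightarrow> c = \<zero>" if "c \<in> carrier R" for c
    using inj_on_eq_iff[OF inj that zero_closed] j0 by simp
  have "abs_value (E\<lparr>carrier := j ` carrier R\<rparr>) u"
    unfolding abs_value_def
  proof (intro conjI ballI)
    fix x assume "x \<in> carrier (E\<lparr>carrier := j ` carrier R\<rparr>)"
    then obtain c where c: "c \<in> carrier R" "x = j c" by auto
    show "0 \<le> u x" using v_simps(1) u c by auto
    show "u x = 0 \<longleftrightarrow> x = \<zero>\<^bsub>E\<lparr>carrier := j ` carrier R\<rparr>\<^esub>" using v_simps(2) u c j0' by auto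
    fix y assume "y \<in> carrier (E\<lparr>carrier := j ` carrier R\<rparr>)"
    then obtain d where d: "d \<in> carrier R" "y = j d" by auto
    show "u (x \<otimes>\<^bsub>E\<lparr>carrier := j ` carrier R\<rparr>\<^esub> y) = u x * u y"
      using v_simps(4)[OF c(1) d(1)] u[of "c \<otimes> d"] u[OF c(1)] u[OF d(1)] c d jm[OF c(1) d(1)] by simp
    show "u (x \<oplus>\<^bsub>E\<lparr>carrier := j ` carrier R\<rparr>\<^esub> y) \<le> u x + u y"
      using v_ultra[OF c(1) d(1)] v_simps(1)[OF c(1)] v_simps(1)[OF d(1)] u[of "c \<oplus> d"] u[OF c(1)] u[OF d(1)] c d ja[OF c(1) d(1)] by simp
  qed
  moreover have "u (x \<oplus>\<^bsub>E\<^esub> y) \<le> max (u x) (u y)" if xy: "x \<in> j ` carrier R" "y \<in> j ` carrier R" for x y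
  proof -
    obtain c d where c: "c \<in> carrier R" "x = j c" "d \<in> carrier R" "y = j d" using xy by auto
    show ?thesis using v_ultra[OF c(1,3)] u[of "c \<oplus> d"] u[OF c(1)] u[OF c(3)] c ja[OF c(1,3)] by simp
  qed
  moreover obtain p where p: "p \<in> j ` carrier R" "p \<noteq> \<zero>\<^bsub>E\<^esub>" "u p < 1"
    using exists_nontrivial_small[OF assms] u j0' by fastforce
  ultimately obtain U w where w: "subring U E" "\<forall>x \<in> carrier E. ((ring.algebraic E) over (j ` carrier R)) x \<longrightarrow> x \<in> U"
    "\<forall>x \<in> U. 0 \<le> w x" "\<forall>x \<in> j ` carrier R. w x = u x"
    "\<forall>x \<in> U. \<forall>y \<in> U. w (x \<otimes>\<^bsub>E\<^esub> y) = w x * w y"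
    "\<forall>x \<in> U. \<forall>y \<in> U. w (x \<oplus>\<^bsub>E\<^esub> y) \<le> max (w x) (w y)"
    using field.extend_abs_value[OF Ef Es, of u p] by blast
  have U: "U = carrier E" using w(1,2) algebraic_closure.algebraic_extension[OF ac] subringE(1) by blast
  have wj: "w (j c) = v c" if "c \<in> carrier R" for c using w(4) u that by simp
  have w1: "w \<one>\<^bsub>E\<^esub> = 1" and w0: "w \<zero>\<^bsub>E\<^esub> = 0" using wj[of \<one>] wj[of \<zero>] j1 j0 v_simps by auto
  have "abs_value E w"
    unfolding abs_value_def
  proof (intro conjI ballI)
    fix x assume x: "x \<in> carrier E"
    show "0 \<le> w x" using w(3) U x by auto
    show "w x = 0 \<longleftrightarrow> x = \<zero>\<^bsub>E\<^esub>"
    proof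
      assume wx: "w x = 0"
      show "x = \<zero>\<^bsub>E\<^esub>"
      proof (rule ccontr)
        assume "x \<noteq> \<zero>\<^bsub>E\<^esub>"
        then have "inv\<^bsub>E\<^esub> x \<in> carrier E" "x \<otimes>\<^bsub>E\<^esub> inv\<^bsub>E\<^esub> x = \<one>\<^bsub>E\<^esub>" using field.inv_nonzero[OF Ef x] by auto
        then show False using w(5) U x w1 wx by (metis mult_zero_left zero_neq_one)
      qed
    qed (use w0 in auto)
    fix y assume y: "y \<in> carrier E"
    show "w (x \<otimes>\<^bsub>E\<^esub> y) = w x * w y" using w(5) U x y by auto
    have "w (x \<oplus>\<^bsub>E\<^esub> y) \<le> max (w x) (w y)" "0 \<le> w x" "0 \<le> w y" using w(3,6) U x y by auto
    then show "w (x \<oplus>\<^bsub>E\<^esub> y) \<le> w x + w y" by linarith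
  qed
  then show ?thesis using wj unfolding E_def j_def by blast
qed

text \<open>\<open>S_integral\<close> quantifies over all extensions \<open>w\<close> to the closure
  of the completion; it carries information only once such an extension is known to exist.\<close>

lemma (in nonarch_field) exists_extension_to_closure:
  assumes "\<exists>x \<in> carrier R. x \<noteq> \<zero> \<and> v x \<noteq> 1"
  shows "\<exists>w. extends_to_closure R v w"
proof -
  obtain x where x: "x \<in> carrier R" "x \<noteq> \<zero>" "v x \<noteq> 1" using assms by auto
  define c where "c = completion_embed R v x"
  have c: "c \<in> carrier KV" "completion_abs v c = v x"
    unfolding c_def using ring_hom_closed[OF completion_embed(1) x(1)] completion_embed(2)[OF x(1)] by auto
  have "c \<noteq> \<zero>\<^bsub>KV\<^esub>"
    using x v_simps(2)[OF x(1)] nonarch_field.v_simps(8)[OF nonarch_completion] c by auto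
  then have "\<exists>x \<in> carrier KV. x \<noteq> \<zero>\<^bsub>KV\<^esub> \<and> completion_abs v x \<noteq> 1" using c x by auto
  from nonarch_field.extend_to_alg_closure[OF nonarch_completion this]
  show ?thesis unfolding extends_to_closure_def completion_closure_def .
qed

subsection \<open>Polynomials over subfields of the complex numbers\<close>

definition polys_over :: "complex set \<Rightarrow> complex poly set" where
  "polys_over K = {p. \<forall>i. coeff p i \<in> K}"

locale csubfield =
  fixes K :: "complex set"
  assumes K0: "0 \<in> K" and K1: "1 \<in> K"
    and Kadd: "x \<in> K \<Longrightarrow> y \<in> K \<Longrightarrow> x + y \<in> K" and Kmult: "x \<in> K \<Longrightarrow> y \<in> K \<Longrightarrow> x * y \<in> K"
    and Kneg: "x \<in> K \<Longrightarrow> - x \<in> K" and Kinv: "x \<in> K \<Longrightarrow> inverse x \<in> K"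
begin

lemma Kdiff: "x \<in> K \<Longrightarrow> y \<in> K \<Longrightarrow> x - y \<in> K" using Kadd[of x "- y"] Kneg by simp
lemma Kdiv: "x \<in> K \<Longrightarrow> y \<in> K \<Longrightarrow> x / y \<in> K" using Kmult[of x "inverse y"] Kinv by (simp add: divide_inverse)
lemma Kpow: "x \<in> K \<Longrightarrow> x ^ n \<in> K" by (induct n) (auto simp: K1 Kmult)
lemma Ksum: "(\<And>i. i \<in> A \<Longrightarrow> f i \<in> K) \<Longrightarrow> sum f A \<in> K"
  by (induct A rule: infinite_finite_induct) (auto simp: K0 Kadd)
lemma Kprod: "(\<And>i. i \<in> A \<Longrightarrow> f i \<in> K) \<Longrightarrow> prod f A \<in> K"
  by (induct A rule: infinite_finite_induct) (auto simp: K1 Kmult)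
lemma Knat: "of_nat n \<in> K" by (induct n) (auto simp: K0 K1 Kadd)
lemma Kint: "of_int n \<in> K" using Knat Kneg by (cases n rule: int_cases2) auto
lemma KRats: "x \<in> \<rat> \<Longrightarrow> x \<in> K" by (induct rule: Rats_induct) (auto simp: of_rat_def Kint Kdiv elim!: Rats_cases')

lemma PK0: "0 \<in> polys_over K" by (simp add: polys_over_def K0)
lemma PK1: "1 \<in> polys_over K" by (auto simp: polys_over_def K0 K1 coeff_1)
lemma PKpCons: "a \<in> K \<Longrightarrow> p \<in> polys_over K \<Longrightarrow> pCons a p \<in> polys_over K"
  by (auto simp: polys_over_def coeff_pCons split: nat.splits)
lemma PKpConsD: assumes "pCons a p \<in> polys_over K" shows "a \<in> K \<and> p \<in> polys_over K"
proof -
  have "coeff (pCons a p) 0 \<in> K" "\<And>i. coeff (pCons a p) (Suc i) \<in> K"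
    using assms unfolding polys_over_def by blast+
  then show ?thesis by (simp add: polys_over_def)
qed
lemma PKadd: "p \<in> polys_over K \<Longrightarrow> q \<in> polys_over K \<Longrightarrow> p + q \<in> polys_over K"
  by (auto simp: polys_over_def Kadd)
lemma PKneg: "p \<in> polys_over K \<Longrightarrow> - p \<in> polys_over K" by (auto simp: polys_over_def Kneg)
lemma PKdiff: "p \<in> polys_over K \<Longrightarrow> q \<in> polys_over K \<Longrightarrow> p - q \<in> polys_over K"
  by (auto simp: polys_over_def Kdiff)
lemma PKmult: "p \<in> polys_over K \<Longrightarrow> q \<in> polys_over K \<Longrightarrow> p * q \<in> polys_over K"
  by (auto simp: polys_over_def coeff_mult intro!: Ksum Kmult)
lemma PKsmult: "a \<in> K \<Longrightarrow> p \<in> polys_over K \<Longrightarrow> smult a p \<in> polys_over K"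
  by (auto simp: polys_over_def Kmult)
lemma PKmonom: "a \<in> K \<Longrightarrow> monom a n \<in> polys_over K" by (auto simp: polys_over_def K0)
lemma PKpower: "p \<in> polys_over K \<Longrightarrow> p ^ n \<in> polys_over K" by (induct n) (auto simp: PK1 PKmult)
lemma PKpderiv: "p \<in> polys_over K \<Longrightarrow> pderiv p \<in> polys_over K"
  by (auto simp: polys_over_def coeff_pderiv intro!: Kmult Kadd K1 Knat)
lemma PKpcompose: "p \<in> polys_over K \<Longrightarrow> q \<in> polys_over K \<Longrightarrow> pcompose p q \<in> polys_over K"
proof (induct p)
  case (pCons a p)
  then show ?case using PKpConsD[OF pCons(3)] by (simp add: pcompose_pCons PKadd PKmult PKpCons PK0)
qed (simp add: PK0)
lemma PKint: "map_poly of_int p \<in> polys_over K" by (auto simp: polys_over_def coeff_map_poly Kint)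
lemma PKpoly: "p \<in> polys_over K \<Longrightarrow> x \<in> K \<Longrightarrow> poly p x \<in> K"
  by (auto simp: poly_altdef polys_over_def intro!: Ksum Kmult Kpow)

lemmas PK = PK0 PK1 PKpCons PKadd PKneg PKdiff PKmult PKsmult PKmonom PKpower PKpderiv PKpcompose PKint

lemma division_over:
  assumes f: "f \<in> polys_over K" "lead_coeff f = 1" and p: "p \<in> polys_over K"
  shows "\<exists>q\<in>polys_over K. \<exists>r\<in>polys_over K. p = f * q + r \<and> (r = 0 \<or> degree r < degree f)"
  using p
proof (induct "degree p" arbitrary: p rule: less_induct)
  case less
  have f0: "f \<noteq> 0" using f(2) by auto
  show ?case
  proof (cases "p = 0 \<or> degree p < degree f")
    case True then show ?thesis using less(2) PK0 by (intro bexI[of _ 0] bexI[of _ p]) auto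
  next
    case False
    define m where "m = monom (lead_coeff p) (degree p - degree f)"
    define p' where "p' = p - f * m"
    have m: "m \<in> polys_over K" using less(2) unfolding m_def by (intro PKmonom) (auto simp: polys_over_def)
    have p': "p' \<in> polys_over K" unfolding p'_def by (intro PKdiff PKmult less f m)
    show ?thesis
    proof (cases "p' = 0")
      case True
      then have "p = f * m + 0" by (simp add: p'_def)
      then show ?thesis using m PK0 by blast
    next
      case F: False
      have dm: "degree (f * m) = degree p"
        using False f0 by (simp add: m_def degree_mult_eq monom_eq_0_iff degree_monom_eq)
      have "lead_coeff m = lead_coeff p" unfolding m_def by (rule lead_coeff_monom)
      then have lm: "lead_coeff (f * m) = lead_coeff p" using f(2) by (simp only: lead_coeff_mult mult_1)
      have c0: "coeff p' (degree p) = 0" unfolding p'_def coeff_diff using lm unfolding dm by simp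
      have "degree p' \<le> degree p" unfolding p'_def using dm by (intro degree_diff_le) auto
      moreover have "degree p' \<noteq> degree p" using c0 F by (metis leading_coeff_0_iff)
      ultimately have "degree p' < degree p" by simp
      from less(1)[OF this p'] obtain q r where qr: "q \<in> polys_over K" "r \<in> polys_over K" "p' = f * q + r"
        "r = 0 \<or> degree r < degree f" by blast
      have "p = f * (q + m) + r" using qr(3) by (simp add: p'_def algebra_simps)
      then show ?thesis using qr m PKadd by blast
    qed
  qed
qed

definition min_poly :: "complex \<Rightarrow> complex poly \<Rightarrow> bool" where
  "min_poly x f \<longleftrightarrow> f \<in> polys_over K \<and> lead_coeff f = 1 \<and> poly f x = 0 \<and>
     (\<forall>g\<in>polys_over K. poly g x = 0 \<longrightarrow> (\<exists>h\<in>polys_over K. g = f * h))"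

lemma min_polyD:
  assumes "min_poly x f"
  shows "f \<in> polys_over K" "lead_coeff f = 1" "poly f x = 0" "f \<noteq> 0" "degree f > 0"
    "g \<in> polys_over K \<Longrightarrow> poly g x = 0 \<Longrightarrow> \<exists>h\<in>polys_over K. g = f * h"
    "g \<in> polys_over K \<Longrightarrow> poly g x = 0 \<Longrightarrow> f dvd g"
proof -
  show f: "f \<in> polys_over K" "lead_coeff f = 1" "poly f x = 0"
    "g \<in> polys_over K \<Longrightarrow> poly g x = 0 \<Longrightarrow> \<exists>h\<in>polys_over K. g = f * h"
    using assms unfolding min_poly_def by blast+
  show "g \<in> polys_over K \<Longrightarrow> poly g x = 0 \<Longrightarrow> f dvd g" using f(4) by auto
  show "f \<noteq> 0" using f(2) by auto
  show "degree f > 0"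
  proof (rule ccontr)
    assume "\<not> degree f > 0"
    then obtain c where "f = [:c:]" using degree_eq_zeroE by auto
    then show False using f(2,3) by auto
  qed
qed

lemma min_poly_exists:
  assumes "p \<in> polys_over K" "p \<noteq> 0" "poly p x = 0"
  obtains f where "min_poly x f"
proof -
  define Q where "Q n \<longleftrightarrow> (\<exists>p\<in>polys_over K. p \<noteq> 0 \<and> poly p x = 0 \<and> degree p = n)" for n
  have "Q (LEAST n. Q n)" using assms by (intro LeastI[of Q "degree p"]) (auto simp: Q_def)
  then obtain g where g: "g \<in> polys_over K" "g \<noteq> 0" "poly g x = 0" "degree g = (LEAST n. Q n)" unfolding Q_def by auto
  define f where "f = smult (inverse (lead_coeff g)) g"
  have f: "f \<in> polys_over K" "lead_coeff f = 1" "poly f x = 0" "degree f = degree g"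
    using g(1-3) unfolding f_def by (auto intro!: Kmult Kinv simp: polys_over_def)
  have "\<exists>h\<in>polys_over K. p = f * h" if p: "p \<in> polys_over K" "poly p x = 0" for p
  proof -
    obtain q r where qr: "q \<in> polys_over K" "r \<in> polys_over K" "p = f * q + r" "r = 0 \<or> degree r < degree f"
      using division_over[OF f(1,2) p(1)] by blast
    have "poly r x = 0" using qr(3) p(2) f(3) by simp
    then have "r = 0" using qr(2,4) f(4) g(4) not_less_Least[of "degree r" Q] unfolding Q_def by force
    then show ?thesis using qr by auto
  qed
  then have "min_poly x f" using f unfolding min_poly_def by blast
  then show ?thesis by (rule that)
qed

text \<open>Irreducibility in disguise: the minimal polynomial \<open>g\<close> of \<open>r\<close>
  divides \<open>f\<close>, the cofactor cannot vanish at \<open>x\<close> for degree reasons, so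
  \<open>g\<close> vanishes at \<open>x\<close> and is in turn a multiple of
  \<open>f\<close>.\<close>

lemma min_poly_root:
  assumes f: "min_poly x f" and r: "poly f r = 0" shows "min_poly r f"
proof -
  note fD = min_polyD[OF f]
  obtain g where g: "min_poly r g" using min_poly_exists[OF fD(1,4) r] .
  note gD = min_polyD[OF g]
  obtain h where h: "h \<in> polys_over K" "f = g * h" using gD(6)[OF fD(1) r] by blast
  have "poly g x * poly h x = 0" using fD(3) h(2) by simp
  moreover have "poly h x \<noteq> 0"
  proof
    assume "poly h x = 0"
    then have "f dvd h" using fD(7)[OF h(1)] by simp
    moreover have h0: "h \<noteq> 0" using h fD(4) by auto
    ultimately have "degree f \<le> degree h" by (intro dvd_imp_degree_le)
    moreover have "degree f = degree g + degree h" using h h0 gD(4) by (simp add: degree_mult_eq)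
    ultimately show False using gD(5) by simp
  qed
  ultimately have "poly g x = 0" by simp
  then obtain k where k: "g = f * k" using fD(6)[OF gD(1)] by blast
  then have "f * (k * h) = f * 1" using h(2) by (metis mult.assoc mult_1_right)
  then have kh: "k * h = 1" using mult_left_cancel[OF fD(4)] by blast
  have "degree h = 0" using kh by (metis degree_1 degree_mult_eq add_is_0 mult_zero_left mult_zero_right zero_neq_one)
  then obtain c where c: "h = [:c:]" using degree_eq_zeroE by auto
  then have "lead_coeff f = lead_coeff g * c" using h by (simp add: lead_coeff_mult)
  then have "c = 1" using fD(2) gD(2) by simp
  then have "f = g" using h c by simp
  then show ?thesis using g by simp
qed

lemma min_poly_conj: assumes "min_poly x f" "poly f r = 0" "g \<in> polys_over K" shows "poly g x = 0 \<longleftrightarrow> poly g r = 0"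
  using min_polyD(6)[OF assms(1,3)] min_polyD(6)[OF min_poly_root[OF assms(1,2)] assms(3)] assms(2) min_polyD(3)[OF assms(1)]
  by fastforce

lemma min_poly_simple_root: assumes f: "min_poly x f" and r: "poly f r = 0" shows "poly (pderiv f) r \<noteq> 0"
proof
  assume d: "poly (pderiv f) r = 0"
  note fD = min_polyD[OF min_poly_root[OF f r]]
  have d0: "pderiv f \<noteq> 0" using fD(5) by (simp add: pderiv_eq_0_iff)
  have "f dvd pderiv f" using fD(7)[OF PKpderiv[OF fD(1)] d] .
  then have "degree f \<le> degree (pderiv f)" using d0 by (rule dvd_imp_degree_le)
  then show False using fD(5) by (simp add: degree_pderiv)
qed

text \<open>An element of least degree in the ideal generated by \<open>p\<close> and
  \<open>q\<close> divides both. It is constant, since otherwise the fundamental theorem of algebra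
  would give it a root, common to \<open>p\<close> and \<open>q\<close>.\<close>

lemma bezout_over:
  assumes p: "p \<in> polys_over K" "p \<noteq> 0" and q: "q \<in> polys_over K"
    and nc: "\<And>r. poly p r = 0 \<Longrightarrow> poly q r \<noteq> 0"
  shows "\<exists>u\<in>polys_over K. \<exists>v\<in>polys_over K. u * p + v * q = 1"
proof -
  define I where "I = {u * p + v * q | u v. u \<in> polys_over K \<and> v \<in> polys_over K}"
  have II: "a - g * b \<in> I" if ab: "a \<in> I" "b \<in> I" "g \<in> polys_over K" for a b g
  proof -
    obtain u v u' v' where uv: "u \<in> polys_over K" "v \<in> polys_over K" "u' \<in> polys_over K" "v' \<in> polys_over K"
      "a = u * p + v * q" "b = u' * p + v' * q" using ab unfolding I_def by blast
    have "a - g * b = (u - g * u') * p + (v - g * v') * q" unfolding uv by (simp add: algebra_simps)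
    moreover have "u - g * u' \<in> polys_over K" "v - g * v' \<in> polys_over K"
      using uv ab by (auto intro!: PKdiff PKmult)
    ultimately show ?thesis unfolding I_def by blast
  qed
  have IK: "I \<subseteq> polys_over K" unfolding I_def using p q by (auto intro!: PKadd PKmult)
  have pI: "p \<in> I" unfolding I_def using PK0 PK1 by (intro CollectI exI[of _ 1] exI[of _ 0]) auto
  have qI: "q \<in> I" unfolding I_def using PK0 PK1 by (intro CollectI exI[of _ 0] exI[of _ 1]) auto
  define Q where "Q n \<longleftrightarrow> (\<exists>g\<in>I. g \<noteq> 0 \<and> degree g = n)" for n
  have "Q (LEAST n. Q n)" using pI p(2) by (intro LeastI[of Q "degree p"]) (auto simp: Q_def)
  then obtain g0 where g0: "g0 \<in> I" "g0 \<noteq> 0" "degree g0 = (LEAST n. Q n)" unfolding Q_def by auto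
  define c where "c = inverse (lead_coeff g0)"
  have c: "c \<in> K" "c \<noteq> 0" using g0(1,2) IK unfolding c_def by (auto intro!: Kinv simp: polys_over_def)
  define g where "g = smult c g0"
  have g: "lead_coeff g = 1" "degree g = degree g0" "g \<noteq> 0" using g0(2) c by (auto simp: g_def c_def)
  have "g = 0 * p - [:- c:] * g0" by (simp add: g_def)
  moreover have "[:- c:] \<in> polys_over K" using c by (intro PKpCons PK0 Kneg)
  moreover have "0 * p \<in> I" unfolding I_def using PK0 by (intro CollectI exI[of _ 0]) auto
  ultimately have gI: "g \<in> I" using II g0 by metis
  have div: "g dvd a" if a: "a \<in> I" for a
  proof -
    obtain k r where kr: "k \<in> polys_over K" "r \<in> polys_over K" "a = g * k + r" "r = 0 \<or> degree r < degree g"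
      using division_over[of g a] IK gI g a by blast
    have "r = a - k * g" using kr(3) by simp
    then have "r \<in> I" using II[OF a gI kr(1)] by simp
    then have "r = 0" using kr(4) g(2) g0(3) not_less_Least[of "degree r" Q] unfolding Q_def by force
    then show ?thesis using kr(3) by simp
  qed
  have "degree g = 0"
  proof (rule ccontr)
    assume "degree g \<noteq> 0"
    then have "\<not> constant (poly g)" unfolding constant_degree .
    then obtain r where "poly g r = 0" using Fundamental_Theorem_Algebra.fundamental_theorem_of_algebra by blast
    then have "poly p r = 0" "poly q r = 0" using div[OF pI] div[OF qI] by (auto elim!: dvdE)
    then show False using nc by blast
  qed
  then have "g = 1" using g(1) by (metis degree_eq_zeroE lead_coeff_pCons(2) one_pCons pCons_0_0)
  then show ?thesis using gI unfolding I_def by auto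
qed

end

lemma simple_roots_product:
  fixes f :: "complex poly"
  assumes "lead_coeff f = 1" and "\<And>r. poly f r = 0 \<Longrightarrow> poly (pderiv f) r \<noteq> 0"
  shows "f = (\<Prod>r | poly f r = 0. [:- r, 1:])" "card {r. poly f r = 0} = degree f" "finite {r. poly f r = 0}"
    "poly f y = (\<Prod>r | poly f r = 0. y - r)"
proof -
  have f0: "f \<noteq> 0" using assms(1) by auto
  show fin: "finite {r. poly f r = 0}" using poly_roots_finite[OF f0] .
  have "rsquarefree f" using assms(2) unfolding rsquarefree_roots by blast
  then show f: "f = (\<Prod>r | poly f r = 0. [:- r, 1:])"
    using complex_poly_decompose_rsquarefree[of f] assms(1) by simp
  have "degree f = degree (\<Prod>r | poly f r = 0. [:- r, 1:])" using f by simp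
  also have "\<dots> = (\<Sum>r | poly f r = 0. degree [:- r, 1:])" by (intro degree_prod_eq_sum_degree) auto
  finally show "card {r. poly f r = 0} = degree f" by simp
  have "poly f y = poly (\<Prod>r | poly f r = 0. [:- r, 1:]) y" using f by simp
  then show "poly f y = (\<Prod>r | poly f r = 0. y - r)" by (simp add: poly_prod)
qed

interpretation Rats: csubfield \<rat> by unfold_locales auto

lemma (in csubfield) polys_over_Rats: "p \<in> polys_over \<rat> \<Longrightarrow> p \<in> polys_over K"
  using KRats by (auto simp: polys_over_def)

subsection \<open>Primitive elements\<close>

definition qadj :: "complex \<Rightarrow> complex set" where "qadj t = {poly A t | A. A \<in> polys_over \<rat>}"

lemma algebraic_polys_over: "algebraic x \<longleftrightarrow> (\<exists>p\<in>polys_over \<rat>. p \<noteq> 0 \<and> poly p x = 0)"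
  by (auto simp: algebraic_altdef polys_over_def)

lemma qadj_self: "t \<in> qadj t"
  unfolding qadj_def by (intro CollectI exI[of _ "[:0, 1:]"]) (auto intro!: Rats.PK)

lemma qadj_subset:
  assumes "s \<in> qadj t" shows "qadj s \<subseteq> qadj t"
proof
  fix x assume "x \<in> qadj s"
  then obtain A where A: "A \<in> polys_over \<rat>" "x = poly A s" unfolding qadj_def by auto
  obtain B where B: "B \<in> polys_over \<rat>" "s = poly B t" using assms unfolding qadj_def by auto
  have "x = poly (pcompose A B) t" using A B by (simp add: poly_pcompose)
  then show "x \<in> qadj t" unfolding qadj_def using Rats.PKpcompose[OF A(1) B(1)] by blast
qed

lemma qadj_csubfield:
  assumes "\<And>y. y \<in> qadj t \<Longrightarrow> algebraic y" shows "csubfield (qadj t)"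
proof
  show "0 \<in> qadj t" unfolding qadj_def by (intro CollectI exI[of _ 0]) (auto intro!: Rats.PK)
  show "1 \<in> qadj t" unfolding qadj_def by (intro CollectI exI[of _ 1]) (auto intro!: Rats.PK)
  fix x y assume "x \<in> qadj t" "y \<in> qadj t"
  then obtain A B where AB: "A \<in> polys_over \<rat>" "x = poly A t" "B \<in> polys_over \<rat>" "y = poly B t" unfolding qadj_def by auto
  have "x + y = poly (A + B) t" "x * y = poly (A * B) t" "- x = poly (- A) t" using AB by auto
  moreover have "A + B \<in> polys_over \<rat>" "A * B \<in> polys_over \<rat>" "- A \<in> polys_over \<rat>" using AB by (auto intro!: Rats.PK)
  ultimately show "x + y \<in> qadj t" "x * y \<in> qadj t" "- x \<in> qadj t" unfolding qadj_def by blast+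
next
  fix x assume x: "x \<in> qadj t"
  show "inverse x \<in> qadj t"
  proof (cases "x = 0")
    case True then show ?thesis using x by simp
  next
    case False
    obtain p where "p \<in> polys_over \<rat>" "p \<noteq> 0" "poly p x = 0" using assms[OF x] algebraic_polys_over by auto
    then obtain g where g: "Rats.min_poly x g" by (rule Rats.min_poly_exists)
    note gD = Rats.min_polyD[OF g]
    obtain c h where ch: "g = pCons c h" by (cases g)
    have hc: "c \<in> \<rat>" "h \<in> polys_over \<rat>" using Rats.PKpConsD gD(1) ch by auto
    have e: "c + x * poly h x = 0" using gD(3) ch by simp
    \<comment> \<open>The inverse of \<open>x\<close> is read off from the minimal equation
      \<open>c + x h(x) = 0\<close>; a vanishing constant term would leave \<open>h\<close>, of
      smaller degree, with the root \<open>x\<close>.\<close>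
    have c0: "c \<noteq> 0"
    proof
      assume "c = 0"
      then have "poly h x = 0" using e False by simp
      then have "g dvd h" using gD(7)[OF hc(2)] by simp
      moreover have "h \<noteq> 0" using gD(5) ch by auto
      ultimately have "degree g \<le> degree h" by (intro dvd_imp_degree_le)
      then show False using ch \<open>h \<noteq> 0\<close> by simp
    qed
    have "inverse x = poly (smult (- inverse c) h) x"
      using e c0 False by (simp add: field_simps) (metis add_eq_0_iff2 mult.commute)
    moreover have "smult (- inverse c) h \<in> polys_over \<rat>" using hc by (intro Rats.PK) auto
    ultimately have "inverse x \<in> qadj x" unfolding qadj_def by blast
    then show ?thesis using qadj_subset[OF x] by auto
  qed
qed

text \<open>\<open>c\<close> avoids the finitely many ratios for which \<open>fb\<close> and
  \<open>fa(t - c X)\<close> share a root besides \<open>b\<close>. The minimal polynomial of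
  \<open>b\<close> over the field of \<open>t\<close> divides both, so \<open>b\<close> is its only
  root; as its roots are simple, it is linear with coefficients in that field.\<close>

lemma primitive_element_pair:
  assumes alg: "\<And>y c. y \<in> qadj (a + of_nat c * b) \<Longrightarrow> algebraic y" and a: "algebraic a" and b: "algebraic b"
  shows "\<exists>c::nat. a \<in> qadj (a + of_nat c * b) \<and> b \<in> qadj (a + of_nat c * b)"
proof -
  obtain fa where fa: "Rats.min_poly a fa" using a unfolding algebraic_polys_over by (auto intro: Rats.min_poly_exists)
  obtain fb where fb: "Rats.min_poly b fb" using b unfolding algebraic_polys_over by (auto intro: Rats.min_poly_exists)
  note faD = Rats.min_polyD[OF fa] and fbD = Rats.min_polyD[OF fb]
  define E where "E = (\<lambda>(r, s). (r - a) / (b - s)) ` ({r. poly fa r = 0} \<times> {s. poly fb s = 0})"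
  have "finite E" unfolding E_def using poly_roots_finite[OF faD(4)] poly_roots_finite[OF fbD(4)] by auto
  then have "finite {c::nat. of_nat c \<in> E}"
    by (intro finite_vimageI[of E "of_nat :: nat \<Rightarrow> complex", unfolded vimage_def]) (auto simp: inj_def)
  then obtain c :: nat where c: "of_nat c \<notin> E" using ex_new_if_finite[OF infinite_UNIV_nat] by blast
  define t where "t = a + of_nat c * b"
  interpret F: csubfield "qadj t" by (rule qadj_csubfield) (use alg t_def in auto)
  have fbF: "fb \<in> polys_over (qadj t)" "fa \<in> polys_over (qadj t)" using F.polys_over_Rats fbD(1) faD(1) by auto
  obtain m where m: "F.min_poly b m" using F.min_poly_exists[OF fbF(1) fbD(4,3)] .
  note mD = F.min_polyD[OF m]
  define g where "g = pcompose fa [:t, - of_nat c:]"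
  have gF: "g \<in> polys_over (qadj t)" unfolding g_def using fbF(2) qadj_self by (intro F.PK F.Kneg F.Knat)
  have gb: "poly g b = 0" unfolding g_def using faD(3) by (simp add: poly_pcompose t_def mult.commute)
  have only: "r = b" if r: "poly m r = 0" for r
  proof (rule ccontr)
    assume rb: "r \<noteq> b"
    have "poly fb r = 0" "poly g r = 0"
      using F.min_poly_conj[OF m r fbF(1)] F.min_poly_conj[OF m r gF] fbD(3) gb by auto
    then have "poly fa (t - of_nat c * r) = 0" by (simp add: g_def poly_pcompose mult.commute)
    then have "((t - of_nat c * r) - a) / (b - r) \<in> E" unfolding E_def using \<open>poly fb r = 0\<close> by force
    moreover have "((t - of_nat c * r) - a) / (b - r) = of_nat c" using rb by (simp add: t_def field_simps)
    ultimately show False using c by simp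
  qed
  have "{r. poly m r = 0} = {b}" using only mD(3) by blast
  then have "m = [:- b, 1:]"
    using simple_roots_product(1)[OF mD(2) F.min_poly_simple_root[OF m]] by simp
  then have "- b \<in> qadj t" using mD(1) F.PKpConsD by blast
  then have bt: "b \<in> qadj t" using F.Kneg by fastforce
  then have "t - of_nat c * b \<in> qadj t" using qadj_self by (intro F.Kdiff F.Kmult F.Knat)
  then have "a \<in> qadj t" by (simp add: t_def)
  then show ?thesis using bt unfolding t_def by blast
qed

lemma primitive_element:
  assumes "csubfield K" and alg: "\<And>y. y \<in> K \<Longrightarrow> algebraic y" and "finite U" "U \<subseteq> K"
  shows "\<exists>t\<in>K. U \<subseteq> qadj t"
  using assms(3,4)
proof (induct U rule: finite_induct)
  case empty
  interpret csubfield K by fact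
  show ?case using K0 by auto
next
  case (insert u U)
  interpret csubfield K by fact
  obtain a where a: "a \<in> K" "U \<subseteq> qadj a" using insert by auto
  have u: "u \<in> K" using insert by auto
  have sub: "qadj s \<subseteq> K" if "s \<in> K" for s
    unfolding qadj_def using PKpoly[OF polys_over_Rats that] by auto
  have ac: "a + of_nat c * u \<in> K" for c using a u by (intro Kadd Kmult Knat)
  obtain c :: nat where c: "a \<in> qadj (a + of_nat c * u)" "u \<in> qadj (a + of_nat c * u)"
    using primitive_element_pair[of a u] alg sub ac a u by blast
  then have "insert u U \<subseteq> qadj (a + of_nat c * u)" using qadj_subset[OF c(1)] a by blast
  then show ?case using ac by blast
qed

subsection \<open>Symmetric functions of conjugates\<close>

text \<open>The logarithmic derivative of the product generates the power sums; Newton's identities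
  are its coefficients.\<close>

lemma newton_deriv:
  fixes y :: "'i \<Rightarrow> complex"
  assumes "finite I"
  shows "fps_deriv (\<Prod>i\<in>I. 1 - fps_const (y i) * fps_X) =
    - (\<Prod>i\<in>I. 1 - fps_const (y i) * fps_X) * Abs_fps (\<lambda>k. \<Sum>i\<in>I. y i ^ Suc k)"
  using assms
proof (induct I rule: finite_induct)
  case empty
  have "Abs_fps (\<lambda>k. 0) = (0 :: complex fps)" by (simp add: fps_eq_iff)
  then show ?case by simp
next
  case (insert i I)
  let ?P = "\<Prod>i\<in>I. 1 - fps_const (y i) * fps_X" and ?S = "Abs_fps (\<lambda>k. \<Sum>i\<in>I. y i ^ Suc k)"
  let ?L = "1 - fps_const (y i) * fps_X" and ?G = "Abs_fps (\<lambda>k. y i ^ Suc k)"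
  have G: "?L * ?G = fps_const (y i)"
  proof (rule fps_ext)
    fix n show "(?L * ?G) $ n = fps_const (y i) $ n"
      by (cases n) (auto simp: algebra_simps)
  qed
  have S: "Abs_fps (\<lambda>k. \<Sum>i\<in>insert i I. y i ^ Suc k) = ?G + ?S" using insert by (auto simp: fps_eq_iff)
  have alg: "L * (- P * S) + (- c) * P = - (L * P) * S - c * P" "- (L * P) * S - (L * G) * P = - (L * P) * (G + S)"
    for L P S G c :: "complex fps" by (simp_all add: algebra_simps)
  have D: "fps_deriv ?L = - fps_const (y i)" by simp
  have "fps_deriv (?L * ?P) = ?L * fps_deriv ?P + (- fps_const (y i)) * ?P"
    unfolding D[symmetric] by (simp only: fps_deriv_mult)
  also have "\<dots> = - (?L * ?P) * ?S - (?L * ?G) * ?P" unfolding insert(3) G by (rule alg(1))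
  also have "\<dots> = - (?L * ?P) * (?G + ?S)" by (rule alg(2))
  finally show ?case using insert S by simp
qed

lemma newton_identity:
  fixes y :: "'i \<Rightarrow> complex"
  assumes "finite I"
  defines "P \<equiv> \<Prod>i\<in>I. 1 - fps_const (y i) * fps_X"
  shows "of_nat (Suc k) * P $ Suc k = - (\<Sum>j\<le>k. P $ j * (\<Sum>i\<in>I. y i ^ Suc (k - j)))"
proof -
  have "of_nat (Suc k) * P $ Suc k = fps_deriv P $ k" by simp
  also have "fps_deriv P = - (P * Abs_fps (\<lambda>k. \<Sum>i\<in>I. y i ^ Suc k))" using newton_deriv[OF assms(1), of y] by (simp add: P_def)
  also have "\<dots> $ k = - (\<Sum>j\<le>k. P $ j * (\<Sum>i\<in>I. y i ^ Suc (k - j)))" by (simp add: fps_mult_nth atMost_atLeast0)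
  finally show ?thesis .
qed

lemma prod_fps_nth_0: "(\<Prod>i\<in>I. 1 - fps_const (y i) * fps_X) $ 0 = (1 :: complex)"
  by (induct I rule: infinite_finite_induct) auto

lemma power_sums_rational:
  fixes y :: "'i \<Rightarrow> complex"
  assumes I: "finite I" and r: "\<And>k. (\<Prod>i\<in>I. 1 - fps_const (y i) * fps_X) $ k \<in> \<rat>"
  shows "(\<Sum>i\<in>I. y i ^ Suc k) \<in> \<rat>"
proof (induct k rule: less_induct)
  case (less k)
  let ?P = "\<Prod>i\<in>I. 1 - fps_const (y i) * fps_X"
  have alg: "s = - a - t" if "a = - (s + t)" for a s t :: complex using that by simp
  have P0: "?P $ 0 = 1" by (rule prod_fps_nth_0)
  have "of_nat (Suc k) * ?P $ Suc k = - (\<Sum>j\<le>k. ?P $ j * (\<Sum>i\<in>I. y i ^ Suc (k - j)))" by (rule newton_identity[OF I])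
  also have "(\<Sum>j\<le>k. ?P $ j * (\<Sum>i\<in>I. y i ^ Suc (k - j))) =
     (\<Sum>i\<in>I. y i ^ Suc k) + (\<Sum>j\<in>{..k} - {0}. ?P $ j * (\<Sum>i\<in>I. y i ^ Suc (k - j)))"
    by (subst sum.remove[of _ 0]) (auto simp: P0)
  finally have "(\<Sum>i\<in>I. y i ^ Suc k) =
     - (of_nat (Suc k) * ?P $ Suc k) - (\<Sum>j\<in>{..k} - {0}. ?P $ j * (\<Sum>i\<in>I. y i ^ Suc (k - j)))" by (rule alg)
  moreover have "(\<Sum>j\<in>{..k} - {0}. ?P $ j * (\<Sum>i\<in>I. y i ^ Suc (k - j))) \<in> \<rat>"
    by (intro Rats.Ksum Rats_mult r less) auto
  ultimately show ?case using r[of "Suc k"] by (auto intro!: Rats_diff Rats.Kneg Rats_mult)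
qed

text \<open>Newton's identities solved for the coefficients of the product: rational power sums make
  all of them rational, and the top one is the product of the \<open>- y i\<close>.\<close>

lemma product_rational_of_power_sums:
  fixes y :: "'i \<Rightarrow> complex"
  assumes I: "finite I" and r: "\<And>k. (\<Sum>i\<in>I. y i ^ Suc k) \<in> \<rat>"
  shows "(\<Prod>i\<in>I. y i) \<in> \<rat>"
proof -
  let ?P = "\<Prod>i\<in>I. 1 - fps_const (y i) * fps_X"
  have "?P $ k \<in> \<rat>" for k
  proof (induct k rule: less_induct)
    case (less k)
    show ?case
    proof (cases k)
      case 0 then show ?thesis by (simp add: prod_fps_nth_0)
    next
      case (Suc l)
      have alg: "z = - s / a" if "a * z = - s" "a \<noteq> 0" for a z s :: complex using that by (metis nonzero_mult_div_cancel_left)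
      have e: "?P $ k = (- (\<Sum>j\<le>l. ?P $ j * (\<Sum>i\<in>I. y i ^ Suc (l - j)))) / of_nat (Suc l)"
        unfolding Suc by (rule alg[OF newton_identity[OF I]]) (simp del: of_nat_Suc)
      have m: "(\<Sum>j\<le>l. ?P $ j * (\<Sum>i\<in>I. y i ^ Suc (l - j))) \<in> \<rat>"
      proof (rule Rats.Ksum, rule Rats_mult)
        fix j assume "j \<in> {..l}"
        then show "?P $ j \<in> \<rat>" using less Suc by simp
        show "(\<Sum>i\<in>I. y i ^ Suc (l - j)) \<in> \<rat>" by (rule r)
      qed
      show ?thesis unfolding e by (rule Rats_divide[OF Rats.Kneg[OF m] Rats.Knat])
    qed
  qed
  moreover have "?P $ card I = (\<Prod>i\<in>I. - y i) \<and> (\<forall>k>card I. ?P $ k = 0)"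
    using I
  proof (induct I rule: finite_induct)
    case (insert i I)
    have e: "((1 - fps_const (y i) * fps_X) * Q) $ Suc k = Q $ Suc k - y i * Q $ k" for Q :: "complex fps" and k
      by (simp add: left_diff_distrib mult.assoc)
    have "(\<Prod>i\<in>insert i I. 1 - fps_const (y i) * fps_X) $ k = 0" if "k > card (insert i I)" for k
      using that insert e[of _ "k - 1"] by (cases k) auto
    then show ?case using insert e[of _ "card I"] by auto
  qed auto
  ultimately have r: "(\<Prod>i\<in>I. - y i) \<in> \<rat>" by metis
  have e: "(\<Prod>i\<in>I. - y i) = (-1) ^ card I * (\<Prod>i\<in>I. y i)"
    by (subst prod_constant[symmetric], subst prod.distrib[symmetric]) simp
  have "(\<Prod>i\<in>I. y i) = (-1) ^ card I * (\<Prod>i\<in>I. - y i)"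
    unfolding e by (cases "even (card I)") simp_all
  then show ?thesis using Rats_mult[OF Rats.Kpow[OF Rats.Kneg[OF Rats_1], of "card I"] r] by metis
qed

text \<open>Newton's identities are used in both directions: from the rational coefficients of
  \<open>q\<close> to the power sums of its roots, hence to sums over the roots of any rational
  polynomial, in particular of the powers of \<open>A\<close>, and from these power sums back to the
  product.\<close>

lemma norm_rational:
  assumes q: "Rats.min_poly t q" and A: "A \<in> polys_over \<rat>"
  shows "(\<Prod>r | poly q r = 0. poly A r) \<in> \<rat>"
proof -
  note qD = Rats.min_polyD[OF q]
  define I where "I = {r. poly q r = 0}"
  have I: "finite I" unfolding I_def using poly_roots_finite[OF qD(4)] .
  have qp: "q = (\<Prod>r\<in>I. [:- r, 1:])" unfolding I_def
    by (rule simple_roots_product(1)[OF qD(2) Rats.min_poly_simple_root[OF q]])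
  have refl: "reflect_poly [:- r, 1:] = [:1, - r:]" for r :: complex
    by (rule poly_eqI) (auto simp: coeff_reflect_poly coeff_pCons split: nat.splits)
  have "(\<Prod>r\<in>I. 1 - fps_const r * fps_X) = fps_of_poly (\<Prod>r\<in>I. [:1, - r:])"
    by (simp add: fps_of_poly_prod fps_of_poly_linear' flip: fps_const_neg)
  also have "(\<Prod>r\<in>I. [:1, - r:]) = reflect_poly q" unfolding qp by (simp add: reflect_poly_prod refl)
  finally have P: "(\<Prod>r\<in>I. 1 - fps_const r * fps_X) = fps_of_poly (reflect_poly q)" .
  have c: "coeff p i \<in> \<rat>" if "p \<in> polys_over \<rat>" for p i using that by (auto simp: polys_over_def)
  have ps: "(\<Sum>r\<in>I. r ^ k) \<in> \<rat>" for k
  proof (cases k)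
    case (Suc l)
    then show ?thesis using power_sums_rational[OF I, of "\<lambda>r. r" l] c[OF qD(1)] by (simp add: P coeff_reflect_poly)
  qed (simp add: Rats.Knat)
  have pA: "(\<Sum>r\<in>I. poly B r) \<in> \<rat>" if B: "B \<in> polys_over \<rat>" for B
  proof -
    have "(\<Sum>r\<in>I. poly B r) = (\<Sum>i\<le>degree B. coeff B i * (\<Sum>r\<in>I. r ^ i))"
      by (simp add: poly_altdef sum_distrib_left) (rule sum.swap)
    also have "\<dots> \<in> \<rat>" by (rule Rats.Ksum, rule Rats_mult, rule c[OF B], rule ps)
    finally show ?thesis .
  qed
  have "(\<Sum>r\<in>I. poly A r ^ Suc k) \<in> \<rat>" for k
    using pA[OF Rats.PKpower[OF A, of "Suc k"]] by (simp add: poly_power)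
  then show ?thesis using product_rational_of_power_sums[OF I] unfolding I_def by blast
qed

text \<open>Meant for norms of polynomials, whose values at natural numbers are rational as norms of
  elements. The threshold \<open>m\<close> moves up in the induction because the quotient by
  \<open>X - m\<close> is not controlled at \<open>m\<close> itself.\<close>

lemma polys_over_Rats_by_values:
  fixes p :: "complex poly"
  assumes "\<And>k. k \<ge> m \<Longrightarrow> poly p (of_nat k) \<in> \<rat>"
  shows "p \<in> polys_over \<rat>"
  using assms
proof (induct "degree p" arbitrary: p m rule: less_induct)
  case less
  define c where "c = poly p (of_nat m)"
  have c: "c \<in> \<rat>" using less(2) c_def by auto
  have "poly (p - [:c:]) (of_nat m) = 0" by (simp add: c_def)
  then obtain q where q: "p - [:c:] = [:- of_nat m, 1:] * q" unfolding poly_eq_0_iff_dvd by (rule dvdE)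
  then have p: "p = [:c:] + [:- of_nat m, 1:] * q" by (simp add: algebra_simps)
  show ?case
  proof (cases "degree p = 0")
    case True
    then obtain a where a: "p = [:a:]" using degree_eq_zeroE by auto
    then have "a \<in> \<rat>" using less(2)[of m] by simp
    then show ?thesis using a by (auto intro!: Rats.PK)
  next
    case False
    have q0: "q \<noteq> 0" using False p by auto
    have "degree ([:- of_nat m, 1:] * q) = Suc (degree q)" using q0 by (subst degree_mult_eq) auto
    moreover have "degree p = degree ([:- of_nat m, 1:] * q)"
      unfolding p using calculation by (subst degree_add_eq_right) auto
    ultimately have dq: "degree q < degree p" by simp
    have "poly q (of_nat k) \<in> \<rat>" if k: "k \<ge> Suc m" for k
    proof -
      have "poly p (of_nat k) = c + (of_nat k - of_nat m) * poly q (of_nat k)" unfolding p by (simp add: algebra_simps)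
      moreover have "(of_nat k - of_nat m :: complex) \<noteq> 0" using k by simp
      ultimately have "poly q (of_nat k) = (poly p (of_nat k) - c) / (of_nat k - of_nat m)" by (simp add: field_simps)
      then show ?thesis using less(2)[of k] k c by (auto intro!: Rats_divide Rats_diff Rats.Knat)
    qed
    then have "q \<in> polys_over \<rat>" using less(1)[OF dq] by blast
    then show ?thesis unfolding p using c by (intro Rats.PK Rats.Kneg Rats.Knat) auto
  qed
qed

subsection \<open>Integrality and minimal polynomials\<close>

lemma complex_field_simps [simp]:
  "carrier complex_field = UNIV" "x \<otimes>\<^bsub>complex_field\<^esub> y = x * y" "x \<oplus>\<^bsub>complex_field\<^esub> y = x + y"
  "\<one>\<^bsub>complex_field\<^esub> = 1" "\<zero>\<^bsub>complex_field\<^esub> = 0"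
  by (auto simp: ring_of_type_algebra_def)

lemma complex_field_field: "field complex_field" by (rule field_from_type_algebra)

lemma complex_field_inv: "\<ominus>\<^bsub>complex_field\<^esub> x = - x" "x \<noteq> 0 \<Longrightarrow> inv\<^bsub>complex_field\<^esub> x = inverse x"
proof -
  interpret C: field complex_field by (rule complex_field_field)
  show "\<ominus>\<^bsub>complex_field\<^esub> x = - x" by (rule C.minus_equality) auto
  show "x \<noteq> 0 \<Longrightarrow> inv\<^bsub>complex_field\<^esub> x = inverse x" by (rule C.comm_inv_char) auto
qed

lemma complex_field_pow: "x [^]\<^bsub>complex_field\<^esub> (n::nat) = x ^ n"
proof -
  interpret C: field complex_field by (rule complex_field_field)
  show ?thesis by (induct n) (simp_all add: mult.commute)
qed

lemma subfield_csubfield: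
  assumes "subfield K complex_field" shows "csubfield K"
proof -
  interpret C: field complex_field by (rule complex_field_field)
  note E = subringE[OF subfieldE(1)[OF assms]]
  show ?thesis
  proof
    show "0 \<in> K" "1 \<in> K" using E(2,3) by auto
    fix x y assume xy: "x \<in> K" "y \<in> K"
    show "x + y \<in> K" using E(7)[OF xy] by simp
    show "x * y \<in> K" using E(6)[OF xy] by simp
    show "- x \<in> K" using E(5)[OF xy(1)] by (simp add: complex_field_inv)
  next
    fix x assume x: "x \<in> K"
    show "inverse x \<in> K"
    proof (cases "x = 0")
      case False
      then show ?thesis using C.subfield_inv(1)[OF assms x] by (simp add: complex_field_inv)
    qed (use x in auto)
  qed
qed

lemma (in csubfield) subfield_complex: "subfield K complex_field"
proof -
  interpret C: field complex_field by (rule complex_field_field)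
  show ?thesis
  proof (rule C.subfieldI')
    show "subring K complex_field"
      by (rule C.subringI) (auto simp: K1 Kadd Kmult Kneg complex_field_inv)
    show "\<And>k. k \<in> K - {\<zero>\<^bsub>complex_field\<^esub>} \<Longrightarrow> inv\<^bsub>complex_field\<^esub> k \<in> K" by (auto simp: complex_field_inv Kinv)
  qed
qed

text \<open>The absolute value of a monic polynomial at \<open>c\<close> is the product of the
  distances from \<open>c\<close> to its roots, so a value below 1 forces one distance below 1.
  Linear factors are split off one at a time.\<close>

lemma (in algebraically_closed) root_near:
  assumes w: "abs_value L w" and c: "c \<in> carrier L"
    and p: "p \<in> carrier (poly_ring L)" "p \<noteq> []" "hd p = \<one>" and small: "w (eval p c) < 1"
  shows "\<exists>r\<in>carrier L. eval p r = \<zero> \<and> w (r \<ominus> c) < 1"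
  using p small
proof (induct "length p" arbitrary: p rule: less_induct)
  case less
  have wm: "\<And>x y. x \<in> carrier L \<Longrightarrow> y \<in> carrier L \<Longrightarrow> w (x \<otimes> y) = w x * w y"
    and wp: "\<And>x. x \<in> carrier L \<Longrightarrow> w x \<ge> 0" and w1: "w \<one> = 1"
    using w abs_value_simps(5)[OF carrier_is_subfield, of w] unfolding abs_value_def by auto
  have wneg: "w (\<ominus> x) = w x" if "x \<in> carrier L" for x
  proof -
    have "w (\<ominus> \<one>) * w (\<ominus> \<one>) = 1" using wm[of "\<ominus> \<one>" "\<ominus> \<one>"] w1 by (simp add: l_minus)
    then have "w (\<ominus> \<one>) = 1" using wp[of "\<ominus> \<one>"] by (metis a_inv_closed abs_of_nonneg abs_one one_closed power2_eq_1_iff power2_eq_square abs_minus_cancel)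
    then show ?thesis using wm[of "\<ominus> \<one>" x] that by (simp add: l_minus)
  qed
  have pset: "set p \<subseteq> carrier L" using less(2) unfolding sym[OF univ_poly_carrier] polynomial_def by auto
  show ?case
  proof (cases "length p = 1")
    case True
    then have "p = [\<one>]" using less(3,4) by (cases p) auto
    then show ?thesis using less(5) w1 c by simp
  next
    case False
    then have "length p > 1" using less(3) by (cases p) auto
    then have "roots p \<noteq> {#}" using roots_over_carrier[OF less(2)] unfolding splitted_def by auto
    then obtain a where a: "a \<in> carrier L" "[ \<one>, \<ominus> a ] \<in> carrier (poly_ring L)" "[ \<one>, \<ominus> a ] pdivides p"
      using not_empty_rootsE[OF less(2)] by blast
    then obtain q where q: "q \<in> carrier (poly_ring L)" "p = [ \<one>, \<ominus> a ] \<otimes>\<^bsub>poly_ring L\<^esub> q"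
      unfolding pdivides_def by blast
    have qpol: "polynomial (carrier L) q" "polynomial (carrier L) [ \<one>, \<ominus> a ]" using q(1) a(2) univ_poly_carrier by auto
    have qset: "set q \<subseteq> carrier L" using qpol unfolding polynomial_def by auto
    have pm: "p = poly_mult [ \<one>, \<ominus> a ] q" using q(2) by (simp add: univ_poly_mult)
    have qn: "q \<noteq> []"
    proof
      assume "q = []" then show False using pm less(3) poly_mult_zero(2)[of "[ \<one>, \<ominus> a ]"] by simp
    qed
    have hq: "hd q = \<one>"
      using poly_mult_lead_coeff[OF carrier_is_subring qpol(2,1) _ qn] pm less(4) hd_in_set[OF qn] qset by auto
    have "length p - 1 = 1 + (length q - 1)"
      using poly_mult_degree_eq[OF carrier_is_subring qpol(2,1)] pm qn by simp
    then have len: "length q < length p" using qn \<open>length p > 1\<close> by (cases q) auto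
    have ev: "eval p z = (z \<ominus> a) \<otimes> eval q z" if z: "z \<in> carrier L" for z
      unfolding pm using eval_poly_mult[of "[ \<one>, \<ominus> a ]" q z] qset a(1) z by (simp add: a_minus_def)
    have evq: "eval q z \<in> carrier L" if "z \<in> carrier L" for z using eval_in_carrier[OF qset that] .
    have "w (c \<ominus> a) * w (eval q c) < 1" using less(5) ev[OF c] wm[of "c \<ominus> a" "eval q c"] evq[OF c] a c by simp
    then consider "w (c \<ominus> a) < 1" | "w (eval q c) < 1"
      using wp[of "c \<ominus> a"] wp[OF evq[OF c]] a c
      by (metis linorder_not_less minus_closed mult_mono mult_1_left zero_le_one)
    then show ?thesis
    proof cases
      case 1
      have "w (a \<ominus> c) = w (c \<ominus> a)" using wneg[of "c \<ominus> a"] a c minus_add[of c "\<ominus> a"] by (simp add: a_minus_def a_comm)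
      moreover have "eval p a = \<zero>" using ev[OF a(1)] a(1) evq[OF a(1)] by (simp add: a_minus_def r_neg)
      ultimately show ?thesis using 1 a(1) by auto
    next
      case 2
      then obtain r where r: "r \<in> carrier L" "eval q r = \<zero>" "w (r \<ominus> c) < 1" using less(1)[OF len q(1) qn hq] by blast
      moreover have "eval p r = \<zero>" using ev[OF r(1)] r a(1) by simp
      ultimately show ?thesis by blast
    qed
  qed
qed

locale poly_eval_hom = csubfield K + E: field E for K and E :: "('e, 'f) ring_scheme" (structure) +
  fixes j :: "complex \<Rightarrow> 'e"
  assumes j_hom: "j \<in> ring_hom (subfield_ring K) E"
begin

lemma jc: "a \<in> K \<Longrightarrow> j a \<in> carrier E" and jadd: "a \<in> K \<Longrightarrow> b \<in> K \<Longrightarrow> j (a + b) = j a \<oplus> j b"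
  and jmult: "a \<in> K \<Longrightarrow> b \<in> K \<Longrightarrow> j (a * b) = j a \<otimes> j b" and j1: "j 1 = \<one>" and j0: "j 0 = \<zero>"
proof -
  show "a \<in> K \<Longrightarrow> j a \<in> carrier E" using ring_hom_closed[OF j_hom] by simp
  show a: "\<And>a b. a \<in> K \<Longrightarrow> b \<in> K \<Longrightarrow> j (a + b) = j a \<oplus> j b" using ring_hom_add[OF j_hom] by simp
  show "a \<in> K \<Longrightarrow> b \<in> K \<Longrightarrow> j (a * b) = j a \<otimes> j b" using ring_hom_mult[OF j_hom] by simp
  show "j 1 = \<one>" using ring_hom_one[OF j_hom] by simp
  have "j 0 \<in> carrier E" using ring_hom_closed[OF j_hom] K0 by simp
  moreover have "j 0 \<oplus> j 0 = j 0" using a[OF K0 K0] by simp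
  ultimately show "j 0 = \<zero>" by (metis E.add.r_cancel_one')
qed

definition ev where "ev g r = E.eval (map j (rev (coeffs g))) r"

context
  fixes r assumes r: "r \<in> carrier E"
begin

lemma coeffs_carrier: "g \<in> polys_over K \<Longrightarrow> set (map j (rev (coeffs g))) \<subseteq> carrier E"
  using jc by (auto simp: polys_over_def coeffs_def)

lemma ev_closed: "g \<in> polys_over K \<Longrightarrow> ev g r \<in> carrier E"
  unfolding ev_def using E.eval_in_carrier[OF coeffs_carrier r] .

lemma ev_pCons:
  assumes "a \<in> K" "g \<in> polys_over K" shows "ev (pCons a g) r = j a \<oplus> r \<otimes> ev g r"
proof (cases "a = 0 \<and> g = 0")
  case True then show ?thesis using r by (simp add: ev_def j0)
next
  case False
  then have "coeffs (pCons a g) = a # coeffs g" by (auto simp: cCons_def)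
  then have "ev (pCons a g) r = E.eval (map j (rev (coeffs g)) @ [j a]) r" by (simp add: ev_def)
  also have "\<dots> = ev g r \<otimes> r \<oplus> j a"
    unfolding ev_def by (rule E.eval_append_aux[OF coeffs_carrier[OF assms(2)] jc[OF assms(1)] r])
  also have "\<dots> = j a \<oplus> r \<otimes> ev g r"
    using ev_closed[OF assms(2)] jc[OF assms(1)] r by (simp add: E.a_comm E.m_comm)
  finally show ?thesis .
qed

lemma ev_0: "ev 0 r = \<zero>" by (simp add: ev_def)

lemma ev_const: "a \<in> K \<Longrightarrow> ev [:a:] r = j a"
  using ev_pCons[OF _ PK0, of a] r jc by (simp add: ev_0)

lemma ev_add: "g \<in> polys_over K \<Longrightarrow> h \<in> polys_over K \<Longrightarrow> ev (g + h) r = ev g r \<oplus> ev h r"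
proof (induct g arbitrary: h)
  case 0 then show ?case using ev_closed by (simp add: ev_0)
next
  case (pCons a g)
  obtain b h' where h: "h = pCons b h'" by (cases h)
  have m: "a \<in> K" "g \<in> polys_over K" "b \<in> K" "h' \<in> polys_over K" using PKpConsD pCons(3,4) h by auto
  have c: "ev g r \<in> carrier E" "ev h' r \<in> carrier E" "j a \<in> carrier E" "j b \<in> carrier E" using m ev_closed jc by auto
  have "ev (pCons a g + h) r = (j a \<oplus> j b) \<oplus> r \<otimes> (ev g r \<oplus> ev h' r)"
    using ev_pCons[of "a + b" "g + h'"] m jadd pCons(2)[OF m(2,4)] by (simp add: h Kadd PKadd)
  also have "\<dots> = (j a \<oplus> r \<otimes> ev g r) \<oplus> (j b \<oplus> r \<otimes> ev h' r)"
    using c r by (simp add: E.r_distr E.a_ac)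
  finally show ?case using m by (simp add: h ev_pCons)
qed

lemma ev_smult: "g \<in> polys_over K \<Longrightarrow> a \<in> K \<Longrightarrow> ev (smult a g) r = j a \<otimes> ev g r"
proof (induct g)
  case 0 then show ?case using jc by (simp add: ev_0)
next
  case (pCons b g)
  have m: "b \<in> K" "g \<in> polys_over K" using PKpConsD pCons(3) by auto
  have c: "ev g r \<in> carrier E" "j a \<in> carrier E" "j b \<in> carrier E" using m ev_closed jc pCons by auto
  show ?case using m pCons(4) pCons(2)[OF m(2)] c r
    by (simp add: ev_pCons Kmult PKsmult jmult E.r_distr E.m_ac)
qed

lemma ev_mult: "g \<in> polys_over K \<Longrightarrow> h \<in> polys_over K \<Longrightarrow> ev (g * h) r = ev g r \<otimes> ev h r"
proof (induct g)
  case 0 then show ?case using ev_closed by (simp add: ev_0)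
next
  case (pCons a g)
  have m: "a \<in> K" "g \<in> polys_over K" using PKpConsD pCons(3) by auto
  have c: "ev g r \<in> carrier E" "ev h r \<in> carrier E" "j a \<in> carrier E" using m ev_closed jc pCons by auto
  have "ev (pCons a g * h) r = ev (smult a h) r \<oplus> ev (pCons 0 (g * h)) r"
    using m pCons(4) by (simp add: ev_add PK K0)
  also have "\<dots> = j a \<otimes> ev h r \<oplus> r \<otimes> (ev g r \<otimes> ev h r)"
    using m pCons(4) pCons(2)[OF m(2) pCons(4)] c r by (simp add: ev_smult ev_pCons K0 PKmult j0)
  also have "\<dots> = (j a \<oplus> r \<otimes> ev g r) \<otimes> ev h r" using c r by (simp add: E.l_distr E.m_assoc)
  finally show ?case using m by (simp add: ev_pCons)
qed

end

lemma ev_at: "g \<in> polys_over K \<Longrightarrow> a \<in> K \<Longrightarrow> ev g (j a) = j (poly g a)"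
proof (induct g)
  case 0 then show ?case using jc by (simp add: ev_0 j0)
next
  case (pCons b g)
  have m: "b \<in> K" "g \<in> polys_over K" using PKpConsD pCons(3) by auto
  show ?case using ev_pCons[OF jc[OF pCons(4)] m] pCons(2)[OF m(2) pCons(4)] m pCons(4) PKpoly[OF m(2) pCons(4)]
    by (simp add: jadd jmult Kmult)
qed

lemma adjoin_subset:
  assumes f: "min_poly x f" shows "adjoin K x \<subseteq> {poly g x | g. g \<in> polys_over K}"
proof
  fix y assume "y \<in> adjoin K x"
  then show "y \<in> {poly g x | g. g \<in> polys_over K}"
    unfolding adjoin_def
  proof (induct rule: generate_field.induct)
    case one then show ?case by (intro CollectI exI[of _ 1]) (auto simp: PK1)
  next
    case (incl h)
    then consider "h = x" | "h \<in> K" by auto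
    then show ?case
    proof cases
      case 1 then show ?thesis by (intro CollectI exI[of _ "[:0, 1:]"]) (auto simp: PK K0 K1)
    next
      case 2 then show ?thesis by (intro CollectI exI[of _ "[:h:]"]) (auto simp: PK)
    qed
  next
    case (a_inv h)
    then obtain g where "g \<in> polys_over K" "h = poly g x" by auto
    then show ?case by (intro CollectI exI[of _ "- g"]) (auto simp: PK complex_field_inv)
  next
    case (m_inv h)
    then obtain g where g: "g \<in> polys_over K" "h = poly g x" by auto
    \<comment> \<open>A root common to \<open>f\<close> and \<open>g\<close> would make
      \<open>g\<close> vanish at the conjugate \<open>x\<close> as well; the resulting Bezout
      relation provides the inverse as a polynomial in \<open>x\<close>.\<close>
    have "poly g r \<noteq> 0" if "poly f r = 0" for r using min_poly_conj[OF f that g(1)] m_inv g by auto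
    then obtain u v where uv: "u \<in> polys_over K" "v \<in> polys_over K" "u * f + v * g = 1"
      using bezout_over[OF min_polyD(1,4)[OF f] g(1)] by blast
    have "poly (u * f + v * g) x = 1" unfolding uv(3) by simp
    then have "poly v x * h = 1" using min_polyD(3)[OF f] g by simp
    then have "inverse h = poly v x" by (metis inverse_unique mult.commute)
    then show ?case using uv(2) m_inv by (auto simp: complex_field_inv)
  next
    case (eng_add h1 h2)
    then obtain g1 g2 where "g1 \<in> polys_over K" "h1 = poly g1 x" "g2 \<in> polys_over K" "h2 = poly g2 x" by auto
    then show ?case by (intro CollectI exI[of _ "g1 + g2"]) (auto simp: PK)
  next
    case (eng_mult h1 h2)
    then obtain g1 g2 where "g1 \<in> polys_over K" "h1 = poly g1 x" "g2 \<in> polys_over K" "h2 = poly g2 x" by auto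
    then show ?case by (intro CollectI exI[of _ "g1 * g2"]) (auto simp: PK)
  qed
qed

text \<open>Sending \<open>poly g x\<close> to the value of \<open>g\<close> at \<open>r\<close> is
  well defined, since two representatives differ by a multiple of \<open>f\<close> and
  \<open>f\<close> vanishes at \<open>r\<close>.\<close>

lemma embedding_of_root:
  assumes f: "min_poly x f" and r: "r \<in> carrier E" "ev f r = \<zero>"
  shows "\<exists>\<sigma> \<in> ring_hom (subfield_ring (adjoin K x)) E. (\<forall>a\<in>K. \<sigma> a = j a) \<and> \<sigma> x = r"
proof -
  define rep where "rep y = (SOME g. g \<in> polys_over K \<and> poly g x = y)" for y
  define \<sigma> where "\<sigma> y = ev (rep y) r" for y
  have s: "\<sigma> (poly g x) = ev g r" if g: "g \<in> polys_over K" for g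
  proof -
    define g' where "g' = rep (poly g x)"
    have g': "g' \<in> polys_over K" "poly g' x = poly g x"
      using someI[of "\<lambda>h. h \<in> polys_over K \<and> poly h x = poly g x" g] g unfolding g'_def rep_def by auto
    then obtain h where h: "h \<in> polys_over K" "g' - g = f * h"
      using min_polyD(6)[OF f PKdiff[OF g'(1) g]] by auto
    have "g' = g + f * h" using h by (simp add: algebra_simps)
    then have "ev g' r = ev g r \<oplus> ev f r \<otimes> ev h r"
      using ev_add[OF r(1) g PKmult[OF min_polyD(1)[OF f] h(1)]] ev_mult[OF r(1) min_polyD(1)[OF f] h(1)] by simp
    then show ?thesis using r ev_closed[OF r(1) h(1)] ev_closed[OF r(1) g] by (simp add: \<sigma>_def g'_def)
  qed
  have "\<sigma> \<in> ring_hom (subfield_ring (adjoin K x)) E"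
  proof (rule ring_hom_memI)
    fix y z assume "y \<in> carrier (subfield_ring (adjoin K x))" "z \<in> carrier (subfield_ring (adjoin K x))"
    then have "y \<in> {poly g x | g. g \<in> polys_over K}" "z \<in> {poly g x | g. g \<in> polys_over K}"
      using adjoin_subset[OF f] by auto
    then obtain g h where g: "g \<in> polys_over K" "y = poly g x" "h \<in> polys_over K" "z = poly h x" by blast
    show "\<sigma> (y \<otimes>\<^bsub>subfield_ring (adjoin K x)\<^esub> z) = \<sigma> y \<otimes> \<sigma> z"
      using s[OF PKmult[OF g(1,3)]] s[OF g(1)] s[OF g(3)] g ev_mult[OF r(1) g(1,3)] by simp
    show "\<sigma> (y \<oplus>\<^bsub>subfield_ring (adjoin K x)\<^esub> z) = \<sigma> y \<oplus> \<sigma> z"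
      using s[OF PKadd[OF g(1,3)]] s[OF g(1)] s[OF g(3)] g ev_add[OF r(1) g(1,3)] by simp
  next
    fix y assume "y \<in> carrier (subfield_ring (adjoin K x))"
    then have "y \<in> {poly g x | g. g \<in> polys_over K}" using adjoin_subset[OF f] by auto
    then obtain g where g: "g \<in> polys_over K" "y = poly g x" by blast
    show "\<sigma> y \<in> carrier E" using s[OF g(1)] g ev_closed[OF r(1) g(1)] by simp
  next
    show "\<sigma> \<one>\<^bsub>subfield_ring (adjoin K x)\<^esub> = \<one>"
      using s[OF PK1] ev_const[OF r(1) K1] j1 by (simp add: one_pCons)
  qed
  moreover have "\<sigma> a = j a" if "a \<in> K" for a using s[of "[:a:]"] ev_const[OF r(1) that] that by (simp add: PK)
  moreover have "\<sigma> x = r"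
    using s[of "[:0, 1:]"] ev_pCons[OF r(1) K0, of "[:1:]"] ev_const[OF r(1) K1] r by (simp add: PK K0 K1 j0 j1)
  ultimately show ?thesis by blast
qed

end

text \<open>If \<open>f(\<alpha>)\<close> were small at \<open>v\<close>, some root \<open>r\<close>
  of the image of \<open>f\<close> in the closure of the completion would be at distance below 1
  from \<open>\<alpha>\<close>. Sending \<open>x\<close> to \<open>r\<close> is a
  \<open>K\<close>-embedding, so integrality is violated.\<close>

lemma S_integral_min_poly_value:
  assumes sub: "subfield K complex_field" and v: "nontrivial_abs_value (subfield_ring K) v"
    and ultra: "\<And>x y. x \<in> K \<Longrightarrow> y \<in> K \<Longrightarrow> v (x + y) \<le> max (v x) (v y)"
    and nS: "abs_value_equiv (subfield_ring K) `` {v} \<notin> S"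
    and int: "S_integral K S \<alpha> x" and a: "\<alpha> \<in> K" "v \<alpha> \<le> 1" and f: "csubfield.min_poly K x f"
  shows "v (poly f \<alpha>) \<ge> 1"
proof (rule ccontr)
  assume neg: "\<not> v (poly f \<alpha>) \<ge> 1"
  interpret C: field complex_field by (rule complex_field_field)
  interpret csubfield K by (rule subfield_csubfield[OF sub])
  define R where "R = subfield_ring K"
  have Rf: "field R" unfolding R_def using C.subfield_iff(2)[OF sub] .
  have RS: "carrier R = K" "\<And>x y. x \<oplus>\<^bsub>R\<^esub> y = x + y" "\<And>x y. x \<otimes>\<^bsub>R\<^esub> y = x * y" "\<one>\<^bsub>R\<^esub> = 1" "\<zero>\<^bsub>R\<^esub> = 0"
    by (auto simp: R_def)
  have vR: "abs_value R v" using v unfolding nontrivial_abs_value_def R_def by auto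
  have na: "nonarch_field R v"
    using Rf vR ultra RS by (auto simp: nonarch_field_def nonarch_field_axioms_def)
  have nt: "\<exists>x\<in>carrier R. x \<noteq> \<zero>\<^bsub>R\<^esub> \<and> v x \<noteq> 1" using v unfolding nontrivial_abs_value_def R_def by auto
  obtain w where w: "extends_to_closure R v w" using nonarch_field.exists_extension_to_closure[OF na nt] by blast
  define E where "E = completion_closure R v"
  define j where "j = closure_embed R v"
  have KVf: "field (Defs.completion R v)" by (rule nonarch_field.completion_is_field[OF na])
  have ac: "algebraic_closure E (ring.indexed_const (Defs.completion R v) ` carrier (Defs.completion R v))"
    unfolding E_def completion_closure_def by (rule field.alg_closureE(1)[OF KVf])
  have jh0: "ring.indexed_const (Defs.completion R v) \<in> ring_hom (Defs.completion R v) E"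
    unfolding E_def completion_closure_def by (rule field.alg_closureE(2)[OF KVf])
  have jeq: "j = ring.indexed_const (Defs.completion R v) \<circ> completion_embed R v"
    by (auto simp: j_def closure_embed_def fun_eq_iff)
  have jh: "j \<in> ring_hom R E" unfolding jeq by (rule ring_hom_trans[OF nonarch_field.completion_embed(1)[OF na] jh0])
  have Ef: "field E" using algebraic_closure.axioms(1)[OF ac] .
  have acl: "algebraically_closed E"
  proof -
    interpret A: algebraic_closure E "ring.indexed_const (Defs.completion R v) ` carrier (Defs.completion R v)" by (rule ac)
    show ?thesis by unfold_locales
  qed
  interpret P: poly_eval_hom K E j
    by (intro poly_eval_hom.intro poly_eval_hom_axioms.intro Ef csubfield_axioms) (use jh R_def in simp)
  have wE: "abs_value E w" and wc: "\<And>c. c \<in> carrier (Defs.completion R v) \<Longrightarrow>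
      w (ring.indexed_const (Defs.completion R v) c) = completion_abs v c"
    using w unfolding extends_to_closure_def E_def by auto
  have wj: "w (j a) = v a" if "a \<in> K" for a
    using wc[of "completion_embed R v a"] ring_hom_closed[OF nonarch_field.completion_embed(1)[OF na]]
      nonarch_field.completion_embed(2)[OF na] that RS(1) by (simp add: j_def closure_embed_def)
  note fD = min_polyD[OF f]
  define p where "p = map j (rev (coeffs f))"
  have pn: "p \<noteq> []" using fD(4) by (simp add: p_def)
  have hp: "hd p = \<one>\<^bsub>E\<^esub>"
    using fD(2,4) P.j1 by (simp add: p_def hd_map hd_rev last_coeffs_eq_coeff_degree)
  have p: "p \<in> carrier (poly_ring E)"
    using hp pn P.coeffs_carrier[OF _ fD(1)] P.jc[OF K0] domain.one_not_zero[OF field.axioms(1)[OF Ef]]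
    unfolding sym[OF univ_poly_carrier] polynomial_def p_def by auto
  have "ring.eval E p (j \<alpha>) = j (poly f \<alpha>)" using P.ev_at[OF fD(1) a(1)] by (simp add: P.ev_def p_def)
  then have "w (ring.eval E p (j \<alpha>)) < 1" using wj[OF PKpoly[OF fD(1) a(1)]] neg by simp
  then obtain r where r: "r \<in> carrier E" "ring.eval E p r = \<zero>\<^bsub>E\<^esub>" "w (r \<ominus>\<^bsub>E\<^esub> j \<alpha>) < 1"
    using algebraically_closed.root_near[OF acl wE P.jc[OF a(1)] p pn hp] by blast
  have "P.ev f r = \<zero>\<^bsub>E\<^esub>" using r by (simp add: P.ev_def p_def)
  then obtain \<sigma> where s: "\<sigma> \<in> ring_hom (subfield_ring (adjoin K x)) E" "\<forall>a\<in>K. \<sigma> a = j a" "\<sigma> x = r"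
    using P.embedding_of_root[OF f r(1)] by blast
  have "\<sigma> \<in> K_embeddings K v x" using s unfolding K_embeddings_def E_def j_def R_def by simp
  moreover have "v \<in> abs_value_equiv (subfield_ring K) `` {v}"
    using v unfolding abs_value_equiv_def nontrivial_abs_value_def abs_value_def by (auto intro!: exI[of _ "1::real"])
  moreover have "abs_value_equiv (subfield_ring K) `` {v} \<in> places (subfield_ring K)"
    unfolding places_def using v by (auto simp: quotient_def)
  ultimately have "w (\<sigma> x \<ominus>\<^bsub>E\<^esub> j \<alpha>) \<ge> 1"
    using int nS w a(2) unfolding S_integral_def E_def j_def R_def by blast
  then show False using s r by simp
qed

section \<open>The field of algebraic numbers and primitive elements of number fields\<close>

lemma eval_complex: "ring.eval complex_field P x = poly (Poly (rev P)) x"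
proof -
  interpret C: field complex_field by (rule complex_field_field)
  show ?thesis by (induct P) (auto simp: complex_field_pow Poly_append poly_monom)
qed

lemma (in csubfield) algebraic_over_iff:
  "(ring.algebraic complex_field over K) x \<longleftrightarrow> (\<exists>p\<in>polys_over K. p \<noteq> 0 \<and> poly p x = 0)"
proof
  interpret C: field complex_field by (rule complex_field_field)
  have sr: "subring K complex_field" using subfieldE(1)[OF subfield_complex] .
  {
    assume "(C.algebraic over K) x"
    then obtain P where P: "P \<in> carrier (K[X]\<^bsub>complex_field\<^esub>)" "P \<noteq> []" "C.eval P x = 0"
      using C.algebraicE[OF sr, of x] by auto
    have PK': "set P \<subseteq> K" "hd P \<noteq> 0" using P(1,2) unfolding sym[OF univ_poly_carrier] polynomial_def by auto
    define p where "p = Poly (rev P)"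
    have "coeff p i \<in> K" for i
      using PK'(1) K0 nth_mem[of i "rev P"] by (auto simp: p_def nth_default_def)
    then have "p \<in> polys_over K" by (simp add: polys_over_def)
    moreover have "p \<noteq> 0"
    proof -
      have "coeff p (length P - 1) = hd P"
        using P(2) by (simp add: p_def nth_default_def rev_nth hd_conv_nth)
      then show ?thesis using PK' by auto
    qed
    moreover have "poly p x = 0" using P(3) eval_complex by (simp add: p_def)
    ultimately show "\<exists>p\<in>polys_over K. p \<noteq> 0 \<and> poly p x = 0" by blast
  next
    assume "\<exists>p\<in>polys_over K. p \<noteq> 0 \<and> poly p x = 0"
    then obtain p where p: "p \<in> polys_over K" "p \<noteq> 0" "poly p x = 0" by blast
    define P where "P = rev (coeffs p)"
    have "set P \<subseteq> K" using p(1) by (auto simp: P_def polys_over_def coeffs_def)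
    moreover have "P \<noteq> []" using p(2) by (simp add: P_def)
    moreover have "hd P \<noteq> 0" using p(2) by (simp add: P_def hd_rev last_coeffs_eq_coeff_degree)
    ultimately have "P \<in> carrier (K[X]\<^bsub>complex_field\<^esub>)" unfolding sym[OF univ_poly_carrier] polynomial_def by auto
    moreover have "C.eval P x = \<zero>\<^bsub>complex_field\<^esub>" using p(3) eval_complex[of P x] by (simp add: P_def)
    ultimately show "(C.algebraic over K) x" using C.algebraicI[of P K x] \<open>P \<noteq> []\<close> by blast
  }
qed

lemma Alg_csubfield: "csubfield {x. algebraic x}"
proof (rule subfield_csubfield)
  interpret C: field complex_field by (rule complex_field_field)
  have "{x. algebraic x} = {x \<in> carrier complex_field. (C.algebraic over \<rat>) x}"
    using Rats.algebraic_over_iff algebraic_polys_over by auto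
  then show "subfield {x. algebraic x} complex_field"
    using C.subfield_of_algebraics[OF Rats.subfield_complex] by simp
qed

interpretation Alg: csubfield "{x. algebraic x}" by (rule Alg_csubfield)

lemmas alg_closed = Alg.Kadd[simplified] Alg.Kmult[simplified] Alg.Kneg[simplified] Alg.Kinv[simplified]
  Alg.Kdiff[simplified] Alg.Kdiv[simplified] Alg.Kpow[simplified]

lemma alg_int: "algebraic (of_int a :: complex)" by simp

lemma alg_sum: "(\<And>i. i \<in> A \<Longrightarrow> algebraic (f i)) \<Longrightarrow> algebraic (sum f A :: complex)"
  using Alg.Ksum[of A f] by simp
lemma alg_prod: "(\<And>i. i \<in> A \<Longrightarrow> algebraic (f i)) \<Longrightarrow> algebraic (prod f A :: complex)"
  using Alg.Kprod[of A f] by simp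
lemma alg_Rats: "x \<in> \<rat> \<Longrightarrow> algebraic (x::complex)" using Alg.KRats by simp
lemma alg_root: "p \<in> polys_over \<rat> \<Longrightarrow> p \<noteq> 0 \<Longrightarrow> poly p x = 0 \<Longrightarrow> algebraic x"
  using algebraic_polys_over by blast
lemma alg_poly: "p \<in> polys_over \<rat> \<Longrightarrow> algebraic x \<Longrightarrow> algebraic (poly p x)"
  using Alg.PKpoly[OF Alg.polys_over_Rats] by simp

lemma number_field_primitive:
  assumes "number_field K" obtains t where "t \<in> K" "K = qadj t" "algebraic t" "csubfield K"
proof -
  interpret C: field complex_field by (rule complex_field_field)
  have sub: "subfield K complex_field" and fd: "C.finite_dimension \<rat> K" using assms unfolding number_field_def by auto
  interpret csubfield K by (rule subfield_csubfield[OF sub])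
  have alg: "algebraic y" if "y \<in> K" for y
    using C.finite_dimension_imp_algebraic[OF Rats.subfield_complex subfieldE(1)[OF sub] fd that]
      Rats.algebraic_over_iff algebraic_polys_over by simp
  obtain n where n: "C.dimension n \<rat> K" using fd by auto
  \<comment> \<open>Finite dimension is built up one vector at a time, so induction extracts a
    finite set \<open>U\<close> such that every set containing \<open>U\<close> and the rationals
    and closed under sums and products contains \<open>K\<close>. The set \<open>qadj t\<close> is
    of this kind once it contains \<open>U\<close>.\<close>
  define gen where "gen T U \<longleftrightarrow> \<rat> \<subseteq> T \<and> U \<subseteq> T \<and> (\<forall>x\<in>T. \<forall>y\<in>T. x + y \<in> T \<and> x * y \<in> T)" for T U :: "complex set"
  have "\<exists>U. finite U \<and> U \<subseteq> K \<and> 0 \<in> K \<and> (\<forall>T. gen T U \<longrightarrow> K \<subseteq> T)"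
    using n
  proof (induct n "\<rat> :: complex set" K rule: C.dimension.induct)
    case zero_dim
    have "{\<zero>\<^bsub>complex_field\<^esub>} \<subseteq> T" if "gen T {}" for T using that unfolding gen_def by auto
    then show ?case by (intro exI[of _ "{}"]) simp
  next
    case (Suc_dim v E n)
    obtain U where U: "finite U" "U \<subseteq> E" "0 \<in> E" "\<forall>T. gen T U \<longrightarrow> E \<subseteq> T" using Suc_dim(4) by (elim exE conjE)
    have le: "C.line_extension \<rat> v E = {k * v + e | k e. k \<in> \<rat> \<and> e \<in> E}"
      unfolding C.line_extension_def set_add_def set_mult_def r_coset_def by auto
    have "v = 1 * v + 0" by simp
    then have m1: "v \<in> C.line_extension \<rat> v E" unfolding le using U(3) Rats_1 by blast
    have m2: "e \<in> C.line_extension \<rat> v E" if "e \<in> E" for e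
    proof -
      have "e = 0 * v + e" by simp
      then show ?thesis unfolding le using that Rats_0 by blast
    qed
    have "C.line_extension \<rat> v E \<subseteq> T" if T: "gen T (insert v U)" for T
    proof -
      have "gen T U" using T unfolding gen_def by simp
      then have "E \<subseteq> T" using U(4) by simp
      then have "k * v + e \<in> T" if "k \<in> \<rat>" "e \<in> E" for k e
        using that T unfolding gen_def by (simp add: subset_iff)
      then show ?thesis unfolding le by auto
    qed
    then show ?case using m1 m2 U(1,2,3) by (intro exI[of _ "insert v U"]) auto
  qed
  then obtain U where U: "finite U" "U \<subseteq> K" "\<forall>T. gen T U \<longrightarrow> K \<subseteq> T" by (elim exE conjE)
  obtain t where t: "t \<in> K" "U \<subseteq> qadj t" using primitive_element[OF csubfield_axioms alg U(1,2)] by blast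
  have qK: "qadj t \<subseteq> K" unfolding qadj_def using PKpoly[OF polys_over_Rats t(1)] by auto
  interpret Q: csubfield "qadj t" by (rule qadj_csubfield) (use alg qK in auto)
  have "gen (qadj t) U" unfolding gen_def using t(2) Q.KRats Q.Kadd Q.Kmult by auto
  then have "K \<subseteq> qadj t" using U(3) by simp
  then show ?thesis using that t qK alg csubfield_axioms by blast
qed

subsection \<open>p-adic absolute values on the algebraic numbers\<close>

lemma padic_on_Rats:
  fixes p :: nat assumes p: "prime p"
  shows "\<exists>v. abs_value (subfield_ring \<rat>) v \<and> (\<forall>x\<in>\<rat>. \<forall>y\<in>\<rat>. v (x + y) \<le> max (v x) (v y)) \<and>
    (\<forall>a::int. a \<noteq> 0 \<longrightarrow> v (of_int a) = (1 / real p) ^ multiplicity (int p) a)"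
proof -
  define v0 where "v0 a = (if a = 0 then 0 else (1 / real p) ^ multiplicity (int p) a)" for a :: int
  have pp: "prime_elem (int p)" "\<not> is_unit (int p)" "real p > 1" using p prime_gt_1_nat[OF p] by auto
  have v0m: "v0 (a * b) = v0 a * v0 b" for a b
    using prime_elem_multiplicity_mult_distrib[OF pp(1)] by (auto simp: v0_def power_add)
  have v0p: "v0 a \<ge> 0" "v0 a = 0 \<longleftrightarrow> a = 0" for a using pp by (auto simp: v0_def)
  have v0u: "v0 (a + b) \<le> max (v0 a) (v0 b)" for a b
  proof (cases "a = 0 \<or> b = 0 \<or> a + b = 0")
    case True then show ?thesis using v0p(1)[of a] v0p(1)[of b] v0p(2)[of 0] by (auto simp: le_max_iff_disj)
  next
    case False
    define m where "m = min (multiplicity (int p) a) (multiplicity (int p) b)"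
    have "int p ^ m dvd a" "int p ^ m dvd b" unfolding m_def by (auto intro!: multiplicity_dvd')
    then have "int p ^ m dvd a + b" by simp
    then have "m \<le> multiplicity (int p) (a + b)" using False pp by (intro multiplicity_geI) auto
    then have "v0 (a + b) \<le> (1 / real p) ^ m" using False pp by (auto simp: v0_def intro!: power_decreasing)
    also have "\<dots> \<le> max (v0 a) (v0 b)" using False by (auto simp: v0_def m_def min_def)
    finally show ?thesis .
  qed
  define rp where "rp x = (SOME ab :: int \<times> int. snd ab \<noteq> 0 \<and> x = of_int (fst ab) / of_int (snd ab))" for x :: complex
  define v where "v x = v0 (fst (rp x)) / v0 (snd (rp x))" for x
  have v: "v (of_int a / of_int b) = v0 a / v0 b" if b: "b \<noteq> 0" for a b
  proof -
    define x :: complex where "x = of_int a / of_int b"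
    have "snd (rp x) \<noteq> 0 \<and> x = of_int (fst (rp x)) / of_int (snd (rp x))"
      unfolding rp_def by (rule someI[of _ "(a, b)"]) (use b in \<open>auto simp: x_def\<close>)
    then have r: "snd (rp x) \<noteq> 0" "x = of_int (fst (rp x)) / of_int (snd (rp x))" by auto
    have "(of_int a :: complex) * of_int (snd (rp x)) = of_int (fst (rp x)) * of_int b"
      using r b unfolding x_def by (simp add: field_simps)
    then have "a * snd (rp x) = fst (rp x) * b" unfolding of_int_mult[symmetric] of_int_eq_iff .
    then have "v0 a * v0 (snd (rp x)) = v0 (fst (rp x)) * v0 b" using v0m by metis
    then show ?thesis using r(1) b v0p(2) unfolding x_def[symmetric] v_def by (simp add: field_simps)
  qed
  have rep: "\<exists>a b. b \<noteq> 0 \<and> x = of_int a / of_int b" if xQ: "x \<in> \<rat>" for x :: complex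
  proof -
    obtain a b :: int where "b > 0" "x = of_int a / of_int b" using xQ by (rule Rats_cases')
    then show ?thesis by (intro exI[of _ a] exI[of _ b]) auto
  qed
  have v01: "v0 1 = 1" by (simp add: v0_def)
  have "abs_value (subfield_ring \<rat>) v \<and> (\<forall>x\<in>\<rat>. \<forall>y\<in>\<rat>. v (x + y) \<le> max (v x) (v y))"
  proof -
    have z: "v x \<ge> 0 \<and> (v x = 0 \<longleftrightarrow> x = 0)" if x: "x \<in> \<rat>" for x
    proof -
      obtain a b where ab: "b \<noteq> 0" "x = of_int a / of_int b" using rep[OF x] by auto
      show ?thesis unfolding ab(2) v[OF ab(1)] using v0p ab(1) by auto
    qed
    have m: "v (x * y) = v x * v y" and u: "v (x + y) \<le> max (v x) (v y)" if xy: "x \<in> \<rat>" "y \<in> \<rat>" for x y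
    proof -
      obtain a b where ab: "b \<noteq> 0" "x = of_int a / of_int b" using rep[OF xy(1)] by auto
      obtain c d where cd: "d \<noteq> 0" "y = of_int c / of_int d" using rep[OF xy(2)] by auto
      have bd: "b * d \<noteq> 0" using ab cd by simp
      have e0: "x * y = of_int (a * c) / of_int (b * d)" using ab cd by simp
      have vxy: "v (x * y) = v0 (a * c) / v0 (b * d)" unfolding e0 by (rule v[OF bd])
      have vx: "v x = v0 a / v0 b" unfolding ab(2) by (rule v[OF ab(1)])
      have vy: "v y = v0 c / v0 d" unfolding cd(2) by (rule v[OF cd(1)])
      have "v0 (b * d) \<noteq> 0" unfolding v0p(2) by (rule bd)
      then have "v0 (b * d) > 0" using v0p(1)[of "b * d"] by linarith
      moreover have "v0 b \<noteq> 0" unfolding v0p(2) by (rule ab(1))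
      moreover have "v0 d \<noteq> 0" unfolding v0p(2) by (rule cd(1))
      ultimately have pos: "v0 (b * d) > 0" "v0 b \<noteq> 0" "v0 d \<noteq> 0" by blast+
      show "v (x * y) = v x * v y" unfolding vxy vx vy v0m by (rule times_divide_times_eq[symmetric])
      have e: "x + y = of_int (a * d + c * b) / of_int (b * d)"
        unfolding ab(2) cd(2) using ab(1) cd(1) by (simp add: add_frac_eq)
      have "v (x + y) = v0 (a * d + c * b) / v0 (b * d)" unfolding e by (rule v[OF bd])
      also have "\<dots> \<le> max (v0 (a * d)) (v0 (c * b)) / v0 (b * d)" by (intro divide_right_mono v0u v0p(1))
      also have "\<dots> = max (v0 (a * d) / v0 (b * d)) (v0 (c * b) / v0 (b * d))"
        using pos(1) by (simp add: max_def divide_le_cancel)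
      also have "v0 (a * d) / v0 (b * d) = v x" unfolding vx v0m using pos(2,3) by simp
      also have "v0 (c * b) / v0 (b * d) = v y" unfolding vy v0m using pos(2,3) by simp
      finally show "v (x + y) \<le> max (v x) (v y)" .
    qed
    have "v (x + y) \<le> v x + v y" if "x \<in> \<rat>" "y \<in> \<rat>" for x y using u[OF that] z[OF that(1)] z[OF that(2)] by linarith
    then show ?thesis using z m u unfolding abs_value_def by simp
  qed
  moreover have "v (of_int a) = (1 / real p) ^ multiplicity (int p) a" if "a \<noteq> 0" for a
    using v[of 1 a] v01 that by (simp add: v0_def)
  ultimately show ?thesis by blast
qed

text \<open>The absolute value is defined on all algebraic numbers rather than on one number field,
  so that it can be composed with every embedding \<open>emb t\<close>. It is normalised to
  \<open>1 / p\<close> at \<open>p\<close>; its values at transcendental numbers are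
  unconstrained.\<close>

locale padic =
  fixes p :: nat and w :: "complex \<Rightarrow> real"
  assumes p: "prime p"
    and w_nonneg: "algebraic x \<Longrightarrow> w x \<ge> 0"
    and w_eq_0: "algebraic x \<Longrightarrow> w x = 0 \<longleftrightarrow> x = 0"
    and w_mult: "algebraic x \<Longrightarrow> algebraic y \<Longrightarrow> w (x * y) = w x * w y"
    and w_add: "algebraic x \<Longrightarrow> algebraic y \<Longrightarrow> w (x + y) \<le> max (w x) (w y)"
    and w_of_int: "a \<noteq> 0 \<Longrightarrow> w (of_int a) = (1 / real p) ^ multiplicity (int p) a"

lemma padic_exists: assumes p: "prime p" shows "\<exists>w. padic p w"
proof -
  interpret C: field complex_field by (rule complex_field_field)
  obtain v where v: "abs_value (subfield_ring \<rat>) v" "\<And>x y. x \<in> \<rat> \<Longrightarrow> y \<in> \<rat> \<Longrightarrow> v (x + y) \<le> max (v x) (v y)"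
    "\<And>a::int. a \<noteq> 0 \<Longrightarrow> v (of_int a) = (1 / real p) ^ multiplicity (int p) a"
    using padic_on_Rats[OF p] by (elim exE conjE) simp
  have p1: "real p > 1" using prime_gt_1_nat[OF p] by simp
  have "v (of_int (int p)) = 1 / real p"
    using v(3)[of "int p"] p p1 by (simp add: multiplicity_self prime_gt_1_nat)
  then have vp: "v (of_nat p) < 1" using p1 by simp
  have "\<exists>U w. subring U complex_field \<and> \<rat> \<subseteq> U \<and> (\<forall>x \<in> carrier complex_field. (C.algebraic over \<rat>) x \<longrightarrow> x \<in> U) \<and>
    (\<forall>x \<in> U. 0 \<le> w x) \<and> (\<forall>x \<in> \<rat>. w x = v x) \<and>
    (\<forall>x \<in> U. \<forall>y \<in> U. w (x \<otimes>\<^bsub>complex_field\<^esub> y) = w x * w y) \<and>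
    (\<forall>x \<in> U. \<forall>y \<in> U. w (x \<oplus>\<^bsub>complex_field\<^esub> y) \<le> max (w x) (w y))"
    by (rule C.extend_abs_value[OF Rats.subfield_complex v(1), of "of_nat p"]) (use v(2) vp p1 in auto)
  then obtain U w where W: "\<forall>x \<in> carrier complex_field. (C.algebraic over \<rat>) x \<longrightarrow> x \<in> U"
    "\<forall>x \<in> U. 0 \<le> w x" "\<forall>x \<in> \<rat>. w x = v x"
    "\<forall>x \<in> U. \<forall>y \<in> U. w (x \<otimes>\<^bsub>complex_field\<^esub> y) = w x * w y"
    "\<forall>x \<in> U. \<forall>y \<in> U. w (x \<oplus>\<^bsub>complex_field\<^esub> y) \<le> max (w x) (w y)"
    by (elim exE conjE)
  have w: "\<And>x. algebraic x \<Longrightarrow> x \<in> U" "\<And>x. x \<in> U \<Longrightarrow> 0 \<le> w x" "\<And>x. x \<in> \<rat> \<Longrightarrow> w x = v x"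
    "\<And>x y. x \<in> U \<Longrightarrow> y \<in> U \<Longrightarrow> w (x * y) = w x * w y" "\<And>x y. x \<in> U \<Longrightarrow> y \<in> U \<Longrightarrow> w (x + y) \<le> max (w x) (w y)"
    using W Rats.algebraic_over_iff algebraic_polys_over by simp_all
  have w0: "w 0 = 0" "w 1 = 1" using w(3)[of 0] w(3)[of 1] v(1) v(3)[of 1] unfolding abs_value_def by auto
  have "padic p w"
  proof
    fix x :: complex assume x: "algebraic x"
    show "w x = 0 \<longleftrightarrow> x = 0"
    proof
      assume wx: "w x = 0"
      show "x = 0"
      proof (rule ccontr)
        assume "x \<noteq> 0"
        then have "w x * w (inverse x) = 1" using w(4)[OF w(1)[OF x] w(1)[OF alg_closed(4)[OF x]]] w0 by simp
        then show False using wx by simp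
      qed
    qed (use w0 in auto)
  qed (use w p v(3) in auto)
  then show ?thesis by blast
qed

context padic begin

lemma p1: "real p > 1" using prime_gt_1_nat[OF p] by simp
lemma w_0: "w 0 = 0" using w_eq_0[of 0] by simp
lemma w_1: "w 1 = 1" using w_of_int[of 1] by simp
lemma w_int_le: "w (of_int a) \<le> 1"
proof (cases "a = 0")
  case False
  have "(1 / real p) ^ multiplicity (int p) a \<le> 1" using p1 by (intro power_le_one) auto
  then show ?thesis using w_of_int[OF False] by simp
qed (simp add: w_0)
lemma w_nat_le: "w (of_nat n) \<le> 1" using w_int_le[of "int n"] by simp
lemma w_p: "w (of_nat p) = 1 / real p"
  using w_of_int[of "int p"] p p1 by (simp add: multiplicity_self prime_gt_1_nat)
lemma w_nat_ge: assumes "n > 0" shows "w (of_nat n) \<ge> 1 / real n"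
proof -
  define m where "m = multiplicity (int p) (int n)"
  have "int p ^ m dvd int n" unfolding m_def by (rule multiplicity_dvd)
  then have "int p ^ m \<le> int n" using assms by (intro zdvd_imp_le) auto
  then have "real p ^ m \<le> real n" by (metis of_nat_le_iff of_nat_power of_int_of_nat_eq of_int_le_iff)
  moreover have "real p ^ m > 0" using p1 by simp
  moreover have "w (of_nat n) = 1 / real p ^ m" using w_of_int[of "int n"] assms by (simp add: m_def power_one_over)
  ultimately show ?thesis using assms by (simp add: frac_le)
qed
lemma w_not_dvd: assumes "\<not> p dvd n" shows "w (of_nat n) = 1"
proof -
  have "n \<noteq> 0" using assms by (cases "n = 0") auto
  then show ?thesis using w_of_int[of "int n"] assms not_dvd_imp_multiplicity_0[of "int p" "int n"] by simp
qed
lemma w_pos: "algebraic x \<Longrightarrow> x \<noteq> 0 \<Longrightarrow> w x > 0" using w_nonneg w_eq_0 by fastforce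
lemma w_neg: assumes "algebraic x" shows "w (- x) = w x"
  using w_mult[of "of_int (-1)" x] assms w_of_int[of "-1"] alg_int[of "-1"] by simp
lemma w_diff: "algebraic x \<Longrightarrow> algebraic y \<Longrightarrow> w (x - y) \<le> max (w x) (w y)"
  using w_add[of x "- y"] w_neg alg_closed(3) by simp
lemma w_pow: "algebraic x \<Longrightarrow> w (x ^ n) = w x ^ n"
  by (induct n) (auto simp: w_1 w_mult alg_closed)
lemma w_inverse: assumes "algebraic x" shows "w (inverse x) = inverse (w x)"
proof (cases "x = 0")
  case False
  then have "w x * w (inverse x) = 1" using w_mult[OF assms alg_closed(4)[OF assms]] w_1 by simp
  then show ?thesis by (metis inverse_unique)
qed (simp add: w_0)
lemma w_prod: "(\<And>i. i \<in> A \<Longrightarrow> algebraic (f i)) \<Longrightarrow> w (prod f A) = (\<Prod>i\<in>A. w (f i))"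
  by (induct A rule: infinite_finite_induct) (auto simp: w_1 w_mult alg_prod)
lemma w_sum_le: "(\<And>i. i \<in> A \<Longrightarrow> algebraic (f i) \<and> w (f i) \<le> c) \<Longrightarrow> c \<ge> 0 \<Longrightarrow> w (sum f A) \<le> c"
proof (induct A rule: infinite_finite_induct)
  case (insert x F)
  have "w (f x + sum f F) \<le> max (w (f x)) (w (sum f F))" using insert by (intro w_add alg_sum) auto
  then show ?case using insert by force
qed (auto simp: w_0)
lemma w_sum_less: "(\<And>i. i \<in> A \<Longrightarrow> algebraic (f i) \<and> w (f i) < c) \<Longrightarrow> c > 0 \<Longrightarrow> w (sum f A) < c"
proof (induct A rule: infinite_finite_induct)
  case (insert x F)
  have "w (f x + sum f F) \<le> max (w (f x)) (w (sum f F))" using insert by (intro w_add alg_sum) auto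
  then show ?case using insert by force
qed (auto simp: w_0)
lemma w_add_eq: assumes "algebraic x" "algebraic y" "w x < w y" shows "w (x + y) = w y"
proof -
  have "w y \<le> max (w (x + y)) (w x)" using w_diff[of "x + y" x] assms alg_closed(1) by simp
  then show ?thesis using w_add[OF assms(1,2)] assms(3) by auto
qed
lemma w_unity: assumes "x ^ n = 1" "n > 0" "algebraic x" shows "w x = 1"
proof -
  have "w x ^ n = 1" using w_pow[OF assms(3), of n] assms w_1 by simp
  then have "w x ^ n = 1 ^ n" by simp
  then show ?thesis using power_eq_imp_eq_base[of "w x" n 1] assms(2) w_nonneg[OF assms(3)] by simp
qed
lemma w_diff_commute: "algebraic x \<Longrightarrow> algebraic y \<Longrightarrow> w (x - y) = w (y - x)"
  using w_neg[of "x - y"] alg_closed(5) by simp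

text \<open>Fermat's little theorem for fractions \<open>a / b\<close> with \<open>b\<close> prime
  to \<open>p\<close>, obtained by clearing the denominator and applying it to \<open>a\<close> and
  \<open>b\<close>. It is what makes rational coefficients invariant under the Frobenius map in
  \<open>poly_frobenius\<close>.\<close>

lemma w_Rats_integral: "x \<in> \<rat> \<Longrightarrow> w x \<le> 1 \<Longrightarrow> w (x ^ p - x) < 1"
proof -
  assume x: "x \<in> \<rat>" "w x \<le> 1"
  obtain a b :: int where ab: "b > 0" "coprime a b" "x = of_int a / of_int b" using x(1) by (rule Rats_cases')
  have alg: "algebraic (of_int c :: complex)" for c by (rule alg_int)
  have xb: "x * of_int b = of_int a" using ab by simp
  have nb: "\<not> int p dvd b"
  proof
    assume d: "int p dvd b"
    then have na: "\<not> int p dvd a" using coprime_common_divisor[OF ab(2), of "int p"] p1 by auto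
    have "w (of_int b) < 1"
      using ab(1) d p1 w_of_int[of b] p by (simp add: power_less_one_iff prime_multiplicity_gt_zero_iff multiplicity_gt_zero_iff)
    moreover have "w (of_int a) = 1" using na w_of_int[of a] not_dvd_imp_multiplicity_0[OF na] by (cases "a = 0") auto
    moreover have "w x * w (of_int b) = w (of_int a)" using w_mult[OF alg_Rats[OF x(1)] alg[of b]] unfolding xb by simp
    moreover have "w x * w (of_int b) \<le> 1 * w (of_int b)" by (rule mult_right_mono[OF x(2) w_nonneg[OF alg]])
    ultimately show False by linarith
  qed
  have wb: "w (of_int b) = 1" using nb ab(1) w_of_int[of b] not_dvd_imp_multiplicity_0[OF nb] by simp
  have fermat: "int p dvd c ^ p - c" for c :: int
  proof (cases "int p dvd c")
    case True
    then have "int p dvd c ^ p" using prime_gt_0_nat[OF p] dvd_trans[OF True dvd_power] by blast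
    then show ?thesis using True by simp
  next
    case False
    define m where "m = nat (c mod int p)"
    have pz: "int p > 0" using prime_gt_0_nat[OF p] by simp
    then have m: "int m = c mod int p" unfolding m_def by simp
    have cm: "[int m = c] (mod int p)" unfolding m by (simp add: cong_def)
    have "\<not> p dvd m" 
    proof
      assume "p dvd m"
      then have "int p dvd c mod int p" unfolding m[symmetric] by simp
      then show False using False by (simp add: dvd_mod_iff)
    qed
    then have "[m ^ (p - 1) = 1] (mod p)" using fermat_theorem[OF p] by blast
    then have "[int (m ^ (p - 1)) = int 1] (mod int p)" unfolding cong_int_iff .
    then have B: "[int m ^ (p - 1) = 1] (mod int p)" by simp
    have "[c ^ (p - 1) = 1] (mod int p)" by (rule cong_trans[OF cong_pow[OF cong_sym[OF cm]] B])
    then have "[c ^ (p - 1) * c = 1 * c] (mod int p)" by (rule cong_scalar_right)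
    moreover have "c ^ (p - 1) * c = c ^ p" using prime_gt_0_nat[OF p] by (metis power_minus_mult)
    ultimately show ?thesis by (simp add: cong_iff_dvd_diff)
  qed
  have "int p dvd (a ^ p - a) * b - a * (b ^ p - b)" by (rule dvd_diff[OF dvd_mult2[OF fermat[of a]] dvd_mult[OF fermat[of b]]])
  moreover have "(a ^ p - a) * b - a * (b ^ p - b) = a ^ p * b - a * b ^ p" by (simp add: algebra_simps)
  ultimately obtain c where c: "a ^ p * b - a * b ^ p = int p * c" by (auto elim!: dvdE)
  have "(x ^ p - x) * (of_int b ^ p * of_int b) = of_int (a ^ p * b - a * b ^ p)"
  proof -
    have "(x ^ p - x) * (of_int b ^ p * of_int b) = (x * of_int b) ^ p * of_int b - (x * of_int b) * of_int b ^ p"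
      by (simp add: algebra_simps power_mult_distrib)
    then show ?thesis unfolding xb by simp
  qed
  also have "\<dots> = of_nat p * of_int c" unfolding c by simp
  finally have "w ((x ^ p - x) * (of_int b ^ p * of_int b)) = w (of_nat p * of_int c)" by simp
  then have "w (x ^ p - x) = w (of_nat p) * w (of_int c)"
    using alg wb alg_Rats[OF x(1)] by (simp add: w_mult w_pow alg_closed)
  also have "\<dots> \<le> 1 / real p * 1" using w_int_le[of c] p1 w_p by (intro mult_mono) (auto simp: w_nonneg alg)
  also have "\<dots> < 1" using p1 by simp
  finally show ?thesis .
qed

end

subsection \<open>Chebyshev polynomials\<close>

abbreviation cheb :: "nat \<Rightarrow> complex poly" where "cheb n \<equiv> map_poly of_int (chebyshev n)"

lemma map_poly_of_int_hom:
  "map_poly of_int (p * q) = (map_poly of_int p * map_poly of_int q :: complex poly)"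
  "map_poly of_int (p - q) = (map_poly of_int p - map_poly of_int q :: complex poly)"
  by (auto intro!: poly_eqI simp: coeff_map_poly coeff_mult)

lemma cheb_rec: "cheb (Suc (Suc (Suc m))) = [:0, 1:] * cheb (Suc (Suc m)) - cheb (Suc m)"
  unfolding chebyshev.simps(4) map_poly_of_int_hom by (simp add: map_poly_pCons)

lemma cheb_plus_inverse:
  assumes "z \<noteq> 0" shows "poly (cheb n) (z + inverse z) = z ^ n + inverse z ^ n"
proof -
  define w where "w = inverse z"
  have zw: "z * w = 1" using assms by (simp add: w_def)
  have "poly (cheb n) (z + w) = z ^ n + w ^ n"
  proof (induct n rule: chebyshev.induct)
    case 3
    have "(z + w) * (z + w) - 2 = z * z + w * w + 2 * (z * w) - 2" by (simp add: algebra_simps)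
    then show ?case unfolding zw by (simp add: map_poly_pCons algebra_simps)
  next
    case (4 m)
    define P Q where "P = z ^ Suc m" and "Q = w ^ Suc m"
    have e: "z ^ Suc (Suc m) = z * P" "w ^ Suc (Suc m) = w * Q" "z ^ Suc (Suc (Suc m)) = z * (z * P)" "w ^ Suc (Suc (Suc m)) = w * (w * Q)"
      by (simp_all add: P_def Q_def)
    have "poly (cheb (Suc (Suc (Suc m)))) (z + w) = (z + w) * (z * P + w * Q) - (P + Q)"
      unfolding cheb_rec using 4 unfolding e P_def[symmetric] Q_def[symmetric] by simp
    also have "\<dots> = z * (z * P) + w * (w * Q) + (z * w) * (P + Q) - (P + Q)" by (simp add: algebra_simps)
    finally show ?case unfolding zw e by simp
  qed (simp_all add: map_poly_pCons)
  then show ?thesis unfolding w_def .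
qed

lemma plus_inverse_eq_iff:
  fixes z y :: complex assumes "z \<noteq> 0" "y \<noteq> 0"
  shows "z + inverse z = y + inverse y \<longleftrightarrow> z = y \<or> z = inverse y"
proof -
  define w u where "w = inverse z" and "u = inverse y"
  have zw: "z * w = 1" and yu: "y * u = 1" using assms by (simp_all add: w_def u_def)
  have "z * y * ((z + w) - (y + u)) = z * z * y + y * (z * w) - z * y * y - z * (y * u)" by (simp add: algebra_simps)
  also have "\<dots> = (z - y) * (z * y - 1)" unfolding zw yu by (simp add: algebra_simps)
  finally have "z + w = y + u \<longleftrightarrow> (z - y) * (z * y - 1) = 0"
    using assms by (metis eq_iff_diff_eq_0 mult_eq_0_iff)
  also have "\<dots> \<longleftrightarrow> z = y \<or> z * y = 1" by simp
  also have "z * y = 1 \<longleftrightarrow> z = u"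
  proof
    assume "z * y = 1"
    then show "z = u" unfolding u_def by (metis inverse_unique mult.commute)
  qed (use yu mult.commute in metis)
  finally show ?thesis unfolding w_def u_def .
qed

lemma plus_inverse_eq_2: fixes z :: complex assumes "z \<noteq> 0" "z + inverse z = 2" shows "z = 1"
  using plus_inverse_eq_iff[of z 1] assms by simp

lemma exists_plus_inverse: "\<exists>z::complex. z \<noteq> 0 \<and> x = z + inverse z"
proof -
  have "\<not> constant (poly [:1, - x, 1:])" by (simp add: constant_degree)
  then obtain z where z: "poly [:1, - x, 1:] z = 0" using Fundamental_Theorem_Algebra.fundamental_theorem_of_algebra by blast
  have z0: "z \<noteq> 0" using z by auto
  have "x * z = (z + inverse z) * z" using z z0 by (simp add: algebra_simps)
  then show ?thesis using z0 by auto
qed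

text \<open>In the coordinate \<open>z + inverse z\<close> the map is \<open>z\<close> to
  \<open>z ^ m\<close>. For \<open>j < k\<close>, equal iterates force \<open>z ^ (m ^ k)\<close> to
  be \<open>z ^ (m ^ j)\<close> or its inverse; either way a positive power of \<open>z\<close> is
  1.\<close>

lemma preperiodic_cheb:
  assumes m: "m \<ge> 2" and pre: "preperiodic (poly_map (chebyshev m)) x"
  shows "\<exists>z n. n > 0 \<and> z ^ n = 1 \<and> x = z + inverse z"
proof -
  obtain z where z: "z \<noteq> 0" "x = z + inverse z" using exists_plus_inverse by blast
  have it: "(poly_map (chebyshev m) ^^ j) x = z ^ (m ^ j) + inverse (z ^ (m ^ j))" for j
  proof (induct j)
    case (Suc j)
    have "(poly_map (chebyshev m) ^^ Suc j) x = poly (cheb m) (z ^ (m ^ j) + inverse (z ^ (m ^ j)))"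
      unfolding Suc[symmetric] by (simp add: poly_map_def)
    also have "\<dots> = (z ^ (m ^ j)) ^ m + inverse (z ^ (m ^ j)) ^ m" using z by (intro cheb_plus_inverse) simp
    finally show ?case by (simp add: power_mult[symmetric] power_inverse mult.commute)
  qed (simp add: z)
  obtain j k where jk: "j \<noteq> k" "(poly_map (chebyshev m) ^^ j) x = (poly_map (chebyshev m) ^^ k) x"
    using pre unfolding preperiodic_def by blast
  have "\<exists>n>0. z ^ n = 1" if "j < k" "(poly_map (chebyshev m) ^^ j) x = (poly_map (chebyshev m) ^^ k) x" for j k
  proof -
    have lt: "m ^ j < m ^ k" using m that(1) by (intro power_strict_increasing) auto
    have "z ^ (m ^ k) = z ^ (m ^ j) \<or> z ^ (m ^ k) = inverse (z ^ (m ^ j))"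
      using plus_inverse_eq_iff[of "z ^ (m ^ k)" "z ^ (m ^ j)"] that(2) z unfolding it by auto
    then show ?thesis
    proof
      assume e: "z ^ (m ^ k) = z ^ (m ^ j)"
      have "z ^ (m ^ k) = z ^ (m ^ j) * z ^ (m ^ k - m ^ j)" using lt by (simp add: power_add[symmetric])
      then have "z ^ (m ^ k - m ^ j) = 1" using e z by simp
      then show ?thesis using lt by (intro exI[of _ "m ^ k - m ^ j"]) simp
    next
      assume e: "z ^ (m ^ k) = inverse (z ^ (m ^ j))"
      then have "z ^ (m ^ k + m ^ j) = 1" using z by (simp add: power_add)
      moreover have "0 < m ^ k + m ^ j" using lt by linarith
      ultimately show ?thesis by blast
    qed
  qed
  from this[of j k] this[of k j] have "\<exists>n>0. z ^ n = 1" using jk by (cases "j < k") auto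
  then show ?thesis using z(2) by blast
qed

subsection \<open>Embeddings of a number field given by a primitive element\<close>

locale prim_field = csubfield K for K +
  fixes \<theta> :: complex and q :: "complex poly"
  assumes q: "Rats.min_poly \<theta> q" and Kq: "K = qadj \<theta>"
begin

definition \<Theta> where "\<Theta> = {t. poly q t = 0}"
definition rep where "rep k = (SOME A. A \<in> polys_over \<rat> \<and> poly A \<theta> = k)"
text \<open>For a root \<open>t\<close> of \<open>q\<close> this is the field embedding sending
  \<open>\<theta>\<close> to \<open>t\<close>. The choice hidden in \<open>rep\<close> is
  immaterial, as two representatives differ by a multiple of \<open>q\<close>.\<close>

definition emb where "emb t k = poly (rep k) t"
abbreviation memb where "memb t f \<equiv> map_poly (emb t) f"

lemma rep: "k \<in> K \<Longrightarrow> rep k \<in> polys_over \<rat>" "k \<in> K \<Longrightarrow> poly (rep k) \<theta> = k"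
proof -
  assume "k \<in> K"
  then obtain A where "A \<in> polys_over \<rat> \<and> poly A \<theta> = k" unfolding Kq qadj_def by blast
  then have "rep k \<in> polys_over \<rat> \<and> poly (rep k) \<theta> = k" unfolding rep_def by (rule someI)
  then show "rep k \<in> polys_over \<rat>" "poly (rep k) \<theta> = k" by auto
qed

lemma finite_\<Theta>: "finite \<Theta>" unfolding \<Theta>_def using poly_roots_finite[OF Rats.min_polyD(4)[OF q]] .
lemma \<theta>_in: "\<theta> \<in> \<Theta>" unfolding \<Theta>_def using Rats.min_polyD(3)[OF q] by simp
lemma alg_\<Theta>: "t \<in> \<Theta> \<Longrightarrow> algebraic t"
  unfolding \<Theta>_def using alg_root[OF Rats.min_polyD(1,4)[OF q]] by simp

context
  fixes t assumes t: "t \<in> \<Theta>"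
begin

lemma emb_poly: assumes "A \<in> polys_over \<rat>" shows "emb t (poly A \<theta>) = poly A t"
proof -
  have k: "poly A \<theta> \<in> K" unfolding Kq qadj_def using assms by blast
  have "poly (rep (poly A \<theta>) - A) \<theta> = 0" using rep(2)[OF k] by simp
  moreover have "rep (poly A \<theta>) - A \<in> polys_over \<rat>" using rep(1)[OF k] assms by (rule Rats.PKdiff)
  ultimately have "poly (rep (poly A \<theta>) - A) t = 0"
    using Rats.min_poly_conj[OF q, of t] t unfolding \<Theta>_def by blast
  then show ?thesis by (simp add: emb_def)
qed

lemma emb_Rats: assumes "a \<in> \<rat>" shows "emb t a = a"
  using emb_poly[of "[:a:]"] Rats.PKpCons[OF assms Rats.PK0] by simp
lemma emb_0: "emb t 0 = 0" and emb_1: "emb t 1 = 1" using emb_Rats by auto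
lemma emb_add: assumes "a \<in> K" "b \<in> K" shows "emb t (a + b) = emb t a + emb t b"
  using emb_poly[OF Rats.PKadd[OF rep(1)[OF assms(1)] rep(1)[OF assms(2)]]] rep(2)[OF assms(1)] rep(2)[OF assms(2)]
  by (simp add: emb_def)
lemma emb_mult: assumes "a \<in> K" "b \<in> K" shows "emb t (a * b) = emb t a * emb t b"
  using emb_poly[OF Rats.PKmult[OF rep(1)[OF assms(1)] rep(1)[OF assms(2)]]] rep(2)[OF assms(1)] rep(2)[OF assms(2)]
  by (simp add: emb_def)
lemma emb_nonzero: assumes "a \<in> K" "a \<noteq> 0" shows "emb t a \<noteq> 0"
proof
  assume "emb t a = 0"
  then have "emb t (a * inverse a) = 0" using emb_mult[OF assms(1) Kinv[OF assms(1)]] by simp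
  then show False using assms(2) emb_1 by simp
qed
lemma emb_alg: "a \<in> K \<Longrightarrow> algebraic (emb t a)" unfolding emb_def using alg_poly[OF rep(1) alg_\<Theta>[OF t]] .
lemma emb_sum: "(\<And>i. i \<in> A \<Longrightarrow> g i \<in> K) \<Longrightarrow> emb t (sum g A) = (\<Sum>i\<in>A. emb t (g i))"
  by (induct A rule: infinite_finite_induct) (auto simp: emb_0 emb_add Ksum)

lemma coeff_memb: "coeff (memb t f) i = emb t (coeff f i)" by (simp add: coeff_map_poly emb_0)
lemma coeffK: "f \<in> polys_over K \<Longrightarrow> coeff f i \<in> K" by (simp add: polys_over_def)
lemma memb_pCons: "memb t (pCons a f) = pCons (emb t a) (memb t f)"
  by (intro poly_eqI) (auto simp: coeff_memb coeff_pCons split: nat.splits)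
lemma memb_add: "f \<in> polys_over K \<Longrightarrow> g \<in> polys_over K \<Longrightarrow> memb t (f + g) = memb t f + memb t g"
  by (intro poly_eqI) (auto simp: coeff_memb coeffK emb_add)
lemma memb_mult: "f \<in> polys_over K \<Longrightarrow> g \<in> polys_over K \<Longrightarrow> memb t (f * g) = memb t f * memb t g"
  by (intro poly_eqI) (auto simp: coeff_memb coeffK coeff_mult emb_mult emb_sum Kmult)
lemma memb_Rats: "f \<in> polys_over \<rat> \<Longrightarrow> memb t f = f"
  by (intro poly_eqI) (auto simp: coeff_memb polys_over_def emb_Rats)
lemma memb_pderiv: assumes "f \<in> polys_over K" shows "memb t (pderiv f) = pderiv (memb t f)"
proof (intro poly_eqI)
  fix i
  have "(of_nat (Suc i) :: complex) \<in> K" "(of_nat (Suc i) :: complex) \<in> \<rat>" using Knat Rats.Knat by blast+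
  then show "coeff (memb t (pderiv f)) i = coeff (pderiv (memb t f)) i"
    by (simp add: coeff_memb coeff_pderiv emb_mult[OF _ coeffK[OF assms]] emb_Rats del: of_nat_Suc)
qed
lemma memb_poly: "f \<in> polys_over K \<Longrightarrow> a \<in> K \<Longrightarrow> poly (memb t f) (emb t a) = emb t (poly f a)"
proof (induct f)
  case (pCons b f)
  have m: "b \<in> K" "f \<in> polys_over K" using PKpConsD pCons by auto
  show ?case using m pCons(2)[OF m(2) pCons(4)] pCons(4) PKpoly[OF m(2) pCons(4)] by (simp add: memb_pCons emb_add emb_mult Kmult)
qed (simp add: emb_0)
lemma memb_pcompose:
  assumes "g \<in> polys_over \<rat>" shows "f \<in> polys_over K \<Longrightarrow> memb t (pcompose f g) = pcompose (memb t f) g"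
proof (induct f)
  case (pCons b f)
  have m: "b \<in> K" "f \<in> polys_over K" using PKpConsD pCons by auto
  have gK: "g \<in> polys_over K" using polys_over_Rats[OF assms] .
  show ?case using m pCons(2)[OF m(2)] gK
    by (simp add: memb_pCons pcompose_pCons memb_add memb_mult memb_Rats[OF assms] PK)
qed simp
lemma memb_degree: assumes "lead_coeff f = 1" shows "degree (memb t f) = degree f" "lead_coeff (memb t f) = 1"
proof -
  have le: "degree (memb t f) \<le> degree f" by (rule map_poly_degree_leq)
  have c: "coeff (memb t f) (degree f) = 1" using assms by (simp add: coeff_memb emb_1)
  then have "degree f \<le> degree (memb t f)" by (intro le_degree) simp
  then show "degree (memb t f) = degree f" using le by simp
  then show "lead_coeff (memb t f) = 1" using c by simp
qed

end

lemma norm_in_Rats: "k \<in> K \<Longrightarrow> (\<Prod>t\<in>\<Theta>. emb t k) \<in> \<rat>"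
  unfolding emb_def \<Theta>_def using norm_rational[OF q rep(1)] .

lemma poly_norm_in_Rats:
  assumes f: "f \<in> polys_over K" shows "(\<Prod>t\<in>\<Theta>. memb t f) \<in> polys_over \<rat>"
proof (rule polys_over_Rats_by_values[of 0])
  fix k :: nat
  have "poly (\<Prod>t\<in>\<Theta>. memb t f) (of_nat k) = (\<Prod>t\<in>\<Theta>. emb t (poly f (of_nat k)))"
    unfolding poly_prod
  proof (rule prod.cong[OF refl])
    fix t assume t: "t \<in> \<Theta>"
    show "poly (memb t f) (of_nat k) = emb t (poly f (of_nat k))"
      using memb_poly[OF t f Knat[of k]] emb_Rats[OF t Rats.Knat[of k]] by simp
  qed
  then show "poly (\<Prod>t\<in>\<Theta>. memb t f) (of_nat k) \<in> \<rat>" using norm_in_Rats[OF PKpoly[OF f Knat[of k]]] by simp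
qed

end

subsection \<open>Conjugates of the trace of a root of unity\<close>

definition primitive_root_of_unity :: "nat \<Rightarrow> complex \<Rightarrow> bool" where
  "primitive_root_of_unity n z \<longleftrightarrow> n > 0 \<and> z ^ n = 1 \<and> (\<forall>m. 0 < m \<longrightarrow> m < n \<longrightarrow> z ^ m \<noteq> 1)"

lemma primitive_dvd: assumes z: "primitive_root_of_unity n z" and m: "z ^ m = 1" shows "n dvd m"
proof -
  have zn: "n > 0" "z ^ n = 1" using z unfolding primitive_root_of_unity_def by auto
  have "z ^ m = z ^ (n * (m div n) + m mod n)" by simp
  also have "\<dots> = z ^ (m mod n)" unfolding power_add power_mult zn by simp
  finally have "z ^ (m mod n) = 1" using m by simp
  then have "m mod n = 0" using z mod_less_divisor[OF zn(1), of m] unfolding primitive_root_of_unity_def by auto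
  then show ?thesis by auto
qed

lemma primitive_powers_inj: assumes z: "primitive_root_of_unity n z" shows "inj_on (\<lambda>c. z ^ c) {..<n}"
proof (rule inj_onI)
  have z0: "z \<noteq> 0" using z unfolding primitive_root_of_unity_def by (auto simp: power_0_left)
  have *: "c = d" if "c \<le> d" "d < n" "z ^ c = z ^ d" for c d
  proof -
    have "z ^ d = z ^ c * z ^ (d - c)" using that(1) by (simp only: power_add[symmetric] le_add_diff_inverse)
    then have "z ^ (d - c) = 1" using that z0 by simp
    then have "n dvd d - c" by (rule primitive_dvd[OF z])
    show ?thesis
    proof (rule ccontr)
      assume "c \<noteq> d"
      then have "0 < d - c" using that(1) by simp
      then have "n \<le> d - c" using dvd_imp_le[OF \<open>n dvd d - c\<close>] by blast
      then show False using that(2) by linarith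
    qed
  qed
  fix c d assume "c \<in> {..<n}" "d \<in> {..<n}" "z ^ c = z ^ d"
  then show "c = d" using *[of c d] *[of d c] by (cases "c \<le> d") auto
qed

lemma primitive_powers_all: assumes z: "primitive_root_of_unity n z" shows "(\<lambda>c. z ^ c) ` {..<n} = {r. r ^ n = 1}"
proof (rule card_seteq)
  have zn: "n > 0" "z ^ n = 1" using z unfolding primitive_root_of_unity_def by auto
  show "finite {r::complex. r ^ n = 1}" using zn(1) by (intro finite_roots_unity) simp
  show "(\<lambda>c. z ^ c) ` {..<n} \<subseteq> {r. r ^ n = 1}"
  proof (rule image_subsetI)
    fix c have "(z ^ c) ^ n = (z ^ n) ^ c" by (simp add: power_mult[symmetric] mult.commute)
    then show "z ^ c \<in> {r. r ^ n = 1}" using zn(2) by simp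
  qed
  show "card {r::complex. r ^ n = 1} \<le> card ((\<lambda>c. z ^ c) ` {..<n})"
    using card_image[OF primitive_powers_inj[OF z]] card_roots_unity_eq[of n] zn(1) by simp
qed

subsection \<open>A Schwarz lemma with approximate zeros\<close>

lemma holomorphic_divide_zeros:
  assumes "finite T" "G holomorphic_on UNIV" "\<And>t. t \<in> T \<Longrightarrow> G t = 0"
  shows "\<exists>h. h holomorphic_on UNIV \<and> (\<forall>z. G z = (\<Prod>t\<in>T. z - t) * h z)"
  using assms
proof (induct T arbitrary: G rule: finite_induct)
  case empty then show ?case by (intro exI[of _ G]) simp
next
  case (insert a T)
  define g where "g z = (if z = a then deriv G a else (G z - G a) / (z - a))" for z
  have "(\<lambda>z. if z = a then deriv G a else (G z - G a) / (z - a)) holomorphic_on UNIV"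
    by (rule pole_lemma[OF insert(4)]) simp
  then have g: "g holomorphic_on UNIV" unfolding g_def .
  have Gg: "G z = (z - a) * g z" for z using insert(5)[of a] by (simp add: g_def)
  have "g t = 0" if "t \<in> T" for t
  proof -
    have "t \<noteq> a" using insert(2) that by blast
    then show ?thesis using insert(5)[of t] insert(5)[of a] that by (simp add: g_def)
  qed
  then obtain h where h: "h holomorphic_on UNIV" "\<And>z. g z = (\<Prod>t\<in>T. z - t) * h z" using insert(3)[OF g] by blast
  have "G z = (\<Prod>t\<in>insert a T. z - t) * h z" for z
    unfolding Gg[of z] h(2)[of z] using insert(1,2) by (simp add: mult.assoc)
  then show ?case using h(1) by blast
qed

text \<open>The approximate zeros become exact after subtracting the Lagrange interpolant
  \<open>J\<close> of \<open>F\<close> on \<open>T\<close>, which is small because the nodes are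
  1-separated and numerators are at most \<open>8 * \<rho>\<close>. The difference, divided by its
  zeros, obeys the maximum principle on the circle of radius \<open>7 * \<rho>\<close>: there each
  linear factor is at least \<open>6 * \<rho>\<close>, at \<open>x\<close> it is at most
  \<open>\<rho>\<close>, whence a gain of 6 per node.\<close>

lemma schwarz_approximate_zeros:
  fixes F :: "complex \<Rightarrow> complex" and T :: "complex set" and \<rho> \<eta> M :: real
  assumes F: "F holomorphic_on UNIV" and T: "finite T" and \<rho>: "\<rho> \<ge> 1"
    and Tsep: "\<And>s t. s \<in> T \<Longrightarrow> t \<in> T \<Longrightarrow> s \<noteq> t \<Longrightarrow> norm (s - t) \<ge> 1"
    and Tbd: "\<And>t. t \<in> T \<Longrightarrow> norm t \<le> \<rho>" and \<eta>: "\<And>t. t \<in> T \<Longrightarrow> norm (F t) \<le> \<eta>"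
    and M: "\<And>z. norm z = 7 * \<rho> \<Longrightarrow> norm (F z) \<le> M"
    and x: "norm x \<le> \<rho>" "\<And>t. t \<in> T \<Longrightarrow> norm (x - t) \<le> \<rho>"
  shows "norm (F x) \<le> M / 6 ^ card T + 2 * (card T * \<eta> * (8 * \<rho>) ^ card T)"
proof -
  define l where "l t z = (\<Prod>s\<in>T - {t}. (z - s) / (t - s))" for t z
  define J where "J z = (\<Sum>t\<in>T. F t * l t z)" for z
  define e where "e = card T * \<eta> * (8 * \<rho>) ^ card T"
  have lb: "norm (l t z) \<le> (8 * \<rho>) ^ card T" if t: "t \<in> T" and z: "norm z \<le> 7 * \<rho>" for t z
  proof -
    have "norm (l t z) = (\<Prod>s\<in>T - {t}. norm ((z - s) / (t - s)))" unfolding l_def by (rule prod_norm[symmetric])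
    also have "\<dots> \<le> (\<Prod>s\<in>T - {t}. 8 * \<rho>)"
    proof (rule prod_mono, intro conjI norm_ge_zero)
      fix s assume s: "s \<in> T - {t}"
      have a: "norm (t - s) \<ge> 1" using Tsep[of t s] s t by blast
      have "norm (z - s) \<le> 7 * \<rho> + \<rho>" using norm_triangle_ineq4[of z s] z Tbd[of s] s by simp
      then have "norm (z - s) / norm (t - s) \<le> (8 * \<rho>) / 1" using a \<rho> by (intro frac_le) auto
      then show "norm ((z - s) / (t - s)) \<le> 8 * \<rho>" by (simp add: norm_divide)
    qed
    also have "\<dots> = (8 * \<rho>) ^ card (T - {t})" by simp
    also have "\<dots> \<le> (8 * \<rho>) ^ card T" using \<rho> T by (intro power_increasing) (auto intro: card_mono)
    finally show ?thesis .
  qed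
  have Jb: "norm (J z) \<le> e" if z: "norm z \<le> 7 * \<rho>" for z
  proof -
    have "norm (J z) \<le> (\<Sum>t\<in>T. norm (F t * l t z))" unfolding J_def by (rule norm_sum)
    also have "\<dots> \<le> (\<Sum>t\<in>T. \<eta> * (8 * \<rho>) ^ card T)"
    proof (rule sum_mono)
      fix t assume t: "t \<in> T"
      have "0 \<le> \<eta>" using \<eta>[OF t] norm_ge_zero order_trans by blast
      then show "norm (F t * l t z) \<le> \<eta> * (8 * \<rho>) ^ card T"
        unfolding norm_mult by (intro mult_mono \<eta>[OF t] lb[OF t z]) auto
    qed
    also have "\<dots> = e" by (simp add: e_def)
    finally show ?thesis .
  qed
  have Jt: "J t = F t" if t: "t \<in> T" for t
  proof -
    have "J t = F t * l t t + (\<Sum>s\<in>T - {t}. F s * l s t)" unfolding J_def by (rule sum.remove[OF T t])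
    moreover have "l t t = 1" unfolding l_def by (rule prod.neutral) auto
    moreover have "(\<Sum>s\<in>T - {t}. F s * l s t) = 0"
    proof (rule sum.neutral, rule ballI)
      fix s assume s: "s \<in> T - {t}"
      have "l s t = 0" unfolding l_def using s t T by (intro prod_zero) auto
      then show "F s * l s t = 0" by simp
    qed
    ultimately show ?thesis by simp
  qed
  have Jh: "J holomorphic_on UNIV" unfolding J_def l_def
    by (intro holomorphic_intros) auto
  define G where "G z = F z - J z" for z
  have Gh: "G holomorphic_on UNIV" unfolding G_def by (intro holomorphic_intros F Jh)
  have "G t = 0" if "t \<in> T" for t unfolding G_def using Jt[OF that] by simp
  then obtain h where h: "h holomorphic_on UNIV" "\<And>z. G z = (\<Prod>t\<in>T. z - t) * h z"
    using holomorphic_divide_zeros[OF T Gh] by blast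
  have hb: "norm (h z) \<le> (M + e) / (6 * \<rho>) ^ card T" if z: "norm z = 7 * \<rho>" for z
  proof -
    have "(6 * \<rho>) ^ card T = (\<Prod>t\<in>T. 6 * \<rho>)" by simp
    also have "\<dots> \<le> (\<Prod>t\<in>T. norm (z - t))"
    proof (rule prod_mono, intro conjI)
      fix t assume t: "t \<in> T"
      show "0 \<le> 6 * \<rho>" using \<rho> by simp
      show "6 * \<rho> \<le> norm (z - t)" using norm_triangle_ineq2[of z t] z Tbd[OF t] by simp
    qed
    also have "\<dots> = norm (\<Prod>t\<in>T. z - t)" by (rule prod_norm)
    finally have a: "(6 * \<rho>) ^ card T \<le> norm (\<Prod>t\<in>T. z - t)" .
    have "norm (\<Prod>t\<in>T. z - t) * norm (h z) = norm (G z)" unfolding h(2) norm_mult ..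
    also have "\<dots> \<le> M + e" unfolding G_def using norm_triangle_ineq4[of "F z" "J z"] M[OF z] Jb[of z] z by simp
    finally have b: "norm (\<Prod>t\<in>T. z - t) * norm (h z) \<le> M + e" .
    have "(6 * \<rho>) ^ card T * norm (h z) \<le> M + e" using mult_right_mono[OF a norm_ge_zero[of "h z"]] b by linarith
    then show ?thesis using \<rho> by (simp add: pos_le_divide_eq mult.commute)
  qed
  have hx: "norm (h x) \<le> (M + e) / (6 * \<rho>) ^ card T"
  proof (rule maximum_modulus_frontier[of h "cball 0 (7 * \<rho>)"])
    show "h holomorphic_on interior (cball 0 (7 * \<rho>))" using holomorphic_on_subset[OF h(1)] by blast
    show "continuous_on (closure (cball 0 (7 * \<rho>))) h"
      using holomorphic_on_imp_continuous_on[OF h(1)] continuous_on_subset by blast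
    show "bounded (cball 0 (7 * \<rho>))" by simp
    show "x \<in> cball 0 (7 * \<rho>)" using x \<rho> by simp
    fix z assume "z \<in> frontier (cball (0::complex) (7 * \<rho>))"
    then have "norm z = 7 * \<rho>" using \<rho> by (simp add: frontier_cball)
    then show "norm (h z) \<le> (M + e) / (6 * \<rho>) ^ card T" by (rule hb)
  qed
  have "norm (\<Prod>t\<in>T. x - t) = (\<Prod>t\<in>T. norm (x - t))" by (rule prod_norm[symmetric])
  also have "\<dots> \<le> (\<Prod>t\<in>T. \<rho>)" by (rule prod_mono) (use x in auto)
  finally have px: "norm (\<Prod>t\<in>T. x - t) \<le> \<rho> ^ card T" by simp
  have "norm (G x) = norm (\<Prod>t\<in>T. x - t) * norm (h x)" unfolding h(2) norm_mult ..
  also have "\<dots> \<le> \<rho> ^ card T * ((M + e) / (6 * \<rho>) ^ card T)" by (rule mult_mono[OF px hx]) (use \<rho> in auto)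
  also have "\<dots> = (M + e) / 6 ^ card T" using \<rho> by (simp add: power_mult_distrib)
  finally have Gx: "norm (G x) \<le> M / 6 ^ card T + e / 6 ^ card T" by (simp add: add_divide_distrib)
  have e0: "0 \<le> e" using Jb[of x] x \<rho> norm_ge_zero[of "J x"] by linarith
  have "e / 6 ^ card T \<le> e / 1" by (rule divide_left_mono) (use e0 in auto)
  moreover have "norm (F x) \<le> norm (G x) + norm (J x)" unfolding G_def using norm_triangle_ineq[of "F x - J x" "J x"] by simp
  ultimately show ?thesis using Gx Jb[of x] x \<rho> unfolding e_def[symmetric] by linarith
qed

subsection \<open>Pigeonhole\<close>

text \<open>Two coefficient vectors with entries from 0 to \<open>H\<close> whose values fall into
  the same cells of a grid of mesh \<open>\<delta>\<close> are subtracted. Real and imaginary parts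
  account for the \<open>2 * card J\<close> coordinates and for the final factor 2.\<close>

lemma pigeonhole_small_combination:
  fixes c :: "'i \<Rightarrow> 'j \<Rightarrow> complex" and H :: nat and W \<delta> :: real
  assumes I: "finite I" and J: "finite J" and W: "\<And>i j. i \<in> I \<Longrightarrow> j \<in> J \<Longrightarrow> norm (c i j) \<le> W" "W > 0"
    and \<delta>: "\<delta> > 0"
    and big: "(2 * (card I * H * W) / \<delta> + 2) ^ (2 * card J) < real (H + 1) ^ card I"
  shows "\<exists>p :: 'i \<Rightarrow> int. (\<exists>i\<in>I. p i \<noteq> 0) \<and> (\<forall>i\<in>I. \<bar>p i\<bar> \<le> int H) \<and>
     (\<forall>j\<in>J. norm (\<Sum>i\<in>I. of_int (p i) * c i j) \<le> 2 * \<delta>)"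
proof -
  define P where "P = (I \<rightarrow>\<^sub>E {0..int H})"
  define val where "val p j = (\<Sum>i\<in>I. of_int (p i) * c i j)" for p :: "'i \<Rightarrow> int" and j
  define N where "N = card I * H * W / \<delta>"
  define cell where "cell p = (\<lambda>jb\<in>J \<times> UNIV. \<lfloor>(if snd jb then Re (val p (fst jb)) else Im (val p (fst jb))) / \<delta>\<rfloor>)" for p
  define Q where "Q = ((J \<times> (UNIV :: bool set)) \<rightarrow>\<^sub>E {\<lfloor>- N\<rfloor>..\<lfloor>N\<rfloor>})"
  have N0: "N \<ge> 0" using W \<delta> by (simp add: N_def)
  have vb: "norm (val p j) \<le> N * \<delta>" if p: "p \<in> P" and j: "j \<in> J" for p j
  proof -
    have "norm (val p j) \<le> (\<Sum>i\<in>I. norm (of_int (p i) * c i j))" unfolding val_def by (rule norm_sum)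
    also have "\<dots> \<le> (\<Sum>i\<in>I. real H * W)"
    proof (rule sum_mono)
      fix i assume i: "i \<in> I"
      have "p i \<in> {0..int H}" using p i unfolding P_def by (auto simp: PiE_def Pi_def)
      then have "norm (of_int (p i) :: complex) \<le> real H" by (simp add: abs_of_nonneg)
      then show "norm (of_int (p i) * c i j) \<le> real H * W" unfolding norm_mult using W(1)[OF i j] by (intro mult_mono) auto
    qed
    also have "\<dots> = N * \<delta>" using \<delta> by (simp add: N_def)
    finally show ?thesis .
  qed
  have "cell ` P \<subseteq> Q"
  proof (rule image_subsetI)
    fix p assume p: "p \<in> P"
    have "\<lfloor>(if b then Re (val p j) else Im (val p j)) / \<delta>\<rfloor> \<in> {\<lfloor>- N\<rfloor>..\<lfloor>N\<rfloor>}" if j: "j \<in> J" for j b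
    proof -
      define y where "y = (if b then Re (val p j) else Im (val p j))"
      have "\<bar>y\<bar> \<le> N * \<delta>" using vb[OF p j] abs_Re_le_cmod[of "val p j"] abs_Im_le_cmod[of "val p j"] unfolding y_def by (cases b) auto
      then have "y / \<delta> \<le> N" "- N \<le> y / \<delta>" using \<delta> by (auto simp: divide_le_eq le_divide_eq)
      then show ?thesis unfolding y_def[symmetric] using floor_mono by auto
    qed
    then show "cell p \<in> Q" unfolding cell_def Q_def by (auto simp: PiE_def Pi_def)
  qed
  moreover have finQ: "finite Q" unfolding Q_def using J by (intro finite_PiE) auto
  ultimately have "card (cell ` P) \<le> card Q" by (rule card_mono[rotated])
  have cQ: "real (card Q) \<le> (2 * N + 2) ^ (2 * card J)"
  proof -
    have "card Q = card {\<lfloor>- N\<rfloor>..\<lfloor>N\<rfloor>} ^ (2 * card J)" unfolding Q_def using J by (simp add: card_PiE card_cartesian_product mult.commute)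
    moreover have "real (card {\<lfloor>- N\<rfloor>..\<lfloor>N\<rfloor>}) \<le> 2 * N + 2"
    proof -
      have "real_of_int (\<lfloor>N\<rfloor> - \<lfloor>- N\<rfloor> + 1) \<le> 2 * N + 2" using floor_correct[of N] floor_correct[of "- N"] by linarith
      moreover have "0 \<le> \<lfloor>N\<rfloor> - \<lfloor>- N\<rfloor> + 1" using N0 floor_mono[of "- N" N] by linarith
      ultimately show ?thesis by (simp add: of_nat_nat)
    qed
    ultimately show ?thesis by (simp add: power_mono)
  qed
  have cP: "card P = (H + 1) ^ card I" unfolding P_def using I by (simp add: card_PiE nat_add_distrib)
  have "real (card Q) < real (card P)" using cQ big cP by (simp add: N_def algebra_simps)
  then have "card (cell ` P) < card P" using \<open>card (cell ` P) \<le> card Q\<close> by simp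
  then have "\<not> inj_on cell P" using card_image[of cell P] by linarith
  then obtain p p' where pp: "p \<in> P" "p' \<in> P" "p \<noteq> p'" "cell p = cell p'" unfolding inj_on_def by blast
  define d where "d i = p i - p' i" for i
  have "\<exists>i\<in>I. d i \<noteq> 0"
  proof (rule ccontr)
    assume "\<not> ?thesis"
    then have "p i = p' i" if "i \<in> I" for i using that by (simp add: d_def)
    then have "p = p'" using pp(1,2) unfolding P_def by (intro PiE_ext[of p I _ p']) auto
    then show False using pp(3) by simp
  qed
  moreover have "\<bar>d i\<bar> \<le> int H" if i: "i \<in> I" for i
  proof -
    have "p i \<in> {0..int H}" "p' i \<in> {0..int H}" using pp(1,2) i unfolding P_def by (auto simp: PiE_def Pi_def)
    then show ?thesis by (auto simp: d_def)
  qed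
  moreover have "norm (\<Sum>i\<in>I. of_int (d i) * c i j) \<le> 2 * \<delta>" if j: "j \<in> J" for j
  proof -
    have e: "(\<Sum>i\<in>I. of_int (d i) * c i j) = val p j - val p' j"
      unfolding val_def d_def by (simp add: sum_subtractf algebra_simps)
    have c: "\<lfloor>Re (val p j) / \<delta>\<rfloor> = \<lfloor>Re (val p' j) / \<delta>\<rfloor>" "\<lfloor>Im (val p j) / \<delta>\<rfloor> = \<lfloor>Im (val p' j) / \<delta>\<rfloor>"
      using fun_cong[OF pp(4), of "(j, True)"] fun_cong[OF pp(4), of "(j, False)"] j unfolding cell_def by auto
    have d1: "\<bar>a - b\<bar> \<le> \<delta>" if "\<lfloor>a / \<delta>\<rfloor> = \<lfloor>b / \<delta>\<rfloor>" for a b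
    proof -
      have "\<bar>a / \<delta> - b / \<delta>\<bar> \<le> 1" using that floor_correct[of "a / \<delta>"] floor_correct[of "b / \<delta>"] by linarith
      then have "\<bar>(a - b) / \<delta>\<bar> \<le> 1" by (simp add: diff_divide_distrib)
      then show ?thesis using \<delta> by (simp add: abs_divide divide_le_eq)
    qed
    have "norm (val p j - val p' j) \<le> \<bar>Re (val p j - val p' j)\<bar> + \<bar>Im (val p j - val p' j)\<bar>" by (rule cmod_le)
    also have "\<dots> \<le> \<delta> + \<delta>" using d1[OF c(1)] d1[OF c(2)] by simp
    finally show ?thesis unfolding e by simp
  qed
  ultimately show ?thesis by blast
qed

section \<open>Conjugates of roots of unity and their power sums\<close>

lemma cheb2_over: "cheb m - [:2:] \<in> polys_over \<rat>"
  using Rats.PKdiff[OF Rats.PKint Rats.PKpCons[OF _ Rats.PK0], of 2] by simp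

text \<open>The trace \<open>z + inverse z\<close> equals 2 only at \<open>z = 1\<close>. Hence
  \<open>cheb m - [:2:]\<close> plays for traces the role that \<open>z ^ m - 1\<close> plays for
  roots of unity.\<close>

lemma cheb2_iff: assumes "z \<noteq> 0" shows "poly (cheb m - [:2:]) (z + inverse z) = 0 \<longleftrightarrow> z ^ m = 1"
proof -
  have "poly (cheb m - [:2:]) (z + inverse z) = z ^ m + inverse (z ^ m) - 2"
    using cheb_plus_inverse[OF assms, of m] by (simp add: power_inverse)
  then show ?thesis using plus_inverse_eq_2[of "z ^ m"] assms by auto
qed

lemma norm_root_of_unity: assumes "(r::complex) ^ n = 1" "n > 0" shows "norm r = 1" "r \<noteq> 0" "cnj r = inverse r" "algebraic r"
proof -
  have "norm r ^ n = 1 ^ n" using assms(1) by (metis norm_power norm_one power_one)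
  then show n: "norm r = 1" using power_eq_imp_eq_base[of "norm r" n 1] assms(2) by simp
  then show "r \<noteq> 0" by auto
  have "r * cnj r = 1" using n by (simp add: complex_norm_square[symmetric])
  then show "cnj r = inverse r" by (metis inverse_unique)
  have "monom 1 n - 1 \<in> polys_over \<rat>" by (intro Rats.PK) simp
  moreover have "poly (monom 1 n - 1) r = 0" using assms by (simp add: poly_monom)
  moreover have "monom 1 n - 1 \<noteq> (0 :: complex poly)"
  proof
    assume "monom 1 n - 1 = (0 :: complex poly)"
    then have "poly (monom 1 n - 1) (0::complex) = 0" by simp
    then show False using assms(2) by (simp add: poly_monom power_0_left)
  qed
  ultimately show "algebraic r" using alg_root by blast
qed

text \<open>Over each root \<open>y\<close> of \<open>g\<close> lie exactly two points
  \<open>r\<close> and \<open>inverse r\<close>, distinct since \<open>y\<close> is neither 2 nor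
  -2. Such a pair contributes \<open>(r - \<gamma>) (inverse r - \<gamma>) = \<gamma> (\<gamma> +
  inverse \<gamma> - y)\<close>, which turns the product over \<open>R\<close> into a value of
  \<open>g\<close>.\<close>

lemma trace_roots:
  fixes g :: "complex poly"
  assumes lead: "lead_coeff g = 1" and simple: "\<And>r. poly g r = 0 \<Longrightarrow> poly (pderiv g) r \<noteq> 0"
    and ch: "\<And>y. poly g y = 0 \<Longrightarrow> poly (cheb n - [:2:]) y = 0" and n: "n > 0"
    and g2: "poly g 2 \<noteq> 0" "poly g (-2) \<noteq> 0"
  defines "R \<equiv> {r. r \<noteq> 0 \<and> poly g (r + inverse r) = 0}"
  shows "finite R" "R \<subseteq> {r. r ^ n = 1}" "card R = 2 * degree g"
    "\<gamma> \<noteq> 0 \<Longrightarrow> (\<Prod>r\<in>R. r - \<gamma>) = \<gamma> ^ degree g * poly g (\<gamma> + inverse \<gamma>)"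
proof -
  define Y where "Y = {y. poly g y = 0}"
  note sp = simple_roots_product[OF lead simple]
  show R1: "R \<subseteq> {r. r ^ n = 1}"
  proof
    fix r assume "r \<in> R"
    then show "r \<in> {r. r ^ n = 1}" using cheb2_iff[of r n] ch[of "r + inverse r"] unfolding R_def by simp
  qed
  have "finite {r::complex. r ^ n = 1}" using n by (intro finite_roots_unity) simp
  then show finR: "finite R" using R1 finite_subset by blast
  have finY: "finite Y" unfolding Y_def by (rule sp(3))
  have img: "(\<lambda>r. r + inverse r) ` R \<subseteq> Y" unfolding R_def Y_def by auto
  have fib: "\<exists>r. r \<noteq> 0 \<and> r \<noteq> inverse r \<and> y = r + inverse r \<and> {x. x \<in> R \<and> x + inverse x = y} = {r, inverse r}" if y: "y \<in> Y" for y
  proof -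
    obtain r where r: "r \<noteq> 0" "y = r + inverse r" using exists_plus_inverse by blast
    have "r \<noteq> inverse r"
    proof
      assume e: "r = inverse r"
      then have "r * r = 1" using r(1) by (metis right_inverse)
      then have "r = 1 \<or> r = -1" by (simp add: square_eq_1_iff)
      then have "y = 2 \<or> y = -2" using r(2) by auto
      then show False using g2 y unfolding Y_def by auto
    qed
    moreover have "{x. x \<in> R \<and> x + inverse x = y} = {r, inverse r}"
    proof (intro equalityI subsetI)
      fix x assume "x \<in> {x. x \<in> R \<and> x + inverse x = y}"
      then have "x \<noteq> 0" "x + inverse x = r + inverse r" unfolding R_def r(2) by auto
      then show "x \<in> {r, inverse r}" using plus_inverse_eq_iff[of x r] r(1) by simp
    next
      fix x assume "x \<in> {r, inverse r}"
      then have "x \<noteq> 0" "x + inverse x = y" using r by (auto simp: add.commute)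
      then show "x \<in> {x. x \<in> R \<and> x + inverse x = y}" using y unfolding R_def Y_def by simp
    qed
    ultimately show ?thesis using r by blast
  qed
  have "card R = (\<Sum>y\<in>Y. (\<Sum>x\<in>{x. x \<in> R \<and> x + inverse x = y}. 1))"
    using sum.group[OF finR finY img, of "\<lambda>_. 1::nat"] by simp
  also have "\<dots> = (\<Sum>y\<in>Y. 2)"
  proof (rule sum.cong[OF refl])
    fix y assume "y \<in> Y"
    then obtain r where "r \<noteq> inverse r" "{x. x \<in> R \<and> x + inverse x = y} = {r, inverse r}" using fib by blast
    then show "(\<Sum>x\<in>{x. x \<in> R \<and> x + inverse x = y}. 1) = (2::nat)" by simp
  qed
  also have "\<dots> = 2 * degree g" using sp(2) unfolding Y_def by simp
  finally show "card R = 2 * degree g" .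
  assume g0: "\<gamma> \<noteq> 0"
  have "(\<Prod>r\<in>R. r - \<gamma>) = (\<Prod>y\<in>Y. (\<Prod>x\<in>{x. x \<in> R \<and> x + inverse x = y}. x - \<gamma>))"
    using prod.group[OF finR finY img, of "\<lambda>r. r - \<gamma>"] by simp
  also have "\<dots> = (\<Prod>y\<in>Y. \<gamma> * ((\<gamma> + inverse \<gamma>) - y))"
  proof (rule prod.cong[OF refl])
    fix y assume "y \<in> Y"
    then obtain r where r: "r \<noteq> 0" "r \<noteq> inverse r" "y = r + inverse r" "{x. x \<in> R \<and> x + inverse x = y} = {r, inverse r}" using fib by blast
    have "(\<Prod>x\<in>{x. x \<in> R \<and> x + inverse x = y}. x - \<gamma>) = (r - \<gamma>) * (inverse r - \<gamma>)" unfolding r(4) using r(2) by simp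
    also have "\<dots> = r * inverse r + \<gamma> * \<gamma> - \<gamma> * (r + inverse r)" by (simp add: algebra_simps)
    also have "\<dots> = \<gamma> * inverse \<gamma> + \<gamma> * \<gamma> - \<gamma> * y" using r(1,3) g0 by simp
    also have "\<dots> = \<gamma> * ((\<gamma> + inverse \<gamma>) - y)" by (simp add: algebra_simps)
    finally show "(\<Prod>x\<in>{x. x \<in> R \<and> x + inverse x = y}. x - \<gamma>) = \<gamma> * ((\<gamma> + inverse \<gamma>) - y)" .
  qed
  also have "\<dots> = \<gamma> ^ card Y * (\<Prod>y\<in>Y. (\<gamma> + inverse \<gamma>) - y)" by (simp add: prod.distrib)
  also have "card Y = degree g" unfolding Y_def by (rule sp(2))
  also have "(\<Prod>y\<in>Y. (\<gamma> + inverse \<gamma>) - y) = poly g (\<gamma> + inverse \<gamma>)" unfolding Y_def by (rule sp(4)[symmetric])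
  finally show "(\<Prod>r\<in>R. r - \<gamma>) = \<gamma> ^ degree g * poly g (\<gamma> + inverse \<gamma>)" .
qed

lemma geometric_unity:
  assumes "(u::complex) ^ n = 1" shows "(\<Sum>c<n. u ^ c) = (if u = 1 then of_nat n else 0)"
  using assms by (cases "u = 1") (simp_all add: geometric_sum)

text \<open>Expanding the squares and summing the geometric series over \<open>c\<close> leaves
  \<open>n\<close> for each pair with \<open>r ^ j = s ^ j\<close> and 0 for the others; for given
  \<open>r\<close> there are at most \<open>j\<close> such \<open>s\<close>, being roots of a
  polynomial of degree \<open>j\<close>.\<close>

lemma parseval_unity:
  fixes R :: "complex set"
  assumes R: "finite R" "R \<subseteq> {r. r ^ n = 1}" and n: "n > 0" and j: "j > 0"
  shows "(\<Sum>c<n. (norm (\<Sum>r\<in>R. (r ^ j) ^ c))\<^sup>2) \<le> real n * (real (card R) * real j)"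
proof -
  have cn: "cnj s = inverse s" "s \<noteq> 0" "s ^ n = 1" if "s \<in> R" for s using R(2) that norm_root_of_unity[of s n] n by auto
  have "complex_of_real (\<Sum>c<n. (norm (\<Sum>r\<in>R. (r ^ j) ^ c))\<^sup>2) = (\<Sum>c<n. (\<Sum>r\<in>R. (r ^ j) ^ c) * cnj (\<Sum>s\<in>R. (s ^ j) ^ c))"
    unfolding of_real_sum by (rule sum.cong[OF refl], rule complex_norm_square)
  also have "\<dots> = (\<Sum>c<n. \<Sum>r\<in>R. \<Sum>s\<in>R. ((r ^ j) * inverse (s ^ j)) ^ c)"
  proof (rule sum.cong[OF refl])
    fix c
    have "cnj (\<Sum>s\<in>R. (s ^ j) ^ c) = (\<Sum>s\<in>R. inverse (s ^ j) ^ c)"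
      unfolding cnj_sum by (rule sum.cong[OF refl]) (simp add: cn power_inverse)
    then show "(\<Sum>r\<in>R. (r ^ j) ^ c) * cnj (\<Sum>s\<in>R. (s ^ j) ^ c) = (\<Sum>r\<in>R. \<Sum>s\<in>R. ((r ^ j) * inverse (s ^ j)) ^ c)"
      by (simp only: sum_product power_mult_distrib)
  qed
  also have "\<dots> = (\<Sum>r\<in>R. \<Sum>s\<in>R. \<Sum>c<n. ((r ^ j) * inverse (s ^ j)) ^ c)"
    by (subst sum.swap, rule sum.cong[OF refl], rule sum.swap)
  also have "\<dots> = (\<Sum>r\<in>R. \<Sum>s\<in>R. if r ^ j = s ^ j then of_nat n else 0)"
  proof (intro sum.cong refl)
    fix r s assume rs: "r \<in> R" "s \<in> R"
    have "(r ^ j * inverse (s ^ j)) ^ n = (r ^ n) ^ j * inverse ((s ^ n) ^ j)"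
      by (simp add: power_mult_distrib power_inverse power_mult[symmetric] mult.commute)
    then have "(r ^ j * inverse (s ^ j)) ^ n = 1" using cn(3) rs by simp
    moreover have "r ^ j * inverse (s ^ j) = 1 \<longleftrightarrow> r ^ j = s ^ j" using cn(2)[OF rs(2)] by (simp add: divide_inverse[symmetric])
    ultimately show "(\<Sum>c<n. ((r ^ j) * inverse (s ^ j)) ^ c) = (if r ^ j = s ^ j then of_nat n else 0)"
      using geometric_unity by simp
  qed
  also have "\<dots> = complex_of_real (\<Sum>r\<in>R. \<Sum>s\<in>R. if r ^ j = s ^ j then real n else 0)"
    unfolding of_real_sum by (intro sum.cong refl) simp
  finally have e: "(\<Sum>c<n. (norm (\<Sum>r\<in>R. (r ^ j) ^ c))\<^sup>2) = (\<Sum>r\<in>R. \<Sum>s\<in>R. if r ^ j = s ^ j then real n else 0)"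
    unfolding of_real_eq_iff .
  have "(\<Sum>s\<in>R. if r ^ j = s ^ j then real n else 0) \<le> real j * real n" if r: "r \<in> R" for r
  proof -
    have sub: "{s\<in>R. r ^ j = s ^ j} \<subseteq> {s. poly (monom 1 j - [:r ^ j:]) s = 0}" by (auto simp: poly_monom)
    have nz: "monom 1 j - [:r ^ j:] \<noteq> 0"
    proof
      assume "monom 1 j - [:r ^ j:] = 0"
      then have "coeff (monom 1 j - [:r ^ j:]) j = 0" by simp
      then show False using j by (simp add: coeff_pCons split: nat.splits)
    qed
    have "degree (monom 1 j - [:r ^ j:]) \<le> j" by (intro degree_diff_le) (auto simp: degree_monom_le)
    then have c: "card {s\<in>R. r ^ j = s ^ j} \<le> j"
      using card_mono[OF poly_roots_finite[OF nz] sub] card_poly_roots_bound[OF nz] by linarith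
    have "(\<Sum>s\<in>R. if r ^ j = s ^ j then real n else 0) = (\<Sum>s\<in>{s\<in>R. r ^ j = s ^ j}. real n)"
      using sum.inter_filter[OF R(1), of "\<lambda>_. real n" "\<lambda>s. r ^ j = s ^ j"] by simp
    also have "\<dots> \<le> real j * real n" using c by (simp add: mult_right_mono)
    finally show ?thesis .
  qed
  then have "(\<Sum>r\<in>R. \<Sum>s\<in>R. if r ^ j = s ^ j then real n else 0) \<le> (\<Sum>r\<in>R. real j * real n)" by (rule sum_mono)
  then show ?thesis unfolding e by (simp add: algebra_simps)
qed

text \<open>For \<open>c\<close> in \<open>H\<close>, the permutation \<open>r\<close> to
  \<open>r ^ c\<close> of \<open>R\<close> shows that the \<open>c\<close>-th Parseval term is the
  square of the very sum in question. Keeping only these \<open>card R\<close> terms cancels the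
  factor \<open>card R\<close> on the other side.\<close>

lemma period_bound:
  fixes R :: "complex set"
  assumes R: "finite R" "R \<subseteq> {r. r ^ n = 1}" and n: "n > 0" and j: "j > 0"
    and H: "H \<subseteq> {..<n}" "card H = card R" "\<And>c. c \<in> H \<Longrightarrow> bij_betw (\<lambda>r. r ^ c) R R"
  shows "norm (\<Sum>r\<in>R. r ^ j) \<le> sqrt (real n * real j)"
proof (cases "R = {}")
  case False
  then have cR: "real (card R) > 0" using R(1) by (simp add: card_gt_0_iff)
  have finH: "finite H" using H(1) finite_subset by blast
  have eq: "(\<Sum>r\<in>R. (r ^ j) ^ c) = (\<Sum>r\<in>R. r ^ j)" if c: "c \<in> H" for c
  proof -
    have "(\<Sum>r\<in>R. (r ^ j) ^ c) = (\<Sum>r\<in>R. (r ^ c) ^ j)" by (simp add: power_mult[symmetric] mult.commute)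
    also have "\<dots> = (\<Sum>r\<in>R. r ^ j)" by (rule sum.reindex_bij_betw[OF H(3)[OF c]])
    finally show ?thesis .
  qed
  have "real (card R) * (norm (\<Sum>r\<in>R. r ^ j))\<^sup>2 = (\<Sum>c\<in>H. (norm (\<Sum>r\<in>R. (r ^ j) ^ c))\<^sup>2)" using eq H(2) by simp
  also have "\<dots> \<le> (\<Sum>c<n. (norm (\<Sum>r\<in>R. (r ^ j) ^ c))\<^sup>2)" using H(1) by (intro sum_mono2) auto
  also have "\<dots> \<le> real n * (real (card R) * real j)" by (rule parseval_unity[OF R n j])
  also have "\<dots> = real (card R) * (real n * real j)" by simp
  finally have "(norm (\<Sum>r\<in>R. r ^ j))\<^sup>2 \<le> real n * real j" using mult_le_cancel_left_pos[OF cR] by blast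
  then show ?thesis by (rule real_le_rsqrt)
qed simp

text \<open>The bound on \<open>n\<close> keeps the trace away from 2 and -2, where \<open>r\<close>
  and \<open>inverse r\<close> would coincide.\<close>

locale trace_conj = prim_field +
  fixes n :: nat and \<zeta> :: complex and f :: "complex poly"
  assumes prim: "primitive_root_of_unity n \<zeta>" and n3: "n \<ge> 3" and f: "min_poly (\<zeta> + inverse \<zeta>) f"
begin

definition Rt where "Rt t = {r. r \<noteq> 0 \<and> poly (memb t f) (r + inverse r) = 0}"

lemma z: "\<zeta> ^ n = 1" "n > 0" "\<zeta> \<noteq> 0"
  using prim n3 norm_root_of_unity(2)[of \<zeta> n] unfolding primitive_root_of_unity_def by auto

lemma fK: "f \<in> polys_over K" and fl: "lead_coeff f = 1" and fx: "poly f (\<zeta> + inverse \<zeta>) = 0" using min_polyD[OF f] by auto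

lemma emb_\<theta>: "k \<in> K \<Longrightarrow> emb \<theta> k = k" unfolding emb_def using rep(2) .
lemma memb_\<theta>: "g \<in> polys_over K \<Longrightarrow> memb \<theta> g = g"
  by (intro poly_eqI) (simp add: coeff_memb[OF \<theta>_in] emb_\<theta> polys_over_def)

lemma f_conj_unity: assumes "poly f (r + inverse r) = 0" "r \<noteq> 0" shows "r ^ m = 1 \<longleftrightarrow> \<zeta> ^ m = 1"
  using min_poly_conj[OF f assms(1) polys_over_Rats[OF cheb2_over[of m]]] cheb2_iff[OF assms(2), of m] cheb2_iff[OF z(3), of m] by simp

lemma memb_f_cheb: assumes t: "t \<in> \<Theta>" "poly (memb t f) y = 0" shows "poly (cheb n - [:2:]) y = 0"
proof -
  have c: "cheb n - [:2:] \<in> polys_over K" by (rule polys_over_Rats[OF cheb2_over])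
  have "poly (cheb n - [:2:]) (\<zeta> + inverse \<zeta>) = 0" using cheb2_iff[OF z(3), of n] z(1) by simp
  then obtain h where h: "h \<in> polys_over K" "cheb n - [:2:] = f * h" using min_polyD(6)[OF f c] by blast
  have "cheb n - [:2:] = memb t f * memb t h"
    using memb_mult[OF t(1) fK h(1)] memb_Rats[OF t(1) cheb2_over[of n]] h(2) by simp
  then show ?thesis using t(2) by simp
qed

text \<open>Separability is carried through the embedding as a Bezout identity between
  \<open>f\<close> and its derivative.\<close>

lemma memb_f_simple: assumes t: "t \<in> \<Theta>" "poly (memb t f) y = 0" shows "poly (pderiv (memb t f)) y \<noteq> 0"
proof -
  obtain u v where uv: "u \<in> polys_over K" "v \<in> polys_over K" "u * f + v * pderiv f = 1"
    using bezout_over[OF fK min_polyD(4)[OF f] PKpderiv[OF fK] min_poly_simple_root[OF f]] by blast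
  have "memb t (u * f + v * pderiv f) = memb t u * memb t f + memb t v * pderiv (memb t f)"
    using uv(1,2) fK by (simp add: memb_add[OF t(1)] memb_mult[OF t(1)] memb_pderiv[OF t(1)] PKmult PKpderiv)
  moreover have "memb t (1 :: complex poly) = 1" using memb_Rats[OF t(1) Rats.PK1] .
  ultimately have "poly (memb t u * memb t f + memb t v * pderiv (memb t f)) y = 1" using uv(3) by (metis poly_1)
  then show ?thesis using t(2) by auto
qed

lemma memb_f_2: assumes t: "t \<in> \<Theta>" and s: "s = 1 \<or> s = (-1::complex)" shows "poly (memb t f) (s * 2) \<noteq> 0"
proof -
  have s1: "s \<noteq> 0" "s * 2 = s + inverse s" "s ^ 2 = 1" using s by auto
  have sK: "s * 2 \<in> \<rat>" using s by auto
  have "poly f (s * 2) \<noteq> 0"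
  proof
    assume "poly f (s * 2) = 0"
    then have "\<zeta> ^ 2 = 1" using f_conj_unity[of s 2] s1 by simp
    then show False using prim n3 unfolding primitive_root_of_unity_def by auto
  qed
  then have "emb t (poly f (s * 2)) \<noteq> 0" using emb_nonzero[OF t PKpoly[OF fK KRats[OF sK]]] by blast
  then show ?thesis using memb_poly[OF t fK KRats[OF sK]] emb_Rats[OF t sK] by simp
qed

lemma Rt_props:
  assumes t: "t \<in> \<Theta>"
  shows "finite (Rt t)" "Rt t \<subseteq> {r. r ^ n = 1}" "card (Rt t) = 2 * degree f"
    "\<gamma> \<noteq> 0 \<Longrightarrow> (\<Prod>r\<in>Rt t. r - \<gamma>) = \<gamma> ^ degree f * poly (memb t f) (\<gamma> + inverse \<gamma>)"
proof -
  have "poly (memb t f) 2 \<noteq> 0" "poly (memb t f) (-2) \<noteq> 0" using memb_f_2[OF t, of 1] memb_f_2[OF t, of "-1"] by auto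
  note tr = trace_roots[OF memb_degree(2)[OF t fl] memb_f_simple[OF t] memb_f_cheb[OF t] z(2) this]
  show "finite (Rt t)" "Rt t \<subseteq> {r. r ^ n = 1}" "card (Rt t) = 2 * degree f"
    "\<gamma> \<noteq> 0 \<Longrightarrow> (\<Prod>r\<in>Rt t. r - \<gamma>) = \<gamma> ^ degree f * poly (memb t f) (\<gamma> + inverse \<gamma>)"
    using tr unfolding Rt_def memb_degree(1)[OF t fl] by blast+
qed

text \<open>A substitute for the Galois group: the exponents of \<open>\<zeta>\<close> occurring
  among the conjugates in the identity embedding. By \<open>H_action\<close> the same exponents act
  in every embedding.\<close>

definition H where "H = {c. c < n \<and> \<zeta> ^ c \<in> Rt \<theta>}"

lemma card_H: "card H = 2 * degree f"
proof -
  have "(\<lambda>c. \<zeta> ^ c) ` H = Rt \<theta>"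
  proof (intro equalityI subsetI)
    fix r assume r: "r \<in> Rt \<theta>"
    then have "r \<in> (\<lambda>c. \<zeta> ^ c) ` {..<n}" using Rt_props(2)[OF \<theta>_in] primitive_powers_all[OF prim] by blast
    then show "r \<in> (\<lambda>c. \<zeta> ^ c) ` H" using r unfolding H_def by auto
  qed (auto simp: H_def)
  moreover have "inj_on (\<lambda>c. \<zeta> ^ c) H" by (rule inj_on_subset[OF primitive_powers_inj[OF prim]]) (auto simp: H_def)
  ultimately show ?thesis using card_image Rt_props(3)[OF \<theta>_in] by metis
qed

text \<open>Since \<open>f\<close> vanishes at the trace of \<open>\<zeta> ^ c\<close>, it divides
  the composition of \<open>f\<close> with \<open>cheb c\<close>. This polynomial identity survives
  every embedding, so \<open>c\<close>-th powers preserve \<open>Rt t\<close>; injectivity comes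
  from \<open>c\<close> being prime to \<open>n\<close>.\<close>

lemma H_action:
  assumes t: "t \<in> \<Theta>" and c: "c \<in> H" shows "bij_betw (\<lambda>r. r ^ c) (Rt t) (Rt t)"
proof -
  have fc: "poly f (\<zeta> ^ c + inverse (\<zeta> ^ c)) = 0" and zc: "\<zeta> ^ c \<noteq> 0"
    using c z(3) unfolding H_def Rt_def by (auto simp: memb_\<theta>[OF fK])
  have chQ: "cheb c \<in> polys_over \<rat>" by (rule Rats.PKint)
  have "poly (pcompose f (cheb c)) (\<zeta> + inverse \<zeta>) = 0"
    using fc cheb_plus_inverse[OF z(3), of c] by (simp add: poly_pcompose power_inverse)
  then obtain h where h: "h \<in> polys_over K" "pcompose f (cheb c) = f * h"
    using min_polyD(6)[OF f PKpcompose[OF fK polys_over_Rats[OF chQ]]] by blast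
  have e: "pcompose (memb t f) (cheb c) = memb t f * memb t h"
    using memb_pcompose[OF t chQ fK] memb_mult[OF t fK h(1)] h(2) by simp
  have maps: "r ^ c \<in> Rt t" if r: "r \<in> Rt t" for r
  proof -
    have r0: "r \<noteq> 0" "poly (memb t f) (r + inverse r) = 0" using r unfolding Rt_def by auto
    have "poly (pcompose (memb t f) (cheb c)) (r + inverse r) = 0" unfolding e using r0(2) by simp
    then show ?thesis using r0(1) cheb_plus_inverse[OF r0(1), of c] unfolding Rt_def by (simp add: poly_pcompose power_inverse)
  qed
  \<comment> \<open>A conjugate of \<open>\<zeta>\<close> has the same order as
    \<open>\<zeta>\<close>, which a common divisor of \<open>c\<close> and \<open>n\<close> would
    lower.\<close>
  have cop: "coprime c n"
  proof -
    define d where "d = gcd c n"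
    obtain m where m: "n = d * m" unfolding d_def by (metis dvdE gcd_dvd2)
    obtain k where k: "c = d * k" unfolding d_def by (metis dvdE gcd_dvd1)
    have "(\<zeta> ^ c) ^ m = (\<zeta> ^ n) ^ k" unfolding m k by (simp add: power_mult[symmetric] mult_ac)
    then have "(\<zeta> ^ c) ^ m = 1" using z(1) by simp
    then have "\<zeta> ^ m = 1" using f_conj_unity[OF fc zc] by simp
    then have "n dvd m" by (rule primitive_dvd[OF prim])
    moreover have "m > 0" using m z(2) by (cases m) auto
    ultimately have "d * m \<le> m" using m dvd_imp_le by metis
    then have "d \<le> 1" using \<open>m > 0\<close> by simp
    moreover have "d > 0" using m z(2) by (cases d) auto
    ultimately have "d = 1" by simp
    then show ?thesis unfolding d_def coprime_iff_gcd_eq_1 .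
  qed
  have inj: "inj_on (\<lambda>r. r ^ c) (Rt t)"
  proof (rule inj_onI)
    fix r s assume rs: "r \<in> Rt t" "s \<in> Rt t" "r ^ c = s ^ c"
    have rn: "r ^ n = 1" "s ^ n = 1" "s \<noteq> 0" using rs Rt_props(2)[OF t] unfolding Rt_def by auto
    define u where "u = r / s"
    have u: "u ^ c = 1" "u ^ n = 1" using rs(3) rn unfolding u_def by (simp_all add: power_divide)
    obtain a b where ab: "c * a = n * b + 1"
    proof (cases "c = 0")
      case True
      then have "n = 1" using cop by simp
      then show ?thesis using n3 by simp
    next
      case False
      then show ?thesis using bezout_nat[of c n] cop that by auto
    qed
    have "u = u ^ (n * b + 1)" using u(2) by (simp add: power_add power_mult)
    also have "\<dots> = 1" using u(1) unfolding ab[symmetric] power_mult by simp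
    finally show "r = s" using rn(3) unfolding u_def by simp
  qed
  have "(\<lambda>r. r ^ c) ` Rt t = Rt t"
    by (rule card_subset_eq[OF Rt_props(1)[OF t]]) (use maps card_image[OF inj] in auto)
  then show ?thesis using inj unfolding bij_betw_def by blast
qed

lemma Rt_period: assumes t: "t \<in> \<Theta>" and j: "j > 0" shows "norm (\<Sum>r\<in>Rt t. r ^ j) \<le> sqrt (real n * real j)"
  by (rule period_bound[OF Rt_props(1,2)[OF t] z(2) j, of H])
     (use H_action[OF t] card_H Rt_props(3)[OF t] in \<open>auto simp: H_def\<close>)

end

subsection \<open>Irreducibility of cyclotomic traces\<close>

context padic begin

lemma w_poly_le: "(\<And>i. algebraic (coeff g i) \<and> w (coeff g i) \<le> 1) \<Longrightarrow> algebraic x \<Longrightarrow> w x \<le> 1 \<Longrightarrow> algebraic (poly g x) \<and> w (poly g x) \<le> 1"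
proof -
  assume g: "\<And>i. algebraic (coeff g i) \<and> w (coeff g i) \<le> 1" and x: "algebraic x" "w x \<le> 1"
  have t: "algebraic (coeff g i * x ^ i) \<and> w (coeff g i * x ^ i) \<le> 1" for i
  proof -
    have "w (coeff g i * x ^ i) = w (coeff g i) * w x ^ i" using g x by (simp add: w_mult w_pow alg_closed)
    also have "\<dots> \<le> 1" using g[of i] x w_nonneg by (intro mult_le_one power_le_one) auto
    finally show ?thesis using g x by (simp add: alg_closed)
  qed
  have "algebraic (\<Sum>i\<le>degree g. coeff g i * x ^ i)" by (rule alg_sum) (use t in blast)
  moreover have "w (\<Sum>i\<le>degree g. coeff g i * x ^ i) \<le> 1" by (rule w_sum_le) (use t in auto)
  ultimately show ?thesis unfolding poly_altdef by blast
qed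

text \<open>With \<open>u = s / r\<close>, the sum of \<open>1 - u ^ c\<close> over
  \<open>c < n\<close> equals \<open>n\<close>, a \<open>p\<close>-adic unit. Each summand is an
  integral multiple of \<open>1 - u\<close>, so \<open>1 - u\<close> cannot be small.\<close>

lemma w_diff_unity:
  assumes r: "r ^ n = 1" "s ^ n = 1" "r \<noteq> s" and n: "n > 0" "\<not> p dvd n" shows "w (r - s) = 1"
proof -
  have ra: "algebraic r" "algebraic s" "r \<noteq> 0" using norm_root_of_unity r n by auto
  define u where "u = s / r"
  have u: "u ^ n = 1" "u \<noteq> 1" "algebraic u" using r ra unfolding u_def by (auto simp: power_divide alg_closed)
  have wu: "w u = 1" "w r = 1" "w s = 1" using w_unity[OF u(1) n(1) u(3)] w_unity[OF r(1) n(1) ra(1)] w_unity[OF r(2) n(1) ra(2)] by auto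
  have rs: "r - s = r * (1 - u)" using ra(3) unfolding u_def by (simp add: algebra_simps)
  have a1: "algebraic (1 - u)" using u(3) by (simp add: alg_closed)
  have e: "w (r - s) = w (1 - u)" unfolding rs using w_mult[OF ra(1) a1] wu by simp
  have "w (1 - u) \<le> 1" using w_diff[of 1 u] u(3) wu w_1 by simp
  moreover have "\<not> w (1 - u) < 1"
  proof
    assume lt: "w (1 - u) < 1"
    have "w (1 - u ^ c) < 1" "algebraic (1 - u ^ c)" for c
    proof -
      have "algebraic (\<Sum>i<c. u ^ i)" by (rule alg_sum) (simp add: alg_closed u)
      moreover have "w (\<Sum>i<c. u ^ i) \<le> 1" by (rule w_sum_le) (simp_all add: alg_closed u w_pow wu)
      ultimately have "w (1 - u ^ c) \<le> w (1 - u) * 1" unfolding one_diff_power_eq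
        using w_mult[OF a1] mult_left_mono[of _ 1 "w (1 - u)"] w_nonneg[OF a1] by metis
      then show "w (1 - u ^ c) < 1" using lt by simp
      show "algebraic (1 - u ^ c)" using u(3) by (simp add: alg_closed)
    qed
    then have "w (\<Sum>c<n. 1 - u ^ c) < 1" by (intro w_sum_less) auto
    moreover have "(\<Sum>c<n. 1 - u ^ c) = of_nat n" using geometric_unity[OF u(1)] u(2) by (simp add: sum_subtractf)
    ultimately show False using w_not_dvd[OF n(2)] by simp
  qed
  ultimately show ?thesis using e by linarith
qed

lemma freshman:
  assumes a: "algebraic a" "w a \<le> 1" and b: "algebraic b" "w b \<le> 1" shows "w ((a + b) ^ p - (a ^ p + b ^ p)) < 1"
proof -
  define T where "T k = of_nat (p choose k) * a ^ k * b ^ (p - k)" for k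
  have p0: "p > 1" using prime_gt_1_nat[OF p] .
  have "(a + b) ^ p = (\<Sum>k\<le>p. T k)" unfolding T_def by (rule binomial_ring)
  also have "{..p} = insert 0 (insert p {1..<p})" using p0 by auto
  also have "sum T (insert 0 (insert p {1..<p})) = T 0 + (T p + sum T {1..<p})" using p0 by simp
  finally have e: "(a + b) ^ p - (a ^ p + b ^ p) = sum T {1..<p}" by (simp add: T_def)
  have "algebraic (T k) \<and> w (T k) < 1" if k: "k \<in> {1..<p}" for k
  proof -
    have "p dvd (p choose k)" by (rule dvd_choose_prime) (use k p in auto)
    then obtain m where m: "p choose k = p * m" by (auto elim: dvdE)
    have T: "T k = of_nat p * (of_nat m * a ^ k * b ^ (p - k))" unfolding T_def m by simp
    have al: "algebraic (of_nat m * a ^ k * b ^ (p - k))" using a b by (simp add: alg_closed)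
    have "w (of_nat m * a ^ k * b ^ (p - k)) = w (of_nat m) * w a ^ k * w b ^ (p - k)"
      using a b by (simp add: w_mult w_pow alg_closed)
    also have "\<dots> \<le> 1" using a b w_nat_le[of m] w_nonneg by (intro mult_le_one power_le_one mult_nonneg_nonneg zero_le_power) auto
    finally have le: "w (of_nat m * a ^ k * b ^ (p - k)) \<le> 1" .
    have "w (T k) = w (of_nat p) * w (of_nat m * a ^ k * b ^ (p - k))" unfolding T by (rule w_mult) (use al in auto)
    also have "\<dots> \<le> 1 / real p * 1" unfolding w_p by (rule mult_left_mono[OF le]) simp
    also have "\<dots> < 1" using p1 by simp
    finally have "w (T k) < 1" .
    moreover have "algebraic (T k)" unfolding T by (rule alg_closed(2)[OF _ al]) simp
    ultimately show ?thesis by blast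
  qed
  then show ?thesis unfolding e by (intro w_sum_less) auto
qed

text \<open>Congruence modulo the maximal ideal, expressed by \<open>w\<close> below 1: raising to
  the power \<open>p\<close> is additive by \<open>freshman\<close> and fixes rational coefficients
  by Fermat.\<close>

lemma poly_frobenius:
  assumes x: "algebraic x" "w x \<le> 1"
  shows "g \<in> polys_over \<rat> \<Longrightarrow> (\<And>i. w (coeff g i) \<le> 1) \<Longrightarrow> w (poly g x ^ p - poly g (x ^ p)) < 1"
proof (induct g)
  case 0 then show ?case using prime_gt_0_nat[OF p] by (simp add: w_0 power_0_left)
next
  case (pCons c g)
  have m: "c \<in> \<rat>" "g \<in> polys_over \<rat>" using Rats.PKpConsD pCons(3) by auto
  have wc: "w c \<le> 1" using pCons(4)[of 0] by simp
  have wg: "w (coeff g i) \<le> 1" for i using pCons(4)[of "Suc i"] by simp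
  have ca: "algebraic c" using alg_Rats[OF m(1)] .
  have ga: "algebraic (coeff g i) \<and> w (coeff g i) \<le> 1" for i using wg m(2) alg_Rats by (simp add: polys_over_def)
  define G where "G = poly g x"
  define G' where "G' = poly g (x ^ p)"
  have G: "algebraic G" "w G \<le> 1" using w_poly_le[OF ga x] unfolding G_def by auto
  have xp: "algebraic (x ^ p)" "w (x ^ p) \<le> 1" using x w_nonneg by (auto simp: alg_closed w_pow intro: power_le_one)
  have G': "algebraic G'" using w_poly_le[OF ga xp] unfolding G'_def by auto
  have xG: "algebraic (x * G)" "w (x * G) \<le> 1" using x G w_nonneg by (auto simp: alg_closed w_mult intro!: mult_le_one)
  have 1: "w ((c + x * G) ^ p - (c ^ p + (x * G) ^ p)) < 1" by (rule freshman[OF ca wc xG])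
  have 2: "w (c ^ p - c) < 1" by (rule w_Rats_integral[OF m(1) wc])
  have ih: "w (G ^ p - G') < 1" unfolding G_def G'_def by (rule pCons(2)[OF m(2) wg])
  have al: "algebraic (G ^ p - G')" using G G' by (simp add: alg_closed)
  have "w (x ^ p * (G ^ p - G')) = w (x ^ p) * w (G ^ p - G')" by (rule w_mult[OF xp(1) al])
  also have "\<dots> \<le> 1 * w (G ^ p - G')" by (rule mult_right_mono[OF xp(2) w_nonneg[OF al]])
  finally have 3: "w (x ^ p * (G ^ p - G')) < 1" using ih by simp
  have a1: "algebraic ((c + x * G) ^ p - (c ^ p + (x * G) ^ p))" "algebraic (c ^ p - c)" "algebraic (x ^ p * (G ^ p - G'))"
    using ca x(1) G(1) G' by (simp_all add: alg_closed)
  have "poly (pCons c g) x ^ p - poly (pCons c g) (x ^ p) =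
     ((c + x * G) ^ p - (c ^ p + (x * G) ^ p)) + ((c ^ p - c) + x ^ p * (G ^ p - G'))"
    by (simp add: G_def G'_def power_mult_distrib algebra_simps)
  moreover have "w ((c ^ p - c) + x ^ p * (G ^ p - G')) < 1" using w_add[OF a1(2,3)] 2 3 by linarith
  ultimately show ?case using w_add[OF a1(1) alg_closed(1)[OF a1(2,3)]] 1 by (simp only: max_def split: if_splits)
qed

lemma poly_cong_w:
  assumes x: "algebraic x" "w x \<le> 1" and y: "algebraic y" "w y \<le> 1" and xy: "w (x - y) < 1"
  shows "(\<And>i. algebraic (coeff g i) \<and> w (coeff g i) \<le> 1) \<Longrightarrow> w (poly g x - poly g y) < 1"
proof (induct g)
  case 0 then show ?case by (simp add: w_0)
next
  case (pCons c g)
  have ga: "algebraic (coeff g i) \<and> w (coeff g i) \<le> 1" for i using pCons(3)[of "Suc i"] by simp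
  have X: "algebraic (poly g x)" "w (poly g x) \<le> 1" using w_poly_le[OF ga x] by auto
  have Y: "algebraic (poly g y)" "w (poly g y) \<le> 1" using w_poly_le[OF ga y] by auto
  have d: "algebraic (poly g x - poly g y)" "algebraic (x - y)" using X Y x y by (simp_all add: alg_closed)
  have "w (x * (poly g x - poly g y)) \<le> 1 * w (poly g x - poly g y)"
    unfolding w_mult[OF x(1) d(1)] by (rule mult_right_mono[OF x(2) w_nonneg[OF d(1)]])
  then have 1: "w (x * (poly g x - poly g y)) < 1" using pCons(2)[OF ga] by simp
  have "w ((x - y) * poly g y) \<le> w (x - y) * 1"
    unfolding w_mult[OF d(2) Y(1)] by (rule mult_left_mono[OF Y(2) w_nonneg[OF d(2)]])
  then have 2: "w ((x - y) * poly g y) < 1" using xy by simp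
  have "poly (pCons c g) x - poly (pCons c g) y = x * (poly g x - poly g y) + (x - y) * poly g y" by (simp add: algebra_simps)
  then show ?case using w_add[of "x * (poly g x - poly g y)" "(x - y) * poly g y"] d X Y x y 1 2 by (simp add: alg_closed)
qed

lemma w_prod_linear_coeffs:
  assumes "finite Y" "\<And>y. y \<in> Y \<Longrightarrow> algebraic y \<and> w y \<le> 1"
  shows "algebraic (coeff (\<Prod>y\<in>Y. [:- y, 1:]) i) \<and> w (coeff (\<Prod>y\<in>Y. [:- y, 1:]) i) \<le> 1"
  using assms
proof (induct Y arbitrary: i rule: finite_induct)
  case empty then show ?case by (cases i) (auto simp: w_0 w_1)
next
  case (insert y Y)
  define g where "g = (\<Prod>y\<in>Y. [:- y, 1:])"
  have IH: "algebraic (coeff g i) \<and> w (coeff g i) \<le> 1" for i unfolding g_def using insert by blast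
  have y: "algebraic y" "w y \<le> 1" using insert(4)[of y] by auto
  define b where "b = (case i of 0 \<Rightarrow> 0 | Suc k \<Rightarrow> coeff g k)"
  have b: "algebraic b" "w b \<le> 1" unfolding b_def using IH by (auto simp: w_0 split: nat.splits)
  have c: "coeff (\<Prod>y\<in>insert y Y. [:- y, 1:]) i = - (y * coeff g i) + b"
    using insert(1,2) unfolding b_def by (simp add: g_def coeff_pCons split: nat.splits)
  have a1: "algebraic (- (y * coeff g i))" using y IH by (simp add: alg_closed)
  have "w (- (y * coeff g i)) = w y * w (coeff g i)" using y IH by (simp add: w_neg w_mult alg_closed)
  also have "\<dots> \<le> 1" using y IH w_nonneg by (intro mult_le_one) auto
  finally have "w (- (y * coeff g i) + b) \<le> 1" using w_add[OF a1 b(1)] b(2) by linarith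
  then show ?case unfolding c using a1 b(1) by (simp add: alg_closed)
qed

end

text \<open>The classical reduction argument for cyclotomic polynomials, carried over to traces.
  Modulo \<open>p\<close> the \<open>p\<close>-th power of the trace of \<open>z\<close> is the
  trace of \<open>A = z ^ p\<close>, so \<open>f\<close> is small there. If it did not vanish, it
  would be a product of factors \<open>(A - r) (A - inverse r) / A\<close> built from differences of
  distinct \<open>n\<close>-th roots of unity, all of absolute value 1.\<close>

lemma trace_conj_prime_step:
  assumes z: "primitive_root_of_unity n z" and p: "prime p" "\<not> p dvd n" and f: "Rats.min_poly (z + inverse z) f"
  shows "poly f (z ^ p + inverse (z ^ p)) = 0"
proof (rule ccontr)
  assume neg: "poly f (z ^ p + inverse (z ^ p)) \<noteq> 0"
  obtain w where "padic p w" using padic_exists[OF p(1)] by blast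
  then interpret padic p w .
  have zn: "n > 0" "z ^ n = 1" using z unfolding primitive_root_of_unity_def by auto
  have z0: "z \<noteq> 0" and za: "algebraic z" using norm_root_of_unity[OF zn(2,1)] by auto
  have wz: "w z = 1" by (rule w_unity[OF zn(2,1) za])
  note fD = Rats.min_polyD[OF f]
  define Y where "Y = {y. poly f y = 0}"
  note sp = simple_roots_product[OF fD(2) Rats.min_poly_simple_root[OF f]]
  have Y: "\<exists>r. r \<noteq> 0 \<and> r ^ n = 1 \<and> y = r + inverse r" if y: "y \<in> Y" for y
  proof -
    obtain r where r: "r \<noteq> 0" "y = r + inverse r" using exists_plus_inverse by blast
    have "poly (cheb n - [:2:]) (z + inverse z) = 0" using cheb2_iff[OF z0, of n] zn by simp
    then have "poly (cheb n - [:2:]) y = 0" using Rats.min_poly_conj[OF f _ cheb2_over] y unfolding Y_def by simp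
    then show ?thesis using r cheb2_iff[OF r(1), of n] by auto
  qed
  have unit: "algebraic (r + inverse r) \<and> w (r + inverse r) \<le> 1" if r: "r ^ n = 1" for r
  proof -
    have ra: "algebraic r" "algebraic (inverse r)" using norm_root_of_unity[OF r zn(1)] by (auto simp: alg_closed)
    then show ?thesis using w_add[OF ra] w_unity[OF r zn(1) ra(1)] w_inverse[OF ra(1)] by (simp add: alg_closed)
  qed
  have Yi: "algebraic y \<and> w y \<le> 1" if "y \<in> Y" for y using Y[OF that] unit by auto
  have fi: "algebraic (coeff f i) \<and> w (coeff f i) \<le> 1" for i
    using w_prod_linear_coeffs[of Y i] Yi sp(1,3) unfolding Y_def by simp
  define A where "A = z ^ p"
  have A: "A \<noteq> 0" "A ^ n = 1" "algebraic A" using z0 zn za unfolding A_def by (simp_all add: alg_closed power_mult[symmetric] mult.commute) (simp add: power_mult)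
  define x where "x = z + inverse z"
  have x: "algebraic x" "w x \<le> 1" using unit[OF zn(2)] unfolding x_def by auto
  have y: "algebraic (A + inverse A)" "w (A + inverse A) \<le> 1" using unit[OF A(2)] by auto
  have iz: "algebraic (inverse z)" "w (inverse z) \<le> 1" using za wz w_inverse[OF za] by (auto simp: alg_closed)
  have "w (x ^ p - (z ^ p + inverse z ^ p)) < 1" unfolding x_def by (rule freshman[OF za _ iz]) (simp add: wz)
  then have c1: "w (x ^ p - (A + inverse A)) < 1" unfolding A_def by (simp add: power_inverse)
  have xp: "algebraic (x ^ p)" "w (x ^ p) \<le> 1" using x w_nonneg by (auto simp: alg_closed w_pow intro: power_le_one)
  have "w (poly f (x ^ p) - poly f (A + inverse A)) < 1" by (rule poly_cong_w[OF xp y c1 fi])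
  moreover have "w (poly f x ^ p - poly f (x ^ p)) < 1" by (rule poly_frobenius[OF x fD(1)]) (use fi in blast)
  moreover have "poly f x ^ p = 0" using fD(3) prime_gt_0_nat[OF p(1)] by (simp add: x_def power_0_left)
  moreover have al: "algebraic (poly f (x ^ p))" "algebraic (poly f (A + inverse A))" using w_poly_le[OF fi] xp y by auto
  ultimately have small: "w (poly f (A + inverse A)) < 1"
  proof -
    assume a: "w (poly f (x ^ p) - poly f (A + inverse A)) < 1" and b: "w (poly f x ^ p - poly f (x ^ p)) < 1" and c: "poly f x ^ p = 0"
    have "w (poly f (x ^ p)) < 1" using b unfolding c using w_neg[OF al(1)] by simp
    moreover have "w (poly f (A + inverse A)) \<le> max (w (poly f (x ^ p))) (w (poly f (x ^ p) - poly f (A + inverse A)))"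
      using w_diff[OF al(1) alg_closed(5)[OF al]] by simp
    ultimately show ?thesis using a by linarith
  qed
  have "w (A + inverse A - y) = 1" if yY: "y \<in> Y" for y
  proof -
    obtain r where r: "r \<noteq> 0" "r ^ n = 1" "y = r + inverse r" using Y[OF yY] by blast
    have ra: "algebraic r" using norm_root_of_unity[OF r(2) zn(1)] by simp
    have ri: "inverse r ^ n = 1" "algebraic (inverse r)" using r(2) ra by (simp_all add: power_inverse alg_closed)
    have ne: "A \<noteq> r" "A \<noteq> inverse r" using neg yY r(1) unfolding A_def[symmetric] Y_def r(3) by (auto simp: add.commute)
    have "A * (A + inverse A - y) = A * A + A * inverse A - A * r - A * inverse r" unfolding r(3) by (simp add: algebra_simps)
    also have "\<dots> = A * A + r * inverse r - A * r - A * inverse r" using A(1) r(1) by simp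
    also have "\<dots> = (A - r) * (A - inverse r)" by (simp add: algebra_simps)
    finally have e: "A * (A + inverse A - y) = (A - r) * (A - inverse r)" .
    have ya: "algebraic (A + inverse A - y)" using y(1) Yi[OF yY] by (simp add: alg_closed)
    have "w A * w (A + inverse A - y) = w (A - r) * w (A - inverse r)"
      using w_mult[OF A(3) ya] w_mult[of "A - r" "A - inverse r"] A(3) ra ri(2) unfolding e by (simp add: alg_closed)
    then show ?thesis
      using w_unity[OF A(2) zn(1) A(3)] w_diff_unity[OF A(2) r(2) ne(1) zn(1) assms(3)] w_diff_unity[OF A(2) ri(1) ne(2) zn(1) assms(3)] by simp
  qed
  moreover have "w (poly f (A + inverse A)) = (\<Prod>y\<in>Y. w (A + inverse A - y))"
  proof -
    have "poly f (A + inverse A) = (\<Prod>y\<in>Y. A + inverse A - y)"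
      unfolding Y_def by (rule simple_roots_product(4)[OF fD(2) Rats.min_poly_simple_root[OF f]])
    moreover have "w (\<Prod>y\<in>Y. A + inverse A - y) = (\<Prod>y\<in>Y. w (A + inverse A - y))"
      by (rule w_prod) (use y(1) Yi in \<open>simp add: alg_closed\<close>)
    ultimately show ?thesis by simp
  qed
  ultimately show False using small by simp
qed

text \<open>\<open>z\<close> varies in the induction: once a prime \<open>p\<close> is split off
  from \<open>a\<close>, the number \<open>z ^ p\<close> is again primitive and \<open>f\<close> is
  also the minimal polynomial of its trace.\<close>

lemma trace_conj_all:
  assumes "0 < a" "coprime a n" "primitive_root_of_unity n z" "Rats.min_poly (z + inverse z) f"
  shows "poly f (z ^ a + inverse (z ^ a)) = 0"
  using assms
proof (induct a arbitrary: z rule: less_induct)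
  case (less a)
  show ?case
  proof (cases "a = 1")
    case True then show ?thesis using Rats.min_polyD(3)[OF less(5)] by simp
  next
    case False
    then obtain p where p: "prime p" "p dvd a" using prime_factor_nat by blast
    then obtain b where b: "a = p * b" by (auto elim: dvdE)
    have b0: "0 < b" "b < a" using less(2) b prime_gt_1_nat[OF p(1)] by auto
    have pn: "coprime p n" "coprime b n" using less(3) unfolding b by simp_all
    have npn: "\<not> p dvd n" using pn(1) p(1) by (metis coprime_absorb_left not_prime_unit)
    have zn: "n > 0" "z ^ n = 1" using less(4) unfolding primitive_root_of_unity_def by auto
    have step: "poly f (z ^ p + inverse (z ^ p)) = 0" by (rule trace_conj_prime_step[OF less(4) p(1) npn less(5)])
    have "primitive_root_of_unity n (z ^ p)"
      unfolding primitive_root_of_unity_def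
    proof (intro conjI allI impI notI)
      show "n > 0" by (rule zn(1))
      have "(z ^ p) ^ n = (z ^ n) ^ p" by (simp add: power_mult[symmetric] mult.commute)
      then show "(z ^ p) ^ n = 1" using zn by simp
      fix m assume m: "0 < m" "m < n" "(z ^ p) ^ m = 1"
      then have "n dvd p * m" using primitive_dvd[OF less(4), of "p * m"] by (simp add: power_mult)
      then have "n dvd m" using pn(1) by (metis coprime_commute coprime_dvd_mult_right_iff)
      then show False using m dvd_imp_le by fastforce
    qed
    from less(1)[OF b0(2,1) pn(2) this Rats.min_poly_root[OF less(5) step]]
    show ?thesis unfolding b by (simp add: power_mult)
  qed
qed

text \<open>The norm \<open>N\<close> of \<open>f\<close> is a rational polynomial of degree
  \<open>degree f * card \<Theta>\<close> that vanishes at the trace of \<open>\<zeta>\<close>,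
  hence at the traces of all \<open>\<zeta> ^ a\<close> with \<open>a\<close> prime to
  \<open>n\<close>. Each of its roots is the trace of at most two numbers.\<close>

lemma (in trace_conj) totient_le: "totient n \<le> 2 * (degree f * card \<Theta>)"
proof -
  define N where "N = (\<Prod>t\<in>\<Theta>. memb t f)"
  have NQ: "N \<in> polys_over \<rat>" unfolding N_def by (rule poly_norm_in_Rats[OF fK])
  have l1: "lead_coeff (memb t f) = 1" "degree (memb t f) = degree f" if "t \<in> \<Theta>" for t using memb_degree[OF that fl] by auto
  have nz: "memb t f \<noteq> 0" if "t \<in> \<Theta>" for t using l1(1)[OF that] by auto
  have N0: "N \<noteq> 0" unfolding N_def using finite_\<Theta> nz by (simp add: prod_zero_iff)
  have "degree N = (\<Sum>t\<in>\<Theta>. degree (memb t f))" unfolding N_def by (rule degree_prod_eq_sum_degree) (use nz in blast)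
  then have dN: "degree N = degree f * card \<Theta>" using l1(2) by simp
  have Nx: "poly N (\<zeta> + inverse \<zeta>) = 0"
    unfolding N_def poly_prod by (rule prod_zero[OF finite_\<Theta>], rule bexI[OF _ \<theta>_in]) (simp add: memb_\<theta>[OF fK] fx)
  obtain g where g: "Rats.min_poly (\<zeta> + inverse \<zeta>) g" using Rats.min_poly_exists[OF NQ N0 Nx] .
  then have gN: "g dvd N" using Rats.min_polyD(7)[OF g NQ Nx] by simp
  define Y where "Y = {y. poly N y = 0}"
  have Y: "finite Y" "card Y \<le> degree N" unfolding Y_def using poly_roots_finite[OF N0] card_poly_roots_bound[OF N0] by auto
  define D where "D = (\<Union>y\<in>Y. {r. r \<noteq> 0 \<and> r + inverse r = y})"
  have fib: "finite {r::complex. r \<noteq> 0 \<and> r + inverse r = y} \<and> card {r::complex. r \<noteq> 0 \<and> r + inverse r = y} \<le> 2" for y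
  proof -
    obtain r where r: "r \<noteq> 0" "y = r + inverse r" using exists_plus_inverse by blast
    have "{x. x \<noteq> 0 \<and> x + inverse x = y} \<subseteq> {r, inverse r}" using plus_inverse_eq_iff r by auto
    moreover have "card {r, inverse r} \<le> 2" by (simp add: card_insert_if)
    ultimately show ?thesis using finite_subset card_mono[of "{r, inverse r}"] by (meson finite.emptyI finite.insertI le_trans)
  qed
  have finD: "finite D" unfolding D_def using Y(1) fib by auto
  have "card D \<le> (\<Sum>y\<in>Y. card {r::complex. r \<noteq> 0 \<and> r + inverse r = y})" unfolding D_def by (rule card_UN_le[OF Y(1)])
  also have "\<dots> \<le> (\<Sum>y\<in>Y. 2)" by (rule sum_mono) (use fib in blast)
  also have "\<dots> \<le> 2 * (degree f * card \<Theta>)" using Y(2) dN by simp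
  finally have cD: "card D \<le> 2 * (degree f * card \<Theta>)" .
  have sub: "(\<lambda>a. \<zeta> ^ a) ` totatives n \<subseteq> D"
  proof (rule image_subsetI)
    fix a assume "a \<in> totatives n"
    then have a: "0 < a" "coprime a n" by (auto simp: totatives_def)
    have "poly g (\<zeta> ^ a + inverse (\<zeta> ^ a)) = 0" by (rule trace_conj_all[OF a prim g])
    then have "poly N (\<zeta> ^ a + inverse (\<zeta> ^ a)) = 0" using gN by (auto elim!: dvdE)
    then show "\<zeta> ^ a \<in> D" unfolding D_def Y_def using z(3) by auto
  qed
  have "inj_on (\<lambda>a. \<zeta> ^ a) (totatives n)"
  proof (rule inj_on_subset[OF primitive_powers_inj[OF prim]], rule subsetI)
    fix a assume "a \<in> totatives n"
    then show "a \<in> {..<n}" using totatives_less[of a n] n3 by simp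
  qed
  then have "totient n = card ((\<lambda>a. \<zeta> ^ a) ` totatives n)" by (simp add: card_image totient_def)
  also have "\<dots> \<le> card D" by (rule card_mono[OF finD sub])
  finally show ?thesis using cD by linarith
qed

text \<open>The largest element is at least \<open>card P + 1\<close>, and removing it gives the
  induction step; equality holds for consecutive integers starting at 2, where the product
  telescopes.\<close>

lemma prod_one_minus_inverse_ge:
  fixes P :: "nat set" assumes "finite P" "\<And>p. p \<in> P \<Longrightarrow> p \<ge> 2"
  shows "(\<Prod>p\<in>P. 1 - 1 / real p) \<ge> 1 / (real (card P) + 1)"
  using assms
proof (induct "card P" arbitrary: P)
  case 0 then show ?case by simp
next
  case (Suc k)
  define m where "m = Max P"
  have P: "P \<noteq> {}" using Suc(2) by auto
  have mP: "m \<in> P" unfolding m_def using Suc(3) P by simp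
  have "P \<subseteq> {2..m}" using Suc(3,4) unfolding m_def by (auto intro: Max_ge)
  then have "card P \<le> card {2..m}" by (intro card_mono) auto
  then have km: "Suc k + 1 \<le> m" using Suc(2) Suc(4)[OF mP] by simp
  have c: "k = card (P - {m})" using Suc(2,3) mP by simp
  have ih: "(\<Prod>p\<in>P - {m}. 1 - 1 / real p) \<ge> 1 / (real k + 1)" using Suc(1)[OF c] Suc(3,4) c by simp
  have "1 / (real (card P) + 1) = (1 - 1 / real (k + 2)) * (1 / (real k + 1))"
    using Suc(2)[symmetric] by (simp add: field_simps)
  also have "\<dots> \<le> (1 - 1 / real m) * (\<Prod>p\<in>P - {m}. 1 - 1 / real p)"
  proof (rule mult_mono[OF _ ih])
    show "1 - 1 / real (k + 2) \<le> 1 - 1 / real m" using km by (simp add: frac_le)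
    show "0 \<le> 1 - 1 / real m" using km by simp
  qed simp
  also have "\<dots> = (\<Prod>p\<in>P. 1 - 1 / real p)" using prod.remove[OF Suc(3) mP, of "\<lambda>p. 1 - 1 / real p"] by simp
  finally show ?case .
qed

text \<open>There are at most \<open>log 2 n\<close> distinct prime factors, because the product of
  that many twos is at most \<open>n\<close>; Euler's product over them is then bounded by
  \<open>prod_one_minus_inverse_ge\<close>.\<close>

lemma totient_lower: assumes "n > 0" shows "real n \<le> real (totient n) * (log 2 (real n) + 1)"
proof -
  define P where "P = prime_factors n"
  have P: "finite P" "\<And>p. p \<in> P \<Longrightarrow> p \<ge> 2" unfolding P_def using prime_ge_2_nat by auto
  have "(2::nat) ^ card P = (\<Prod>p\<in>P. 2)" by simp
  also have "\<dots> \<le> (\<Prod>p\<in>P. p ^ multiplicity p n)"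
  proof (rule prod_mono, intro conjI)
    fix p assume p: "p \<in> P"
    have "multiplicity p n > 0" using p unfolding P_def by (simp add: prime_factors_multiplicity)
    then have "p ^ 1 \<le> p ^ multiplicity p n" using P(2)[OF p] by (intro power_increasing) auto
    then show "2 \<le> p ^ multiplicity p n" using P(2)[OF p] by simp
  qed simp
  also have "\<dots> = n" unfolding P_def by (rule prime_factorization_nat[OF assms, symmetric])
  finally have "(2::real) ^ card P \<le> real n" by (metis of_nat_le_iff of_nat_numeral of_nat_power)
  then have "real (card P) \<le> log 2 (real n)" using assms by (simp add: le_log_iff powr_realpow)
  then have c: "real (card P) + 1 \<le> log 2 (real n) + 1" by simp
  have "real n * (1 / (real (card P) + 1)) \<le> real n * (\<Prod>p\<in>P. 1 - 1 / real p)"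
    by (rule mult_left_mono[OF prod_one_minus_inverse_ge[OF P]]) simp_all
  also have "\<dots> = real (totient n)" unfolding P_def by (rule totient_formula2[symmetric])
  finally have "real n \<le> real (totient n) * (real (card P) + 1)" by (simp add: field_simps)
  also have "\<dots> \<le> real (totient n) * (log 2 (real n) + 1)" by (rule mult_left_mono[OF c]) simp
  finally show ?thesis .
qed

subsection \<open>Logarithmic sums over roots of unity\<close>

text \<open>The power series of the logarithm brings in the power sums. Their growth
  \<open>sqrt (N * j)\<close> is compensated by the coefficient \<open>1 / j\<close>, which leaves a
  geometric series.\<close>

lemma sum_ln_bound:
  fixes R :: "complex set" and u :: complex and N :: real
  assumes R: "finite R" "\<And>r. r \<in> R \<Longrightarrow> norm r = 1"
    and per: "\<And>j. j > 0 \<Longrightarrow> norm (\<Sum>r\<in>R. r ^ j) \<le> sqrt (N * real j)" and N: "N \<ge> 0" and u: "norm u < 1"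
  shows "\<bar>\<Sum>r\<in>R. ln (norm (1 - r * u))\<bar> \<le> sqrt N / (1 - norm u)"
proof -
  have ser: "(\<lambda>j. - (r ^ j * u ^ j / of_nat j)) sums Ln (1 - r * u)" if r: "r \<in> R" for r
  proof -
    have "norm (- (r * u)) < 1" using u R(2)[OF r] by (simp add: norm_mult)
    from Ln_series[OF this] have s: "(\<lambda>j. (-1) ^ Suc j / of_nat j * (- (r * u)) ^ j) sums Ln (1 - r * u)" by simp
    have "(-1) ^ Suc j / of_nat j * (- (r * u)) ^ j = - (r ^ j * u ^ j / of_nat j)" for j
    proof -
      have "(-1::complex) ^ j * (-1) ^ j = 1" by (simp add: power_mult_distrib[symmetric])
      moreover have "(- (r * u)) ^ j = (-1) ^ j * (r ^ j * u ^ j)" by (metis power_minus power_mult_distrib)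
      ultimately have "(-1::complex) ^ j * (- (r * u)) ^ j = r ^ j * u ^ j" by (simp add: mult.assoc[symmetric])
      then show ?thesis by simp
    qed
    then show ?thesis using s by (simp only:)
  qed
  have S: "(\<lambda>j. \<Sum>r\<in>R. - (r ^ j * u ^ j / of_nat j)) sums (\<Sum>r\<in>R. Ln (1 - r * u))"
    by (rule sums_sum) (rule ser)
  have geo: "(\<lambda>j. sqrt N * norm u ^ j) sums (sqrt N * (1 / (1 - norm u)))"
    by (intro sums_mult geometric_sums) (use u in simp)
  have bd: "norm (\<Sum>r\<in>R. - (r ^ j * u ^ j / of_nat j)) \<le> sqrt N * norm u ^ j" for j
  proof (cases "j = 0")
    case False
    have e: "(\<Sum>r\<in>R. - (r ^ j * u ^ j / of_nat j)) = - ((\<Sum>r\<in>R. r ^ j) * (u ^ j / of_nat j))"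
      by (simp add: sum_negf sum_distrib_right sum_divide_distrib)
    have "norm (\<Sum>r\<in>R. - (r ^ j * u ^ j / of_nat j)) = norm (\<Sum>r\<in>R. r ^ j) * (norm u ^ j / real j)"
      unfolding e by (simp add: norm_mult norm_divide norm_power)
    also have "\<dots> \<le> sqrt (N * real j) * (norm u ^ j / real j)" by (rule mult_right_mono[OF per]) (use False in auto)
    also have "\<dots> = sqrt N * norm u ^ j * (sqrt (real j) / real j)" by (simp add: real_sqrt_mult)
    also have "\<dots> \<le> sqrt N * norm u ^ j * 1"
    proof (rule mult_left_mono)
      have "sqrt (real j) \<le> real j" using False by (intro real_le_lsqrt) (auto simp: power2_eq_square)
      then show "sqrt (real j) / real j \<le> 1" using False by simp
    qed (use N in simp)
    finally show ?thesis by simp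
  qed (use N in simp)
  have "norm (\<Sum>r\<in>R. Ln (1 - r * u)) \<le> sqrt N * (1 / (1 - norm u))"
  proof -
    have "norm (\<Sum>j. \<Sum>r\<in>R. - (r ^ j * u ^ j / of_nat j)) \<le> (\<Sum>j. sqrt N * norm u ^ j)"
      by (rule norm_suminf_le[OF bd sums_summable[OF geo]])
    then show ?thesis using sums_unique[OF S] sums_unique[OF geo] by simp
  qed
  moreover have "Re (\<Sum>r\<in>R. Ln (1 - r * u)) = (\<Sum>r\<in>R. ln (norm (1 - r * u)))"
    unfolding Re_sum
  proof (rule sum.cong[OF refl])
    fix r assume r: "r \<in> R"
    have "norm (r * u) < 1" using u R(2)[OF r] by (simp add: norm_mult)
    then have "1 - r * u \<noteq> 0" by auto
    then show "Re (Ln (1 - r * u)) = ln (norm (1 - r * u))" by (rule Re_Ln)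
  qed
  ultimately show ?thesis using abs_Re_le_cmod[of "\<Sum>r\<in>R. Ln (1 - r * u)"] by simp
qed

lemma sum_ln_outside:
  fixes R :: "complex set" and \<gamma> :: complex and N :: real
  assumes R: "finite R" "\<And>r. r \<in> R \<Longrightarrow> norm r = 1"
    and per: "\<And>j. j > 0 \<Longrightarrow> norm (\<Sum>r\<in>R. r ^ j) \<le> sqrt (N * real j)" and N: "N \<ge> 0" and g: "norm \<gamma> > 1"
  shows "(\<Sum>r\<in>R. ln (norm (r - \<gamma>))) \<ge> real (card R) * ln (norm \<gamma>) - sqrt N / (1 - 1 / norm \<gamma>)"
proof -
  define u where "u = inverse \<gamma>"
  have g0: "\<gamma> \<noteq> 0" using g by auto
  have nu: "norm u = 1 / norm \<gamma>" unfolding u_def norm_inverse by (rule inverse_eq_divide)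
  have u1: "norm u < 1" unfolding nu using g g0 by (simp add: divide_less_eq)
  have "ln (norm (r - \<gamma>)) = ln (norm \<gamma>) + ln (norm (1 - r * u))" if r: "r \<in> R" for r
  proof -
    have "norm (r * u) < 1" using u1 R(2)[OF r] by (simp add: norm_mult)
    then have "1 - r * u \<noteq> 0" by auto
    then have p: "norm (1 - r * u) > 0" by simp
    have "\<gamma> * (1 - r * u) = \<gamma> - r" using g0 unfolding u_def by (simp add: algebra_simps)
    then have "norm (r - \<gamma>) = norm \<gamma> * norm (1 - r * u)" by (metis norm_minus_commute norm_mult)
    then show ?thesis using p g0 by (simp add: ln_mult)
  qed
  then have "(\<Sum>r\<in>R. ln (norm (r - \<gamma>))) = real (card R) * ln (norm \<gamma>) + (\<Sum>r\<in>R. ln (norm (1 - r * u)))"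
    by (simp add: sum.distrib)
  then show ?thesis using sum_ln_bound[OF R per N u1] unfolding nu by linarith
qed

text \<open>The squares of the two sides differ by \<open>2 (1 - s)^2 (1 + Re u)\<close>, which is
  nonnegative. So moving \<open>u\<close> radially inward shrinks its distance to 1 by no more than
  the factor \<open>(1 + s) / 2\<close>.\<close>

lemma norm_one_minus_scaled:
  fixes u :: complex and s :: real
  assumes u: "norm u = 1" and s: "0 \<le> s"
  shows "norm (1 - u) * (1 + s) \<le> 2 * norm (1 - of_real s * u)"
proof -
  define x where "x = Re u" define y where "y = Im u"
  have xy: "x\<^sup>2 + y\<^sup>2 = 1" using u unfolding x_def y_def by (metis cmod_power2 one_power2)
  have x1: "x \<ge> -1" using abs_Re_le_cmod[of u] u unfolding x_def by simp
  have a: "(norm (1 - u))\<^sup>2 = 2 - 2 * x"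
  proof -
    have "(norm (1 - u))\<^sup>2 = (1 - x)\<^sup>2 + y\<^sup>2" unfolding cmod_power2 x_def y_def by simp
    also have "\<dots> = 1 - 2 * x + (x\<^sup>2 + y\<^sup>2)" by (simp add: power2_diff)
    finally show ?thesis using xy by simp
  qed
  have b: "(norm (1 - of_real s * u))\<^sup>2 = 1 - 2 * (s * x) + s\<^sup>2"
  proof -
    have "(norm (1 - of_real s * u))\<^sup>2 = (1 - s * x)\<^sup>2 + (s * y)\<^sup>2" unfolding cmod_power2 x_def y_def by simp
    also have "\<dots> = 1 - 2 * (s * x) + s\<^sup>2 * (x\<^sup>2 + y\<^sup>2)" by (simp add: power2_diff power_mult_distrib algebra_simps)
    finally show ?thesis using xy by simp
  qed
  have "(norm (1 - u) * (1 + s))\<^sup>2 = (2 - 2 * x) * (1 + s)\<^sup>2" unfolding power_mult_distrib a ..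
  also have "\<dots> = 4 * (1 - 2 * (s * x) + s\<^sup>2) - 2 * ((1 - s)\<^sup>2 * (1 + x))" by (simp add: power2_eq_square algebra_simps)
  also have "\<dots> \<le> 4 * (1 - 2 * (s * x) + s\<^sup>2)" using x1 by simp
  also have "\<dots> = (2 * norm (1 - of_real s * u))\<^sup>2" unfolding power_mult_distrib b by simp
  finally show ?thesis by (rule power2_le_imp_le) simp
qed

lemma prod_unity_roots:
  assumes n: "n > 0"
  shows "finite {r::complex. r ^ n = 1}" "(\<Prod>r\<in>{r::complex. r ^ n = 1}. \<gamma> - r) = \<gamma> ^ n - 1"
proof -
  define g :: "complex poly" where "g = monom 1 n - 1"
  have pg: "poly g x = x ^ n - 1" for x unfolding g_def by (simp add: poly_monom)
  have dg: "degree g = n"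
  proof -
    have "degree (monom (1::complex) n + (- 1)) = degree (monom (1::complex) n)"
      by (rule degree_add_eq_left) (use n in \<open>simp add: degree_monom_eq\<close>)
    then show ?thesis unfolding g_def by (simp add: degree_monom_eq)
  qed
  have lg: "lead_coeff g = 1" unfolding dg unfolding g_def using n by simp
  have simple: "poly (pderiv g) r \<noteq> 0" if r: "poly g r = 0" for r
  proof -
    have "r ^ n = 1" using r pg by simp
    then have "r \<noteq> 0" using n by (metis power_0_left zero_neq_one less_irrefl)
    then show ?thesis using n unfolding g_def by (simp add: pderiv_diff pderiv_monom poly_monom)
  qed
  have e: "{r::complex. r ^ n = 1} = {r. poly g r = 0}" unfolding pg by simp
  note sp = simple_roots_product[OF lg simple]
  show "finite {r::complex. r ^ n = 1}" unfolding e using sp by blast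
  show "(\<Prod>r\<in>{r::complex. r ^ n = 1}. \<gamma> - r) = \<gamma> ^ n - 1"
    unfolding e using sp(4)[of \<gamma>] pg[of \<gamma>] by simp
qed

text \<open>The sum over all \<open>n\<close>-th roots of unity vanishes unless \<open>n\<close>
  divides \<open>j\<close>, so the complement has the opposite power sum. If \<open>n\<close>
  divides \<open>j\<close>, then \<open>n <= j\<close> and the trivial bound \<open>n\<close> is at
  most \<open>sqrt (n j)\<close>.\<close>

lemma complement_period:
  assumes prim: "primitive_root_of_unity n \<zeta>" and n: "n > 0" and R: "R \<subseteq> {r::complex. r ^ n = 1}"
    and per: "\<And>j. j > 0 \<Longrightarrow> norm (\<Sum>r\<in>R. r ^ j) \<le> sqrt (real n * real j)" and j: "j > 0"
  shows "norm (\<Sum>r\<in>{r. r ^ n = 1} - R. r ^ j) \<le> sqrt (real n * real j)"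
proof -
  define U where "U = {r::complex. r ^ n = 1}"
  have U: "finite U" unfolding U_def by (rule prod_unity_roots(1)[OF n])
  have zn: "\<zeta> ^ n = 1" using prim unfolding primitive_root_of_unity_def by auto
  have Ui: "U = (\<lambda>c. \<zeta> ^ c) ` {..<n}"
  proof
    show "(\<lambda>c. \<zeta> ^ c) ` {..<n} \<subseteq> U"
    proof (rule image_subsetI)
      fix c
      have "(\<zeta> ^ c) ^ n = (\<zeta> ^ n) ^ c" by (simp add: power_mult[symmetric] mult.commute)
      then show "\<zeta> ^ c \<in> U" unfolding U_def using zn by simp
    qed
  qed (use primitive_powers_all[OF prim] in \<open>auto simp: U_def\<close>)
  have cU: "card U = n" unfolding Ui using card_image[OF primitive_powers_inj[OF prim]] by simp
  show ?thesis
  proof (cases "\<zeta> ^ j = 1")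
    case True
    have "r ^ j = 1" if "r \<in> U" for r
    proof -
      obtain c where "r = \<zeta> ^ c" using \<open>r \<in> U\<close> Ui by blast
      then have "r ^ j = (\<zeta> ^ j) ^ c" by (simp add: power_mult[symmetric] mult.commute)
      then show ?thesis using True by simp
    qed
    then have e: "(\<Sum>r\<in>U - R. r ^ j) = of_nat (card (U - R))" by simp
    have "card (U - R) \<le> n" using card_mono[of U "U - R"] U cU by auto
    moreover have "n \<le> j" using primitive_dvd[OF prim True] j dvd_imp_le by blast
    ultimately have "real (card (U - R)) \<le> sqrt (real n * real j)"
      by (intro real_le_rsqrt) (simp add: power2_eq_square, intro mult_mono, auto)
    then show ?thesis using e unfolding U_def by simp
  next
    case False
    have "(\<zeta> ^ j) ^ n = (\<zeta> ^ n) ^ j" by (simp add: power_mult[symmetric] mult.commute)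
    then have zj: "(\<zeta> ^ j) ^ n = 1" using zn by simp
    have "(\<Sum>r\<in>U. r ^ j) = (\<Sum>c<n. (\<zeta> ^ c) ^ j)" unfolding Ui by (simp add: sum.reindex[OF primitive_powers_inj[OF prim]])
    also have "\<dots> = (\<Sum>c<n. (\<zeta> ^ j) ^ c)" by (simp add: power_mult[symmetric] mult.commute)
    also have "\<dots> = 0" using geometric_unity[OF zj] False by simp
    finally have "(\<Sum>r\<in>U - R. r ^ j) = - (\<Sum>r\<in>R. r ^ j)"
      using sum.subset_diff[of R U "\<lambda>r. r ^ j"] U R unfolding U_def by (simp add: eq_neg_iff_add_eq_0)
    then show ?thesis using per[OF j] unfolding U_def by simp
  qed
qed

lemma sum_ln_circle:
  fixes \<gamma> :: complex
  assumes prim: "primitive_root_of_unity n \<zeta>" and n: "n > 0" and R: "R \<subseteq> {r::complex. r ^ n = 1}"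
    and per: "\<And>j. j > 0 \<Longrightarrow> norm (\<Sum>r\<in>R. r ^ j) \<le> sqrt (real n * real j)"
    and g: "norm \<gamma> = 1" "\<gamma> ^ n \<noteq> 1"
  shows "(\<Sum>r\<in>R. ln (norm (r - \<gamma>))) \<ge> ln (norm (\<gamma> ^ n - 1)) - 2 * real n powr (3/4)"
proof -
  define U where "U = {r::complex. r ^ n = 1}"
  define C where "C = U - R"
  have U: "finite U" unfolding U_def by (rule prod_unity_roots(1)[OF n])
  have fC: "finite C" unfolding C_def using U by simp
  have rU: "norm r = 1" if "r \<in> U" for r using norm_root_of_unity(1)[of r n] that n unfolding U_def by auto
  have gU: "r \<noteq> \<gamma>" if "r \<in> U" for r using g(2) that unfolding U_def by auto
  have "ln (norm (\<gamma> ^ n - 1)) = ln (\<Prod>r\<in>U. norm (\<gamma> - r))" unfolding U_def prod_unity_roots(2)[OF n, symmetric] prod_norm ..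
  also have "\<dots> = (\<Sum>r\<in>U. ln (norm (\<gamma> - r)))" by (rule ln_prod) (use gU U in auto)
  also have "\<dots> = (\<Sum>r\<in>U. ln (norm (r - \<gamma>)))" by (simp add: norm_minus_commute)
  also have "\<dots> = (\<Sum>r\<in>C. ln (norm (r - \<gamma>))) + (\<Sum>r\<in>R. ln (norm (r - \<gamma>)))"
    unfolding C_def by (rule sum.subset_diff) (use R U in \<open>auto simp: U_def\<close>)
  finally have tot: "ln (norm (\<gamma> ^ n - 1)) = (\<Sum>r\<in>C. ln (norm (r - \<gamma>))) + (\<Sum>r\<in>R. ln (norm (r - \<gamma>)))" .
  \<comment> \<open>The inner radius is \<open>1 - e\<close>. The shift costs at most
    \<open>e\<close> for each of at most \<open>n\<close> roots and the series costs
    \<open>sqrt n / e\<close>; this \<open>e\<close> makes both equal to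
    \<open>n powr (3/4)\<close>.\<close>
  define e where "e = real n powr (-1/4)"
  define s where "s = 1 - e"
  have e: "0 < e" "e \<le> 1" unfolding e_def using n powr_mono[of "-1/4" 0 "real n"] by auto
  have s: "0 \<le> s" "s < 1" unfolding s_def using e by auto
  define v where "v = cnj \<gamma>"
  have gv: "\<gamma> * v = 1" using complex_norm_square[of \<gamma>] g(1) unfolding v_def by simp
  have nv: "norm v = 1" unfolding v_def using g by simp
  define u where "u = of_real s * v"
  have nu: "norm u = s" unfolding u_def using nv s by (simp add: norm_mult)
  have bnd: "ln (norm (r - \<gamma>)) \<le> (1 - s) + ln (norm (1 - r * u))" if r: "r \<in> C" for r
  proof -
    have rU': "r \<in> U" using r C_def by auto
    have "\<gamma> * (1 - r * v) = \<gamma> - r" using gv by (simp add: algebra_simps)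
    then have "norm (\<gamma> - r) = norm \<gamma> * norm (1 - r * v)" by (metis norm_mult)
    then have e1: "norm (r - \<gamma>) = norm (1 - r * v)" using g(1) by (simp add: norm_minus_commute)
    have "norm (r * v) = 1" using rU[OF rU'] nv by (simp add: norm_mult)
    from norm_one_minus_scaled[OF this s(1)] have "norm (r - \<gamma>) * (1 + s) \<le> 2 * norm (1 - r * u)"
      unfolding e1 u_def by (simp add: mult_ac)
    then have le: "norm (r - \<gamma>) \<le> (2 / (1 + s)) * norm (1 - r * u)" using s by (simp add: field_simps)
    have p: "norm (r - \<gamma>) > 0" using gU[OF rU'] by simp
    have "norm (r * u) < 1" using nu s rU[OF rU'] by (simp add: norm_mult)
    then have "1 - r * u \<noteq> 0" by auto
    then have q: "norm (1 - r * u) > 0" by simp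
    have s2: "2 / (1 + s) > 0" using s by simp
    have "ln (norm (r - \<gamma>)) \<le> ln ((2 / (1 + s)) * norm (1 - r * u))" using le p q s by (subst ln_le_cancel_iff) auto
    also have "\<dots> = ln (2 / (1 + s)) + ln (norm (1 - r * u))" using q s2 by (intro ln_mult_pos) auto
    also have "ln (2 / (1 + s)) \<le> 2 / (1 + s) - 1" using s2 by (rule ln_le_minus_one)
    also have "2 / (1 + s) - 1 = (1 - s) / (1 + s)" using s by (simp add: field_simps)
    also have "\<dots> \<le> (1 - s) / 1" using s by (intro divide_left_mono) auto
    finally show ?thesis by simp
  qed
  have per': "norm (\<Sum>r\<in>C. r ^ j) \<le> sqrt (real n * real j)" if "j > 0" for j
    unfolding C_def U_def by (rule complement_period[OF prim n R per that])
  have "(\<Sum>r\<in>C. ln (norm (r - \<gamma>))) \<le> (\<Sum>r\<in>C. (1 - s) + ln (norm (1 - r * u)))" by (rule sum_mono[OF bnd])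
  also have "\<dots> = real (card C) * e + (\<Sum>r\<in>C. ln (norm (1 - r * u)))" by (simp add: sum.distrib s_def)
  also have "\<dots> \<le> real n * e + sqrt (real n) / e"
  proof (rule add_mono)
    have "card U \<le> n"
    proof -
      have "U = {x. poly (monom 1 n - 1) x = 0}" unfolding U_def by (simp add: poly_monom)
      moreover have nz: "monom 1 n - 1 \<noteq> (0::complex poly)"
      proof
        assume "monom 1 n - 1 = (0::complex poly)"
        then have "coeff (monom 1 n - 1 :: complex poly) n = 0" by simp
        then show False using n by simp
      qed
      moreover have "degree (monom 1 n - 1 :: complex poly) \<le> n" by (intro degree_diff_le) (auto simp: degree_monom_le)
      ultimately show ?thesis using card_poly_roots_bound[OF nz] by simp
    qed
    moreover have "card C \<le> card U" unfolding C_def by (rule card_mono[OF U]) auto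
    ultimately show "real (card C) * e \<le> real n * e" using e by (intro mult_right_mono) auto
    have "\<bar>\<Sum>r\<in>C. ln (norm (1 - r * u))\<bar> \<le> sqrt (real n) / (1 - norm u)"
      by (rule sum_ln_bound[OF fC _ per']) (use rU C_def nu s in auto)
    then show "(\<Sum>r\<in>C. ln (norm (1 - r * u))) \<le> sqrt (real n) / e" unfolding nu s_def by simp
  qed
  also have "real n * e = real n powr (3/4)"
  proof -
    have "real n powr (3/4) = real n powr (1 + -1/4)" by simp
    also have "\<dots> = real n powr 1 * e" unfolding e_def by (rule powr_add)
    finally show ?thesis using n by simp
  qed
  also have "sqrt (real n) / e = real n powr (3/4)"
  proof -
    have "real n powr (1/2 - (-1/4)) = real n powr (1/2) / e" unfolding e_def by (rule powr_diff)
    then show ?thesis using n by (simp add: powr_half_sqrt)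
  qed
  finally show ?thesis using tot by simp
qed

context trace_conj begin

lemma Rt_ln:
  assumes t: "t \<in> \<Theta>" and g: "\<gamma> \<noteq> 0" "poly (memb t f) (\<gamma> + inverse \<gamma>) \<noteq> 0"
  shows "(\<Sum>r\<in>Rt t. ln (norm (r - \<gamma>))) = real (degree f) * ln (norm \<gamma>) + ln (norm (poly (memb t f) (\<gamma> + inverse \<gamma>)))"
proof -
  have nz: "(\<Prod>r\<in>Rt t. r - \<gamma>) \<noteq> 0" unfolding Rt_props(4)[OF t g(1)] using g by simp
  have "(\<Sum>r\<in>Rt t. ln (norm (r - \<gamma>))) = ln (\<Prod>r\<in>Rt t. norm (r - \<gamma>))"
    by (rule ln_prod[symmetric]) (use nz Rt_props(1)[OF t] in auto)
  also have "\<dots> = ln (norm (\<gamma> ^ degree f * poly (memb t f) (\<gamma> + inverse \<gamma>)))" unfolding prod_norm Rt_props(4)[OF t g(1)] ..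
  also have "\<dots> = ln (norm \<gamma> ^ degree f) + ln (norm (poly (memb t f) (\<gamma> + inverse \<gamma>)))"
    unfolding norm_mult norm_power using g by (intro ln_mult_pos) auto
  also have "ln (norm \<gamma> ^ degree f) = real (degree f) * ln (norm \<gamma>)" using g(1) by (simp add: ln_realpow)
  finally show ?thesis .
qed

lemma Rt_norm: "t \<in> \<Theta> \<Longrightarrow> r \<in> Rt t \<Longrightarrow> norm r = 1"
  using Rt_props(2)[of t] norm_root_of_unity(1)[of r n] z(2) by auto

lemma ln_outside:
  assumes t: "t \<in> \<Theta>" and g: "norm \<gamma> > 1" "poly (memb t f) (\<gamma> + inverse \<gamma>) \<noteq> 0"
  shows "ln (norm (poly (memb t f) (\<gamma> + inverse \<gamma>))) \<ge> real (degree f) * ln (norm \<gamma>) - sqrt (real n) / (1 - 1 / norm \<gamma>)"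
proof -
  have g0: "\<gamma> \<noteq> 0" using g by auto
  have "(\<Sum>r\<in>Rt t. ln (norm (r - \<gamma>))) \<ge> real (card (Rt t)) * ln (norm \<gamma>) - sqrt (real n) / (1 - 1 / norm \<gamma>)"
    by (rule sum_ln_outside[OF Rt_props(1)[OF t] Rt_norm[OF t] Rt_period[OF t] _ g(1)]) auto
  then show ?thesis unfolding Rt_ln[OF t g0 g(2)] Rt_props(3)[OF t] by (simp add: algebra_simps)
qed

lemma ln_circle:
  assumes t: "t \<in> \<Theta>" and g: "norm \<gamma> = 1" "\<gamma> ^ n \<noteq> 1" "poly (memb t f) (\<gamma> + inverse \<gamma>) \<noteq> 0"
  shows "ln (norm (poly (memb t f) (\<gamma> + inverse \<gamma>))) \<ge> ln (norm (\<gamma> ^ n - 1)) - 2 * real n powr (3/4)"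
proof -
  have g0: "\<gamma> \<noteq> 0" using g by auto
  have "(\<Sum>r\<in>Rt t. ln (norm (r - \<gamma>))) \<ge> ln (norm (\<gamma> ^ n - 1)) - 2 * real n powr (3/4)"
    by (rule sum_ln_circle[OF prim z(2) Rt_props(2)[OF t] Rt_period[OF t] g(1,2)])
  then show ?thesis unfolding Rt_ln[OF t g0 g(3)] using g(1) by simp
qed

end

subsection \<open>Integrality and a Liouville inequality\<close>

text \<open>The leading coefficient times \<open>x\<close> is an algebraic integer: multiplied by
  the power \<open>N - 1\<close> of \<open>a\<close>, the equation becomes monic in
  \<open>y = a x\<close> with integer coefficients, and an absolute value above 1 would let
  \<open>y ^ N\<close> dominate all other terms.\<close>

lemma (in padic) w_integral_multiple:
  fixes P :: "int poly"
  assumes P: "P \<noteq> 0" "poly (map_poly of_int P) x = 0" and x: "algebraic x"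
  shows "w (of_int (lead_coeff P) * x) \<le> 1"
proof (rule ccontr)
  define a where "a = lead_coeff P"
  define N where "N = degree P"
  define y where "y = of_int a * x"
  assume "\<not> ?thesis"
  then have y1: "w y > 1" unfolding y_def a_def by simp
  have y: "algebraic y" unfolding y_def using x by (simp add: alg_closed)
  have a0: "a \<noteq> 0" unfolding a_def using P by simp
  have e: "(\<Sum>k\<le>N. of_int (coeff P k) * x ^ k) = 0"
    using P(2) unfolding poly_altdef N_def by (simp add: coeff_map_poly degree_map_poly)
  have N0: "N > 0"
  proof (rule ccontr)
    assume "\<not> N > 0"
    then have "(of_int a :: complex) = 0" using e unfolding a_def N_def by simp
    then show False using a0 by simp
  qed
  define T where "T k = of_int (coeff P k * a ^ (N - 1 - k)) * y ^ k" for k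
  have "of_int a ^ (N - 1) * (of_int (coeff P k) * x ^ k) = T k" if "k < N" for k
  proof -
    have "a ^ (N - 1) = a ^ (N - 1 - k) * a ^ k" using that by (simp add: power_add[symmetric])
    then have "(of_int a :: complex) ^ (N - 1) = of_int (a ^ (N - 1 - k)) * of_int a ^ k" by (metis of_int_mult of_int_power)
    then show ?thesis unfolding T_def y_def by (simp add: power_mult_distrib)
  qed
  then have s: "(\<Sum>k<N. of_int a ^ (N - 1) * (of_int (coeff P k) * x ^ k)) = (\<Sum>k<N. T k)" by (intro sum.cong) auto
  have "y ^ N = of_int a ^ (N - 1) * (of_int a * x ^ N)"
    using N0 unfolding y_def power_mult_distrib by (metis mult.assoc mult.commute power_minus_mult)
  moreover have "of_int a ^ (N - 1) * (\<Sum>k\<le>N. of_int (coeff P k) * x ^ k) = (\<Sum>k<N. T k) + of_int a ^ (N - 1) * (of_int a * x ^ N)"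
    unfolding lessThan_Suc_atMost[symmetric] sum.lessThan_Suc distrib_left sum_distrib_left s by (simp add: a_def N_def)
  ultimately have yN: "y ^ N = - (\<Sum>k<N. T k)" using e by (simp add: eq_neg_iff_add_eq_0 add.commute)
  have T: "algebraic (T k) \<and> w (T k) \<le> w y ^ (N - 1)" if "k \<in> {..<N}" for k
  proof
    show "algebraic (T k)" unfolding T_def using y by (simp add: alg_closed)
    have "w (T k) = w (of_int (coeff P k * a ^ (N - 1 - k))) * w y ^ k" unfolding T_def using y by (simp only: w_mult w_pow alg_closed alg_int)
    also have "\<dots> \<le> 1 * w y ^ k" using y1 by (intro mult_right_mono w_int_le) auto
    also have "\<dots> \<le> w y ^ (N - 1)" using that y1 by (simp add: power_increasing)
    finally show "w (T k) \<le> w y ^ (N - 1)" .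
  qed
  have "algebraic (\<Sum>k<N. T k)" by (rule alg_sum) (use T in blast)
  then have "w y ^ N = w (\<Sum>k<N. T k)" using w_neg w_pow[OF y, of N] unfolding yN by simp
  also have "\<dots> \<le> w y ^ (N - 1)" by (rule w_sum_le[OF T]) (use y1 in simp_all)
  finally show False using y1 N0 by (simp add: power_increasing_iff[of "w y" N "N - 1"])
qed

lemma (in padic) w_nat_less: assumes "p dvd n" "n > 0" shows "w (of_nat n) < 1"
proof -
  obtain m where m: "n = p * m" using assms(1) by blast
  have "w (of_nat n) = w (of_nat p) * w (of_nat m)" unfolding m of_nat_mult by (rule w_mult) simp_all
  also have "\<dots> \<le> w (of_nat p) * 1" using w_p w_nat_le by (intro mult_left_mono) auto
  also have "\<dots> < 1" using w_p p1 by simp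
  finally show ?thesis .
qed

lemma Rats_integral_Ints:
  fixes x :: complex
  assumes x: "x \<in> \<rat>" and int: "\<And>p w. padic p w \<Longrightarrow> w x \<le> 1" shows "x \<in> \<int>"
proof -
  obtain r where r: "x = of_rat r" using x by (auto elim: Rats_cases)
  obtain a b where ab: "quotient_of r = (a, b)" by fastforce
  have b0: "b > 0" and cop: "coprime a b" and rab: "r = of_int a / of_int b"
    using quotient_of_denom_pos[OF ab] quotient_of_coprime[OF ab] quotient_of_div[OF ab] by auto
  have "x = of_int a / of_int b" unfolding r rab by (simp add: of_rat_divide)
  then have xb: "x * of_int b = of_int a" using b0 by simp
  have "nat b = 1"
  proof (rule ccontr)
    assume "nat b \<noteq> 1"
    then obtain p where pp: "prime p" "p dvd nat b" using prime_factor_nat by blast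
    obtain w where "padic p w" using padic_exists[OF pp(1)] by blast
    then interpret padic p w .
    have wb: "w (of_int b) < 1" using w_nat_less[OF pp(2)] b0 by simp
    have "\<not> p dvd nat \<bar>a\<bar>"
    proof
      assume "p dvd nat \<bar>a\<bar>"
      then have "int p dvd a" "int p dvd b" using pp(2) b0 by (auto simp: int_dvd_int_iff[symmetric] simp del: int_dvd_int_iff)
      then have "int p dvd 1" using cop coprime_common_divisor by blast
      then show False using pp(1) by auto
    qed
    then have "w (of_int \<bar>a\<bar>) = 1" using w_not_dvd[of "nat \<bar>a\<bar>"] by simp
    then have wa: "w (of_int a) = 1" using w_neg[of "of_int a"] by (cases "a \<ge> 0") auto
    have "w (of_int a) = w x * w (of_int b)" unfolding xb[symmetric] by (rule w_mult) (use alg_Rats[OF x] in auto)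
    also have "\<dots> \<le> 1 * w (of_int b)" using int[OF \<open>padic p w\<close>] w_nonneg by (intro mult_right_mono) auto
    finally show False using wa wb by simp
  qed
  then have "b = 1" using b0 by linarith
  then show ?thesis using xb by auto
qed

text \<open>The absolute value of the leading coefficient of a single integer equation serves all
  conjugates and all primes at once.\<close>

lemma algebraic_denominator:
  assumes "algebraic x"
  obtains c :: nat where "c > 0" "\<And>y p w q. Rats.min_poly x q \<Longrightarrow> poly q y = 0 \<Longrightarrow> padic p w \<Longrightarrow> w (of_nat c * y) \<le> 1"
proof -
  obtain P where P: "P \<noteq> 0" "poly (map_poly of_int P) x = 0" using algebraicE'[OF assms] by blast
  define c where "c = nat \<bar>lead_coeff P\<bar>"
  have c0: "c > 0" unfolding c_def using P by simp
  have PQ: "map_poly of_int P \<in> polys_over \<rat>" by (simp add: polys_over_def coeff_map_poly)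
  have "w (of_nat c * y) \<le> 1" if q: "Rats.min_poly x q" "poly q y = 0" and pw: "padic p w" for y p w q
  proof -
    interpret padic p w by (rule pw)
    have y: "algebraic y" using alg_root[OF Rats.min_polyD(1,4)[OF q(1)] q(2)] .
    have "poly (map_poly of_int P) y = 0" using Rats.min_poly_conj[OF q(1,2) PQ] P(2) by simp
    from w_integral_multiple[OF P(1) this y] have le: "w (of_int (lead_coeff P) * y) \<le> 1" .
    have "of_nat c * y = of_int (lead_coeff P) * y \<or> of_nat c * y = - (of_int (lead_coeff P) * y)"
      unfolding c_def by (cases "lead_coeff P \<ge> 0") auto
    moreover have "algebraic (of_int (lead_coeff P) * y)" using y by (simp add: alg_closed)
    ultimately show ?thesis using le w_neg by metis
  qed
  then show thesis using that c0 by blast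
qed

text \<open>The norm of \<open>c ^ N\<close> times the given value is a nonzero rational that is
  integral at every prime, hence an integer of absolute value at least 1. Bounding the other
  conjugates by \<open>L * G ^ N\<close> leaves the lower bound; \<open>E = c * G\<close> combines
  denominator and size, and \<open>D\<close> is the degree of \<open>\<gamma>\<close>.\<close>

lemma liouville:
  fixes \<gamma> :: complex
  assumes g: "algebraic \<gamma>"
  obtains D :: nat and E :: real where "D \<ge> 1" "E \<ge> 1"
    "\<And>(u :: nat \<Rightarrow> int) N L. (\<Sum>i\<le>N. of_int (u i) * \<gamma> ^ i) \<noteq> 0 \<Longrightarrow> (\<Sum>i\<le>N. real_of_int \<bar>u i\<bar>) \<le> L \<Longrightarrow>
       1 \<le> (L * E ^ N) ^ D * norm (\<Sum>i\<le>N. of_int (u i) * \<gamma> ^ i)"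
proof -
  obtain P where P: "P \<in> polys_over \<rat>" "P \<noteq> 0" "poly P \<gamma> = 0" using g algebraic_polys_over by blast
  obtain q where q: "Rats.min_poly \<gamma> q" using Rats.min_poly_exists[OF P] by blast
  note qD = Rats.min_polyD[OF q]
  define Y where "Y = {y. poly q y = 0}"
  have Y: "finite Y" "\<gamma> \<in> Y" unfolding Y_def using poly_roots_finite[OF qD(4)] qD(3) by auto
  obtain c :: nat where c: "c > 0" "\<And>y p w q. Rats.min_poly \<gamma> q \<Longrightarrow> poly q y = 0 \<Longrightarrow> padic p w \<Longrightarrow> w (of_nat c * y) \<le> 1"
    using algebraic_denominator[OF g] by blast
  define G where "G = 1 + (\<Sum>y\<in>Y. norm y)"
  have G1: "G \<ge> 1" unfolding G_def by (simp add: sum_nonneg)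
  have Gy: "norm y \<le> G" if "y \<in> Y" for y unfolding G_def using member_le_sum[OF that, of norm] Y(1) by simp
  define D where "D = card Y"
  have D1: "D \<ge> 1" unfolding D_def using Y card_gt_0_iff[of Y] by auto
  define E where "E = real c * G"
  have E1: "E \<ge> 1" unfolding E_def using c(1) G1 mult_mono[of 1 "real c" 1 G] by simp
  have "1 \<le> (L * E ^ N) ^ D * norm (\<Sum>i\<le>N. of_int (u i) * \<gamma> ^ i)"
    if nz: "(\<Sum>i\<le>N. of_int (u i) * \<gamma> ^ i) \<noteq> 0" and L: "(\<Sum>i\<le>N. real_of_int \<bar>u i\<bar>) \<le> L" for u :: "nat \<Rightarrow> int" and N L
  proof -
    define Q where "Q y = (\<Sum>i\<le>N. of_int (u i) * y ^ i)" for y :: complex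
    define A where "A = (\<Sum>i\<le>N. monom (of_int (u i) :: complex) i)"
    have AQ: "A \<in> polys_over \<rat>" unfolding A_def polys_over_def by (auto simp: coeff_sum intro!: Rats.Ksum)
    have pA: "poly A y = Q y" for y unfolding A_def Q_def by (simp add: poly_sum poly_monom)
    have Qnz: "Q y \<noteq> 0" if y: "y \<in> Y" for y
    proof
      assume "Q y = 0"
      then have 0: "poly A y = 0" using pA by simp
      have "Rats.min_poly y q" by (rule Rats.min_poly_root[OF q]) (use y in \<open>simp add: Y_def\<close>)
      then have "poly A \<gamma> = 0" using Rats.min_poly_conj[of y q \<gamma> A] qD(3) AQ 0 by blast
      then show False using nz pA unfolding Q_def by simp
    qed
    define Z where "Z = (\<Prod>y\<in>Y. of_nat c ^ N * Q y)"
    have Ze: "Z = of_nat c ^ (N * D) * (\<Prod>y\<in>Y. Q y)" unfolding Z_def D_def by (simp add: prod.distrib power_mult)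
    have "(\<Prod>y\<in>Y. Q y) \<in> \<rat>" using norm_rational[OF q AQ] unfolding pA Y_def .
    then have ZQ: "Z \<in> \<rat>" unfolding Ze by (intro Rats_mult Rats_power) auto
    have "w Z \<le> 1" if pw: "padic p w" for p w
    proof -
      interpret padic p w by (rule pw)
      have "algebraic (of_nat c ^ N * Q y) \<and> w (of_nat c ^ N * Q y) \<le> 1" if y: "y \<in> Y" for y
      proof -
        have ya: "algebraic y" using alg_root[OF qD(1,4)] y unfolding Y_def by simp
        have cy: "algebraic (of_nat c * y)" "w (of_nat c * y) \<le> 1" using ya c(2)[OF q _ pw] y unfolding Y_def by (auto simp: alg_closed)
        have eq: "of_nat c ^ N * Q y = (\<Sum>i\<le>N. of_int (u i * int c ^ (N - i)) * (of_nat c * y) ^ i)"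
          unfolding Q_def sum_distrib_left
        proof (rule sum.cong[OF refl])
          fix i assume "i \<in> {..N}"
          then have "(of_nat c :: complex) ^ N = of_nat c ^ (N - i) * of_nat c ^ i" by (simp add: power_add[symmetric])
          then show "of_nat c ^ N * (of_int (u i) * y ^ i) = of_int (u i * int c ^ (N - i)) * (of_nat c * y) ^ i"
            by (simp add: power_mult_distrib)
        qed
        have t: "algebraic (of_int (u i * int c ^ (N - i)) * (of_nat c * y) ^ i) \<and> w (of_int (u i * int c ^ (N - i)) * (of_nat c * y) ^ i) \<le> 1" for i
        proof
          have pa: "algebraic ((of_nat c * y) ^ i)" using cy(1) by (rule alg_closed)
          show "algebraic (of_int (u i * int c ^ (N - i)) * (of_nat c * y) ^ i)" by (rule alg_closed(2)[OF alg_int pa])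
          have "w (of_int (u i * int c ^ (N - i)) * (of_nat c * y) ^ i) = w (of_int (u i * int c ^ (N - i))) * w (of_nat c * y) ^ i"
            unfolding w_mult[OF alg_int pa] w_pow[OF cy(1)] ..
          also have "\<dots> \<le> 1 * 1" by (intro mult_mono power_le_one w_int_le) (use cy w_nonneg in auto)
          finally show "w (of_int (u i * int c ^ (N - i)) * (of_nat c * y) ^ i) \<le> 1" by simp
        qed
        show ?thesis unfolding eq using t by (intro conjI alg_sum w_sum_le) auto
      qed
      then show ?thesis unfolding Z_def using w_prod[of Y "\<lambda>y. of_nat c ^ N * Q y"] w_nonneg by (auto intro!: prod_le_1)
    qed
    then have "Z \<in> \<int>" by (rule Rats_integral_Ints[OF ZQ])
    then obtain z where z: "Z = of_int z" by (auto elim: Ints_cases)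
    have "Z \<noteq> 0" unfolding Z_def using Y(1) Qnz c(1) by simp
    then have Z1: "norm Z \<ge> 1" unfolding z by (simp add: norm_of_int)
    have Qb: "norm (Q y) \<le> L * G ^ N" if y: "y \<in> Y" for y
    proof -
      have "norm (Q y) \<le> (\<Sum>i\<le>N. norm (of_int (u i) * y ^ i))" unfolding Q_def by (rule norm_sum)
      also have "\<dots> \<le> (\<Sum>i\<le>N. real_of_int \<bar>u i\<bar> * G ^ N)"
      proof (rule sum_mono)
        fix i assume i: "i \<in> {..N}"
        have "norm y ^ i \<le> G ^ i" by (rule power_mono[OF Gy[OF y]]) simp
        also have "\<dots> \<le> G ^ N" using i G1 by (intro power_increasing) auto
        finally show "norm (of_int (u i) * y ^ i) \<le> real_of_int \<bar>u i\<bar> * G ^ N"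
          by (simp add: norm_mult norm_power mult_left_mono)
      qed
      also have "\<dots> \<le> L * G ^ N" unfolding sum_distrib_right[symmetric] using L G1 by (intro mult_right_mono) auto
      finally show ?thesis .
    qed
    have L1: "L \<ge> 1"
    proof (rule ccontr)
      assume "\<not> L \<ge> 1"
      then have "(\<Sum>i\<le>N. real_of_int \<bar>u i\<bar>) < 1" using L by linarith
      then have "real_of_int (\<Sum>i\<le>N. \<bar>u i\<bar>) < 1" by simp
      then have "(\<Sum>i\<le>N. \<bar>u i\<bar>) < 1" by linarith
      moreover have "(\<Sum>i\<le>N. \<bar>u i\<bar>) \<ge> 0" by (rule sum_nonneg) simp
      ultimately have "(\<Sum>i\<le>N. \<bar>u i\<bar>) = 0" by linarith
      then have "u i = 0" if "i \<le> N" for i using that sum_nonneg_eq_0_iff[of "{..N}" "\<lambda>i. \<bar>u i\<bar>"] by auto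
      then have "(\<Sum>i\<le>N. of_int (u i) * \<gamma> ^ i) = 0" by (intro sum.neutral) auto
      then show False using nz by simp
    qed
    have "norm (\<Prod>y\<in>Y. Q y) = norm (Q \<gamma>) * (\<Prod>y\<in>Y - {\<gamma>}. norm (Q y))"
      unfolding prod_norm[symmetric] using prod.remove[OF Y, of "\<lambda>y. norm (Q y)"] by simp
    also have "\<dots> \<le> norm (Q \<gamma>) * (\<Prod>y\<in>Y - {\<gamma>}. L * G ^ N)" by (intro mult_left_mono prod_mono) (use Qb in auto)
    also have "\<dots> = norm (Q \<gamma>) * (L * G ^ N) ^ (D - 1)" using Y unfolding D_def by (simp add: card_Diff_singleton)
    also have "\<dots> \<le> norm (Q \<gamma>) * (L * G ^ N) ^ D"
    proof (rule mult_left_mono[OF power_increasing])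
      show "1 \<le> L * G ^ N" using mult_mono[of 1 L 1 "G ^ N"] L1 G1 by simp
    qed auto
    finally have "real c ^ (N * D) * norm (\<Prod>y\<in>Y. Q y) \<le> real c ^ (N * D) * (norm (Q \<gamma>) * (L * G ^ N) ^ D)"
      by (rule mult_left_mono) simp
    then have "norm Z \<le> real c ^ (N * D) * (norm (Q \<gamma>) * (L * G ^ N) ^ D)" unfolding Ze by (simp add: norm_mult norm_power)
    also have "\<dots> = (L * E ^ N) ^ D * norm (Q \<gamma>)" unfolding E_def by (simp add: power_mult_distrib power_mult[symmetric] mult_ac)
    finally show ?thesis using Z1 unfolding Q_def by simp
  qed
  then show thesis using that[OF D1 E1] by blast
qed

subsection \<open>An auxiliary function argument\<close>

lemma coefficients_zero:
  fixes c :: "nat \<Rightarrow> complex"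
  assumes Z: "finite Z" "card Z \<ge> N" "\<And>x. x \<in> Z \<Longrightarrow> (\<Sum>i<N. c i * x ^ i) = 0" and i: "i < N"
  shows "c i = 0"
proof (rule ccontr)
  assume ci: "c i \<noteq> 0"
  define f where "f = (\<Sum>i<N. monom (c i) i)"
  have cf: "coeff f j = (if j < N then c j else 0)" for j unfolding f_def by (simp add: coeff_sum)
  have f0: "f \<noteq> 0" using cf[of i] i ci by auto
  have "degree f \<le> N - 1" by (rule degree_le) (use cf in auto)
  moreover have "Z \<subseteq> {x. poly f x = 0}" using Z(3) unfolding f_def by (auto simp: poly_sum poly_monom)
  then have "card Z \<le> card {x. poly f x = 0}" by (rule card_mono[OF poly_roots_finite[OF f0]])
  moreover have "card {x. poly f x = 0} \<le> degree f" by (rule card_poly_roots_bound[OF f0])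
  ultimately show False using Z(2) i by linarith
qed

text \<open>In this locale \<open>\<gamma>\<close> is assumed to be exceptionally close to a primitive \<open>n\<close>-th root of unity \<open>\<omega>\<close>. The auxiliary
  function \<open>F(z) = \<Sum> P\<^sub>a\<^sub>b z\<^sup>a exp(2\<pi>ibz/n)\<close> takes at the integer \<open>r k + s n\<close> a value close to the same sum \<open>V\<close> with \<open>\<omega>\<close> replaced
  by \<open>\<gamma>\<close>, which by Liouville is zero or not too small.\<close>

locale schneider =
  fixes \<gamma> :: complex and A B R S0 n k T D H :: nat and E \<delta> \<Lambda> :: real
  assumes g: "norm \<gamma> = 1" "\<And>m. m > 0 \<Longrightarrow> \<gamma> ^ m \<noteq> 1"
    and liou: "\<And>(u :: nat \<Rightarrow> int) N L. (\<Sum>i\<le>N. of_int (u i) * \<gamma> ^ i) \<noteq> 0 \<Longrightarrow> (\<Sum>i\<le>N. real_of_int \<bar>u i\<bar>) \<le> L \<Longrightarrow>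
       1 \<le> (L * E ^ N) ^ D * norm (\<Sum>i\<le>N. of_int (u i) * \<gamma> ^ i)"
    and D: "D \<ge> 1" and E: "E \<ge> 1"
    and AB: "A * B = 4 * (D + 1) * (R * S0)" and B: "B \<ge> 1" "B \<le> R" "R \<le> n" and S0: "S0 \<ge> 1" and T: "n * (R + A) \<le> T"
    and k: "coprime k n" "k \<le> n"
    and \<Lambda>: "\<Lambda> = real (A * B) * real T ^ A * E ^ (R * B)" and H: "10 * \<Lambda> \<le> real H"
    and est1: "\<And>S. S0 \<le> S \<Longrightarrow> S < A \<Longrightarrow>
       3 * (\<Lambda> * H) ^ D * (real (A * B) * H * (7 * real T) ^ A * exp (14 * pi * real (R + S)) ^ B) < 6 ^ (R * S)"
    and est2: "3 * (\<Lambda> * H) ^ D * (3 * real (R * A) * (8 * real T) ^ (R * A) * (real (A * B) * H * real T ^ A * real (R * B) * \<delta>)) \<le> 1"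
    and \<delta>: "norm (exp (2 * of_real pi * \<i> / of_nat n * of_nat k) - \<gamma>) \<le> \<delta>"
begin

definition I where "I = {..<A} \<times> {..<B}"
definition pt :: "nat \<Rightarrow> nat \<Rightarrow> nat" where "pt r s = r * k + s * n"
definition V :: "(nat \<times> nat \<Rightarrow> int) \<Rightarrow> nat \<Rightarrow> nat \<Rightarrow> complex" where
  "V P r s = (\<Sum>ab\<in>I. of_int (P ab) * (of_nat (pt r s) ^ fst ab * (\<gamma> ^ r) ^ snd ab))"

lemma I: "finite I" "card I = A * B" by (simp_all add: I_def)

lemma A: "A \<ge> S0" "A \<ge> 1"
proof -
  have "B * S0 \<le> R * S0" using B by simp
  also have "\<dots> \<le> A * B" unfolding AB by simp
  finally show "A \<ge> S0" using B by (simp add: mult.commute)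
  then show "A \<ge> 1" using S0 by simp
qed

lemma n: "n \<ge> 1" "T \<ge> 1" "R \<ge> 1"
proof -
  show n: "n \<ge> 1" "R \<ge> 1" using B by auto
  have "1 * 1 \<le> n * (R + A)" using n by (intro mult_le_mono) auto
  then show "T \<ge> 1" using T by linarith
qed

lemma pt_le: "r < R \<Longrightarrow> s \<le> S \<Longrightarrow> pt r s \<le> n * (R + S)"
proof -
  assume rs: "r < R" "s \<le> S"
  have "r * k \<le> R * n" "s * n \<le> S * n" using rs k by (auto intro: mult_le_mono)
  then have "pt r s \<le> R * n + S * n" unfolding pt_def by linarith
  then show ?thesis by (simp add: algebra_simps)
qed

lemma pt_T: "r < R \<Longrightarrow> s \<le> A \<Longrightarrow> pt r s \<le> T" using pt_le[of r s A] T by linarith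

text \<open>\<open>k\<close> is prime to \<open>n\<close>, so \<open>r * k\<close> determines
  \<open>r\<close> modulo \<open>n\<close>, and \<open>R <= n\<close>.\<close>

lemma pt_inj: assumes "r < R" "r' < R" "pt r s = pt r' s'" shows "r = r' \<and> s = s'"
proof -
  have *: "r = r'" if "r < R" "r' < R" "r \<le> r'" "pt r s = pt r' s'" for r r' s s'
  proof -
    have "r * k + s * n = r * k + (r' - r) * k + s' * n" using that unfolding pt_def by (simp add: algebra_simps)
    then have e: "s * n = (r' - r) * k + s' * n" by simp
    have "n dvd (r' - r) * k" using e by (metis dvd_add_left_iff dvd_triv_right)
    then have "n dvd r' - r" using k(1) by (simp add: coprime_commute coprime_dvd_mult_left_iff)
    moreover have "r' - r < n" using that B by linarith
    ultimately show ?thesis using that nat_dvd_not_less[of "r' - r" n] by linarith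
  qed
  have r: "r = r'" using *[of r r' s s'] *[of r' r s' s] assms by (cases "r \<le> r'") auto
  then have "s * n = s' * n" using assms(3) unfolding pt_def by simp
  then show ?thesis using r n by simp
qed

lemma T1: "real T \<ge> 1" using n by simp
lemma AB1: "real (A * B) \<ge> 1" using A B mult_mono[of 1 "real A" 1 "real B"] by simp
lemma \<Lambda>1: "\<Lambda> \<ge> 1"
proof -
  have "1 \<le> real (A * B) * real T ^ A" using mult_mono[of 1 "real (A * B)" 1 "real T ^ A"] AB1 T1 by simp
  then show ?thesis unfolding \<Lambda> using mult_mono[of 1 "real (A * B) * real T ^ A" 1 "E ^ (R * B)"] E by simp
qed
lemma H1: "real H \<ge> 1" using H \<Lambda>1 by linarith
lemma \<Lambda>H1: "\<Lambda> * H \<ge> 1" using mult_mono[of 1 \<Lambda> 1 "real H"] \<Lambda>1 H1 by simp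

text \<open>Collected by powers of \<open>\<gamma>\<close>, \<open>V P r s\<close> is an integer
  polynomial of degree at most \<open>R * B\<close> whose coefficients have absolute sum at most
  \<open>real (A * B) * real T ^ A * H\<close>. The factor \<open>\<Lambda> * H\<close> is the
  Liouville base for these data.\<close>

lemma V_lower:
  assumes P: "\<And>ab. ab \<in> I \<Longrightarrow> \<bar>P ab\<bar> \<le> int H" and r: "r < R" and s: "s \<le> A" and V: "V P r s \<noteq> 0"
  shows "1 \<le> (\<Lambda> * H) ^ D * norm (V P r s)"
proof -
  define N where "N = R * B"
  define h where "h ab = P ab * int (pt r s) ^ fst ab" for ab
  define u where "u i = (\<Sum>ab | ab \<in> I \<and> r * snd ab = i. h ab)" for i
  have img: "(\<lambda>ab. r * snd ab) ` I \<subseteq> {..N}" using r unfolding I_def N_def by (auto intro: mult_le_mono)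
  have "(\<Sum>i\<le>N. of_int (u i) * \<gamma> ^ i) = (\<Sum>i\<le>N. \<Sum>ab | ab \<in> I \<and> r * snd ab = i. of_int (h ab) * (\<gamma> ^ r) ^ snd ab)"
    unfolding u_def of_int_sum sum_distrib_right by (intro sum.cong refl) (auto simp: power_mult)
  also have "\<dots> = (\<Sum>ab\<in>I. of_int (h ab) * (\<gamma> ^ r) ^ snd ab)" by (rule sum.group[OF I(1) _ img]) simp
  also have "\<dots> = V P r s" unfolding V_def h_def by (simp add: mult_ac)
  finally have e: "(\<Sum>i\<le>N. of_int (u i) * \<gamma> ^ i) = V P r s" .
  have "(\<Sum>i\<le>N. \<bar>u i\<bar>) \<le> (\<Sum>i\<le>N. \<Sum>ab | ab \<in> I \<and> r * snd ab = i. \<bar>h ab\<bar>)" unfolding u_def by (intro sum_mono sum_abs)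
  also have "\<dots> = (\<Sum>ab\<in>I. \<bar>h ab\<bar>)" by (rule sum.group[OF I(1) _ img]) simp
  finally have "real_of_int (\<Sum>i\<le>N. \<bar>u i\<bar>) \<le> real_of_int (\<Sum>ab\<in>I. \<bar>h ab\<bar>)" by linarith
  then have "(\<Sum>i\<le>N. real_of_int \<bar>u i\<bar>) \<le> (\<Sum>ab\<in>I. real_of_int \<bar>h ab\<bar>)" by (simp only: of_int_sum)
  also have "\<dots> \<le> (\<Sum>ab\<in>I. real H * real T ^ A)"
  proof (rule sum_mono)
    fix ab assume ab: "ab \<in> I"
    have "real (pt r s) ^ fst ab \<le> real T ^ fst ab" using pt_T[OF r s] by (intro power_mono) auto
    also have "\<dots> \<le> real T ^ A" using T1 ab unfolding I_def by (intro power_increasing) auto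
    finally have "real (pt r s) ^ fst ab \<le> real T ^ A" .
    moreover have "real_of_int \<bar>P ab\<bar> \<le> real H" using P[OF ab] by linarith
    ultimately show "real_of_int \<bar>h ab\<bar> \<le> real H * real T ^ A" unfolding h_def abs_mult of_int_mult by (intro mult_mono) auto
  qed
  also have "\<dots> = real (A * B) * real T ^ A * H" using I(2) by simp
  finally have L: "(\<Sum>i\<le>N. real_of_int \<bar>u i\<bar>) \<le> real (A * B) * real T ^ A * H" .
  have "1 \<le> (real (A * B) * real T ^ A * H * E ^ N) ^ D * norm (V P r s)" using liou[OF _ L] V unfolding e by blast
  moreover have "real (A * B) * real T ^ A * H * E ^ N = \<Lambda> * H" unfolding \<Lambda> N_def by (simp only: mult_ac)
  ultimately show ?thesis by (simp only:)
qed

text \<open>There are \<open>4 * (D + 1)\<close> times as many coefficients as conditions: each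
  condition has two real coordinates, and each coordinate has fewer than
  \<open>(H + 1) ^ (2 * (D + 1))\<close> cells. The values reached by the pigeonhole principle fall
  below the Liouville bound, so they vanish exactly.\<close>

lemma siegel:
  obtains P where "\<exists>ab\<in>I. P ab \<noteq> 0" "\<And>ab. ab \<in> I \<Longrightarrow> \<bar>P ab\<bar> \<le> int H" "\<And>r s. r < R \<Longrightarrow> s < S0 \<Longrightarrow> V P r s = 0"
proof -
  define J where "J = {..<R} \<times> {..<S0}"
  define c where "c ab rs = (of_nat (pt (fst rs) (snd rs)) ^ fst ab * (\<gamma> ^ fst rs) ^ snd ab :: complex)" for ab rs :: "nat \<times> nat"
  define W where "W = real T ^ A"
  define Q where "Q = (\<Lambda> * H) ^ D"
  have Q1: "Q \<ge> 1" unfolding Q_def using \<Lambda>H1 by simp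
  have W: "norm (c ab rs) \<le> W" if "ab \<in> I" "rs \<in> J" for ab rs
  proof -
    have rs: "fst rs < R" "snd rs \<le> A" using that(2) A unfolding J_def by auto
    have "norm (c ab rs) = real (pt (fst rs) (snd rs)) ^ fst ab" unfolding c_def using g(1) by (simp add: norm_mult norm_power)
    also have "\<dots> \<le> real T ^ fst ab" using pt_T[OF rs] by (intro power_mono) auto
    also have "\<dots> \<le> real T ^ A" using T1 that(1) unfolding I_def by (intro power_increasing) auto
    finally show ?thesis unfolding W_def .
  qed
  have W0: "W > 0" unfolding W_def using T1 by simp
  have cJ: "finite J" "card J = R * S0" unfolding J_def by simp_all
  \<comment> \<open>The pigeonhole bound \<open>2 * dl\<close> becomes \<open>1 / (2 * Q)\<close>,
    half of the Liouville bound \<open>1 / Q\<close>.\<close>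
  define dl where "dl = 1 / (4 * Q)"
  have dl: "dl > 0" unfolding dl_def using Q1 by simp
  have "real (card I) * H * W * 1 \<le> real (card I) * H * W * E ^ (R * B)" using E W0 by (intro mult_left_mono) auto
  also have "\<dots> = \<Lambda> * H" unfolding \<Lambda> W_def I(2) by (simp only: mult_ac)
  finally have "real (card I) * H * W * Q \<le> \<Lambda> * H * Q" using Q1 by (intro mult_right_mono) auto
  also have "\<Lambda> * H * Q = (\<Lambda> * H) ^ (D + 1)" unfolding Q_def by simp
  finally have c1: "real (card I) * H * W * Q \<le> (\<Lambda> * H) ^ (D + 1)" .
  have "2 * (real (card I) * H * W) / dl + 2 = 8 * (real (card I) * H * W * Q) + 2" unfolding dl_def by simp
  also have "\<dots> \<le> 10 * (\<Lambda> * H) ^ (D + 1)" using c1 one_le_power[OF \<Lambda>H1, of "D + 1"] by linarith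
  also have "\<dots> \<le> 10 ^ (D + 1) * (\<Lambda> * H) ^ (D + 1)" using \<Lambda>H1 by (intro mult_right_mono) (auto simp: self_le_power)
  also have "\<dots> = (10 * \<Lambda> * H) ^ (D + 1)" by (simp only: power_mult_distrib mult.assoc)
  also have "\<dots> \<le> (real H * real H) ^ (D + 1)" using H \<Lambda>1 by (intro power_mono mult_right_mono) auto
  also have "\<dots> = real H ^ (2 * (D + 1))" by (simp only: power_mult power2_eq_square)
  also have "\<dots> < real (H + 1) ^ (2 * (D + 1))" by (rule power_strict_mono) auto
  finally have lt: "2 * (real (card I) * H * W) / dl + 2 < real (H + 1) ^ (2 * (D + 1))" .
  have "(2 * (real (card I) * H * W) / dl + 2) ^ (2 * card J) < (real (H + 1) ^ (2 * (D + 1))) ^ (2 * card J)"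
    by (rule power_strict_mono[OF lt]) (use W0 dl n S0 cJ in auto)
  also have "\<dots> = real (H + 1) ^ card I" unfolding power_mult[symmetric] cJ I(2) AB by (simp only: mult_ac) simp
  finally have big: "(2 * (card I * H * W) / dl + 2) ^ (2 * card J) < real (H + 1) ^ card I" by simp
  have "\<exists>P :: nat \<times> nat \<Rightarrow> int. (\<exists>i\<in>I. P i \<noteq> 0) \<and> (\<forall>i\<in>I. \<bar>P i\<bar> \<le> int H) \<and> (\<forall>j\<in>J. norm (\<Sum>i\<in>I. of_int (P i) * c i j) \<le> 2 * dl)"
    by (rule pigeonhole_small_combination[where W = W]) (use I(1) cJ(1) W W0 dl big in simp_all)
  then obtain P :: "nat \<times> nat \<Rightarrow> int" where P: "\<exists>i\<in>I. P i \<noteq> 0" "\<And>i. i \<in> I \<Longrightarrow> \<bar>P i\<bar> \<le> int H" "\<And>j. j \<in> J \<Longrightarrow> norm (\<Sum>i\<in>I. of_int (P i) * c i j) \<le> 2 * dl"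
    by blast
  have "V P r s = 0" if rs: "r < R" "s < S0" for r s
  proof (rule ccontr)
    assume V: "V P r s \<noteq> 0"
    have "norm (V P r s) \<le> 2 * dl" using P(3)[of "(r, s)"] rs unfolding V_def c_def J_def by simp
    then have "Q * norm (V P r s) \<le> Q * (2 * dl)" using Q1 by (intro mult_left_mono) auto
    also have "\<dots> = 1 / 2" unfolding dl_def using Q1 by simp
    finally show False using V_lower[OF P(2) rs(1) _ V] rs A unfolding Q_def by simp
  qed
  then show thesis using that P(1,2) by blast
qed

text \<open>For fixed \<open>r\<close>, \<open>V\<close> is a polynomial of degree below
  \<open>A\<close> in \<open>pt r s\<close>, so vanishing for \<open>A\<close> values of
  \<open>s\<close> kills its coefficients. These are polynomials of degree below \<open>B\<close>
  evaluated at \<open>\<gamma> ^ r\<close>, and the \<open>R >= B\<close> arguments are distinct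
  because \<open>\<gamma>\<close> is not a root of unity.\<close>

lemma zero_estimate:
  assumes P: "\<exists>ab\<in>I. P ab \<noteq> 0" shows "\<exists>r s. r < R \<and> s < A \<and> V P r s \<noteq> 0"
proof (rule ccontr)
  assume "\<not> ?thesis"
  then have V0: "V P r s = 0" if "r < R" "s < A" for r s using that by blast
  have Ve: "V P r s = (\<Sum>a<A. (\<Sum>b<B. of_int (P (a, b)) * (\<gamma> ^ r) ^ b) * of_nat (pt r s) ^ a)" for r s
    unfolding V_def I_def sum_distrib_right sum.cartesian_product by (rule sum.cong) (auto simp: mult_ac)
  have c0: "(\<Sum>b<B. of_int (P (a, b)) * (\<gamma> ^ r) ^ b) = 0" if r: "r < R" and a: "a < A" for r a
  proof (rule coefficients_zero[of "(\<lambda>s. of_nat (pt r s)) ` {..<A}" A "\<lambda>a. \<Sum>b<B. of_int (P (a, b)) * (\<gamma> ^ r) ^ b"])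
    have "inj_on (\<lambda>s. of_nat (pt r s) :: complex) {..<A}" by (rule inj_onI) (use pt_inj[OF r r] in auto)
    then show "A \<le> card ((\<lambda>s. of_nat (pt r s) :: complex) ` {..<A})" by (simp add: card_image)
    show "(\<Sum>a<A. (\<Sum>b<B. of_int (P (a, b)) * (\<gamma> ^ r) ^ b) * x ^ a) = 0" if "x \<in> (\<lambda>s. of_nat (pt r s)) ` {..<A}" for x
      using that V0[OF r] unfolding Ve by auto
  qed (use a in auto)
  have "P (a, b) = 0" if a: "a < A" and b: "b < B" for a b
  proof -
    have "(of_int (P (a, b)) :: complex) = 0"
    proof (rule coefficients_zero[of "(\<lambda>r. \<gamma> ^ r) ` {..<R}" B "\<lambda>b. of_int (P (a, b))"])
      have ne: "\<gamma> ^ r \<noteq> \<gamma> ^ r'" if "r < r'" for r r'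
      proof
        assume "\<gamma> ^ r = \<gamma> ^ r'"
        also have "\<dots> = \<gamma> ^ r * \<gamma> ^ (r' - r)" using that by (simp add: power_add[symmetric])
        finally have "\<gamma> ^ (r' - r) = 1" using g(1) by auto
        then show False using g(2)[of "r' - r"] that by simp
      qed
      have "inj_on (\<lambda>r. \<gamma> ^ r) {..<R}"
      proof (rule inj_onI)
        fix x y assume "\<gamma> ^ x = \<gamma> ^ y"
        then show "x = y" using ne[of x y] ne[of y x] by (cases x y rule: linorder_cases) auto
      qed
      then show "B \<le> card ((\<lambda>r. \<gamma> ^ r) ` {..<R})" using B by (simp add: card_image)
      show "(\<Sum>b<B. of_int (P (a, b)) * x ^ b) = 0" if "x \<in> (\<lambda>r. \<gamma> ^ r) ` {..<R}" for x using that c0[OF _ a] by auto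
    qed (use b in auto)
    then show ?thesis by simp
  qed
  then show False using P unfolding I_def by auto
qed

text \<open>Extrapolation up to the first layer that fails. At the least \<open>S\<close> with some
  \<open>V P r1 S\<close> nonzero, \<open>F\<close> is small at the \<open>R * S\<close> points of
  the earlier layers, and the Schwarz lemma makes it small at the new point. \<open>est1\<close>
  controls the growth term \<open>M / 6 ^ (R * S)\<close>, \<open>est2\<close> the error
  \<open>\<eta>\<close> of replacing \<open>\<omega>\<close> by \<open>\<gamma>\<close>; together
  they undercut the Liouville bound.\<close>

lemma contradiction: False
proof -
  obtain P where P: "\<exists>ab\<in>I. P ab \<noteq> 0" "\<And>ab. ab \<in> I \<Longrightarrow> \<bar>P ab\<bar> \<le> int H" "\<And>r s. r < R \<Longrightarrow> s < S0 \<Longrightarrow> V P r s = 0"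
    using siegel by blast
  define good where "good s \<longleftrightarrow> (\<exists>r<R. V P r s \<noteq> 0)" for s
  obtain r0 s0 where rs0: "r0 < R" "s0 < A" "V P r0 s0 \<noteq> 0" using zero_estimate[OF P(1)] by blast
  define S where "S = (LEAST s. good s)"
  have g0: "good s0" unfolding good_def using rs0 by blast
  have gS: "good S" unfolding S_def by (rule LeastI[of good, OF g0])
  have SA: "S < A" using Least_le[of good, OF g0] rs0(2) unfolding S_def by linarith
  have lo: "V P r s = 0" if "s < S" "r < R" for r s using not_less_Least[of s good] that unfolding S_def good_def by blast
  obtain r1 where r1: "r1 < R" "V P r1 S \<noteq> 0" using gS unfolding good_def by blast
  have SS0: "S0 \<le> S" using P(3)[OF r1(1), of S] r1(2) by linarith
  define c where "c = 2 * of_real pi * \<i> / of_nat n"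
  define \<omega> where "\<omega> = exp (c * of_nat k)"
  have n0: "of_nat n \<noteq> (0::complex)" using n by simp
  have cn: "exp (c * of_nat n) = 1" unfolding c_def using n0 by simp
  have nc: "norm c = 2 * pi / n" unfolding c_def by (simp add: norm_divide norm_mult)
  have "c * of_nat k = \<i> * of_real (2 * pi * k / n)" unfolding c_def by simp
  then have n\<omega>: "norm \<omega> = 1" unfolding \<omega>_def by (simp only: norm_exp_i_times)
  have \<omega>\<delta>: "norm (\<omega> - \<gamma>) \<le> \<delta>" using \<delta> unfolding \<omega>_def c_def .
  have d0: "\<delta> \<ge> 0" using \<omega>\<delta> norm_ge_zero order_trans by blast
  define F where "F z = (\<Sum>ab\<in>I. of_int (P ab) * (z ^ fst ab * exp (c * z) ^ snd ab))" for z
  have hol: "F holomorphic_on UNIV" unfolding F_def by (intro holomorphic_intros)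
  have Hr: "norm (of_int (P ab) :: complex) \<le> real H" if "ab \<in> I" for ab
    using P(2)[OF that] by simp
  define \<eta> where "\<eta> = real (A * B) * H * real T ^ A * real (R * B) * \<delta>"
  have \<eta>0: "\<eta> \<ge> 0" unfolding \<eta>_def using d0 by simp
  have close: "norm (F (of_nat (pt r s)) - V P r s) \<le> \<eta>" if r: "r < R" and s: "s \<le> A" for r s
  proof -
    have "c * of_nat (pt r s) = of_nat r * (c * of_nat k) + of_nat s * (c * of_nat n)" unfolding pt_def by (simp add: algebra_simps)
    \<comment> \<open>At these points the exponential is exactly a power of \<open>\<omega>\<close>,
      since the part \<open>s * n\<close> is a multiple of the period.\<close>
    then have ex: "exp (c * of_nat (pt r s)) = \<omega> ^ r" by (simp only: exp_add exp_of_nat_mult cn \<omega>_def power_one mult_1_right)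
    have "F (of_nat (pt r s)) - V P r s = (\<Sum>ab\<in>I. of_int (P ab) * (of_nat (pt r s) ^ fst ab * ((\<omega> ^ r) ^ snd ab - (\<gamma> ^ r) ^ snd ab)))"
      unfolding F_def V_def ex by (simp only: sum_subtractf[symmetric] right_diff_distrib)
    also have "norm \<dots> \<le> (\<Sum>ab\<in>I. real H * (real T ^ A * (real (R * B) * \<delta>)))"
    proof (rule sum_norm_le)
      fix ab assume ab: "ab \<in> I"
      have "real (pt r s) ^ fst ab \<le> real T ^ fst ab" using pt_T[OF r s] by (intro power_mono) auto
      also have "\<dots> \<le> real T ^ A" using T1 ab unfolding I_def by (intro power_increasing) auto
      finally have t: "real (pt r s) ^ fst ab \<le> real T ^ A" .
      have "norm (\<omega> ^ (r * snd ab) - \<gamma> ^ (r * snd ab)) \<le> real (r * snd ab) * norm (\<omega> - \<gamma>)"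
        by (rule norm_power_diff) (use n\<omega> g in auto)
      also have "\<dots> \<le> real (R * B) * \<delta>"
      proof (rule mult_mono[OF _ \<omega>\<delta>])
        have "r * snd ab \<le> R * B" using ab r unfolding I_def by (intro mult_le_mono) auto
        then show "real (r * snd ab) \<le> real (R * B)" by (simp only: of_nat_le_iff)
      qed auto
      finally have d: "norm ((\<omega> ^ r) ^ snd ab - (\<gamma> ^ r) ^ snd ab) \<le> real (R * B) * \<delta>" by (simp only: power_mult)
      show "norm (of_int (P ab) * (of_nat (pt r s) ^ fst ab * ((\<omega> ^ r) ^ snd ab - (\<gamma> ^ r) ^ snd ab))) \<le> real H * (real T ^ A * (real (R * B) * \<delta>))"
        unfolding norm_mult norm_power norm_of_nat using Hr[OF ab] t d by (intro mult_mono) auto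
    qed
    also have "\<dots> = \<eta>" unfolding \<eta>_def by (simp add: I(2) mult.assoc)
    finally show ?thesis .
  qed
  define N where "N = (\<lambda>rs. of_nat (pt (fst rs) (snd rs)) :: complex) ` ({..<R} \<times> {..<S})"
  define \<rho> where "\<rho> = real (n * (R + S))"
  have "inj_on (\<lambda>rs. of_nat (pt (fst rs) (snd rs)) :: complex) ({..<R} \<times> {..<S})"
  proof (rule inj_onI)
    fix x y assume xy: "x \<in> {..<R} \<times> {..<S}" "y \<in> {..<R} \<times> {..<S}" "of_nat (pt (fst x) (snd x)) = (of_nat (pt (fst y) (snd y)) :: complex)"
    then have "pt (fst x) (snd x) = pt (fst y) (snd y)" by simp
    then show "x = y" using pt_inj[of "fst x" "fst y" "snd x" "snd y"] xy by (auto simp: prod_eq_iff)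
  qed
  then have cN: "card N = R * S" unfolding N_def by (simp add: card_image)
  have rho: "\<rho> \<ge> 1" "\<rho> \<le> real T"
  proof -
    have "1 * 1 \<le> n * (R + S)" using n by (intro mult_le_mono) auto
    then show "\<rho> \<ge> 1" unfolding \<rho>_def by linarith
    have "n * (R + S) \<le> n * (R + A)" using SA by simp
    then show "\<rho> \<le> real T" unfolding \<rho>_def using T by linarith
  qed
  \<comment> \<open>Maximum of \<open>F\<close> on the circle of radius \<open>7 * \<rho>\<close>:
    the frequency \<open>2 * pi / n\<close> times \<open>7 * n * (R + S)\<close> is the exponent
    \<open>14 * pi * (R + S)\<close>.\<close>
  define M where "M = real (A * B) * H * (7 * real T) ^ A * exp (14 * pi * real (R + S)) ^ B"
  have Mb: "norm (F z) \<le> M" if z: "norm z = 7 * \<rho>" for z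
  proof -
    have "norm (F z) \<le> (\<Sum>ab\<in>I. real H * ((7 * real T) ^ A * exp (14 * pi * real (R + S)) ^ B))"
      unfolding F_def
    proof (rule sum_norm_le)
      fix ab assume ab: "ab \<in> I"
      have "norm z ^ fst ab \<le> (7 * real T) ^ fst ab" unfolding z using rho by (intro power_mono) auto
      also have "\<dots> \<le> (7 * real T) ^ A" using T1 ab unfolding I_def by (intro power_increasing) auto
      finally have 1: "norm z ^ fst ab \<le> (7 * real T) ^ A" .
      have "norm (c * z) = 14 * pi * real (R + S)" unfolding norm_mult nc z \<rho>_def using n by (simp add: field_simps)
      then have "norm (exp (c * z)) \<le> exp (14 * pi * real (R + S))" using norm_exp[of "c * z"] by simp
      then have "norm (exp (c * z)) ^ snd ab \<le> exp (14 * pi * real (R + S)) ^ snd ab" by (intro power_mono) auto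
      also have "\<dots> \<le> exp (14 * pi * real (R + S)) ^ B" using ab unfolding I_def by (intro power_increasing) auto
      finally have 2: "norm (exp (c * z)) ^ snd ab \<le> exp (14 * pi * real (R + S)) ^ B" .
      show "norm (of_int (P ab) * (z ^ fst ab * exp (c * z) ^ snd ab)) \<le> real H * ((7 * real T) ^ A * exp (14 * pi * real (R + S)) ^ B)"
        unfolding norm_mult norm_power using Hr[OF ab] 1 2 by (intro mult_mono) auto
    qed
    also have "\<dots> = M" unfolding M_def by (simp add: I(2) mult.assoc)
    finally show ?thesis .
  qed
  define x where "x = (of_nat (pt r1 S) :: complex)"
  have dist_nat: "norm (of_nat a - of_nat b :: complex) = \<bar>real a - real b\<bar>" for a b
    by (metis of_real_diff of_real_of_nat_eq norm_of_real)
  have "norm (F x) \<le> M / 6 ^ card N + 2 * (card N * \<eta> * (8 * \<rho>) ^ card N)"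
  proof (rule schwarz_approximate_zeros[OF hol _ rho(1)])
    show "finite N" unfolding N_def by simp
    show "norm (s - t) \<ge> 1" if st: "s \<in> N" "t \<in> N" "s \<noteq> t" for s t
    proof -
      obtain a b where ab: "s = of_nat a" "t = of_nat b" using st unfolding N_def by auto
      then have "a \<noteq> b" using st(3) by auto
      then show ?thesis unfolding ab dist_nat by linarith
    qed
    show "norm t \<le> \<rho>" if "t \<in> N" for t using that pt_le unfolding N_def \<rho>_def by (auto simp del: of_nat_mult of_nat_add)
    show "norm (F t) \<le> \<eta>" if t: "t \<in> N" for t
    proof -
      obtain r s where rs: "t = of_nat (pt r s)" "r < R" "s < S" using t unfolding N_def by auto
      then show ?thesis using close[of r s] lo[of s r] SA by simp
    qed
    show "norm (F z) \<le> M" if "norm z = 7 * \<rho>" for z by (rule Mb[OF that])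
    show "norm x \<le> \<rho>" unfolding x_def \<rho>_def using pt_le[OF r1(1), of S S] by (simp del: of_nat_mult of_nat_add)
    show "norm (x - t) \<le> \<rho>" if t: "t \<in> N" for t
    proof -
      obtain r s where rs: "t = of_nat (pt r s)" "r < R" "s < S" using t unfolding N_def by auto
      have "pt r s \<le> n * (R + S)" "pt r1 S \<le> n * (R + S)" using pt_le[of r s S] pt_le[of r1 S S] rs r1 by auto
      then have "real (pt r s) \<le> \<rho>" "real (pt r1 S) \<le> \<rho>" unfolding \<rho>_def by (simp_all only: of_nat_le_iff)
      then show ?thesis unfolding x_def rs(1) dist_nat by (simp add: abs_le_iff)
    qed
  qed
  then have Fx: "norm (F x) \<le> M / 6 ^ (R * S) + 2 * (real (R * S) * \<eta> * (8 * \<rho>) ^ (R * S))" unfolding cN .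
  define Q where "Q = (\<Lambda> * H) ^ D"
  have Q1: "Q \<ge> 1" unfolding Q_def using \<Lambda>H1 by simp
  have m1: "3 * (Q * (M / 6 ^ (R * S))) < 1" using est1[OF SS0 SA] unfolding Q_def[symmetric] M_def[symmetric] by (simp add: divide_less_eq)
  define Y where "Y = real (R * A) * (8 * real T) ^ (R * A)"
  have y1: "1 \<le> Y"
  proof -
    have "1 * 1 \<le> R * A" using n A by (intro mult_le_mono) auto
    then have "1 \<le> real (R * A)" by linarith
    moreover have "1 \<le> (8 * real T) ^ (R * A)" using T1 by (intro one_le_power) simp
    ultimately show ?thesis unfolding Y_def using mult_mono[of 1 "real (R * A)" 1 "(8 * real T) ^ (R * A)"] by simp
  qed
  have y2: "real (R * S) * (8 * \<rho>) ^ (R * S) \<le> Y" unfolding Y_def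
  proof (rule mult_mono)
    show "real (R * S) \<le> real (R * A)" using SA by (simp add: mult_left_mono)
    have "(8 * \<rho>) ^ (R * S) \<le> (8 * real T) ^ (R * S)" using rho by (intro power_mono) auto
    also have "\<dots> \<le> (8 * real T) ^ (R * A)" using T1 SA by (intro power_increasing) auto
    finally show "(8 * \<rho>) ^ (R * S) \<le> (8 * real T) ^ (R * A)" .
  qed (use rho in auto)
  have "norm (V P r1 S) \<le> norm (F x) + \<eta>"
    using close[OF r1(1), of S] SA norm_triangle_ineq4[of "F x" "F x - V P r1 S"] unfolding x_def by simp
  also have "\<dots> \<le> M / 6 ^ (R * S) + (2 * (real (R * S) * \<eta> * (8 * \<rho>) ^ (R * S)) + \<eta>)" using Fx by simp
  also have "\<dots> = M / 6 ^ (R * S) + (2 * (real (R * S) * (8 * \<rho>) ^ (R * S)) + 1) * \<eta>" by (simp add: algebra_simps)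
  also have "\<dots> \<le> M / 6 ^ (R * S) + (3 * Y) * \<eta>" using y1 y2 \<eta>0 by (intro add_left_mono mult_right_mono) simp_all
  finally have "Q * norm (V P r1 S) \<le> Q * (M / 6 ^ (R * S) + (3 * Y) * \<eta>)" using Q1 by (intro mult_left_mono) auto
  then have "Q * norm (V P r1 S) \<le> Q * (M / 6 ^ (R * S)) + Q * ((3 * Y) * \<eta>)" by (simp only: distrib_left)
  moreover have "3 * (Q * ((3 * Y) * \<eta>)) \<le> 1" using est2 unfolding Q_def Y_def \<eta>_def by (simp only: mult.assoc)
  moreover have "1 \<le> Q * norm (V P r1 S)" unfolding Q_def by (rule V_lower[OF P(2) r1(1) _ r1(2)]) (use SA in auto)
  ultimately show False using m1 by linarith
qed

end

subsection \<open>Powers close to 1\<close>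

text \<open>These are the inequalities between exponents, and the size condition on
  \<open>B\<close>, that the parameters proportional to \<open>B\<close> demand. Divided by
  \<open>B\<close>, \<open>B^2\<close>, \<open>B^2\<close> and \<open>B^3\<close>, the four
  left-hand sides tend to 0. The factor 800 is twice the 400 of \<open>R\<close>, which brings the
  interpolation exponent below \<open>B^3 / 2\<close>.\<close>

lemma schneider_parameters:
  fixes D a :: nat and g :: real
  assumes g: "g \<ge> 0" and a: "a > 0"
  shows "\<forall>\<^sub>F B :: nat in sequentially.
     800 * real a * (ln 8 + (4 * ln (real B + 1) + ln (400 + real a) + ln (real B))) \<le> real B \<and>
     ln (real a) + 2 * ln (real B) \<le> (real B)\<^sup>2 \<and>
     2 + 10 * (real D + 1) + 6 * real a * real B \<le> (real B)\<^sup>2 \<and>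
     2 + (real D + 1) * (10 + 2 * (2 + 400 * g) * (real B)\<^sup>2) + ln (1200 * real a) + 2 * ln (real B) + (ln 400 + 2 * ln (real B)) \<le> (real B) ^ 3 / 2 \<and>
     B \<ge> 8"
proof -
  have l1: "(\<lambda>B::nat. ln (real B + 1) / real B) \<longlonglongrightarrow> 0" "(\<lambda>B::nat. ln (real B) / real B) \<longlonglongrightarrow> 0"
    "(\<lambda>B::nat. 1 / real B) \<longlonglongrightarrow> 0" "(\<lambda>B::nat. ln (real B) / (real B)\<^sup>2) \<longlonglongrightarrow> 0" "(\<lambda>B::nat. 1 / (real B)\<^sup>2) \<longlonglongrightarrow> 0"
    "(\<lambda>B::nat. ln (real B) / (real B) ^ 3) \<longlonglongrightarrow> 0" "(\<lambda>B::nat. 1 / (real B) ^ 3) \<longlonglongrightarrow> 0"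
    by real_asymp+
  have ev: "\<forall>\<^sub>F B in sequentially. f B \<le> c" if "f \<longlonglongrightarrow> z" "z < c" for f :: "nat \<Rightarrow> real" and z c
    using order_tendstoD(2)[OF that] by (rule eventually_mono) simp
  have 1: "\<forall>\<^sub>F B :: nat in sequentially. 800 * real a * ((ln 8 + ln (400 + real a)) * (1 / real B) + (4 * (ln (real B + 1) / real B) + ln (real B) / real B)) \<le> 1"
    by (rule ev, rule tendsto_mult[OF tendsto_const tendsto_add[OF tendsto_mult[OF tendsto_const l1(3)] tendsto_add[OF tendsto_mult[OF tendsto_const l1(1)] l1(2)]]]) simp
  have 2: "\<forall>\<^sub>F B :: nat in sequentially. ln (real a) * (1 / (real B)\<^sup>2) + 2 * (ln (real B) / (real B)\<^sup>2) \<le> 1"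
    by (rule ev, rule tendsto_add[OF tendsto_mult[OF tendsto_const l1(5)] tendsto_mult[OF tendsto_const l1(4)]]) simp
  have 3: "\<forall>\<^sub>F B :: nat in sequentially. (2 + 10 * (real D + 1)) * (1 / (real B)\<^sup>2) + 6 * real a * (1 / real B) \<le> 1"
    by (rule ev, rule tendsto_add[OF tendsto_mult[OF tendsto_const l1(5)] tendsto_mult[OF tendsto_const l1(3)]]) simp
  have 4: "\<forall>\<^sub>F B :: nat in sequentially. (2 + 10 * (real D + 1) + ln (1200 * real a) + ln 400) * (1 / (real B) ^ 3)
     + ((real D + 1) * (2 * (2 + 400 * g)) * (1 / real B) + 4 * (ln (real B) / (real B) ^ 3)) \<le> 1 / 2"
    by (rule ev, rule tendsto_add[OF tendsto_mult[OF tendsto_const l1(7)] tendsto_add[OF tendsto_mult[OF tendsto_const l1(3)] tendsto_mult[OF tendsto_const l1(6)]]]) simp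
  show ?thesis using 1 2 3 4 eventually_ge_at_top[of 8]
  proof eventually_elim
    case (elim B)
    define b where "b = real B"
    have b: "b > 0" using elim(5) unfolding b_def by simp
    have q: "(1 / b) * b = 1" "(1 / b\<^sup>2) * b\<^sup>2 = 1" "(1 / b ^ 3) * b ^ 3 = 1" "(1 / b) * b\<^sup>2 = b" "(1 / b) * b ^ 3 = b\<^sup>2"
      using b by (simp_all add: power2_eq_square power3_eq_cube)
    have d: "x / y = x * (1 / y)" for x y :: real by simp
    have "800 * real a * ((ln 8 + ln (400 + real a)) * (1 / b) + (4 * (ln (b + 1) * (1 / b)) + ln b * (1 / b))) * b \<le> 1 * b"
      using elim(1) b unfolding b_def[symmetric] by (intro mult_right_mono) auto
    then have "800 * real a * ((ln 8 + ln (400 + real a)) * ((1 / b) * b) + (4 * (ln (b + 1) * ((1 / b) * b)) + ln b * ((1 / b) * b))) \<le> b"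
      by (simp only: mult.assoc distrib_right mult_1_left)
    then have e1: "800 * real a * (ln 8 + (4 * ln (b + 1) + ln (400 + real a) + ln b)) \<le> b" unfolding q by (simp add: algebra_simps)
    have "(ln (real a) * (1 / b\<^sup>2) + 2 * (ln b * (1 / b\<^sup>2))) * b\<^sup>2 \<le> 1 * b\<^sup>2"
      using elim(2) b unfolding b_def[symmetric] by (intro mult_right_mono) auto
    then have "ln (real a) * ((1 / b\<^sup>2) * b\<^sup>2) + 2 * (ln b * ((1 / b\<^sup>2) * b\<^sup>2)) \<le> b\<^sup>2" by (simp only: mult.assoc distrib_right mult_1_left)
    then have e2: "ln (real a) + 2 * ln b \<le> b\<^sup>2" unfolding q by simp
    have "((2 + 10 * (real D + 1)) * (1 / b\<^sup>2) + 6 * real a * (1 / b)) * b\<^sup>2 \<le> 1 * b\<^sup>2"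
      using elim(3) b unfolding b_def[symmetric] by (intro mult_right_mono) auto
    then have "(2 + 10 * (real D + 1)) * ((1 / b\<^sup>2) * b\<^sup>2) + 6 * (real a * ((1 / b) * b\<^sup>2)) \<le> b\<^sup>2" by (simp only: mult.assoc distrib_right mult_1_left)
    then have e3: "2 + 10 * (real D + 1) + 6 * real a * b \<le> b\<^sup>2" unfolding q by simp
    have "((2 + 10 * (real D + 1) + ln (1200 * real a) + ln 400) * (1 / b ^ 3)
     + ((real D + 1) * (2 * (2 + 400 * g)) * (1 / b) + 4 * (ln b * (1 / b ^ 3)))) * b ^ 3 \<le> 1 / 2 * b ^ 3"
      using elim(4) b unfolding b_def[symmetric] by (intro mult_right_mono) auto
    then have "(2 + 10 * (real D + 1) + ln (1200 * real a) + ln 400) * ((1 / b ^ 3) * b ^ 3)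
     + ((real D + 1) * (2 * (2 + 400 * g)) * ((1 / b) * b ^ 3) + 4 * (ln b * ((1 / b ^ 3) * b ^ 3))) \<le> 1 / 2 * b ^ 3"
      by (simp only: mult.assoc distrib_right[of _ _ "b ^ 3"])
    then have e4: "2 + (real D + 1) * (10 + 2 * (2 + 400 * g) * b\<^sup>2) + ln (1200 * real a) + 2 * ln b + (ln 400 + 2 * ln b) \<le> b ^ 3 / 2"
      unfolding q by (simp add: algebra_simps)
    show ?case using e1 e2 e3 e4 elim(5) unfolding b_def by blast
  qed
qed

text \<open>\<open>B\<close> is the integer fourth root of \<open>n\<close>, and \<open>A\<close>,
  \<open>R\<close>, \<open>S0\<close> are multiples of \<open>B\<close>. Then
  \<open>ln \<Lambda>\<close> is of order at most \<open>B^2\<close>, like the least gain in the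
  Schwarz lemma, while the interpolation error costs an exponent of order \<open>B^2 ln B\<close>; a
  distance of at most \<open>exp (- B^3)\<close> would absorb it.\<close>

lemma root_of_unity_distance_coprime:
  fixes \<gamma> :: complex
  assumes alg: "algebraic \<gamma>" and g: "norm \<gamma> = 1" "\<And>m. m > 0 \<Longrightarrow> \<gamma> ^ m \<noteq> 1"
  shows "\<exists>B0. \<forall>B\<ge>B0. \<forall>n k. B ^ 4 \<le> n \<longrightarrow> n < (B + 1) ^ 4 \<longrightarrow> coprime k n \<longrightarrow> k \<le> n \<longrightarrow>
     norm (exp (2 * of_real pi * \<i> / of_nat n * of_nat k) - \<gamma>) > exp (- (real B ^ 3))"
proof -
  obtain D E where D: "D \<ge> 1" and E: "E \<ge> 1" and
    liou: "\<And>(u :: nat \<Rightarrow> int) N L. (\<Sum>i\<le>N. of_int (u i) * \<gamma> ^ i) \<noteq> 0 \<Longrightarrow> (\<Sum>i\<le>N. real_of_int \<bar>u i\<bar>) \<le> L \<Longrightarrow>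
       1 \<le> (L * E ^ N) ^ D * norm (\<Sum>i\<le>N. of_int (u i) * \<gamma> ^ i)" using liouville[OF alg] by blast
  define l where "l = ln E"
  have l0: "l \<ge> 0" and El: "E = exp l" unfolding l_def using E by auto
  \<comment> \<open>Sized for \<open>est1\<close>: of the exponent
    \<open>R * S = 400 * B * S\<close>, the exponential growth, with \<open>14 * pi\<close> rounded
    up to 56, takes \<open>56 * B * S\<close>; the remaining \<open>344 * B * S\<close>, with
    \<open>S >= c3 * B\<close>, has to beat all terms of order \<open>B^2\<close>.\<close>
  define c3 where "c3 = 400 + 3 * (D + 1) * (nat \<lceil>l\<rceil> + 1)"
  \<comment> \<open>Forced by the required count of coefficients,
    \<open>4 * (D + 1) * (400 * c3)\<close>.\<close>
  define a where "a = 1600 * (D + 1) * c3"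
  have a0: "a > 0" unfolding a_def c3_def by simp
  have c3: "1 + (real D + 1) * (4 + 800 * l) + 22400 < 344 * real c3"
  proof -
    have "l \<le> real (nat \<lceil>l\<rceil>)" by linarith
    then have "(real D + 1) * (4 + 800 * l) \<le> (real D + 1) * (1032 * (real (nat \<lceil>l\<rceil>) + 1))" by (intro mult_left_mono) auto
    moreover have "344 * real c3 = 137600 + (real D + 1) * (1032 * (real (nat \<lceil>l\<rceil>) + 1))" unfolding c3_def by (simp add: algebra_simps)
    ultimately show ?thesis by linarith
  qed
  obtain B0 where B0: "\<And>B. B \<ge> B0 \<Longrightarrow> 
     800 * real a * (ln 8 + (4 * ln (real B + 1) + ln (400 + real a) + ln (real B))) \<le> real B \<and>
     ln (real a) + 2 * ln (real B) \<le> (real B)\<^sup>2 \<and>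
     2 + 10 * (real D + 1) + 6 * real a * real B \<le> (real B)\<^sup>2 \<and>
     2 + (real D + 1) * (10 + 2 * (2 + 400 * l) * (real B)\<^sup>2) + ln (1200 * real a) + 2 * ln (real B) + (ln 400 + 2 * ln (real B)) \<le> (real B) ^ 3 / 2 \<and>
     B \<ge> 8"
    using schneider_parameters[OF l0 a0, of D] unfolding eventually_sequentially by blast
  have "norm (exp (2 * of_real pi * \<i> / of_nat n * of_nat k) - \<gamma>) > exp (- (real B ^ 3))"
    if BB: "B \<ge> B0" and n: "B ^ 4 \<le> n" "n < (B + 1) ^ 4" and k: "coprime k n" "k \<le> n" for B n k
  proof (rule ccontr)
    assume "\<not> ?thesis"
    then have close: "norm (exp (2 * of_real pi * \<i> / of_nat n * of_nat k) - \<gamma>) \<le> exp (- (real B ^ 3))" by simp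
    define b where "b = real B"
    define A where "A = a * B"
    define R where "R = 400 * B"
    define S0 where "S0 = c3 * B"
    \<comment> \<open>An upper bound for all points \<open>pt r s\<close> in use, from
      \<open>n < (B + 1) ^ 4\<close> and \<open>R + A = (400 + a) * B\<close>.\<close>
    define T where "T = (B + 1) ^ 4 * ((400 + a) * B)"
    define t where "t = 4 * ln (b + 1) + ln (400 + real a) + ln b"
    have e1: "800 * real a * (ln 8 + t) \<le> b" and e2: "ln (real a) + 2 * ln b \<le> b\<^sup>2"
      and e3: "2 + 10 * (real D + 1) + 6 * real a * b \<le> b\<^sup>2"
      and e4: "2 + (real D + 1) * (10 + 2 * (2 + 400 * l) * b\<^sup>2) + ln (1200 * real a) + 2 * ln b + (ln 400 + 2 * ln b) \<le> b ^ 3 / 2"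
      and B8: "B \<ge> 8" using B0[OF BB] unfolding t_def b_def by auto
    have b: "b > 0" using B8 unfolding b_def by simp
    have T: "real T = exp t"
    proof -
      have "real T = (b + 1) ^ 4 * ((400 + real a) * b)" unfolding T_def b_def by (simp add: add.commute)
      moreover have "exp t = exp (ln (b + 1)) ^ 4 * exp (ln (400 + real a)) * exp (ln b)"
        unfolding t_def exp_add using exp_of_nat_mult[of 4 "ln (b + 1)"] by simp
      ultimately show ?thesis using b by simp
    qed
    have "1 \<le> T" unfolding T_def using B8 by simp
    then have t0: "t \<ge> 0" using T by (metis exp_ge_zero exp_le_cancel_iff exp_zero of_nat_1 of_nat_le_iff)
    have AB: "real (A * B) = exp (ln (real a) + 2 * ln b)"
    proof -
      have "exp (ln (real a) + 2 * ln b) = exp (ln (real a)) * exp (ln b) ^ 2" unfolding exp_add using exp_of_nat_mult[of 2 "ln b"] by simp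
      then show ?thesis using a0 b unfolding A_def b_def by (simp add: power2_eq_square)
    qed
    define \<Lambda> where "\<Lambda> = real (A * B) * real T ^ A * E ^ (R * B)"
    define lam where "lam = ln (real a) + 2 * ln b + real A * t + real (R * B) * l"
    have \<Lambda>: "\<Lambda> = exp lam" unfolding \<Lambda>_def lam_def AB T El by (simp only: exp_add exp_of_nat_mult)
    have lnn: "ln (8::real) \<ge> 0" by simp
    have at: "real a * t \<le> b"
    proof -
      have "real a * t \<le> real a * (ln 8 + t)" using lnn by (intro mult_left_mono) auto
      moreover have "0 \<le> real a * (ln 8 + t)" using lnn t0 by simp
      ultimately show ?thesis using e1 by linarith
    qed
    have "real A * t = (real a * t) * b" unfolding A_def b_def by simp
    also have "\<dots> \<le> b * b" using at b by (intro mult_right_mono) auto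
    finally have At: "real A * t \<le> b\<^sup>2" by (simp add: power2_eq_square)
    have RB: "real (R * B) = 400 * b\<^sup>2" unfolding R_def b_def by (simp add: power2_eq_square)
    have lamle: "lam \<le> (2 + 400 * l) * b\<^sup>2" unfolding lam_def RB using e2 At by (simp add: algebra_simps)
    have \<Lambda>1: "\<Lambda> \<ge> 1"
    proof -
      have "1 * 1 \<le> A * B" using a0 B8 unfolding A_def by (intro mult_le_mono) auto
      then have 1: "1 \<le> real (A * B)" by linarith
      have 2: "1 \<le> real T ^ A" "1 \<le> E ^ (R * B)" using \<open>1 \<le> T\<close> E by (auto intro!: one_le_power)
      show ?thesis unfolding \<Lambda>_def using mult_mono[OF mult_mono[OF 1 2(1)] 2(2)] by simp
    qed
    define H where "H = nat \<lceil>10 * \<Lambda>\<rceil>"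
    have H: "10 * \<Lambda> \<le> real H" "real H \<le> 11 * \<Lambda>" unfolding H_def using \<Lambda>1 by linarith+
    define Y where "Y = 10 + 2 * (2 + 400 * l) * b\<^sup>2"
    have "\<Lambda> * real H \<le> \<Lambda> * (11 * \<Lambda>)" using H \<Lambda>1 by (intro mult_left_mono) auto
    also have "\<dots> \<le> exp 10 * (\<Lambda> * \<Lambda>)" using exp_ge_add_one_self[of "10::real"] mult_right_mono[of 11 "exp 10" "\<Lambda> * \<Lambda>"] by simp
    also have "\<dots> = exp (10 + (lam + lam))" unfolding \<Lambda> exp_add ..
    also have "\<dots> \<le> exp Y"
    proof -
      have "2 * (2 + 400 * l) * b\<^sup>2 = 2 * ((2 + 400 * l) * b\<^sup>2)" by simp
      then show ?thesis unfolding Y_def exp_le_cancel_iff using lamle by linarith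
    qed
    finally have \<Lambda>H: "\<Lambda> * real H \<le> exp Y" .
    have \<Lambda>H0: "0 \<le> \<Lambda> * real H" using \<Lambda>1 by simp
    have Q: "3 * (\<Lambda> * real H) ^ D \<le> exp (2 + real D * Y)"
    proof -
      have "(\<Lambda> * real H) ^ D \<le> exp Y ^ D" by (rule power_mono[OF \<Lambda>H \<Lambda>H0])
      moreover have "(3::real) \<le> exp 2" using exp_ge_add_one_self[of "2::real"] by simp
      ultimately have "3 * (\<Lambda> * real H) ^ D \<le> exp 2 * exp Y ^ D" using \<Lambda>H0 by (intro mult_mono) auto
      then show ?thesis unfolding exp_add exp_of_nat_mult .
    qed
    have ABT: "real (A * B) * real H * real T ^ A \<le> exp Y"
    proof -
      have "real (A * B) * real H * real T ^ A * 1 \<le> real (A * B) * real H * real T ^ A * E ^ (R * B)"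
        using E by (intro mult_left_mono one_le_power) auto
      also have "\<dots> = \<Lambda> * real H" unfolding \<Lambda>_def by (simp only: mult_ac)
      finally show ?thesis using \<Lambda>H by simp
    qed
    have est1: "3 * (\<Lambda> * H) ^ D * (real (A * B) * H * (7 * real T) ^ A * exp (14 * pi * real (R + S)) ^ B) < 6 ^ (R * S)"
      if S: "S0 \<le> S" for S
    proof -
      define s where "s = real S"
      have s: "s \<ge> real c3 * b" using S unfolding s_def S0_def b_def by (metis of_nat_le_iff of_nat_mult)
      have "(7::real) ^ A \<le> exp 6 ^ A" using exp_ge_add_one_self[of "6::real"] by (intro power_mono) auto
      then have p7: "(7::real) ^ A \<le> exp (6 * real A)" using exp_of_nat_mult[of A "6::real"] by (simp add: mult.commute)
      have "14 * pi * real (R + S) \<le> 56 * real (R + S)" using pi_less_4 by (intro mult_right_mono) auto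
      then have "exp (14 * pi * real (R + S)) ^ B \<le> exp (56 * real (R + S)) ^ B" by (intro power_mono) auto
      then have pe: "exp (14 * pi * real (R + S)) ^ B \<le> exp (b * (56 * (400 * b + s)))"
        unfolding exp_of_nat_mult[symmetric] b_def s_def R_def by simp
      have "real (A * B) * H * (7 * real T) ^ A * exp (14 * pi * real (R + S)) ^ B
          = (real (A * B) * real H * real T ^ A) * 7 ^ A * exp (14 * pi * real (R + S)) ^ B" by (simp add: power_mult_distrib mult_ac)
      also have "\<dots> \<le> exp Y * exp (6 * real A) * exp (b * (56 * (400 * b + s)))"
        by (intro mult_mono ABT p7 pe) auto
      finally have "3 * (\<Lambda> * H) ^ D * (real (A * B) * H * (7 * real T) ^ A * exp (14 * pi * real (R + S)) ^ B)
         \<le> exp (2 + real D * Y) * (exp Y * exp (6 * real A) * exp (b * (56 * (400 * b + s))))"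
        by (intro mult_mono[OF Q]) auto
      also have "\<dots> = exp ((2 + real D * Y) + (Y + 6 * real A + b * (56 * (400 * b + s))))" by (simp only: exp_add)
      also have "\<dots> < exp (real (R * S))"
      proof -
        have rA: "real A = real a * b" and rRS: "real (R * S) = 400 * (b * s)" unfolding A_def R_def b_def s_def by simp_all
        have "(2 + real D * Y) + (Y + 6 * real A + b * (56 * (400 * b + s)))
           = (2 + 10 * (real D + 1) + 6 * real a * b) + (real D + 1) * (4 + 800 * l) * b\<^sup>2 + 22400 * b\<^sup>2 + 56 * (b * s)"
          unfolding Y_def rA by (simp add: algebra_simps power2_eq_square)
        also have "\<dots> \<le> (1 + (real D + 1) * (4 + 800 * l) + 22400) * b\<^sup>2 + 56 * (b * s)" using e3 by (simp add: algebra_simps)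
        also have "\<dots> < 344 * real c3 * b\<^sup>2 + 56 * (b * s)" using mult_strict_right_mono[OF c3, of "b\<^sup>2"] b by simp
        also have "\<dots> \<le> 344 * (b * s) + 56 * (b * s)"
        proof -
          have "real c3 * b * b \<le> s * b" using s b by (intro mult_right_mono) auto
          then show ?thesis by (simp add: power2_eq_square algebra_simps)
        qed
        finally show ?thesis unfolding rRS by simp
      qed
      also have "\<dots> = exp 1 ^ (R * S)" using exp_of_nat_mult[of "R * S" "1::real"] by simp
      also have "\<dots> \<le> 6 ^ (R * S)" using exp_le by (intro power_mono) auto
      finally show ?thesis .
    qed
    define \<delta> where "\<delta> = exp (- (b ^ 3))"
    have est2: "3 * (\<Lambda> * H) ^ D * (3 * real (R * A) * (8 * real T) ^ (R * A) * (real (A * B) * H * real T ^ A * real (R * B) * \<delta>)) \<le> 1"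
    proof -
      have RA: "real (R * A) = 400 * real a * b\<^sup>2" unfolding R_def A_def b_def by (simp add: power2_eq_square)
      have x2: "b\<^sup>2 = exp (2 * ln b)" using exp_of_nat_mult[of 2 "ln b"] b by simp
      have f1: "3 * real (R * A) = exp (ln (1200 * real a) + 2 * ln b)" unfolding RA exp_add x2[symmetric] using a0 by simp
      have f2: "real (R * B) = exp (ln 400 + 2 * ln b)" unfolding RB exp_add x2[symmetric] by simp
      have f3: "(8 * real T) ^ (R * A) = exp (real (R * A) * (ln 8 + t))" unfolding exp_of_nat_mult exp_add T by simp
      have f4: "real (R * A) * (ln 8 + t) \<le> b ^ 3 / 2"
      proof -
        have "800 * real a * (ln 8 + t) * b\<^sup>2 \<le> b * b\<^sup>2" using e1 by (intro mult_right_mono) auto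
        then show ?thesis unfolding RA by (simp add: algebra_simps power2_eq_square power3_eq_cube)
      qed
      have q2: "real (A * B) * H * real T ^ A * real (R * B) * \<delta> \<le> exp Y * exp (ln 400 + 2 * ln b) * exp (- (b ^ 3))"
        unfolding f2 \<delta>_def using ABT by (intro mult_right_mono) auto
      have "3 * (\<Lambda> * H) ^ D * (3 * real (R * A) * (8 * real T) ^ (R * A) * (real (A * B) * H * real T ^ A * real (R * B) * \<delta>))
         \<le> exp (2 + real D * Y) * (exp (ln (1200 * real a) + 2 * ln b) * exp (real (R * A) * (ln 8 + t)) * (exp Y * exp (ln 400 + 2 * ln b) * exp (- (b ^ 3))))"
        unfolding f1 f3 by (rule mult_mono[OF Q mult_left_mono[OF q2]]) (auto simp: \<delta>_def)
      also have "\<dots> = exp ((2 + real D * Y) + ((ln (1200 * real a) + 2 * ln b) + real (R * A) * (ln 8 + t) + (Y + (ln 400 + 2 * ln b) + - (b ^ 3))))"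
        by (simp only: exp_add)
      also have "\<dots> \<le> exp 0"
      proof -
        have "real D * Y + Y = (real D + 1) * Y" by (simp add: algebra_simps)
        then show ?thesis using e4 f4 unfolding Y_def[symmetric] by simp
      qed
      finally show ?thesis by simp
    qed
    interpret schneider \<gamma> A B R S0 n k T D H E \<delta> \<Lambda>
    proof
      show "A * B = 4 * (D + 1) * (R * S0)" unfolding A_def R_def S0_def a_def by (simp add: algebra_simps)
      show "1 \<le> B" "B \<le> R" using B8 unfolding R_def by auto
      show "R \<le> n"
      proof -
        have "8 * 8 * 8 \<le> B * B * B" using B8 by (intro mult_le_mono) auto
        then have "400 \<le> B * B * B" by linarith
        then have "400 * B \<le> B * B * B * B" by (rule mult_le_mono1)
        also have "B * B * B * B = B ^ 4" by (simp add: eval_nat_numeral)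
        finally show ?thesis unfolding R_def using n by linarith
      qed
      show "1 \<le> S0" unfolding S0_def c3_def using B8 by simp
      have "n * ((400 + a) * B) \<le> (B + 1) ^ 4 * ((400 + a) * B)" using n(2) by (intro mult_le_mono1) simp
      then show "n * (R + A) \<le> T" unfolding T_def R_def A_def by (simp add: algebra_simps)
      show "norm (exp (2 * of_real pi * \<i> / of_nat n * of_nat k) - \<gamma>) \<le> \<delta>" using close unfolding \<delta>_def b_def .
    qed (use g liou D E k H \<Lambda>_def est1 est2 in auto)
    show False by (rule contradiction)
  qed
  then show ?thesis by blast
qed

section \<open>From distances to roots of unity to powers near 1 on the unit circle\<close>

lemma exists_primitive_order:
  assumes "(z::complex) ^ n = 1" "n > 0"
  obtains m where "primitive_root_of_unity m z" "m dvd n" "0 < m" "m \<le> n"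
proof -
  define m where "m = (LEAST m. 0 < m \<and> z ^ m = 1)"
  have m: "0 < m \<and> z ^ m = 1" unfolding m_def by (rule LeastI[of "\<lambda>m. 0 < m \<and> z ^ m = 1" n]) (use assms in auto)
  have least: "m \<le> j" if "0 < j" "z ^ j = 1" for j unfolding m_def by (rule Least_le) (use that in auto)
  have "z ^ j \<noteq> 1" if j: "0 < j" "j < m" for j
  proof
    assume "z ^ j = 1"
    then show False using least[OF j(1)] j(2) by simp
  qed
  then have pr: "primitive_root_of_unity m z" unfolding primitive_root_of_unity_def using m by blast
  have "m dvd n" by (rule primitive_dvd[OF pr assms(1)])
  then show thesis using that pr m dvd_imp_le assms(2) by blast
qed

lemma primitive_root_exp:
  assumes pr: "primitive_root_of_unity m z"
  obtains k where "coprime k m" "k \<le> m" "z = exp (2 * of_real pi * \<i> / of_nat m * of_nat k)"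
proof -
  have m: "m > 0" "z ^ m = 1" using pr unfolding primitive_root_of_unity_def by auto
  then have "1 \<le> m" by simp
  from complex_roots_unity[OF this] m(2) obtain k where k: "z = exp (2 * of_real pi * \<i> * of_nat k / of_nat m)" "k < m" by auto
  define d where "d = gcd k m"
  obtain m' where m': "m = d * m'" unfolding d_def by (metis dvdE gcd_dvd2)
  obtain k' where k': "k = d * k'" unfolding d_def by (metis dvdE gcd_dvd1)
  have d0: "d > 0" unfolding d_def using m(1) by simp
  have m'0: "m' > 0" using m(1) m' by (cases m') auto
  have "z ^ m' = exp (of_nat m' * (2 * of_real pi * \<i> * of_nat k / of_nat m))" unfolding k(1) exp_of_nat_mult ..
  also have "of_nat m' * (2 * of_real pi * \<i> * of_nat k / of_nat m) = of_nat k' * (2 * of_real pi * \<i>)"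
    unfolding m' k' using d0 m'0 by simp
  also have "exp \<dots> = 1" unfolding exp_of_nat_mult by simp
  finally have "m dvd m'" by (rule primitive_dvd[OF pr])
  then have "d * m' \<le> m'" using dvd_imp_le[OF _ m'0] m' by simp
  then have "d = 1" using d0 m'0 by simp
  then have cop: "coprime k m" unfolding d_def coprime_iff_gcd_eq_1 .
  have "z = exp (2 * of_real pi * \<i> / of_nat m * of_nat k)" unfolding k(1) by simp
  then show thesis by (rule that[OF cop less_imp_le[OF k(2)]])
qed

text \<open>\<open>\<gamma>\<close> is rotated by \<open>- \<phi> / n\<close>, where
  \<open>\<phi>\<close> is the argument of \<open>\<gamma> ^ n\<close>; this argument is at most
  twice the distance of \<open>\<gamma> ^ n\<close> from 1.\<close>

lemma nearest_root_of_unity: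
  fixes \<gamma> :: complex
  assumes g: "norm \<gamma> = 1" and n: "n > 0" and small: "norm (\<gamma> ^ n - 1) < 1 / 2"
  obtains z where "z ^ n = 1" "norm (z - \<gamma>) \<le> 2 * norm (\<gamma> ^ n - 1)"
proof -
  define x where "x = \<gamma> ^ n"
  have x0: "x \<noteq> 0" unfolding x_def using g by auto
  have nx: "norm x = 1" unfolding x_def by (simp add: norm_power g)
  define \<phi> where "\<phi> = Im (Ln x)"
  have "Re (Ln x) = 0" using Re_Ln[OF x0] nx by simp
  then have L: "Ln x = \<i> * of_real \<phi>" unfolding \<phi>_def by (simp add: complex_eq_iff)
  have "norm (Ln (1 + (x - 1))) \<le> 2 * norm (x - 1)" by (rule norm_Ln_le) (use small in \<open>simp add: x_def\<close>)
  then have \<phi>: "\<bar>\<phi>\<bar> \<le> 2 * norm (x - 1)" unfolding L by (simp add: L norm_mult)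
  define z where "z = \<gamma> * exp (\<i> * of_real (- \<phi> / n))"
  have "exp (\<i> * of_real (- \<phi> / n)) ^ n = exp (of_nat n * (\<i> * of_real (- \<phi> / n)))" by (rule exp_of_nat_mult[symmetric])
  also have "of_nat n * (\<i> * of_real (- \<phi> / n)) = - Ln x" unfolding L using n by simp
  also have "exp (- Ln x) = inverse x" by (simp add: exp_minus x0)
  finally have "z ^ n = 1" unfolding z_def power_mult_distrib using x0 unfolding x_def by simp
  moreover have "norm (z - \<gamma>) \<le> 2 * norm (\<gamma> ^ n - 1)"
  proof -
    have "z - \<gamma> = \<gamma> * (exp (\<i> * of_real (- \<phi> / n)) - 1)" unfolding z_def by (simp add: algebra_simps)
    then have "norm (z - \<gamma>) = 2 * \<bar>sin (- \<phi> / n / 2)\<bar>" by (simp only: norm_mult g dist_exp_i_1 mult_1)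
    also have "\<dots> \<le> 2 * \<bar>- \<phi> / n / 2\<bar>" by (intro mult_left_mono abs_sin_x_le_abs_x) simp
    also have "\<dots> = \<bar>\<phi>\<bar> / n" by (simp add: abs_divide)
    also have "\<dots> \<le> \<bar>\<phi>\<bar> / 1" using n by (intro divide_left_mono) auto
    finally show ?thesis using \<phi> unfolding x_def by simp
  qed
  ultimately show thesis by (rule that)
qed

text \<open>If \<open>\<gamma> ^ n\<close> is near 1, then \<open>\<gamma>\<close> is near an
  \<open>n\<close>-th root of unity. Its exact order \<open>m\<close> is at most \<open>n\<close>,
  and at level \<open>m\<close> its exponent is prime to \<open>m\<close>, as the Schneider estimate
  demands.\<close>

lemma unit_circle_lower_bound:
  fixes \<gamma> :: complex
  assumes alg: "algebraic \<gamma>" and g: "norm \<gamma> = 1" "\<And>m. m > 0 \<Longrightarrow> \<gamma> ^ m \<noteq> 1"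
  shows "\<exists>C\<ge>0. \<forall>n>0. ln (norm (\<gamma> ^ n - 1)) \<ge> - (C * real n powr (3/4))"
proof -
  obtain B0 where B0: "\<And>B n k. B \<ge> B0 \<Longrightarrow> B ^ 4 \<le> n \<Longrightarrow> n < (B + 1) ^ 4 \<Longrightarrow> coprime k n \<Longrightarrow> k \<le> n \<Longrightarrow>
     norm (exp (2 * of_real pi * \<i> / of_nat n * of_nat k) - \<gamma>) > exp (- (real B ^ 3))"
    using root_of_unity_distance_coprime[OF assms] by blast
  define Z where "Z = (\<Union>m\<in>{0<..<B0 ^ 4}. {z::complex. z ^ m = 1})"
  have Z: "finite Z" unfolding Z_def by (intro finite_UN_I) (auto intro: prod_unity_roots(1))
  \<comment> \<open>Orders below \<open>B0 ^ 4\<close> escape the Schneider estimate; their finitely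
    many roots keep a positive distance from \<open>\<gamma>\<close>, which is not a root of unity.
    The inserted 1 covers an empty \<open>Z\<close> and gives \<open>e <= 1\<close>.\<close>
  define e where "e = Min (insert 1 ((\<lambda>z. norm (z - \<gamma>)) ` Z))"
  have ez: "e \<le> norm (z - \<gamma>)" if "z \<in> Z" for z unfolding e_def using Z that by auto
  have e1: "e \<le> 1" unfolding e_def using Z by simp
  have "e \<in> insert 1 ((\<lambda>z. norm (z - \<gamma>)) ` Z)" unfolding e_def using Z by (intro Min_in) auto
  moreover have "z \<noteq> \<gamma>" if z: "z \<in> Z" for z using z g(2) unfolding Z_def by auto
  ultimately have e0: "e > 0" by auto
  have dist: "e * exp (- (real n powr (3/4))) \<le> norm (z - \<gamma>)" if z: "z ^ n = 1" and n: "n > 0" for z n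
  proof -
    obtain m where m: "primitive_root_of_unity m z" "m dvd n" "0 < m" "m \<le> n" using exists_primitive_order[OF z n] by blast
    have zm: "z ^ m = 1" using m(1) unfolding primitive_root_of_unity_def by auto
    show ?thesis
    proof (cases "m < B0 ^ 4")
      case True
      then have "z \<in> Z" unfolding Z_def using m(3) zm by auto
      then have "e * 1 \<le> norm (z - \<gamma>)" using ez by simp
      moreover have "e * exp (- (real n powr (3/4))) \<le> e * 1" using e0 by (intro mult_left_mono) auto
      ultimately show ?thesis by linarith
    next
      case False
      \<comment> \<open>The integer part of the fourth root of \<open>m\<close>.\<close>
      define B where "B = (LEAST b. m < (b + 1) ^ 4)"
      have "m < (m + 1) ^ 4" using power_increasing[of 1 4 "m + 1"] by simp
      then have B1: "m < (B + 1) ^ 4" unfolding B_def by (rule LeastI[of "\<lambda>b. m < (b + 1) ^ 4"])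
      have B2: "B ^ 4 \<le> m"
      proof (cases B)
        case (Suc b)
        then have "\<not> m < (b + 1) ^ 4" using not_less_Least[of b "\<lambda>b. m < (b + 1) ^ 4"] unfolding B_def by simp
        then show ?thesis using Suc by simp
      qed simp
      have "B0 ^ 4 < (B + 1) ^ 4" using False B1 by linarith
      then have "B0 < B + 1" by (rule power_less_imp_less_base) simp
      then have BB: "B \<ge> B0" by simp
      obtain k where k: "coprime k m" "k \<le> m" "z = exp (2 * of_real pi * \<i> / of_nat m * of_nat k)" using primitive_root_exp[OF m(1)] by blast
      have lt: "exp (- (real B ^ 3)) < norm (z - \<gamma>)" unfolding k(3) by (rule B0[OF BB B2 B1 k(1,2)])
      have "real B ^ 3 \<le> real n powr (3/4)"
      proof (cases "B = 0")
        case False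
        have "B ^ 4 \<le> n" using B2 m(4) by linarith
        then have "real B ^ 4 \<le> real n" by (metis of_nat_le_iff of_nat_power)
        then have "(real B ^ 4) powr (3/4) \<le> real n powr (3/4)" by (intro powr_mono2) auto
        moreover have "(real B ^ 4) powr (3/4) = real B powr (4 * (3/4))" using False powr_realpow[of "real B" 4] powr_powr[of "real B" 4 "3/4"] by simp
        moreover have "real B powr (4 * (3/4)) = real B ^ 3" using False powr_realpow[of "real B" 3] by simp
        ultimately show ?thesis by simp
      qed simp
      then have "exp (- (real n powr (3/4))) \<le> exp (- (real B ^ 3))" by simp
      moreover have "e * exp (- (real n powr (3/4))) \<le> 1 * exp (- (real n powr (3/4)))" using e1 by (intro mult_right_mono) auto
      ultimately show ?thesis using lt by linarith
    qed
  qed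
  define C where "C = 1 + ln 2 - ln e"
  have lne: "ln e \<le> 0" using e0 e1 by simp
  have ln2: "ln (2::real) \<ge> 0" by simp
  have C0: "C \<ge> 0" unfolding C_def using lne ln2 by linarith
  have "ln (norm (\<gamma> ^ n - 1)) \<ge> - (C * real n powr (3/4))" if n: "n > 0" for n
  proof -
    define y where "y = real n powr (3/4)"
    have y1: "y \<ge> 1" unfolding y_def using n by (intro ge_one_powr_ge_zero) auto
    have "e * exp (- y) / 2 \<le> norm (\<gamma> ^ n - 1)"
    proof (cases "norm (\<gamma> ^ n - 1) < 1 / 2")
      case True
      obtain z where z: "z ^ n = 1" "norm (z - \<gamma>) \<le> 2 * norm (\<gamma> ^ n - 1)" using nearest_root_of_unity[OF g(1) n True] by blast
      then show ?thesis using dist[OF z(1) n] unfolding y_def by simp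
    next
      case False
      have "e * exp (- y) \<le> 1 * 1" using e0 e1 y1 by (intro mult_mono) auto
      then show ?thesis using False by linarith
    qed
    then have "ln (e * exp (- y) / 2) \<le> ln (norm (\<gamma> ^ n - 1))" using e0 by (intro ln_mono) auto
    moreover have "ln (e * exp (- y) / 2) = ln e - y - ln 2" using e0 by (simp add: ln_mult ln_div)
    moreover have "(ln 2 - ln e) * 1 \<le> (ln 2 - ln e) * y" using y1 ln2 lne by (intro mult_left_mono) linarith+
    ultimately show ?thesis unfolding C_def y_def[symmetric] by (simp add: algebra_simps)
  qed
  then show ?thesis using C0 by blast
qed

section \<open>The p-adic distance of powers from 1\<close>

context padic begin

text \<open>In the expansion of \<open>(1 + t) ^ n\<close> the linear term dominates. From
  \<open>k (n choose k) = n ((n - 1) choose (k - 1))\<close> the coefficient is at most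
  \<open>k\<close> times as large as \<open>n\<close>, and \<open>k <= p ^ (k - 1)\<close> is beaten
  by the powers of \<open>w t < 1 / p\<close>.\<close>

lemma w_binomial_close:
  assumes b: "algebraic b" "b \<noteq> 1" "w (b - 1) < 1 / real p" and n: "n > 0"
  shows "w (b ^ n - 1) = w (of_nat n) * w (b - 1)"
proof -
  define t where "t = b - 1"
  have t: "algebraic t" "t \<noteq> 0" "w t < 1 / real p" using b unfolding t_def by (auto simp: alg_closed)
  have wt: "w t > 0" using w_nonneg[OF t(1)] w_eq_0[OF t(1)] t(2) by linarith
  have wn: "w (of_nat n) > 0" using w_nat_ge[OF n] n by (smt (verit) divide_pos_pos of_nat_0_less_iff)
  define U where "U k = of_nat (n choose k) * t ^ k" for k
  have "b ^ n = (t + 1) ^ n" unfolding t_def by simp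
  also have "\<dots> = (\<Sum>k\<le>n. U k)" unfolding binomial_ring U_def by simp
  also have "{..n} = insert 0 (insert 1 {2..n})" using n by auto
  also have "sum U (insert 0 (insert 1 {2..n})) = U 0 + (U 1 + sum U {2..n})" by simp
  finally have e: "b ^ n - 1 = sum U {2..n} + of_nat n * t" unfolding U_def by simp
  have Uk: "algebraic (U k) \<and> w (U k) < w (of_nat n) * w t" if k: "k \<in> {2..n}" for k
  proof
    show "algebraic (U k)" unfolding U_def using t by (simp add: alg_closed)
    have k0: "k > 0" using k by auto
    have "k * (n choose k) = n * ((n - 1) choose (k - 1))" using k0 n by (simp add: times_binomial_minus1_eq)
    then have "(of_nat k :: complex) * of_nat (n choose k) = of_nat n * of_nat ((n - 1) choose (k - 1))" by (metis of_nat_mult)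
    then have "w (of_nat k) * w (of_nat (n choose k)) = w (of_nat n) * w (of_nat ((n - 1) choose (k - 1)))"
      by (metis w_mult algebraic_of_nat)
    also have "\<dots> \<le> w (of_nat n) * 1" using wn by (intro mult_left_mono w_nat_le) auto
    finally have c: "w (of_nat k) * w (of_nat (n choose k)) \<le> w (of_nat n)" by simp
    have wc0: "w (of_nat (n choose k)) \<ge> 0" by (rule w_nonneg) simp
    have "1 / real k * w (of_nat (n choose k)) \<le> w (of_nat k) * w (of_nat (n choose k))" by (rule mult_right_mono[OF w_nat_ge[OF k0] wc0])
    then have "1 / real k * w (of_nat (n choose k)) \<le> w (of_nat n)" using c by linarith
    then have "real k * (1 / real k * w (of_nat (n choose k))) \<le> real k * w (of_nat n)" by (rule mult_left_mono) simp
    then have c2: "w (of_nat (n choose k)) \<le> real k * w (of_nat n)" using k0 by simp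
    have "real k * w t ^ (k - 1) < 1"
    proof -
      have "k \<le> 2 ^ (k - 1)" using k0
      proof (induct k rule: nat_induct_non_zero)
        case (Suc m)
        then show ?case using Suc by (cases m) auto
      qed simp
      then have "real k \<le> 2 ^ (k - 1)" by (metis of_nat_le_iff of_nat_numeral of_nat_power)
      also have "\<dots> \<le> real p ^ (k - 1)" using prime_ge_2_nat[OF p] by (intro power_mono) auto
      finally have kp: "real k \<le> real p ^ (k - 1)" .
      have "w t ^ (k - 1) < (1 / real p) ^ (k - 1)" using t(3) wt k by (intro power_strict_mono) auto
      then have "real k * w t ^ (k - 1) < real k * (1 / real p) ^ (k - 1)" using k0 by simp
      also have "\<dots> \<le> real p ^ (k - 1) * (1 / real p) ^ (k - 1)" using kp p1 by (intro mult_right_mono) auto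
      also have "\<dots> = 1" using p1 by (simp add: power_one_over)
      finally show ?thesis .
    qed
    then have lt: "(real k * w t ^ (k - 1)) * (w (of_nat n) * w t) < 1 * (w (of_nat n) * w t)" using wn wt by (intro mult_strict_right_mono) auto
    have "w (U k) = w (of_nat (n choose k)) * w t ^ k" unfolding U_def using t by (simp add: w_mult w_pow alg_closed)
    also have "\<dots> \<le> real k * w (of_nat n) * w t ^ k" using c2 wt by (intro mult_right_mono) auto
    also have "w t ^ k = w t ^ (k - 1) * w t" by (rule power_minus_mult[OF k0, symmetric])
    finally show "w (U k) < w (of_nat n) * w t" using lt by (simp add: mult_ac)
  qed
  have "w (sum U {2..n}) < w (of_nat n * t)"
    using w_sum_less[of "{2..n}" U "w (of_nat n) * w t"] Uk wn wt t(1) by (simp add: w_mult)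
  moreover have "algebraic (sum U {2..n})" by (rule alg_sum) (use Uk in blast)
  moreover have "algebraic (of_nat n * t)" using t(1) by (simp add: alg_closed)
  ultimately have "w (b ^ n - 1) = w (of_nat n * t)" unfolding e by (intro w_add_eq)
  then show ?thesis using t(1) unfolding t_def by (simp add: w_mult alg_closed)
qed

text \<open>Either some power \<open>b = g ^ m\<close> lies in the disc of the binomial estimate,
  and \<open>g ^ n - 1\<close> divides \<open>b ^ n - 1\<close> with an integral cofactor, or all
  positive powers stay at distance at least \<open>1 / p\<close> from 1.\<close>

lemma w_power_minus_one_lower:
  assumes g: "algebraic g" "w g = 1" "\<And>m. m > 0 \<Longrightarrow> g ^ m \<noteq> 1"
  shows "\<exists>c>0. \<forall>n>0. w (g ^ n - 1) \<ge> c / real n"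
proof (cases "\<exists>m>0. w (g ^ m - 1) < 1 / real p")
  case True
  then obtain m where m: "m > 0" "w (g ^ m - 1) < 1 / real p" by blast
  define b where "b = g ^ m"
  have b: "algebraic b" "b \<noteq> 1" "w (b - 1) < 1 / real p" using g m unfolding b_def by (auto simp: alg_closed)
  have b1: "algebraic (b - 1)" using b(1) by (simp add: alg_closed)
  have c0: "w (b - 1) > 0" using w_nonneg[OF b1] w_eq_0[OF b1] b(2) by simp
  have "w (g ^ n - 1) \<ge> w (b - 1) / real n" if n: "n > 0" for n
  proof -
    have ga: "algebraic (g ^ n - 1)" using g(1) by (simp add: alg_closed)
    have "b ^ n = (g ^ n) ^ m" unfolding b_def by (simp add: power_mult[symmetric] mult.commute)
    then have "b ^ n - 1 = (g ^ n - 1) * (\<Sum>i<m. (g ^ n) ^ i)" using power_diff_1_eq[of "g ^ n" m] by simp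
    moreover have sa: "algebraic (\<Sum>i<m. (g ^ n) ^ i)" by (rule alg_sum) (simp add: g alg_closed)
    ultimately have "w (b ^ n - 1) = w (g ^ n - 1) * w (\<Sum>i<m. (g ^ n) ^ i)" using w_mult[OF ga sa] by simp
    also have "\<dots> \<le> w (g ^ n - 1) * 1"
    proof (rule mult_left_mono[OF _ w_nonneg[OF ga]])
      show "w (\<Sum>i<m. (g ^ n) ^ i) \<le> 1" by (rule w_sum_le) (use g in \<open>simp_all add: alg_closed w_pow\<close>)
    qed
    finally have "w (of_nat n) * w (b - 1) \<le> w (g ^ n - 1)" unfolding w_binomial_close[OF b n] by simp
    moreover have "1 / real n * w (b - 1) \<le> w (of_nat n) * w (b - 1)" using c0 by (intro mult_right_mono w_nat_ge[OF n]) auto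
    ultimately show ?thesis by simp
  qed
  then show ?thesis using c0 by blast
next
  case False
  have "w (g ^ n - 1) \<ge> (1 / real p) / real n" if n: "n > 0" for n
  proof -
    have "(1 / real p) / real n \<le> (1 / real p) / 1" using n p1 by (intro divide_left_mono) auto
    moreover have "\<not> w (g ^ n - 1) < 1 / real p" using False n by blast
    ultimately show ?thesis by simp
  qed
  moreover have "1 / real p > 0" using p1 by simp
  ultimately show ?thesis by blast
qed

end

subsection \<open>Local lower bounds\<close>

text \<open>Otherwise one of \<open>g\<close> and \<open>inverse g\<close> would have absolute value
  above 1 and dominate the sum.\<close>

lemma (in padic) w_trace_unit:
  assumes g: "algebraic g" "g \<noteq> 0" "w (g + inverse g) \<le> 1" shows "w g = 1"
proof -
  have i: "algebraic (inverse g)" "w (inverse g) = inverse (w g)" using g(1) w_inverse by (auto simp: alg_closed)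
  have p0: "w g > 0" using w_pos g by simp
  have "\<not> w g > 1"
  proof
    assume h: "w g > 1"
    then have "w (inverse g) < w g" unfolding i(2) using less_trans[OF inverse_less_1_iff[THEN iffD2] h] by auto
    then show False using w_add_eq[OF i(1) g(1)] h g(3) by (simp add: add.commute)
  qed
  moreover have "\<not> w g < 1"
  proof
    assume h: "w g < 1"
    then have h': "w (inverse g) > 1" unfolding i(2) using p0 by (simp add: one_less_inverse_iff)
    then show False using w_add_eq[OF g(1) i(1)] h g(3) by simp
  qed
  ultimately show ?thesis by linarith
qed

text \<open>Denominators are cleared in \<open>P(x + inverse x)\<close> by the factor
  \<open>x ^ d\<close>. The resulting \<open>Q\<close> is nonzero because every complex number is of
  the form \<open>x + inverse x\<close>.\<close>

lemma algebraic_trace_root: assumes a: "algebraic (g + inverse g)" and g: "g \<noteq> 0" shows "algebraic (g :: complex)"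
proof -
  obtain P where P: "P \<in> polys_over \<rat>" "P \<noteq> 0" "poly P (g + inverse g) = 0" using a algebraic_polys_over by blast
  define d where "d = degree P"
  define Q where "Q = (\<Sum>i\<le>d. smult (coeff P i) ([:1, 0, 1:] ^ i * monom 1 (d - i)))"
  have c: "coeff P i \<in> \<rat>" for i using P(1) by (simp add: polys_over_def)
  have "smult (coeff P i) ([:1, 0, 1:] ^ i * monom 1 (d - i)) \<in> polys_over \<rat>" for i
    by (intro Rats.PKsmult Rats.PKmult Rats.PKpower Rats.PKmonom Rats.PKpCons Rats.PK0 c) auto
  then have QQ: "Q \<in> polys_over \<rat>" unfolding Q_def polys_over_def by (auto simp: coeff_sum simp del: coeff_smult intro!: Rats.Ksum)
  have pQ: "poly Q x = x ^ d * poly P (x + inverse x)" if x: "x \<noteq> 0" for x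
  proof -
    have "poly Q x = (\<Sum>i\<le>d. coeff P i * ((1 + x * x) ^ i * x ^ (d - i)))" unfolding Q_def by (simp add: poly_sum poly_monom)
    also have "\<dots> = (\<Sum>i\<le>d. x ^ d * (coeff P i * (x + inverse x) ^ i))"
    proof (rule sum.cong[OF refl])
      fix i assume i: "i \<in> {..d}"
      have "1 + x * x = x * (x + inverse x)" using x by (simp add: algebra_simps)
      then have "(1 + x * x) ^ i = x ^ i * (x + inverse x) ^ i" by (simp only: power_mult_distrib)
      moreover have "x ^ d = x ^ i * x ^ (d - i)" using i by (simp add: power_add[symmetric])
      ultimately show "coeff P i * ((1 + x * x) ^ i * x ^ (d - i)) = x ^ d * (coeff P i * (x + inverse x) ^ i)" by (simp only: mult_ac)
    qed
    also have "\<dots> = x ^ d * poly P (x + inverse x)" unfolding sum_distrib_left[symmetric] d_def poly_altdef ..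
    finally show ?thesis .
  qed
  have "Q \<noteq> 0"
  proof
    assume Q0: "Q = 0"
    have "poly P y = 0" for y
    proof -
      obtain x where x: "x \<noteq> 0" "y = x + inverse x" using exists_plus_inverse by blast
      then show ?thesis using pQ[OF x(1)] Q0 by simp
    qed
    then show False using P(2) poly_all_0_iff_0 by blast
  qed
  moreover have "poly Q g = 0" using pQ[OF g] P(3) by simp
  ultimately show ?thesis using alg_root[OF QQ] by blast
qed

lemma ln_le_powr: assumes "n > 0" shows "ln (real n) \<le> 4/3 * real n powr (3/4)"
proof -
  have "ln (real n powr (3/4)) \<le> real n powr (3/4) - 1" by (rule ln_le_minus_one) (use assms in simp)
  moreover have "ln (real n powr (3/4)) = 3/4 * ln (real n)" using assms by (simp add: ln_powr)
  ultimately show ?thesis by linarith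
qed

context prim_field begin

text \<open>Off the circle the logarithmic series loses only a multiple of \<open>sqrt n\<close>. On
  the circle the local height is 0 and the transcendence bound is required.\<close>

lemma arch_bound:
  assumes t: "t \<in> \<Theta>" and a: "\<alpha> \<in> K" and g: "emb t \<alpha> = \<gamma> + inverse \<gamma>" "norm \<gamma> \<ge> 1" "algebraic \<gamma>" "\<And>m. m > 0 \<Longrightarrow> \<gamma> ^ m \<noteq> 1"
  shows "\<exists>C. C \<ge> 0 \<and> (\<forall>n \<zeta> f. trace_conj K \<theta> q n \<zeta> f \<longrightarrow> emb t (poly f \<alpha>) \<noteq> 0 \<longrightarrow>
     ln (norm (emb t (poly f \<alpha>))) \<ge> real (degree f) * ln (norm \<gamma>) - C * real n powr (3/4))"
proof (cases "norm \<gamma> = 1")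
  case True
  obtain C where C: "C \<ge> 0" "\<And>n. n > 0 \<Longrightarrow> ln (norm (\<gamma> ^ n - 1)) \<ge> - (C * real n powr (3/4))"
    using unit_circle_lower_bound[OF g(3) True g(4)] by blast
  have "ln (norm (emb t (poly f \<alpha>))) \<ge> real (degree f) * ln (norm \<gamma>) - (C + 2) * real n powr (3/4)"
    if h: "trace_conj K \<theta> q n \<zeta> f" and nz: "emb t (poly f \<alpha>) \<noteq> 0" for n \<zeta> f
  proof -
    interpret T: trace_conj K \<theta> q n \<zeta> f by (rule h)
    have e: "poly (memb t f) (\<gamma> + inverse \<gamma>) = emb t (poly f \<alpha>)" using memb_poly[OF t T.fK a] g(1) by simp
    have "ln (norm (emb t (poly f \<alpha>))) \<ge> ln (norm (\<gamma> ^ n - 1)) - 2 * real n powr (3/4)"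
      using T.ln_circle[OF t True g(4)[OF T.z(2)]] nz unfolding e by blast
    then show ?thesis using C(2)[OF T.z(2)] True by (simp add: algebra_simps)
  qed
  then show ?thesis using C(1) by (intro exI[of _ "C + 2"]) auto
next
  case False
  then have g1: "norm \<gamma> > 1" using g(2) by linarith
  define C where "C = 1 / (1 - 1 / norm \<gamma>)"
  have C0: "C \<ge> 0" unfolding C_def using g1 by (simp add: divide_le_eq)
  have "ln (norm (emb t (poly f \<alpha>))) \<ge> real (degree f) * ln (norm \<gamma>) - C * real n powr (3/4)"
    if h: "trace_conj K \<theta> q n \<zeta> f" and nz: "emb t (poly f \<alpha>) \<noteq> 0" for n \<zeta> f
  proof -
    interpret T: trace_conj K \<theta> q n \<zeta> f by (rule h)
    have e: "poly (memb t f) (\<gamma> + inverse \<gamma>) = emb t (poly f \<alpha>)" using memb_poly[OF t T.fK a] g(1) by simp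
    have 1: "ln (norm (emb t (poly f \<alpha>))) \<ge> real (degree f) * ln (norm \<gamma>) - sqrt (real n) / (1 - 1 / norm \<gamma>)"
      using T.ln_outside[OF t g1] nz unfolding e by blast
    have "sqrt (real n) = real n powr (1/2)" by (simp add: powr_half_sqrt)
    also have "\<dots> \<le> real n powr (3/4)" using T.z(2) by (intro powr_mono) auto
    finally have "C * sqrt (real n) \<le> C * real n powr (3/4)" using C0 by (rule mult_left_mono)
    then show ?thesis using 1 unfolding C_def by simp
  qed
  then show ?thesis using C0 by blast
qed

text \<open>Conjugate traces are sums of two units and have absolute value at most 1; where
  \<open>\<alpha>\<close> exceeds 1, every factor \<open>\<alpha> - y\<close> has the size of
  \<open>\<alpha>\<close>.\<close>

lemma padic_bound_large:
  assumes pw: "padic p w" and t: "t \<in> \<Theta>" and a: "\<alpha> \<in> K" and big: "w (emb t \<alpha>) > 1" and h: "trace_conj K \<theta> q n \<zeta> f"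
  shows "w (emb t (poly f \<alpha>)) = w (emb t \<alpha>) ^ degree f"
proof -
  interpret padic p w by (rule pw)
  interpret T: trace_conj K \<theta> q n \<zeta> f by (rule h)
  define Y where "Y = {y. poly (memb t f) y = 0}"
  have aa: "algebraic (emb t \<alpha>)" by (rule emb_alg[OF t a])
  have Y1: "algebraic y \<and> w y \<le> 1" if y: "y \<in> Y" for y
  proof -
    have c: "poly (cheb n - [:2:]) y = 0" by (rule T.memb_f_cheb[OF t]) (use y in \<open>simp add: Y_def\<close>)
    obtain r where r: "r \<noteq> 0" "y = r + inverse r" using exists_plus_inverse by blast
    have rn: "r ^ n = 1" using c cheb2_iff[OF r(1)] unfolding r(2) by blast
    have ra: "algebraic r" using norm_root_of_unity(4)[OF rn T.z(2)] .
    have wr: "w r = 1" by (rule w_unity[OF rn T.z(2) ra])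
    have ia: "algebraic (inverse r)" using ra by (rule alg_closed)
    have "w (inverse r) = 1" using w_inverse[OF ra] wr by simp
    then show ?thesis unfolding r(2) using w_add[OF ra ia] wr alg_closed(1)[OF ra ia] by simp
  qed
  have eq: "w (emb t \<alpha> - y) = w (emb t \<alpha>)" if y: "y \<in> Y" for y
  proof -
    have ya: "algebraic (- y)" "w (- y) = w y" using Y1[OF y] w_neg by (auto simp: alg_closed)
    have "w (- y + emb t \<alpha>) = w (emb t \<alpha>)" by (rule w_add_eq[OF ya(1) aa]) (use ya(2) Y1[OF y] big in linarith)
    then show ?thesis by simp
  qed
  note sp = simple_roots_product[OF memb_degree(2)[OF t T.fl] T.memb_f_simple[OF t]]
  have "emb t (poly f \<alpha>) = poly (memb t f) (emb t \<alpha>)" by (rule memb_poly[OF t T.fK a, symmetric])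
  also have "\<dots> = (\<Prod>y\<in>Y. emb t \<alpha> - y)" unfolding Y_def by (rule simple_roots_product(4)[OF memb_degree(2)[OF t T.fl] T.memb_f_simple[OF t]])
  finally have "w (emb t (poly f \<alpha>)) = (\<Prod>y\<in>Y. w (emb t \<alpha> - y))"
    using w_prod[of Y "\<lambda>y. emb t \<alpha> - y"] Y1 aa by (simp add: alg_closed)
  also have "\<dots> = w (emb t \<alpha>) ^ card Y" using eq by simp
  also have "card Y = degree f" using sp(2) memb_degree(1)[OF t T.fl] unfolding Y_def by simp
  finally show ?thesis .
qed

text \<open>Where \<open>\<alpha>\<close> is integral, the local height is 0 and
  \<open>\<gamma>\<close> is a unit. The product over \<open>Rt t\<close> is then at least the
  product over all \<open>n\<close>-th roots of unity, \<open>w (\<gamma> ^ n - 1)\<close>, because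
  the additional factors are at most 1; the loss \<open>ln n\<close> fits into the error
  term.\<close>

lemma padic_bound:
  assumes pw: "padic p w" and t: "t \<in> \<Theta>" and a: "\<alpha> \<in> K"
    and g: "emb t \<alpha> = \<gamma> + inverse \<gamma>" "\<gamma> \<noteq> 0" "algebraic \<gamma>" "\<And>m. m > 0 \<Longrightarrow> \<gamma> ^ m \<noteq> 1"
  shows "\<exists>C. C \<ge> 0 \<and> (\<forall>n \<zeta> f. trace_conj K \<theta> q n \<zeta> f \<longrightarrow> emb t (poly f \<alpha>) \<noteq> 0 \<longrightarrow>
     ln (w (emb t (poly f \<alpha>))) \<ge> real (degree f) * max 0 (ln (w (emb t \<alpha>))) - C * real n powr (3/4))"
proof (cases "w (emb t \<alpha>) > 1")
  case True
  have "ln (w (emb t (poly f \<alpha>))) \<ge> real (degree f) * max 0 (ln (w (emb t \<alpha>))) - 0 * real n powr (3/4)"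
    if h: "trace_conj K \<theta> q n \<zeta> f" for n \<zeta> f
    unfolding padic_bound_large[OF pw t a True h] using True by (simp add: ln_realpow)
  then show ?thesis by (intro exI[of _ 0]) blast
next
  case False
  interpret padic p w by (rule pw)
  have aa: "algebraic (emb t \<alpha>)" by (rule emb_alg[OF t a])
  have wg: "w \<gamma> = 1" by (rule w_trace_unit[OF g(3,2)]) (use False g(1) in simp)
  have m0: "max 0 (ln (w (emb t \<alpha>))) = 0"
  proof (cases "w (emb t \<alpha>) = 0")
    case False
    then have "w (emb t \<alpha>) > 0" using w_nonneg[OF aa] by linarith
    then show ?thesis using \<open>\<not> w (emb t \<alpha>) > 1\<close> by simp
  qed simp
  obtain c where c: "c > 0" "\<And>n. n > 0 \<Longrightarrow> w (\<gamma> ^ n - 1) \<ge> c / real n" using w_power_minus_one_lower[OF g(3) wg g(4)] by blast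
  define C where "C = \<bar>ln c\<bar> + 4/3"
  have "ln (w (emb t (poly f \<alpha>))) \<ge> real (degree f) * max 0 (ln (w (emb t \<alpha>))) - C * real n powr (3/4)"
    if h: "trace_conj K \<theta> q n \<zeta> f" and nz: "emb t (poly f \<alpha>) \<noteq> 0" for n \<zeta> f
  proof -
    interpret T: trace_conj K \<theta> q n \<zeta> f by (rule h)
    have e: "poly (memb t f) (\<gamma> + inverse \<gamma>) = emb t (poly f \<alpha>)" using memb_poly[OF t T.fK a] g(1) by simp
    have fa: "algebraic (emb t (poly f \<alpha>))" by (rule emb_alg[OF t PKpoly[OF T.fK a]])
    define U where "U = {r::complex. r ^ n = 1}"
    have U: "finite U" unfolding U_def by (rule prod_unity_roots(1)[OF T.z(2)])
    have Ua: "algebraic r \<and> w r = 1" if r: "r \<in> U" for r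
      using norm_root_of_unity(4)[of r n] w_unity[of r n] r T.z(2) unfolding U_def by simp
    have Ud: "algebraic (r - \<gamma>)" "w (r - \<gamma>) \<le> 1" if r: "r \<in> U" for r
      using Ua[OF r] g(3) w_diff[of r \<gamma>] wg by (auto simp: alg_closed)
    have R: "T.Rt t \<subseteq> U" unfolding U_def by (rule T.Rt_props(2)[OF t])
    have "w (\<gamma> ^ n - 1) = w (\<Prod>r\<in>U. \<gamma> - r)" unfolding U_def prod_unity_roots(2)[OF T.z(2)] ..
    also have "\<dots> = (\<Prod>r\<in>U. w (r - \<gamma>))" using w_prod[of U "\<lambda>r. \<gamma> - r"] Ua g(3) w_diff_commute by (simp add: alg_closed)
    also have "\<dots> = (\<Prod>r\<in>U - T.Rt t. w (r - \<gamma>)) * (\<Prod>r\<in>T.Rt t. w (r - \<gamma>))" by (rule prod.subset_diff[OF R U])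
    also have "\<dots> \<le> 1 * (\<Prod>r\<in>T.Rt t. w (r - \<gamma>))"
    proof (rule mult_right_mono)
      show "(\<Prod>r\<in>U - T.Rt t. w (r - \<gamma>)) \<le> 1" by (rule prod_le_1) (use Ud w_nonneg in auto)
      show "0 \<le> (\<Prod>r\<in>T.Rt t. w (r - \<gamma>))" by (rule prod_nonneg) (use Ud R w_nonneg in auto)
    qed
    also have "1 * (\<Prod>r\<in>T.Rt t. w (r - \<gamma>)) = w (\<Prod>r\<in>T.Rt t. r - \<gamma>)"
    proof -
      have "algebraic (r - \<gamma>)" if "r \<in> T.Rt t" for r using Ud(1) R that by blast
      then show ?thesis using w_prod[of "T.Rt t" "\<lambda>r. r - \<gamma>"] by simp
    qed
    also have "\<dots> = w (\<gamma> ^ degree f * emb t (poly f \<alpha>))" unfolding T.Rt_props(4)[OF t g(2)] e ..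
    also have "\<dots> = w (emb t (poly f \<alpha>))" using w_mult[OF alg_closed(7)[OF g(3)] fa] w_pow[OF g(3)] wg by simp
    finally have "c / real n \<le> w (emb t (poly f \<alpha>))" using c(2)[OF T.z(2)] by linarith
    moreover have cn: "c / real n > 0" using c T.z(2) by simp
    ultimately have "ln (c / real n) \<le> ln (w (emb t (poly f \<alpha>)))" by (subst ln_le_cancel_iff) auto
    moreover have "ln (c / real n) = ln c - ln (real n)" using c T.z(2) by (simp add: ln_div)
    moreover have "ln (real n) \<le> 4/3 * real n powr (3/4)" by (rule ln_le_powr[OF T.z(2)])
    moreover have "\<bar>ln c\<bar> * 1 \<le> \<bar>ln c\<bar> * real n powr (3/4)" using T.z(2) by (intro mult_left_mono ge_one_powr_ge_zero) auto
    moreover have "- \<bar>ln c\<bar> \<le> ln c" by simp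
    ultimately show ?thesis unfolding m0 C_def distrib_right mult_zero_right by linarith
  qed
  then show ?thesis by (intro exI[of _ C]) (auto simp: C_def)
qed

end

subsection \<open>The product formula\<close>

text \<open>Induction on the prime factors of \<open>N\<close>: a prime \<open>r\<close> contributes
  the factor 1 if it lies in \<open>Q\<close> and the factor \<open>r\<close> otherwise.\<close>

lemma prod_padic_nat:
  assumes Q: "finite Q" "\<And>p. p \<in> Q \<Longrightarrow> prime p" and W: "\<And>p. prime p \<Longrightarrow> padic p (W p)"
  shows "N > 0 \<Longrightarrow> 1 \<le> real N * (\<Prod>p\<in>Q. W p (of_nat N)) \<and>
     ((\<forall>p. prime p \<longrightarrow> p dvd N \<longrightarrow> p \<in> Q) \<longrightarrow> real N * (\<Prod>p\<in>Q. W p (of_nat N)) = 1)"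
proof (induct N rule: less_induct)
  case (less N)
  show ?case
  proof (cases "N = 1")
    case True
    have "(\<Prod>p\<in>Q. W p 1) = 1" by (rule prod.neutral) (use Q(2) W padic.w_1 in blast)
    then show ?thesis using True by simp
  next
    case False
    then obtain r where r: "prime r" "r dvd N" using prime_factor_nat by blast
    obtain M where M: "N = r * M" using r(2) by blast
    have M0: "M > 0" "M < N" using M less(2) prime_gt_1_nat[OF r(1)] by (auto intro: Nat.gr0I)
    have "(\<Prod>p\<in>Q. W p (of_nat N)) = (\<Prod>p\<in>Q. W p (of_nat r) * W p (of_nat M))"
      unfolding M of_nat_mult by (rule prod.cong[OF refl], rule padic.w_mult[OF W[OF Q(2)]]) auto
    also have "\<dots> = (\<Prod>p\<in>Q. W p (of_nat r)) * (\<Prod>p\<in>Q. W p (of_nat M))" by (rule prod.distrib)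
    also have "(\<Prod>p\<in>Q. W p (of_nat r)) = (\<Prod>p\<in>Q. if p = r then 1 / real r else 1)"
    proof (rule prod.cong[OF refl])
      fix p assume pQ: "p \<in> Q"
      interpret padic p "W p" by (rule W[OF Q(2)[OF pQ]])
      show "W p (of_nat r) = (if p = r then 1 / real r else 1)"
      proof (cases "p = r")
        case False
        then have "\<not> p dvd r" using r(1) Q(2)[OF pQ] primes_dvd_imp_eq by blast
        then show ?thesis using w_not_dvd False by simp
      qed (use w_p in simp)
    qed
    also have "\<dots> = (if r \<in> Q then 1 / real r else 1)" using Q(1) by (simp add: prod.delta)
    finally have e: "real N * (\<Prod>p\<in>Q. W p (of_nat N)) = (if r \<in> Q then 1 else real r) * (real M * (\<Prod>p\<in>Q. W p (of_nat M)))"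
      using r(1) unfolding M by (simp add: prime_gt_0_nat)
    have ih: "1 \<le> real M * (\<Prod>p\<in>Q. W p (of_nat M))" "(\<forall>p. prime p \<longrightarrow> p dvd M \<longrightarrow> p \<in> Q) \<longrightarrow> real M * (\<Prod>p\<in>Q. W p (of_nat M)) = 1"
      using less(1)[OF M0(2,1)] by auto
    have r1: "1 \<le> (if r \<in> Q then 1 else real r)" using prime_gt_1_nat[OF r(1)] by simp
    have "1 * 1 \<le> (if r \<in> Q then 1 else real r) * (real M * (\<Prod>p\<in>Q. W p (of_nat M)))" by (rule mult_mono[OF r1 ih(1)]) (use r1 in auto)
    moreover have "real N * (\<Prod>p\<in>Q. W p (of_nat N)) = 1" if all: "\<forall>p. prime p \<longrightarrow> p dvd N \<longrightarrow> p \<in> Q"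
    proof -
      have "r \<in> Q" using all r by blast
      moreover have "\<forall>p. prime p \<longrightarrow> p dvd M \<longrightarrow> p \<in> Q" using all unfolding M by (meson dvd_mult)
      ultimately show ?thesis unfolding e using ih(2) by simp
    qed
    ultimately show ?thesis unfolding e by simp
  qed
qed

text \<open>By \<open>out\<close>, the numerator of \<open>Z\<close> has prime factors only in
  \<open>Q\<close> and contributes exactly 1. Primes of the denominator outside \<open>Q\<close> can
  only lower the product, so an inequality remains.\<close>

lemma product_formula_le:
  fixes Z :: complex
  assumes Q: "finite Q" "\<And>p. p \<in> Q \<Longrightarrow> prime p" and W: "\<And>p. prime p \<Longrightarrow> padic p (W p)"
    and Z: "Z \<in> \<rat>" "Z \<noteq> 0" and out: "\<And>p. prime p \<Longrightarrow> p \<notin> Q \<Longrightarrow> W p Z \<ge> 1"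
  shows "norm Z * (\<Prod>p\<in>Q. W p Z) \<le> 1"
proof -
  obtain r where r: "Z = of_rat r" using Z(1) by (auto elim: Rats_cases)
  obtain a b where ab: "quotient_of r = (a, b)" by fastforce
  have b0: "b > 0" and cop: "coprime a b" and rab: "r = of_int a / of_int b"
    using quotient_of_denom_pos[OF ab] quotient_of_coprime[OF ab] quotient_of_div[OF ab] by auto
  have Zab: "Z = of_int a / of_int b" unfolding r rab by (simp add: of_rat_divide)
  have a0: "a \<noteq> 0" using Z(2) Zab by auto
  define m where "m = nat \<bar>a\<bar>"
  define k where "k = nat b"
  have mk: "m > 0" "k > 0" using a0 b0 unfolding m_def k_def by auto
  have bk: "(of_int b :: complex) = of_nat k" unfolding k_def using b0 by simp
  have am: "(of_int a :: complex) = of_nat m \<or> (of_int a :: complex) = - of_nat m" unfolding m_def by (cases "a \<ge> 0") auto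
  have "int m = \<bar>a\<bar>" "int k = b" unfolding m_def k_def using b0 by auto
  then have "coprime (int m) (int k)" using cop by simp
  then have cmk: "coprime m k" by (simp only: coprime_int_iff)
  have wZ: "W p Z * W p (of_nat k) = W p (of_nat m)" if p: "prime p" for p
  proof -
    interpret padic p "W p" by (rule W[OF p])
    have "Z * of_nat k = of_nat m \<or> Z * of_nat k = - of_nat m" using am mk(2) unfolding Zab bk by auto
    moreover have "W p (Z * of_nat k) = W p Z * W p (of_nat k)" by (rule w_mult) (use alg_Rats[OF Z(1)] in auto)
    ultimately show ?thesis using w_neg[of "of_nat m"] by auto
  qed
  have nm: "real m * (\<Prod>p\<in>Q. W p (of_nat m)) = 1"
  proof -
    have "p \<in> Q" if pm: "prime p" "p dvd m" for p
    proof (rule ccontr)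
      assume pQ: "p \<notin> Q"
      interpret padic p "W p" by (rule W[OF pm(1)])
      have "\<not> p dvd k"
      proof
        assume "p dvd k"
        then have "p = 1" using coprime_common_divisor_nat[OF cmk pm(2)] by simp
        then show False using pm(1) by simp
      qed
      then have "W p (of_nat k) = 1" by (rule w_not_dvd)
      then have "W p (of_nat m) \<ge> 1" using wZ[OF pm(1)] out[OF pm(1) pQ] by simp
      then show False using w_nat_less[OF pm(2) mk(1)] by simp
    qed
    then show ?thesis using prod_padic_nat[OF Q W mk(1)] by blast
  qed
  have nk: "1 \<le> real k * (\<Prod>p\<in>Q. W p (of_nat k))" using prod_padic_nat[OF Q W mk(2)] by blast
  have "(\<Prod>p\<in>Q. W p Z) * (\<Prod>p\<in>Q. W p (of_nat k)) = (\<Prod>p\<in>Q. W p (of_nat m))"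
    unfolding prod.distrib[symmetric] using wZ Q(2) by (intro prod.cong) auto
  moreover have "norm (of_int a :: complex) = real m" unfolding m_def by simp
  then have "norm Z * real k = real m" unfolding Zab bk using mk(2) by (simp add: norm_divide)
  ultimately have e: "(norm Z * (\<Prod>p\<in>Q. W p Z)) * (real k * (\<Prod>p\<in>Q. W p (of_nat k))) = 1" using nm by (metis mult.assoc mult.left_commute)
  have nn: "0 \<le> norm Z * (\<Prod>p\<in>Q. W p Z)"
    by (intro mult_nonneg_nonneg prod_nonneg ballI norm_ge_zero padic.w_nonneg[OF W[OF Q(2)] alg_Rats[OF Z(1)]])
  have "(norm Z * (\<Prod>p\<in>Q. W p Z)) * 1 \<le> (norm Z * (\<Prod>p\<in>Q. W p Z)) * (real k * (\<Prod>p\<in>Q. W p (of_nat k)))"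
    by (rule mult_left_mono[OF nk nn])
  then show ?thesis using e by simp
qed

subsection \<open>Kronecker's theorem for traces\<close>

lemma trace_minus_2: assumes "norm (x::complex) = 1" shows "norm (x + inverse x - 2) = (norm (x - 1))\<^sup>2"
proof -
  have x0: "x \<noteq> 0" using assms by auto
  have "(x + inverse x - 2) * x = (x - 1)\<^sup>2" using x0 by (simp add: algebra_simps power2_eq_square)
  then have "norm (x + inverse x - 2) * norm x = (norm (x - 1))\<^sup>2" by (metis norm_mult norm_power)
  then show ?thesis using assms by simp
qed

text \<open>Simultaneous approximation yields \<open>m\<close> such that every
  \<open>\<gamma> t ^ m\<close> lies at distance below 1 from 1. The conjugates of
  \<open>c = P_m(\<alpha>) - 2\<close> have the squares of these distances as absolute values, so
  the norm of \<open>c\<close> is an integer of absolute value below 1, hence 0.\<close>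

lemma (in prim_field) kronecker_trace:
  assumes a: "\<alpha> \<in> K" and g: "\<And>t. t \<in> \<Theta> \<Longrightarrow> emb t \<alpha> = \<gamma> t + inverse (\<gamma> t)" "\<And>t. t \<in> \<Theta> \<Longrightarrow> norm (\<gamma> t) = 1"
    and int: "\<And>p w t. padic p w \<Longrightarrow> t \<in> \<Theta> \<Longrightarrow> w (emb t \<alpha>) \<le> 1"
  shows "\<exists>m z. m > 0 \<and> z ^ m = 1 \<and> \<alpha> = z + inverse z"
proof -
  obtain h where h: "bij_betw h {0..<card \<Theta>} \<Theta>" using ex_bij_betw_nat_finite[OF finite_\<Theta>] by blast
  define \<phi> where "\<phi> t = Im (Ln (\<gamma> t))" for t
  have g0: "\<gamma> t \<noteq> 0" if "t \<in> \<Theta>" for t using g(2)[OF that] by auto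
  have ex: "\<gamma> t = exp (\<i> * of_real (\<phi> t))" if t: "t \<in> \<Theta>" for t
  proof -
    have "Re (Ln (\<gamma> t)) = 0" using Re_Ln[OF g0[OF t]] g(2)[OF t] by simp
    then have "Ln (\<gamma> t) = \<i> * of_real (\<phi> t)" unfolding \<phi>_def by (simp add: complex_eq_iff)
    then show ?thesis using exp_Ln[OF g0[OF t]] by simp
  qed
  \<comment> \<open>The precision 8 is enough because \<open>2 * pi / 8 < 1\<close>.\<close>
  have "(0::nat) < 8" by simp
  from Dirichlet_approx_simult[OF this, of "card \<Theta>" "\<lambda>i. \<phi> (h i) / (2 * pi)"]
  obtain m' k where m': "0 < m'" and k: "\<And>i. i < card \<Theta> \<Longrightarrow> \<bar>of_int m' * (\<phi> (h i) / (2 * pi)) - of_int (k i)\<bar> < 1 / real 8" by blast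
  define m where "m = nat m'"
  have m0: "m > 0" and mm: "of_int m' = (of_nat m :: real)" unfolding m_def using m' by auto
  define Xt where "Xt t = \<gamma> t ^ m" for t
  have X1: "norm (Xt t) = 1" if "t \<in> \<Theta>" for t unfolding Xt_def using g(2)[OF that] by (simp add: norm_power)
  have small: "norm (Xt t - 1) < 1" if t: "t \<in> \<Theta>" for t
  proof -
    have "t \<in> h ` {0..<card \<Theta>}" using h t unfolding bij_betw_def by blast
    then obtain i where i: "i < card \<Theta>" "t = h i" by auto
    define y where "y = real m * \<phi> t - 2 * pi * of_int (k i)"
    have "2 * pi * \<bar>real m * (\<phi> t / (2 * pi)) - of_int (k i)\<bar> < 2 * pi * (1 / 8)"
      using k[OF i(1)] unfolding i(2) mm by (intro mult_strict_left_mono) auto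
    moreover have e: "2 * pi * (real m * (\<phi> t / (2 * pi)) - of_int (k i)) = y" unfolding y_def by (simp add: algebra_simps)
    have "2 * pi * \<bar>real m * (\<phi> t / (2 * pi)) - of_int (k i)\<bar> = \<bar>y\<bar>" unfolding e[symmetric] by (simp add: abs_mult)
    ultimately have "\<bar>y\<bar> < 2 * pi * (1 / 8)" by linarith
    then have y: "\<bar>y\<bar> < 1" using pi_less_4 by linarith
    have "Xt t = exp (of_nat m * (\<i> * of_real (\<phi> t)))" unfolding Xt_def ex[OF t] exp_of_nat_mult ..
    also have "of_nat m * (\<i> * of_real (\<phi> t)) = \<i> * of_real y + (2 * of_int (k i) * of_real pi) * \<i>" unfolding y_def by (simp add: algebra_simps)
    also have "exp \<dots> = exp (\<i> * of_real y)" unfolding exp_add using exp_integer_2pi[of "of_int (k i)"] by simp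
    finally have "norm (Xt t - 1) = 2 * \<bar>sin (y / 2)\<bar>" using dist_exp_i_1 by simp
    also have "\<dots> \<le> 2 * \<bar>y / 2\<bar>" by (intro mult_left_mono abs_sin_x_le_abs_x) simp
    finally show ?thesis using y by simp
  qed
  define c where "c = poly (cheb m - [:2:]) \<alpha>"
  have chQ: "cheb m - [:2:] \<in> polys_over \<rat>" by (rule cheb2_over)
  have cK: "c \<in> K" unfolding c_def by (rule PKpoly[OF polys_over_Rats[OF chQ] a])
  have ec: "emb t c = Xt t + inverse (Xt t) - 2" if t: "t \<in> \<Theta>" for t
  proof -
    have "emb t c = poly (memb t (cheb m - [:2:])) (emb t \<alpha>)" unfolding c_def by (rule memb_poly[OF t polys_over_Rats[OF chQ] a, symmetric])
    also have "memb t (cheb m - [:2:]) = cheb m - [:2:]" by (rule memb_Rats[OF t chQ])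
    also have "poly (cheb m - [:2:]) (emb t \<alpha>) = Xt t + inverse (Xt t) - 2"
      unfolding g(1)[OF t] Xt_def using cheb_plus_inverse[OF g0[OF t], of m] by (simp add: power_inverse)
    finally show ?thesis .
  qed
  define Z where "Z = (\<Prod>t\<in>\<Theta>. emb t c)"
  have ZQ: "Z \<in> \<rat>" unfolding Z_def by (rule norm_in_Rats[OF cK])
  have "w Z \<le> 1" if pw: "padic p w" for p w
  proof -
    interpret padic p w by (rule pw)
    have ew: "w (emb t c) \<le> 1" if t: "t \<in> \<Theta>" for t
    proof -
      have ga: "algebraic (\<gamma> t)" by (rule algebraic_trace_root[OF _ g0[OF t]]) (use emb_alg[OF t a] g(1)[OF t] in simp)
      have wg: "w (\<gamma> t) = 1" by (rule w_trace_unit[OF ga g0[OF t]]) (use int[OF pw t] g(1)[OF t] in simp)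
      have xa: "algebraic (Xt t)" "algebraic (inverse (Xt t))" "algebraic (Xt t + inverse (Xt t))" unfolding Xt_def using ga by (auto simp: alg_closed)
      have wx: "w (Xt t) = 1" "w (inverse (Xt t)) = 1" using w_pow[OF ga, of m] wg w_inverse[OF xa(1)] unfolding Xt_def by auto
      have "w (Xt t + inverse (Xt t)) \<le> 1" using w_add[OF xa(1,2)] wx by simp
      moreover have "w 2 \<le> 1" using w_nat_le[of 2] by simp
      ultimately show ?thesis unfolding ec[OF t] using w_diff[OF xa(3), of 2] algebraic_of_nat[of 2] by simp
    qed
    have "w Z = (\<Prod>t\<in>\<Theta>. w (emb t c))" unfolding Z_def by (rule w_prod) (use emb_alg[OF _ cK] in auto)
    also have "\<dots> \<le> 1" by (rule prod_le_1) (use ew w_nonneg emb_alg[OF _ cK] in auto)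
    finally show ?thesis .
  qed
  then have "Z \<in> \<int>" by (rule Rats_integral_Ints[OF ZQ])
  then obtain z where z: "Z = of_int z" by (auto elim: Ints_cases)
  have lt: "norm (emb t c) < 1" if t: "t \<in> \<Theta>" for t
    unfolding ec[OF t] trace_minus_2[OF X1[OF t]] abs_square_less_1 using small[OF t] by simp
  have "norm Z < 1"
  proof -
    have "norm Z = norm (emb \<theta> c) * (\<Prod>t\<in>\<Theta> - {\<theta>}. norm (emb t c))"
      unfolding Z_def prod_norm[symmetric] by (rule prod.remove[OF finite_\<Theta> \<theta>_in])
    also have "\<dots> \<le> norm (emb \<theta> c) * 1" by (intro mult_left_mono prod_le_1) (use lt in \<open>auto simp: less_imp_le\<close>)
    finally show ?thesis using lt[OF \<theta>_in] by linarith
  qed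
  then have "Z = 0" unfolding z by simp
  then obtain t where t: "t \<in> \<Theta>" "emb t c = 0" unfolding Z_def using finite_\<Theta> by (auto simp: prod_zero_iff)
  then have "c = 0" using emb_nonzero[OF t(1) cK] by blast
  obtain y where y: "y \<noteq> 0" "\<alpha> = y + inverse y" using exists_plus_inverse by blast
  have "y ^ m = 1" using \<open>c = 0\<close> cheb2_iff[OF y(1), of m] unfolding c_def y(2) by blast
  then show ?thesis using m0 y(2) by blast
qed

subsection \<open>Places above the primes\<close>

context prim_field begin

definition place_above where "place_above w t = abs_value_equiv (subfield_ring K) `` {\<lambda>x. w (emb t x)}"

lemma place_abs_value:
  assumes pw: "padic p w" and t: "t \<in> \<Theta>" shows "nontrivial_abs_value (subfield_ring K) (\<lambda>x. w (emb t x))"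
proof -
  interpret padic p w by (rule pw)
  have al: "algebraic (emb t x)" if "x \<in> K" for x by (rule emb_alg[OF t that])
  have "w (emb t (x + y)) \<le> w (emb t x) + w (emb t y)" if "x \<in> K" "y \<in> K" for x y
    using w_add[OF al al] that w_nonneg[OF al] emb_add[OF t] by (smt (verit))
  moreover have "w (emb t x) = 0 \<longleftrightarrow> x = 0" if "x \<in> K" for x
    using w_eq_0[OF al[OF that]] emb_nonzero[OF t that] emb_0[OF t] by auto
  moreover have "\<exists>x\<in>K. x \<noteq> 0 \<and> w (emb t x) \<noteq> 1"
    by (rule bexI[of _ "of_nat p"]) (use emb_Rats[OF t, of "of_nat p"] w_p p1 Knat in auto)
  ultimately show ?thesis unfolding nontrivial_abs_value_def abs_value_def
    using w_nonneg[OF al] w_mult[OF al al] emb_mult[OF t] by simp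
qed

text \<open>The number \<open>p\<close> separates places over different primes: it is small at one
  and a unit at the other.\<close>

lemma place_above_eqD:
  assumes pw: "padic p w" and pw': "padic p' w'" and t: "t \<in> \<Theta>" "t' \<in> \<Theta>" and eq: "place_above w t = place_above w' t'"
  shows "p = p'"
proof (rule ccontr)
  assume ne: "p \<noteq> p'"
  interpret padic p w by (rule pw)
  interpret P': padic p' w' by (rule pw')
  have nn: "0 \<le> w' (emb t' x)" if "x \<in> K" for x by (rule P'.w_nonneg[OF emb_alg[OF t(2) that]])
  have "(\<lambda>x. w' (emb t' x)) \<in> place_above w' t'"
    unfolding place_above_def abs_value_equiv_def using place_abs_value[OF pw' t(2)] nn by (auto intro!: exI[of _ "1::real"])
  then have "(\<lambda>x. w' (emb t' x)) \<in> place_above w t" using eq by simp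
  then obtain s where s: "s > 0" "\<And>x. x \<in> K \<Longrightarrow> w' (emb t' x) = w (emb t x) powr s"
    unfolding place_above_def abs_value_equiv_def by auto
  have "w' (of_nat p) = w (of_nat p) powr s" using s(2)[OF Knat[of p]] emb_Rats[OF t(1), of "of_nat p"] emb_Rats[OF t(2), of "of_nat p"] by simp
  moreover have "\<not> p' dvd p" using ne p P'.p primes_dvd_imp_eq by blast
  then have "w' (of_nat p) = 1" by (rule P'.w_not_dvd)
  moreover have "w (of_nat p) powr s < 1" unfolding w_p using powr_less_mono2[of s "1 / real p" 1] p1 s(1) by simp
  ultimately show False by simp
qed

lemma finite_primes_below:
  assumes S: "finite S" and W: "\<And>p. prime p \<Longrightarrow> padic p (W p)"
  shows "finite {p. prime p \<and> (\<exists>t\<in>\<Theta>. place_above (W p) t \<in> S)}"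
proof -
  define Q where "Q = {p. prime p \<and> (\<exists>t\<in>\<Theta>. place_above (W p) t \<in> S)}"
  define c where "c p = (SOME t. t \<in> \<Theta> \<and> place_above (W p) t \<in> S)" for p
  have c: "c p \<in> \<Theta> \<and> place_above (W p) (c p) \<in> S" if "p \<in> Q" for p
    unfolding c_def by (rule someI_ex) (use that in \<open>auto simp: Q_def\<close>)
  have "inj_on (\<lambda>p. place_above (W p) (c p)) Q"
    by (rule inj_onI, rule place_above_eqD[OF W W]) (use c in \<open>auto simp: Q_def\<close>)
  moreover have "(\<lambda>p. place_above (W p) (c p)) ` Q \<subseteq> S" using c by blast
  ultimately have "finite Q" using S inj_on_finite by blast
  then show ?thesis unfolding Q_def .
qed

text \<open>Two regimes: where \<open>\<alpha>\<close> is integral the bound comes from the absence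
  of a nearby root, and where \<open>\<alpha>\<close> is large the value is a power of its
  size.\<close>

lemma value_outside_S:
  assumes sub: "subfield K complex_field" and pw: "padic p w" and t: "t \<in> \<Theta>" and a: "\<alpha> \<in> K"
    and nS: "place_above w t \<notin> S" and h: "trace_conj K \<theta> q n \<zeta> f" and int: "S_integral K S \<alpha> (\<zeta> + inverse \<zeta>)"
  shows "w (emb t (poly f \<alpha>)) \<ge> 1"
proof (cases "w (emb t \<alpha>) \<le> 1")
  case True
  interpret padic p w by (rule pw)
  interpret T: trace_conj K \<theta> q n \<zeta> f by (rule h)
  show ?thesis
    by (rule S_integral_min_poly_value[OF sub place_abs_value[OF pw t] _ _ int a True T.f])
       (use w_add[OF emb_alg[OF t] emb_alg[OF t]] emb_add[OF t] nS in \<open>auto simp: place_above_def\<close>)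
next
  case False
  then show ?thesis using padic_bound_large[OF pw t a _ h] by simp
qed

subsection \<open>Bounding the order\<close>

lemma order_bounded:
  assumes sub: "subfield K complex_field" and S: "finite S" and a: "\<alpha> \<in> K"
    and nt: "\<And>m z. m > 0 \<Longrightarrow> z ^ m = 1 \<Longrightarrow> \<alpha> \<noteq> z + inverse z"
  shows "\<exists>N. \<forall>n \<zeta> f. trace_conj K \<theta> q n \<zeta> f \<longrightarrow> S_integral K S \<alpha> (\<zeta> + inverse \<zeta>) \<longrightarrow> n \<le> N"
proof -
  have "\<exists>g. emb t \<alpha> = g + inverse g \<and> norm g \<ge> 1 \<and> g \<noteq> 0" for t
  proof -
    obtain z where z: "z \<noteq> 0" "emb t \<alpha> = z + inverse z" using exists_plus_inverse by blast
    show ?thesis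
    proof (cases "norm z \<ge> 1")
      case True then show ?thesis using z by blast
    next
      case False
      then have "norm (inverse z) \<ge> 1" using z(1) by (simp add: norm_inverse one_le_inverse_iff)
      then show ?thesis using z by (intro exI[of _ "inverse z"]) (simp add: add.commute)
    qed
  qed
  then obtain \<gamma> where g: "\<And>t. emb t \<alpha> = \<gamma> t + inverse (\<gamma> t)" "\<And>t. norm (\<gamma> t) \<ge> 1" "\<And>t. \<gamma> t \<noteq> 0" by metis
  have ga: "algebraic (\<gamma> t)" if t: "t \<in> \<Theta>" for t
    by (rule algebraic_trace_root[OF _ g(3)]) (use emb_alg[OF t a] g(1)[of t] in simp)
  have gu: "\<gamma> t ^ m \<noteq> 1" if t: "t \<in> \<Theta>" and m: "m > 0" for t m
  proof
    assume gm: "\<gamma> t ^ m = 1"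
    have chK: "cheb m - [:2:] \<in> polys_over K" by (rule polys_over_Rats[OF cheb2_over])
    have "poly (cheb m - [:2:]) (emb t \<alpha>) = 0" unfolding g(1)[of t] using cheb2_iff[OF g(3)[of t], of m] gm by simp
    then have "emb t (poly (cheb m - [:2:]) \<alpha>) = 0" using memb_poly[OF t chK a] memb_Rats[OF t cheb2_over] by simp
    then have "poly (cheb m - [:2:]) \<alpha> = 0" using emb_nonzero[OF t PKpoly[OF chK a]] by blast
    moreover obtain z where z: "z \<noteq> 0" "\<alpha> = z + inverse z" using exists_plus_inverse by blast
    ultimately have "z ^ m = 1" using cheb2_iff[OF z(1), of m] by simp
    then show False using nt[OF m] z(2) by blast
  qed
  define W0 where "W0 p = (SOME w. padic p w)" for p
  have W0: "padic p (W0 p)" if "prime p" for p unfolding W0_def by (rule someI_ex[OF padic_exists[OF that]])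
  \<comment> \<open>One absolute value is fixed per prime, but Kronecker's theorem only supplies
    some \<open>w\<close> over some prime at which a conjugate of \<open>\<alpha>\<close> is large.
    If all archimedean heights vanish, this \<open>w\<close> replaces the default choice at its
    prime.\<close>
  have "\<exists>W. (\<forall>p. prime p \<longrightarrow> padic p (W p)) \<and> ((\<exists>t\<in>\<Theta>. norm (\<gamma> t) > 1) \<or> (\<exists>p t. prime p \<and> t \<in> \<Theta> \<and> W p (emb t \<alpha>) > 1))"
  proof (cases "\<exists>t\<in>\<Theta>. norm (\<gamma> t) > 1")
    case True then show ?thesis using W0 by blast
  next
    case False
    have n1: "norm (\<gamma> t) = 1" if "t \<in> \<Theta>" for t using False g(2)[of t] that by force
    have "\<exists>p w t. padic p w \<and> t \<in> \<Theta> \<and> w (emb t \<alpha>) > 1"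
    proof (rule ccontr)
      assume "\<not> ?thesis"
      then have "w (emb t \<alpha>) \<le> 1" if "padic p w" "t \<in> \<Theta>" for p w t using that by (meson not_le)
      then show False using kronecker_trace[OF a g(1) n1] nt by blast
    qed
    then obtain p w t where w: "padic p w" "t \<in> \<Theta>" "w (emb t \<alpha>) > 1" by blast
    have "\<forall>r. prime r \<longrightarrow> padic r ((W0(p := w)) r)" using W0 w(1) by simp
    moreover have "(W0(p := w)) p (emb t \<alpha>) > 1" using w(3) by simp
    ultimately show ?thesis using padic.p[OF w(1)] w(2) by blast
  qed
  then obtain W where W: "\<And>p. prime p \<Longrightarrow> padic p (W p)"
    and pos: "(\<exists>t\<in>\<Theta>. norm (\<gamma> t) > 1) \<or> (\<exists>p t. prime p \<and> t \<in> \<Theta> \<and> W p (emb t \<alpha>) > 1)" by blast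
  obtain p0 where p0: "prime (p0::nat)" "(\<exists>t\<in>\<Theta>. norm (\<gamma> t) > 1) \<or> (\<exists>t\<in>\<Theta>. W p0 (emb t \<alpha>) > 1)" using pos two_is_prime_nat by blast
  \<comment> \<open>The primes under \<open>S\<close>, together with \<open>p0\<close>, which brings
    a positive local height into \<open>\<kappa>\<close> in case no archimedean one is
    positive.\<close>
  define Q where "Q = insert p0 {p. prime p \<and> (\<exists>t\<in>\<Theta>. place_above (W p) t \<in> S)}"
  have Q: "finite Q" "\<And>p. p \<in> Q \<Longrightarrow> prime p" unfolding Q_def using finite_primes_below[OF S W] p0(1) by auto
  define \<mu> where "\<mu> p t = max 0 (ln (W p (emb t \<alpha>)))" for p t
  define \<kappa> where "\<kappa> = (\<Sum>t\<in>\<Theta>. ln (norm (\<gamma> t))) + (\<Sum>p\<in>Q. \<Sum>t\<in>\<Theta>. \<mu> p t)"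
  have lg: "0 \<le> ln (norm (\<gamma> t))" for t using g(2)[of t] by simp
  have l\<mu>: "0 \<le> \<mu> p t" for p t unfolding \<mu>_def by simp
  have s1: "0 \<le> (\<Sum>t\<in>\<Theta>. ln (norm (\<gamma> t)))" and s2: "0 \<le> (\<Sum>p\<in>Q. \<Sum>t\<in>\<Theta>. \<mu> p t)" using lg l\<mu> by (simp_all add: sum_nonneg)
  have \<kappa>: "\<kappa> > 0"
  proof (cases "\<exists>t\<in>\<Theta>. norm (\<gamma> t) > 1")
    case True
    then obtain t where t: "t \<in> \<Theta>" "norm (\<gamma> t) > 1" by blast
    have "0 < ln (norm (\<gamma> t))" by (rule ln_gt_zero[OF t(2)])
    also have "\<dots> \<le> (\<Sum>t\<in>\<Theta>. ln (norm (\<gamma> t)))" by (rule member_le_sum[OF t(1)]) (use lg finite_\<Theta> in auto)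
    finally show ?thesis unfolding \<kappa>_def using s2 by linarith
  next
    case False
    then obtain t where t: "t \<in> \<Theta>" "W p0 (emb t \<alpha>) > 1" using p0(2) by blast
    have "0 < \<mu> p0 t" unfolding \<mu>_def using t(2) by simp
    also have "\<dots> \<le> (\<Sum>t\<in>\<Theta>. \<mu> p0 t)" by (rule member_le_sum[OF t(1)]) (use l\<mu> finite_\<Theta> in auto)
    also have "\<dots> \<le> (\<Sum>p\<in>Q. \<Sum>t\<in>\<Theta>. \<mu> p t)" 
    proof (rule member_le_sum[of p0])
      show "p0 \<in> Q" unfolding Q_def by simp
      show "0 \<le> (\<Sum>t\<in>\<Theta>. \<mu> p t)" for p by (rule sum_nonneg) (rule l\<mu>)
    qed (rule Q(1))
    finally show ?thesis unfolding \<kappa>_def using s1 by linarith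
  qed
  have "\<exists>C. \<forall>t\<in>\<Theta>. C t \<ge> 0 \<and> (\<forall>n \<zeta> f. trace_conj K \<theta> q n \<zeta> f \<longrightarrow> emb t (poly f \<alpha>) \<noteq> 0 \<longrightarrow>
     ln (norm (emb t (poly f \<alpha>))) \<ge> real (degree f) * ln (norm (\<gamma> t)) - C t * real n powr (3/4))"
    by (rule bchoice) (use arch_bound[OF _ a g(1,2) ga gu] in blast)
  then obtain C1 where C1: "\<And>t. t \<in> \<Theta> \<Longrightarrow> C1 t \<ge> 0" "\<And>t n \<zeta> f. t \<in> \<Theta> \<Longrightarrow> trace_conj K \<theta> q n \<zeta> f \<Longrightarrow> emb t (poly f \<alpha>) \<noteq> 0 \<Longrightarrow>
     ln (norm (emb t (poly f \<alpha>))) \<ge> real (degree f) * ln (norm (\<gamma> t)) - C1 t * real n powr (3/4)" by blast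
  have "\<exists>C. \<forall>pt\<in>Q \<times> \<Theta>. C pt \<ge> 0 \<and> (\<forall>n \<zeta> f. trace_conj K \<theta> q n \<zeta> f \<longrightarrow> emb (snd pt) (poly f \<alpha>) \<noteq> 0 \<longrightarrow>
     ln (W (fst pt) (emb (snd pt) (poly f \<alpha>))) \<ge> real (degree f) * \<mu> (fst pt) (snd pt) - C pt * real n powr (3/4))"
  proof (rule bchoice, rule ballI)
    fix pt assume "pt \<in> Q \<times> \<Theta>"
    then have pt: "prime (fst pt)" "snd pt \<in> \<Theta>" using Q(2) by auto
    show "\<exists>C. C \<ge> 0 \<and> (\<forall>n \<zeta> f. trace_conj K \<theta> q n \<zeta> f \<longrightarrow> emb (snd pt) (poly f \<alpha>) \<noteq> 0 \<longrightarrow>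
      ln (W (fst pt) (emb (snd pt) (poly f \<alpha>))) \<ge> real (degree f) * \<mu> (fst pt) (snd pt) - C * real n powr (3/4))"
      unfolding \<mu>_def by (rule padic_bound[OF W[OF pt(1)] pt(2) a g(1,3) ga[OF pt(2)] gu[OF pt(2)]])
  qed
  then obtain C2 where C2: "\<And>p t. p \<in> Q \<Longrightarrow> t \<in> \<Theta> \<Longrightarrow> C2 (p, t) \<ge> 0"
    "\<And>p t n \<zeta> f. p \<in> Q \<Longrightarrow> t \<in> \<Theta> \<Longrightarrow> trace_conj K \<theta> q n \<zeta> f \<Longrightarrow> emb t (poly f \<alpha>) \<noteq> 0 \<Longrightarrow>
     ln (W p (emb t (poly f \<alpha>))) \<ge> real (degree f) * \<mu> p t - C2 (p, t) * real n powr (3/4)" by force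
  define C where "C = (\<Sum>t\<in>\<Theta>. C1 t) + (\<Sum>p\<in>Q. \<Sum>t\<in>\<Theta>. C2 (p, t))"
  have C0: "C \<ge> 0" unfolding C_def using C1(1) C2(1) by (intro add_nonneg_nonneg sum_nonneg) auto
  have main: "real (degree f) * \<kappa> \<le> C * real n powr (3/4)"
    if h: "trace_conj K \<theta> q n \<zeta> f" and int: "S_integral K S \<alpha> (\<zeta> + inverse \<zeta>)" for n \<zeta> f
  proof -
    interpret T: trace_conj K \<theta> q n \<zeta> f by (rule h)
    have faK: "poly f \<alpha> \<in> K" by (rule PKpoly[OF T.fK a])
    have fnz: "poly f \<alpha> \<noteq> 0"
    proof
      assume f0: "poly f \<alpha> = 0"
      have "[:- \<alpha>, 1:] \<in> polys_over K" by (intro PKpCons PK0 Kneg a K1)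
      from min_poly_conj[OF T.f f0 this] have "\<zeta> + inverse \<zeta> = \<alpha>" by simp
      then show False using nt[OF T.z(2,1)] by simp
    qed
    have nz: "emb t (poly f \<alpha>) \<noteq> 0" if "t \<in> \<Theta>" for t by (rule emb_nonzero[OF that faK fnz])
    have al: "algebraic (emb t (poly f \<alpha>))" if "t \<in> \<Theta>" for t by (rule emb_alg[OF that faK])
    define Z where "Z = (\<Prod>t\<in>\<Theta>. emb t (poly f \<alpha>))"
    have ZQ: "Z \<in> \<rat>" "Z \<noteq> 0" unfolding Z_def using norm_in_Rats[OF faK] finite_\<Theta> nz by auto
    have WZ: "W p Z = (\<Prod>t\<in>\<Theta>. W p (emb t (poly f \<alpha>)))" if "prime p" for p
      unfolding Z_def by (rule padic.w_prod[OF W[OF that] al])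
    have out: "W p Z \<ge> 1" if p: "prime p" "p \<notin> Q" for p
      unfolding WZ[OF p(1)]
    proof (rule prod_ge_1)
      fix t assume t: "t \<in> \<Theta>"
      have "place_above (W p) t \<notin> S" using p t unfolding Q_def by auto
      then show "1 \<le> W p (emb t (poly f \<alpha>))" by (rule value_outside_S[OF sub W[OF p(1)] t a _ h int])
    qed
    have le: "norm Z * (\<Prod>p\<in>Q. W p Z) \<le> 1" by (rule product_formula_le[of Q W Z]) (use Q W ZQ out in blast)+
    have Wp: "W p (emb t (poly f \<alpha>)) > 0" if "p \<in> Q" "t \<in> \<Theta>" for p t by (rule padic.w_pos[OF W[OF Q(2)[OF that(1)]] al[OF that(2)] nz[OF that(2)]])
    have WZp: "W p Z > 0" if "p \<in> Q" for p unfolding WZ[OF Q(2)[OF that]] by (rule prod_pos) (use Wp that in blast)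
    have "ln (norm Z) = (\<Sum>t\<in>\<Theta>. ln (norm (emb t (poly f \<alpha>))))" unfolding Z_def prod_norm[symmetric] by (rule ln_prod) (use nz finite_\<Theta> in auto)
    moreover have "ln (\<Prod>p\<in>Q. W p Z) = (\<Sum>p\<in>Q. \<Sum>t\<in>\<Theta>. ln (W p (emb t (poly f \<alpha>))))"
    proof -
      have "ln (\<Prod>p\<in>Q. W p Z) = (\<Sum>p\<in>Q. ln (W p Z))" by (rule ln_prod) (use WZp Q in force)+
      also have "\<dots> = (\<Sum>p\<in>Q. \<Sum>t\<in>\<Theta>. ln (W p (emb t (poly f \<alpha>))))"
      proof (rule sum.cong[OF refl])
        fix p assume p: "p \<in> Q"
        show "ln (W p Z) = (\<Sum>t\<in>\<Theta>. ln (W p (emb t (poly f \<alpha>))))" unfolding WZ[OF Q(2)[OF p]] by (rule ln_prod) (use Wp[OF p] finite_\<Theta> in force)+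
      qed
      finally show ?thesis .
    qed
    moreover have "ln (norm Z) + ln (\<Prod>p\<in>Q. W p Z) \<le> 0"
    proof -
      have pp: "norm Z > 0" "(\<Prod>p\<in>Q. W p Z) > 0" using ZQ WZp by (auto intro: prod_pos)
      then have "ln (norm Z) + ln (\<Prod>p\<in>Q. W p Z) = ln (norm Z * (\<Prod>p\<in>Q. W p Z))" by (simp add: ln_mult_pos)
      also have "\<dots> \<le> ln 1" using le pp by (subst ln_le_cancel_iff) auto
      finally show ?thesis by simp
    qed
    moreover have "(\<Sum>t\<in>\<Theta>. real (degree f) * ln (norm (\<gamma> t)) - C1 t * real n powr (3/4)) \<le> (\<Sum>t\<in>\<Theta>. ln (norm (emb t (poly f \<alpha>))))"
      by (rule sum_mono) (use C1(2)[OF _ h nz] in blast)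
    moreover have "(\<Sum>p\<in>Q. \<Sum>t\<in>\<Theta>. real (degree f) * \<mu> p t - C2 (p, t) * real n powr (3/4)) \<le> (\<Sum>p\<in>Q. \<Sum>t\<in>\<Theta>. ln (W p (emb t (poly f \<alpha>))))"
      by (intro sum_mono) (use C2(2)[OF _ _ h nz] in blast)
    moreover have "(\<Sum>t\<in>\<Theta>. real (degree f) * ln (norm (\<gamma> t)) - C1 t * real n powr (3/4)) + (\<Sum>p\<in>Q. \<Sum>t\<in>\<Theta>. real (degree f) * \<mu> p t - C2 (p, t) * real n powr (3/4))
       = real (degree f) * \<kappa> - C * real n powr (3/4)"
      unfolding \<kappa>_def C_def by (simp add: sum_subtractf sum_distrib_left[symmetric] sum_distrib_right[symmetric] algebra_simps)
    ultimately show ?thesis by linarith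
  qed
  define d where "d = card \<Theta>"
  \<comment> \<open>The error of order \<open>n powr (3/4)\<close>, enlarged by the logarithm lost
    in the degree bound, is still of smaller order than \<open>n\<close>.\<close>
  have "(\<lambda>n::nat. (log 2 (real n) + 1) * real n powr (3/4) / real n) \<longlonglongrightarrow> 0" by real_asymp
  \<comment> \<open>The summand 1 keeps the denominator positive when \<open>C\<close> is 0.\<close>
  moreover have dC: "2 * real d * C + 1 > 0" using C0 by (simp add: add_nonneg_pos)
  then have "0 < \<kappa> / (2 * real d * C + 1)" using \<kappa> by simp
  ultimately have "\<forall>\<^sub>F n in sequentially. (log 2 (real n) + 1) * real n powr (3/4) / real n < \<kappa> / (2 * real d * C + 1)"
    by (rule order_tendstoD(2))
  then obtain N where N: "\<And>n. n \<ge> N \<Longrightarrow> (log 2 (real n) + 1) * real n powr (3/4) / real n < \<kappa> / (2 * real d * C + 1)"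
    unfolding eventually_sequentially by blast
  have "n \<le> N" if h: "trace_conj K \<theta> q n \<zeta> f" and int: "S_integral K S \<alpha> (\<zeta> + inverse \<zeta>)" for n \<zeta> f
  proof (rule ccontr)
    interpret T: trace_conj K \<theta> q n \<zeta> f by (rule h)
    assume "\<not> n \<le> N"
    then have nN: "n \<ge> N" by simp
    have n0: "real n > 0" using T.z(2) by simp
    define L where "L = log 2 (real n) + 1"
    have L0: "L > 0" unfolding L_def using T.z(2) by (simp add: add_nonneg_pos)
    define y where "y = real n powr (3/4)"
    have y0: "y > 0" unfolding y_def using n0 by simp
    have "L * y / real n < \<kappa> / (2 * real d * C + 1)" using N[OF nN] unfolding L_def y_def .
    then have 1: "L * y * (2 * real d * C + 1) < \<kappa> * real n" using n0 dC by (simp add: divide_less_eq less_divide_eq mult_ac)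
    have "real n \<le> real (totient n) * L" unfolding L_def by (rule totient_lower[OF T.z(2)])
    also have "\<dots> \<le> (2 * (real (degree f) * real d)) * L"
    proof (rule mult_right_mono)
      have "real (totient n) \<le> real (2 * (degree f * d))" unfolding d_def using T.totient_le by (simp only: of_nat_le_iff)
      then show "real (totient n) \<le> 2 * (real (degree f) * real d)" by simp
    qed (use L0 in simp)
    finally have "\<kappa> * real n \<le> \<kappa> * ((2 * (real (degree f) * real d)) * L)" using \<kappa> by (intro mult_left_mono) auto
    also have "\<dots> = (real (degree f) * \<kappa>) * (2 * real d * L)" by (simp only: mult_ac)
    also have "\<dots> \<le> (C * y) * (2 * real d * L)" using main[OF h int] L0 unfolding y_def by (intro mult_right_mono) auto
    also have "\<dots> \<le> L * y * (2 * real d * C + 1)" using L0 y0 by (simp add: algebra_simps)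
    finally show False using 1 by linarith
  qed
  then show ?thesis by blast
qed

end

theorem theorem1p2:
  fixes m :: nat and K :: "complex set" and S :: "(complex \<Rightarrow> real) set set" and \<alpha> :: complex
  assumes "m \<ge> 2"
    and "number_field K"
    and "finite S"
    and "S \<subseteq> places (subfield_ring K)"
    and "\<And>p. p \<in> places (subfield_ring K) \<Longrightarrow> archimedean_place (subfield_ring K) p \<Longrightarrow> p \<in> S"
    and "\<alpha> \<in> K"
    and "\<not> (\<exists>\<zeta> :: complex. (\<exists>n :: nat. n > 0 \<and> \<zeta> ^ n = 1) \<and> \<alpha> = \<zeta> + inverse \<zeta>)"
  shows "finite {x :: complex. algebraic x \<and> S_integral K S \<alpha> x \<and>
                   preperiodic (poly_map (chebyshev m)) x}"
proof -
  obtain \<theta> where \<theta>: "\<theta> \<in> K" "K = qadj \<theta>" "algebraic \<theta>" "csubfield K" using number_field_primitive[OF assms(2)] by blast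
  interpret csubfield K by (rule \<theta>(4))
  obtain P where P: "P \<in> polys_over \<rat>" "P \<noteq> 0" "poly P \<theta> = 0" using \<theta>(3) algebraic_polys_over by blast
  obtain q where q: "Rats.min_poly \<theta> q" using Rats.min_poly_exists[OF P] by blast
  interpret prim_field K \<theta> q by unfold_locales (use q \<theta>(2) in auto)
  have sub: "subfield K complex_field" using assms(2) unfolding number_field_def by auto
  have nt: "\<alpha> \<noteq> z + inverse z" if "n > 0" "z ^ n = 1" for n z using assms(7) that by blast
  have "\<exists>N. \<forall>n \<zeta> f. trace_conj K \<theta> q n \<zeta> f \<longrightarrow> S_integral K S \<alpha> (\<zeta> + inverse \<zeta>) \<longrightarrow> n \<le> N"
    by (rule order_bounded[OF sub assms(3,6)]) (use nt in blast)
  then obtain N where N: "\<forall>n \<zeta> f. trace_conj K \<theta> q n \<zeta> f \<longrightarrow> S_integral K S \<alpha> (\<zeta> + inverse \<zeta>) \<longrightarrow> n \<le> N" ..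
  \<comment> \<open>Orders 1 and 2 lie outside the scope of \<open>trace_conj\<close>; the margin 3
    admits them.\<close>
  define U where "U = (\<Union>n\<in>{0<..N + 3}. {z::complex. z ^ n = 1})"
  have U: "finite U" unfolding U_def by (intro finite_UN_I) (auto intro: prod_unity_roots(1))
  have "{x :: complex. algebraic x \<and> S_integral K S \<alpha> x \<and> preperiodic (poly_map (chebyshev m)) x} \<subseteq> (\<lambda>z. z + inverse z) ` U"
  proof
    fix x assume "x \<in> {x :: complex. algebraic x \<and> S_integral K S \<alpha> x \<and> preperiodic (poly_map (chebyshev m)) x}"
    then have x: "algebraic x" "S_integral K S \<alpha> x" "preperiodic (poly_map (chebyshev m)) x" by auto
    obtain z j where z: "j > 0" "z ^ j = 1" "x = z + inverse z" using preperiodic_cheb[OF assms(1) x(3)] by blast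
    obtain n where n: "primitive_root_of_unity n z" "0 < n" using exists_primitive_order[OF z(2,1)] by blast
    have zn: "z ^ n = 1" using n(1) unfolding primitive_root_of_unity_def by auto
    have "n \<le> N + 3"
    proof (cases "n \<ge> 3")
      case True
      obtain F where F: "F \<in> polys_over \<rat>" "F \<noteq> 0" "poly F x = 0" using x(1) algebraic_polys_over by blast
      obtain f where f: "min_poly x f" using min_poly_exists[OF polys_over_Rats[OF F(1)] F(2,3)] by blast
      have "trace_conj K \<theta> q n z f" by unfold_locales (use n True f z(3) in auto)
      then have "n \<le> N" using N x(2) unfolding z(3) by blast
      then show ?thesis by simp
    qed simp
    then have "z \<in> U" unfolding U_def using n(2) zn by auto
    then show "x \<in> (\<lambda>z. z + inverse z) ` U" using z(3) by blast
  qed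
  then show ?thesis using U finite_surj by blast
qed

end
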